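(* Let $r\ge3$ be odd and $q=e^{2\pi i/r}$. The non-semisimple Kirby color, i.e. the family of morphisms $\Omega_{r-1}=t_{r-1}$ and $\Omega_m=(-1)^m\frac{\{m+1\}'}{2}t_m-(-1)^m[m+1]\,t'_m$ for $r\le m\le2r-2$, is a diagrammatic integral of $\mathrm{TL}$. Explicitly, for every $x\in\bar U$, $$F_{\mathrm{TL}}(\Omega_{r-1})\big((x\otimes1)\cdot c_{r-1}\big)=\lambda(xe_{r-1})\,F_{\mathrm{TL}}(\mathbf a)(1),$$ and for every $x\in\bar U$ and every $r\le m\le2r-2$, $$F_{\mathrm{TL}}(\Omega_m)\big((x\otimes1)\cdot c_m\big)+F_{\mathrm{TL}}(\Omega_{3r-m-2})\big((x\otimes1)\cdot c_{3r-m-2}\big)=\lambda(xe_m)\,F_{\mathrm{TL}}(\mathbf a)(1).$$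
   Context: **Numbers.** $r\ge3$ odd, $q=e^{2\pi i/r}$, $\{k\}=q^k-q^{-k}$, $[k]=\{k\}/\{1\}$, $[k]!=\prod_{j=1}^k[j]$, $\{k\}'=q^k+q^{-k}$. **Temperley--Lieb category.** $\mathrm{TL}$ is the $\mathbb C$-linear monoidal category with objects $m\in\mathbb N$; $\mathrm{TL}(m,m')$ has as basis the isotopy classes of planar tangles with $m$ bottom and $m'$ top endpoints, without circles, a circle being evaluated to $-q-q^{-1}$. $vu$ means $v$ on top of $u$; $\otimes$ is juxtaposition; $\mathrm{ev}_m\in\mathrm{TL}(2m,0)$, $\mathrm{coev}_m\in\mathrm{TL}(0,2m)$ are $m$ nested caps/cups; $u^*$ is $u$ rotated by $\pi$; $\mathrm{TL}(m):=\mathrm{TL}(m,m)$. For idempotents $p\in\mathrm{TL}(m)$, $p'\in\mathrm{TL}(m')$, $\mathrm{TL}(p,p')=\{u\in\mathrm{TL}(m,m')\mid up=u=p'u\}$. **Jones--Wenzl idempotents.** Put $u_m:=\mathrm{id}_{m-2}\otimes(\mathrm{coev}_1\mathrm{ev}_1)\in\mathrm{TL}(m)$. For $0\le m\le r-1$: $f_0=\mathrm{id}_0$, $f_1=\mathrm{id}_1$, $f_m=f_{m-1}\otimes\mathrm{id}_1+\frac{[m-1]}{[m]}(f_{m-1}\otimes\mathrm{id}_1)u_m(f_{m-1}\otimes\mathrm{id}_1)$. For $r\le m\le 2r-2$: $h_m=(-1)^{m+1}[m+1]\,(f_{r-1}\otimes\mathrm{id}_{m-r+1})\big(\mathrm{id}_{2r-m-2}\otimes(\mathrm{coev}_{m-r+1}\mathrm{ev}_{m-r+1})\big)(f_{r-1}\otimes\mathrm{id}_{m-r+1})$;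 $g_r=f_{r-1}\otimes\mathrm{id}_1$; $g_{r+1}=g_r\otimes\mathrm{id}_1-(g_r\otimes\mathrm{id}_1)u_{r+1}(h_r\otimes\mathrm{id}_1)-(h_r\otimes\mathrm{id}_1)u_{r+1}(g_r\otimes\mathrm{id}_1)-[2](h_r\otimes\mathrm{id}_1)u_{r+1}(h_r\otimes\mathrm{id}_1)$; for $m\ge r+2$, $g_m=g_{m-1}\otimes\mathrm{id}_1+\frac{[m-1]}{[m]}(g_{m-1}\otimes\mathrm{id}_1)u_m(g_{m-1}\otimes\mathrm{id}_1)-\frac{2}{[m]^2}(g_{m-1}\otimes\mathrm{id}_1)u_m(h_{m-1}\otimes\mathrm{id}_1)$. **Kirby color morphisms.** $\mathbf a:=(f_{r-1}\otimes\mathrm{id}_{r-1})\mathrm{coev}_{r-1}\in\mathrm{TL}(0,g_{2r-2})$; $t_{r-1}:=\mathbf a\,\mathrm{ev}_{r-1}(f_{r-1}\otimes f_{r-1})$; for $r\le m\le2r-2$, $t_m:=\mathbf a\,\mathrm{ev}_m(g_m\otimes g_m^* )$ and $t'_m:=g_{2r-2}(\mathrm{id}_{r-1}\otimes\mathrm{ev}_{m-r+1}\otimes\mathrm{id}_{r-1})(g_m\otimes g_m^* )$. Thus $\Omega_{r-1}\in\mathrm{TL}(f_{r-1}\otimes f_{r-1},g_{2r-2})$ and $\Omega_m\in\mathrm{TL}(g_m\otimes g_m^*,g_{2r-2})$. **Small quantum group.** $\bar U$ is the $\mathbb C$-algebra generated by $E,F,K$ with $E^r=F^r=0$, $K^r=1$,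 $KEK^{-1}=q^2E$, $KFK^{-1}=q^{-2}F$, $[E,F]=\frac{K-K^{-1}}{q-q^{-1}}$, with basis $E^aF^bK^c$, $0\le a,b,c\le r-1$, and coproduct $\Delta(E)=E\otimes K+1\otimes E$, $\Delta(F)=K^{-1}\otimes F+F\otimes1$, $\Delta(K)=K\otimes K$. The left integral is $\lambda\in\bar U^*$, $\lambda(E^aF^bK^c)=r([r-1]!)^2\,\delta_{a,r-1}\delta_{b,r-1}\delta_{c,r-1}$. The Casimir element is $C=FE+\frac{qK+q^{-1}K^{-1}}{\{1\}^2}$; for $r-1\le m\le2r-2$, $e_m$ is the central idempotent of $\bar U$ such that multiplication by $e_m$ is the projection of $\bar U$ onto the generalized eigenspace of (multiplication by) $C$ of eigenvalue $\beta_m=\frac{\{m+1\}'}{\{1\}^2}$, along the other generalized eigenspaces (so $e_{3r-m-2}=e_m$ for $r\le m\le 2r-2$). **The functor.** $X$ is the $\bar U$-module with basis $a_0,a_1$ and $Ka_0=qa_0$, $Ka_1=q^{-1}a_1$, $Ea_0=0$, $Ea_1=a_0$, $Fa_0=a_1$, $Fa_1=0$. $F_{\mathrm{TL}}:\mathrm{TL}\to\mathrm{Vect}_{\mathbb C}$ is the faithful monoidal linear functor with $1\mapsto X$, $\mathrm{ev}_1\mapsto e$, $\mathrm{coev}_1\mapsto c$, where $e(a_0\otimes a_0)=e(a_1\otimes a_1)=0$, $e(a_0\otimes a_1)=-1$, $e(a_1\otimes a_0)=q^{-1}$, $c(1)=q\,a_0\otimes a_1-a_1\otimes a_0$. Let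 $c_m:=F_{\mathrm{TL}}(\mathrm{coev}_m)(1)\in X^{\otimes m}\otimes X^{\otimes m}$, and for $x\in\bar U$ let $(x\otimes1)\cdot c_m$ denote the action of $x$ (through the iterated coproduct) on the first factor $X^{\otimes m}$. **Diagrammatic integral.** A family $\ell_{r-1}\in\mathrm{TL}(f_{r-1}\otimes f_{r-1},g_{2r-2})$, $\ell_m\in\mathrm{TL}(g_m\otimes g_m^*,g_{2r-2})$ ($r\le m\le2r-2$) is a diagrammatic integral if it satisfies the two displayed identities with $\ell$ in place of $\Omega$. *)

theory Defs
  imports Complex_Main "HOL-Library.Poly_Mapping"
begin

section \<open>Numbers\<close>

definition qroot :: "nat \<Rightarrow> complex" where
  "qroot r = exp (2 * of_real pi * \<i> / of_nat r)"

definition qbrace :: "nat \<Rightarrow> nat \<Rightarrow> complex" where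
  "qbrace r k = qroot r ^ k - inverse (qroot r) ^ k"

definition qbrace' :: "nat \<Rightarrow> nat \<Rightarrow> complex" where
  "qbrace' r k = qroot r ^ k + inverse (qroot r) ^ k"

definition qint :: "nat \<Rightarrow> nat \<Rightarrow> complex" where
  "qint r k = qbrace r k / qbrace r 1"

definition qfact :: "nat \<Rightarrow> nat \<Rightarrow> complex" where
  "qfact r k = (\<Prod>j = 1..k. qint r j)"


section \<open>Free complex vector spaces\<close>

text \<open>The complex vector space with basis \<open>'a\<close> is \<open>'a \<Rightarrow>\<^sub>0 complex\<close>; basis vectors are
  \<open>bvec\<close>, and \<open>lext f\<close> is the linear map with value \<open>f x\<close> at the basis vector \<open>x\<close>.\<close>

definition fscale :: "complex \<Rightarrow> ('a \<Rightarrow>\<^sub>0 complex) \<Rightarrow> ('a \<Rightarrow>\<^sub>0 complex)" where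
  "fscale c v = Poly_Mapping.map (\<lambda>z. c * z) v"

definition bvec :: "'a \<Rightarrow> ('a \<Rightarrow>\<^sub>0 complex)" where
  "bvec x = Poly_Mapping.single x 1"

definition lext :: "('a \<Rightarrow> ('b \<Rightarrow>\<^sub>0 complex)) \<Rightarrow> ('a \<Rightarrow>\<^sub>0 complex) \<Rightarrow> ('b \<Rightarrow>\<^sub>0 complex)" where
  "lext f v = (\<Sum>x\<in>Poly_Mapping.keys v. fscale (Poly_Mapping.lookup v x) (f x))"

definition lext2 ::
  "('a \<Rightarrow> 'b \<Rightarrow> ('c \<Rightarrow>\<^sub>0 complex)) \<Rightarrow> ('a \<Rightarrow>\<^sub>0 complex) \<Rightarrow> ('b \<Rightarrow>\<^sub>0 complex) \<Rightarrow> ('c \<Rightarrow>\<^sub>0 complex)"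
  where "lext2 f v w = lext (\<lambda>x. lext (f x) w) v"

definition fspan :: "'a set \<Rightarrow> ('a \<Rightarrow>\<^sub>0 complex) set" where
  "fspan B = {v. Poly_Mapping.keys v \<subseteq> B}"

definition flinear ::
  "('a \<Rightarrow>\<^sub>0 complex) set \<Rightarrow> ('b \<Rightarrow>\<^sub>0 complex) set \<Rightarrow> (('a \<Rightarrow>\<^sub>0 complex) \<Rightarrow> ('b \<Rightarrow>\<^sub>0 complex)) \<Rightarrow> bool"
  where
  "flinear V W f \<longleftrightarrow>
     (\<forall>v\<in>V. f v \<in> W) \<and>
     (\<forall>v\<in>V. \<forall>w\<in>V. f (v + w) = f v + f w) \<and>
     (\<forall>c. \<forall>v\<in>V. f (fscale c v) = fscale c (f v))"


section \<open>Planar tangles without circles\<close>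

text \<open>An endpoint is \<open>(0, i)\<close> (the \<open>i\<close>-th bottom endpoint) or \<open>(1, i)\<close> (the \<open>i\<close>-th top endpoint),
  counted from the left and from \<open>0\<close>. Up to isotopy, a planar tangle without circles is determined
  by which endpoints its arcs join; this is recorded as a symmetric relation. The numbers of
  endpoints are kept as separate fields.\<close>

type_synonym endpt = "nat \<times> nat"

datatype tangle = Tangle (bottoms: nat) (tops: nat) (arcs: "(endpt \<times> endpt) set")

definition endpts :: "nat \<Rightarrow> nat \<Rightarrow> endpt set" where
  "endpts m n = {0} \<times> {..<m} \<union> {1} \<times> {..<n}"

text \<open>Position of an endpoint on the boundary of the rectangle, read counterclockwise from the
  bottom left corner.\<close>

definition bdpos :: "nat \<Rightarrow> nat \<Rightarrow> endpt \<Rightarrow> nat" where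
  "bdpos m n x = (if fst x = 0 then snd x else m + (n - 1 - snd x))"

definition planar_tangles :: "nat \<Rightarrow> nat \<Rightarrow> tangle set" where
  "planar_tangles m n = {Tangle m n A | A.
     A \<subseteq> endpts m n \<times> endpts m n \<and> sym A \<and> irrefl A \<and>
     (\<forall>x\<in>endpts m n. \<exists>!y. (x, y) \<in> A) \<and>
     \<not> (\<exists>(a, b)\<in>A. \<exists>(c, d)\<in>A. bdpos m n a < bdpos m n c \<and> bdpos m n c < bdpos m n b
          \<and> bdpos m n b < bdpos m n d)}"

definition sym_arcs :: "(endpt \<times> endpt) set \<Rightarrow> (endpt \<times> endpt) set" where
  "sym_arcs S = S \<union> S\<inverse>"

definition id_tangle :: "nat \<Rightarrow> tangle" where
  "id_tangle m = Tangle m m (sym_arcs {((0, i), (1, i)) | i. i < m})"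

definition ev_tangle :: "nat \<Rightarrow> tangle" where
  "ev_tangle m = Tangle (2 * m) 0 (sym_arcs {((0, i), (0, 2 * m - 1 - i)) | i. i < m})"

definition coev_tangle :: "nat \<Rightarrow> tangle" where
  "coev_tangle m = Tangle 0 (2 * m) (sym_arcs {((1, i), (1, 2 * m - 1 - i)) | i. i < m})"

text \<open>Stacking \<open>D\<close> on top of \<open>D'\<close>: the glued picture has levels \<open>0\<close> (bottom of \<open>D'\<close>), \<open>1\<close>
  (the glued points) and \<open>2\<close> (top of \<open>D\<close>). The arcs of the composite join the distinct outer
  points lying in the same component, and the components consisting of glued points only are
  the circles.\<close>

definition glue :: "tangle \<Rightarrow> tangle \<Rightarrow> (endpt \<times> endpt) set" where
  "glue D D' = arcs D' \<union> {((Suc i, a), (Suc j, b)) | i a j b. ((i, a), (j, b)) \<in> arcs D}"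

definition stack :: "tangle \<Rightarrow> tangle \<Rightarrow> tangle" where
  "stack D D' = Tangle (bottoms D') (tops D)
     {((i div 2, a), (j div 2, b)) | i a j b.
        i \<in> {0, 2} \<and> j \<in> {0, 2} \<and> (i, a) \<noteq> (j, b) \<and> ((i, a), (j, b)) \<in> (glue D D')\<^sup>+}"

definition circles :: "tangle \<Rightarrow> tangle \<Rightarrow> nat" where
  "circles D D' = card {S. \<exists>a < bottoms D. S = (glue D D')\<^sup>* `` {(1, a)} \<and> S \<subseteq> {1} \<times> UNIV}"

definition beside :: "tangle \<Rightarrow> tangle \<Rightarrow> tangle" where
  "beside D D' =
     (let sh = (\<lambda>(i, a). (i, a + (if i = 0 then bottoms D else tops D)))
      in Tangle (bottoms D + bottoms D') (tops D + tops D')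
           (arcs D \<union> {(sh x, sh y) | x y. (x, y) \<in> arcs D'}))"

definition rotate_tangle :: "tangle \<Rightarrow> tangle" where
  "rotate_tangle D =
     (let rt = (\<lambda>(i, a). if i = 0 then (1, bottoms D - 1 - a) else (0, tops D - 1 - a))
      in Tangle (tops D) (bottoms D) {(rt x, rt y) | x y. (x, y) \<in> arcs D})"


section \<open>The Temperley--Lieb category\<close>

text \<open>All morphism spaces are subspaces of one space. Composites of non-composable tangles are \<open>0\<close>.\<close>

type_synonym tl = "tangle \<Rightarrow>\<^sub>0 complex"

definition TL :: "nat \<Rightarrow> nat \<Rightarrow> tl set" where
  "TL m n = fspan (planar_tangles m n)"

definition tl_comp :: "nat \<Rightarrow> tl \<Rightarrow> tl \<Rightarrow> tl" where
  "tl_comp r = lext2 (\<lambda>D D'. if bottoms D = tops D'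
     then fscale ((- qroot r - inverse (qroot r)) ^ circles D D') (bvec (stack D D')) else 0)"

definition tl_tensor :: "tl \<Rightarrow> tl \<Rightarrow> tl"  (infixr "\<otimes>\<^sub>T" 75) where
  "tl_tensor = lext2 (\<lambda>D D'. bvec (beside D D'))"

definition tl_rot :: "tl \<Rightarrow> tl" where
  "tl_rot = lext (\<lambda>D. bvec (rotate_tangle D))"

definition tl_id :: "nat \<Rightarrow> tl" where "tl_id m = bvec (id_tangle m)"
definition tl_ev :: "nat \<Rightarrow> tl" where "tl_ev m = bvec (ev_tangle m)"
definition tl_coev :: "nat \<Rightarrow> tl" where "tl_coev m = bvec (coev_tangle m)"

text \<open>\<open>TL(p, p')\<close> for idempotents \<open>p \<in> TL(m)\<close> and \<open>p' \<in> TL(m')\<close>.\<close>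

definition TL_idem :: "nat \<Rightarrow> nat \<Rightarrow> tl \<Rightarrow> nat \<Rightarrow> tl \<Rightarrow> tl set" where
  "TL_idem r m p m' p' = {u \<in> TL m m'. tl_comp r u p = u \<and> tl_comp r p' u = u}"


section \<open>Jones--Wenzl idempotents and Kirby color morphisms\<close>

definition tl_u :: "nat \<Rightarrow> nat \<Rightarrow> tl" where
  "tl_u r m = tl_id (m - 2) \<otimes>\<^sub>T tl_comp r (tl_coev 1) (tl_ev 1)"

fun jw_f :: "nat \<Rightarrow> nat \<Rightarrow> tl" where
  "jw_f r 0 = tl_id 0"
| "jw_f r (Suc 0) = tl_id 1"
| "jw_f r (Suc (Suc k)) =
     (let m = Suc (Suc k); p = jw_f r (Suc k) \<otimes>\<^sub>T tl_id 1
      in p + fscale (qint r (m - 1) / qint r m) (tl_comp r p (tl_comp r (tl_u r m) p)))"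

text \<open>\<open>jw_h r m\<close> is only meant for \<open>r \<le> m \<le> 2 r - 2\<close>.\<close>

definition jw_h :: "nat \<Rightarrow> nat \<Rightarrow> tl" where
  "jw_h r m =
     (let p = jw_f r (r - 1) \<otimes>\<^sub>T tl_id (m - r + 1);
          k = m - r + 1
      in fscale ((- 1) ^ (m + 1) * qint r (m + 1))
           (tl_comp r p
             (tl_comp r (tl_id (2 * r - m - 2) \<otimes>\<^sub>T tl_comp r (tl_coev k) (tl_ev k)) p)))"

text \<open>\<open>jw_g r m\<close> is only meant for \<open>r \<le> m \<le> 2 r - 2\<close>; below \<open>r\<close> it is a dummy value.\<close>

fun jw_g :: "nat \<Rightarrow> nat \<Rightarrow> tl" where
  "jw_g r m =
     (if m \<le> r then jw_f r (r - 1) \<otimes>\<^sub>T tl_id 1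
      else
        let g = jw_g r (m - 1) \<otimes>\<^sub>T tl_id 1;
            h = jw_h r (m - 1) \<otimes>\<^sub>T tl_id 1;
            via_u = (\<lambda>a b. tl_comp r a (tl_comp r (tl_u r m) b))
        in if m = r + 1
           then g - via_u g h - via_u h g - fscale (qint r 2) (via_u h h)
           else g + fscale (qint r (m - 1) / qint r m) (via_u g g)
                  - fscale (2 / (qint r m)\<^sup>2) (via_u g h))"

declare jw_g.simps [simp del]

definition kc_a :: "nat \<Rightarrow> tl" where
  "kc_a r = tl_comp r (jw_f r (r - 1) \<otimes>\<^sub>T tl_id (r - 1)) (tl_coev (r - 1))"

text \<open>The idempotent at the source of the \<open>m\<close>-th morphism of a diagrammatic integral.\<close>

definition kc_src :: "nat \<Rightarrow> nat \<Rightarrow> tl" where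
  "kc_src r m = (if m = r - 1 then jw_f r (r - 1) \<otimes>\<^sub>T jw_f r (r - 1)
                 else jw_g r m \<otimes>\<^sub>T tl_rot (jw_g r m))"

definition kc_t :: "nat \<Rightarrow> nat \<Rightarrow> tl" where
  "kc_t r m = tl_comp r (kc_a r) (tl_comp r (tl_ev m) (kc_src r m))"

definition kc_t' :: "nat \<Rightarrow> nat \<Rightarrow> tl" where
  "kc_t' r m = tl_comp r (jw_g r (2 * r - 2))
     (tl_comp r (tl_id (r - 1) \<otimes>\<^sub>T tl_ev (m - r + 1) \<otimes>\<^sub>T tl_id (r - 1)) (kc_src r m))"

definition kirby_color :: "nat \<Rightarrow> nat \<Rightarrow> tl" where
  "kirby_color r m =
     (if m = r - 1 then kc_t r m
      else fscale ((- 1) ^ m * (qbrace' r (m + 1) / 2)) (kc_t r m)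
           - fscale ((- 1) ^ m * qint r (m + 1)) (kc_t' r m))"


section \<open>Tensor powers of \<open>X\<close> and the functor to vector spaces\<close>

datatype xbasis = A0 | A1

text \<open>\<open>X\<^sup>\<otimes>\<^sup>m\<close> has as basis the words of length \<open>m\<close>; the unit object \<open>\<complex>\<close> is \<open>Xpow 0\<close>, with \<open>1\<close> being
  \<open>bvec []\<close>. Concatenation of words makes the tensor product strict.\<close>

type_synonym xvec = "xbasis list \<Rightarrow>\<^sub>0 complex"

definition Xpow :: "nat \<Rightarrow> xvec set" where
  "Xpow m = fspan {w. length w = m}"

definition xtensor :: "xvec \<Rightarrow> xvec \<Rightarrow> xvec"  (infixr "\<otimes>\<^sub>X" 75) where
  "xtensor = lext2 (\<lambda>s t. bvec (s @ t))"

text \<open>\<open>f \<otimes> g\<close> for linear maps \<open>f\<close>, \<open>g\<close>, where \<open>f\<close> is defined on \<open>Xpow m\<close>.\<close>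

definition xmap_tensor :: "nat \<Rightarrow> (xvec \<Rightarrow> xvec) \<Rightarrow> (xvec \<Rightarrow> xvec) \<Rightarrow> xvec \<Rightarrow> xvec" where
  "xmap_tensor m f g = lext (\<lambda>w. f (bvec (take m w)) \<otimes>\<^sub>X g (bvec (drop m w)))"

definition X_e :: "nat \<Rightarrow> xvec \<Rightarrow> xvec" where
  "X_e r = lext (\<lambda>w. if w = [A0, A1] then - bvec []
                     else if w = [A1, A0] then fscale (inverse (qroot r)) (bvec []) else 0)"

definition X_c :: "nat \<Rightarrow> xvec" where
  "X_c r = fscale (qroot r) (bvec [A0, A1]) - bvec [A1, A0]"

text \<open>The characterization of \<open>F\<^sub>T\<^sub>L\<close>: a faithful strict monoidal linear functor sending the object
  \<open>m\<close> to \<open>Xpow m\<close>. A functor is given by its action on morphisms, \<open>\<Phi> u z\<close> being the value of the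
  linear map \<open>\<Phi> u\<close> at \<open>z\<close>; only the values for \<open>u \<in> TL m n\<close> and \<open>z \<in> Xpow m\<close> are constrained, and
  these are determined since cups and caps generate the category.\<close>

locale tl_functor =
  fixes r :: nat and \<Phi> :: "tl \<Rightarrow> xvec \<Rightarrow> xvec"
  assumes map_linear: "u \<in> TL m n \<Longrightarrow> flinear (Xpow m) (Xpow n) (\<Phi> u)"
    and add: "u \<in> TL m n \<Longrightarrow> v \<in> TL m n \<Longrightarrow> z \<in> Xpow m \<Longrightarrow> \<Phi> (u + v) z = \<Phi> u z + \<Phi> v z"
    and scale: "u \<in> TL m n \<Longrightarrow> z \<in> Xpow m \<Longrightarrow> \<Phi> (fscale c u) z = fscale c (\<Phi> u z)"
    and id: "z \<in> Xpow m \<Longrightarrow> \<Phi> (tl_id m) z = z"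
    and comp: "u \<in> TL m k \<Longrightarrow> v \<in> TL k n \<Longrightarrow> z \<in> Xpow m \<Longrightarrow> \<Phi> (tl_comp r v u) z = \<Phi> v (\<Phi> u z)"
    and tensor: "u \<in> TL m n \<Longrightarrow> v \<in> TL m' n' \<Longrightarrow> y \<in> Xpow m \<Longrightarrow> z \<in> Xpow m' \<Longrightarrow>
      \<Phi> (u \<otimes>\<^sub>T v) (y \<otimes>\<^sub>X z) = \<Phi> u y \<otimes>\<^sub>X \<Phi> v z"
    and faithful: "u \<in> TL m n \<Longrightarrow> v \<in> TL m n \<Longrightarrow> (\<And>z. z \<in> Xpow m \<Longrightarrow> \<Phi> u z = \<Phi> v z) \<Longrightarrow> u = v"
    and ev: "z \<in> Xpow 2 \<Longrightarrow> \<Phi> (tl_ev 1) z = X_e r z"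
    and coev: "\<Phi> (tl_coev 1) (bvec []) = X_c r"


section \<open>The small quantum group\<close>

type_synonym pbw_index = "nat \<times> nat \<times> nat"

text \<open>A complex algebra is a ring \<open>'u\<close> with a scalar multiplication \<open>scale\<close>. As \<open>K ^ r = 1\<close>, the
  inverse of \<open>K\<close> is \<open>K ^ (r - 1)\<close>.\<close>

locale small_quantum_group = vector_space scale
  for scale :: "complex \<Rightarrow> 'u \<Rightarrow> 'u::ring_1" +
  fixes r :: nat and E F K :: 'u
  assumes scale_mult_left: "scale c x * y = scale c (x * y)"
    and scale_mult_right: "x * scale c y = scale c (x * y)"
    and E_nilpotent: "E ^ r = 0"
    and F_nilpotent: "F ^ r = 0"
    and K_order: "K ^ r = 1"
    and K_E: "K * E * K ^ (r - 1) = scale ((qroot r)\<^sup>2) E"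
    and K_F: "K * F * K ^ (r - 1) = scale (inverse ((qroot r)\<^sup>2)) F"
    and E_F: "E * F - F * E = scale (1 / (qroot r - inverse (qroot r))) (K - K ^ (r - 1))"
    and pbw_inj: "inj_on (\<lambda>(a, b, c). E ^ a * F ^ b * K ^ c) ({..<r} \<times> {..<r} \<times> {..<r})"
    and pbw_independent:
      "independent ((\<lambda>(a, b, c). E ^ a * F ^ b * K ^ c) ` ({..<r} \<times> {..<r} \<times> {..<r}))"
    and pbw_span:
      "span ((\<lambda>(a, b, c). E ^ a * F ^ b * K ^ c) ` ({..<r} \<times> {..<r} \<times> {..<r})) = UNIV"
begin

definition Kinv :: 'u where "Kinv = K ^ (r - 1)"

definition pbw_indices :: "pbw_index set" where
  "pbw_indices = {..<r} \<times> {..<r} \<times> {..<r}"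

definition pbw :: "pbw_index \<Rightarrow> 'u" where
  "pbw = (\<lambda>(a, b, c). E ^ a * F ^ b * K ^ c)"

definition coords :: "'u \<Rightarrow> (pbw_index \<Rightarrow>\<^sub>0 complex)" where
  "coords x = (\<Sum>i\<in>pbw_indices.
     Poly_Mapping.single i (representation (pbw ` pbw_indices) x (pbw i)))"

text \<open>The linear functional taking the value \<open>r ([r - 1]!)\<^sup>2\<close> at \<open>E\<^sup>r\<^sup>-\<^sup>1 F\<^sup>r\<^sup>-\<^sup>1 K\<^sup>r\<^sup>-\<^sup>1\<close> and \<open>0\<close> at the other
  elements of the PBW basis.\<close>

definition left_integral :: "'u \<Rightarrow> complex" where
  "left_integral x =
     of_nat r * (qfact r (r - 1))\<^sup>2 * Poly_Mapping.lookup (coords x) (r - 1, r - 1, r - 1)"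

definition casimir :: 'u where
  "casimir = F * E + scale (1 / (qbrace r 1)\<^sup>2) (scale (qroot r) K + scale (inverse (qroot r)) Kinv)"

definition casimir_eigenspace :: "complex \<Rightarrow> 'u set" where
  "casimir_eigenspace \<beta> = {x. \<exists>n. ((\<lambda>y. casimir * y - scale \<beta> y) ^^ n) x = 0}"

definition beta :: "nat \<Rightarrow> complex" where
  "beta m = qbrace' r (m + 1) / (qbrace r 1)\<^sup>2"

text \<open>This characterizes \<open>e\<^sub>m\<close> uniquely: the generalized eigenspaces span the algebra, so the last
  two conditions say that multiplication by \<open>e\<close> is the projection onto the one of eigenvalue
  \<open>beta m\<close> along the others.\<close>

definition casimir_idempotent :: "nat \<Rightarrow> 'u \<Rightarrow> bool" where
  "casimir_idempotent m e \<longleftrightarrow>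
     e * e = e \<and> (\<forall>x. e * x = x * e) \<and>
     (\<forall>x\<in>casimir_eigenspace (beta m). e * x = x) \<and>
     (\<forall>\<beta>. \<beta> \<noteq> beta m \<longrightarrow> (\<forall>x\<in>casimir_eigenspace \<beta>. e * x = 0))"

text \<open>The tensor square of the algebra, in coordinates with respect to the tensor square of the PBW
  basis, with its componentwise product. The coproduct is an algebra homomorphism, so its value at
  \<open>E\<^sup>a F\<^sup>b K\<^sup>c\<close> is the product of the powers of its values at the generators.\<close>

definition utensor :: "'u \<Rightarrow> 'u \<Rightarrow> (pbw_index \<times> pbw_index \<Rightarrow>\<^sub>0 complex)" where
  "utensor x y = lext2 (\<lambda>i j. bvec (i, j)) (coords x) (coords y)"

definition utensor_mult ::
  "(pbw_index \<times> pbw_index \<Rightarrow>\<^sub>0 complex) \<Rightarrow> (pbw_index \<times> pbw_index \<Rightarrow>\<^sub>0 complex)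
     \<Rightarrow> (pbw_index \<times> pbw_index \<Rightarrow>\<^sub>0 complex)" where
  "utensor_mult = lext2 (\<lambda>(i, j) (k, l). utensor (pbw i * pbw k) (pbw j * pbw l))"

definition coproduct_pbw :: "pbw_index \<Rightarrow> (pbw_index \<times> pbw_index \<Rightarrow>\<^sub>0 complex)" where
  "coproduct_pbw = (\<lambda>(a, b, c).
     ((utensor_mult (utensor E K + utensor 1 E) ^^ a) \<circ>
      (utensor_mult (utensor Kinv F + utensor F 1) ^^ b) \<circ>
      (utensor_mult (utensor K K) ^^ c)) (utensor 1 1))"

definition coproduct :: "'u \<Rightarrow> (pbw_index \<times> pbw_index \<Rightarrow>\<^sub>0 complex)" where
  "coproduct x = lext coproduct_pbw (coords x)"

text \<open>The counit, with \<open>\<epsilon>(E) = \<epsilon>(F) = 0\<close> and \<open>\<epsilon>(K) = 1\<close>.\<close>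

definition counit :: "'u \<Rightarrow> complex" where
  "counit x = (\<Sum>c<r. Poly_Mapping.lookup (coords x) (0, 0, c))"

definition X_E :: "xvec \<Rightarrow> xvec" where
  "X_E = lext (\<lambda>w. if w = [A1] then bvec [A0] else 0)"

definition X_F :: "xvec \<Rightarrow> xvec" where
  "X_F = lext (\<lambda>w. if w = [A0] then bvec [A1] else 0)"

definition X_K :: "xvec \<Rightarrow> xvec" where
  "X_K = lext (\<lambda>w. if w = [A0] then fscale (qroot r) (bvec [A0])
                   else if w = [A1] then fscale (inverse (qroot r)) (bvec [A1]) else 0)"

definition X_act :: "'u \<Rightarrow> xvec \<Rightarrow> xvec" where
  "X_act x v = lext (\<lambda>(a, b, c). (X_E ^^ a) ((X_F ^^ b) ((X_K ^^ c) v))) (coords x)"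

text \<open>The action on \<open>X\<^sup>\<otimes>\<^sup>m\<close> through the iterated coproduct: \<open>X\<^sup>\<otimes>\<^sup>0\<close> is the trivial module, and \<open>x\<close> acts
  on \<open>X\<^sup>\<otimes>\<^sup>m \<otimes> X\<close> through its coproduct.\<close>

primrec Xpow_act :: "nat \<Rightarrow> 'u \<Rightarrow> xvec \<Rightarrow> xvec" where
  "Xpow_act 0 x v = fscale (counit x) v"
| "Xpow_act (Suc m) x v =
     lext (\<lambda>(i, j). xmap_tensor m (Xpow_act m (pbw i)) (X_act (pbw j)) v) (coproduct x)"

text \<open>\<open>F\<^sub>T\<^sub>L(u)((x \<otimes> 1) \<cdot> c\<^sub>m)\<close>.\<close>

definition pair_coev :: "(tl \<Rightarrow> xvec \<Rightarrow> xvec) \<Rightarrow> tl \<Rightarrow> nat \<Rightarrow> 'u \<Rightarrow> xvec" where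
  "pair_coev \<Phi> u m x = \<Phi> u (xmap_tensor m (Xpow_act m x) (\<lambda>z. z) (\<Phi> (tl_coev m) (bvec [])))"

definition diagrammatic_integral ::
  "(tl \<Rightarrow> xvec \<Rightarrow> xvec) \<Rightarrow> (nat \<Rightarrow> 'u) \<Rightarrow> (nat \<Rightarrow> tl) \<Rightarrow> bool" where
  "diagrammatic_integral \<Phi> e l \<longleftrightarrow>
     (\<forall>m\<in>{r - 1..2 * r - 2}.
        l m \<in> TL_idem r (2 * m) (kc_src r m) (2 * r - 2) (jw_g r (2 * r - 2))) \<and>
     (\<forall>x. pair_coev \<Phi> (l (r - 1)) (r - 1) x
          = fscale (left_integral (x * e (r - 1))) (\<Phi> (kc_a r) (bvec []))) \<and>
     (\<forall>x. \<forall>m\<in>{r..2 * r - 2}.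
        pair_coev \<Phi> (l m) m x + pair_coev \<Phi> (l (3 * r - m - 2)) (3 * r - m - 2) x
          = fscale (left_integral (x * e m)) (\<Phi> (kc_a r) (bvec [])))"

end

end

theory Submission
  imports Defs "HOL-Computational_Algebra.Polynomial"
begin

text \<open>Under the functor every tangle becomes an operator on functions of infinite words in the basis
  of X, on which cups, caps, Jones--Wenzl idempotents and the quantum group act simultaneously. A
  morphism of the color is tested on elements x of the quantum group. Both sides of the identity
  are intertwiners from the adjoint action, and no highest or lowest weight vectors of
  the target have the weights of the nonzero-degree elements, so it suffices to take x in the
  subalgebra generated by K and the Casimir element. There the left integral is a residue of
  polynomials at the Casimir eigenvalues. On the diagrammatic side, inserting the weight projections
  into the closed strands gives sums of constants that jump at two positions, where the jumps
  are computed from a first-order recursion along the weights.\<close>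

section \<open>Operators on infinite words\<close>

text \<open>An operator on functions of infinite words does not notice identity strands added on the
  right. Hence morphisms with different numbers of endpoints and the quantum group generators all
  live in one ring, and identities between them become rewriting. With \<open>r = N + 1\<close> and
  \<open>m = N + k\<close>, the period \<open>r\<close> of the quantum integers replaces
  \<open>m + 1\<close> by \<open>k\<close>, and the partner \<open>3r - m - 2\<close> of
  \<open>m\<close> corresponds to \<open>r - k\<close>. The obstacle is that blocks are not
  semisimple: on \<open>g\<close> the Casimir operator is the scalar \<open>{k}'\<close> plus a
  multiple of the square-zero element \<open>h\<close>. So a power of it contributes a value and a
  derivative at \<open>{k}'\<close>, and these are the two data that the residue formula for the
  integral sees at a double root. Each single morphism of the color also produces sums over all
  weights (\<open>Ssum\<close>), most of which are never evaluated. They cancel between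
  \<open>k\<close> and \<open>r - k\<close> because \<open>[r - k] = - [k]\<close>; this is why the
  identity is stated for a pair. What survives are the jumps of a weight function at
  \<open>k\<close> and \<open>r - k\<close>. They remove half of the contribution of the two closed
  traces, which accounts for the coefficients of \<open>t\<close> and \<open>t'\<close>.\<close>

type_synonym wfun = "(nat => xbasis) => complex"

lemmas massoc = mult.assoc

abbreviation pkeys :: "('a \<Rightarrow>\<^sub>0 complex) => 'a set" where "pkeys \<equiv> Poly_Mapping.keys"

abbreviation lkp :: "('a \<Rightarrow>\<^sub>0 complex) => 'a => complex" where "lkp \<equiv> Poly_Mapping.lookup"

definition clinear :: "(wfun => wfun) => bool" where
 "clinear T \<longleftrightarrow> (\<forall>f g. T (%s. f s + g s) = (%s. T f s + T g s)) \<and>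
   (\<forall>c f. T (%s. c * f s) = (%s. c * T f s))"

text \<open>Making linear operators a type with an instance of \<open>ring_1\<close>, composition
  being the product, lets the generic ring rules of the simplifier do the diagrammatic
  calculus.\<close>

typedef lop = "{T. clinear T}" morphisms ap Lop
 by (rule exI[of _ "%f. f"]) (simp add: clinear_def)

setup_lifting type_definition_lop

lemma clinear_ap: "clinear (ap x)"
 using ap[of x] by simp

lemma ap_add: "ap x (%s. f s + g s) = (%s. ap x f s + ap x g s)"
 and ap_mult: "ap x (%s. c * f s) = (%s. c * ap x f s)"
 using clinear_ap[of x] by (auto simp: clinear_def)

lemma ap_zero: "ap x (%s. 0) = (%s. 0)"
 using ap_mult[of x 0 "%s. 0"] by simp

lemma ap_sum: "ap x (%s. \<Sum>i\<in>A. g i s) = (%s. \<Sum>i\<in>A. ap x (g i) s)"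
 by (induction A rule: infinite_finite_induct) (auto simp: ap_add ap_zero)

lemma lop_eqI: "(!!f s. ap x f s = ap y f s) ==> x = y"
 by (metis ap_inject ext)

instantiation lop :: ring_1
begin

lift_definition zero_lop :: lop is "%f s. 0" by (simp add: clinear_def)
lift_definition one_lop :: lop is "%f. f" by (simp add: clinear_def)
lift_definition plus_lop :: "lop => lop => lop" is "%x y f s. x f s + y f s"
 by (auto simp: clinear_def algebra_simps)
lift_definition uminus_lop :: "lop => lop" is "%x f s. - x f s"
 by (auto simp: clinear_def algebra_simps)
lift_definition minus_lop :: "lop => lop => lop" is "%x y f s. x f s - y f s"
 by (auto simp: clinear_def algebra_simps)
lift_definition times_lop :: "lop => lop => lop" is "%x y f. x (y f)"
 by (auto simp: clinear_def)

instance
proof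
 fix a b c :: lop
 show "a * b * c = a * (b * c)" by transfer simp
 show "1 * a = a" "a * 1 = a" by (transfer, simp)+
 show "a + b + c = a + (b + c)" "a + b = b + a" "0 + a = a"
  by (transfer, simp add: algebra_simps)+
 show "- a + a = 0" "a - b = a + - b" by (transfer, simp)+
 show "(a + b) * c = a * c + b * c" by transfer simp
 show "a * (b + c) = a * b + a * c" by transfer (auto simp: clinear_def)
 show "(0::lop) ~= 1"
  by (transfer, rule notI, drule fun_cong[of _ _ "%_. 1"], drule fun_cong[of _ _ "%_. A0"], simp)
qed

end

lift_definition smult :: "complex => lop => lop" (infixr "*." 75) is "%c x f s. c * x f s"
 by (auto simp: clinear_def algebra_simps)

lemma ap_simps [simp]:
 "ap 0 f = (%s. 0)" "ap 1 f = f" "ap (x + y) f = (%s. ap x f s + ap y f s)"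
 "ap (x - y) f = (%s. ap x f s - ap y f s)" "ap (- x) f = (%s. - ap x f s)"
 "ap (x * y) f = ap x (ap y f)" "ap (c *. x) f = (%s. c * ap x f s)"
 by (transfer, simp)+

lemma ap_sum_lop: "ap (sum x A) f s = (\<Sum>i\<in>A. ap (x i) f s)"
 by (induction A rule: infinite_finite_induct) auto

lemma smult_simps [simp]:
 "x * (c *. y) = c *. (x * y)" "(c *. x) * y = c *. (x * y)"
 "c *. (d *. x) = (c * d) *. x" "1 *. x = x" "0 *. x = 0" "c *. 0 = 0"
 "c *. (- x) = - (c *. x)" "(- c) *. x = - (c *. x)"
 by (rule lop_eqI, simp add: ap_mult)+

lemma smult_add_right: "c *. (x + y) = c *. x + c *. y"
 and smult_add_left: "(c + d) *. x = c *. x + d *. x"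
 and smult_diff_right: "c *. (x - y) = c *. x - c *. y"
 and smult_diff_left: "(c - d) *. x = c *. x - d *. x"
 by (rule lop_eqI, simp add: algebra_simps)+

lemma smult_sum: "c *. sum x A = (\<Sum>i\<in>A. c *. x i)"
 by (rule lop_eqI) (simp add: ap_sum_lop sum_distrib_left)

lemma sum_smult: "(\<Sum>i\<in>A. c i *. x) = sum c A *. x"
 by (rule lop_eqI) (simp add: ap_sum_lop sum_distrib_right)

lemma smult_cancel: "c *. x = c *. y ==> c ~= 0 ==> x = y"
proof -
 assume "c *. x = c *. y" "c ~= 0"
 hence "inverse c *. (c *. x) = inverse c *. (c *. y)" by simp
 with \<open>c ~= 0\<close> show "x = y" by simp
qed

lemmas smult_distrib = smult_add_right smult_diff_right smult_add_left smult_diff_left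

section \<open>Inserting and deleting a pair of neighbouring letters\<close>

definition ins :: "nat => xbasis => xbasis => (nat => xbasis) => nat => xbasis" where
 "ins i x y s = (%n. if n < i then s n else if n = i then x else if n = Suc i then y else s (n - 2))"

definition del :: "nat => (nat => xbasis) => nat => xbasis" where
 "del i s = (%n. if n < i then s n else s (n + 2))"

text \<open>A function on words is read as the family of coefficients of a vector. A cap therefore
  contracts two neighbouring positions with the values of the form \<open>e\<close> and closes the
  gap; the cup below multiplies by the coefficients of \<open>c\<close>.\<close>

lift_definition cap :: "complex => nat => lop" is
 "%q i f s. inverse q * f (ins i A1 A0 s) - f (ins i A0 A1 s)"
 by (auto simp: clinear_def algebra_simps)

lift_definition cup :: "complex => nat => lop" is
 "%q i f s. (if s i = A0 & s (Suc i) = A1 then q * f (del i s)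
   else if s i = A1 & s (Suc i) = A0 then - f (del i s) else 0)"
 by (auto simp: clinear_def algebra_simps)

lift_definition site :: "(xbasis => xbasis => complex) => nat => lop" is
 "%M i f s. M (s i) A0 * f (s(i := A0)) + M (s i) A1 * f (s(i := A1))"
 by (auto simp: clinear_def algebra_simps)

lemma ap_cap: "ap (cap q i) f s = inverse q * f (ins i A1 A0 s) - f (ins i A0 A1 s)"
 by transfer simp
lemma ap_cup: "ap (cup q i) f s = (if s i = A0 & s (Suc i) = A1 then q * f (del i s)
   else if s i = A1 & s (Suc i) = A0 then - f (del i s) else 0)"
 by transfer simp
lemma ap_site: "ap (site M i) f s = M (s i) A0 * f (s(i := A0)) + M (s i) A1 * f (s(i := A1))"
 by transfer simp

lemma ins_nth [simp]: "ins i x y s i = x" "ins i x y s (Suc i) = y"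
 "j < i ==> ins i x y s j = s j" "i <= j ==> ins i x y s (Suc (Suc j)) = s j"
 by (auto simp: ins_def)

lemma del_nth [simp]: "j < i ==> del i s j = s j" "i <= j ==> del i s j = s (Suc (Suc j))"
 by (auto simp: del_def)

lemma del_ins [simp]: "del i (ins i x y s) = s"
 by (rule ext) (auto simp: ins_def del_def)

lemma del_ins_Suc: "del (Suc i) (ins i x y s) = s(i := x)"
 by (rule ext) (auto simp: ins_def del_def)

lemma del_Suc_ins: "del i (ins (Suc i) x y s) = s(i := y)"
 by (rule ext) (auto simp: ins_def del_def)

text \<open>In the last case the witness is the position after the pair has been removed, so that
  \<open>ins\<close> and \<open>del\<close> evaluate by simplification.\<close>

lemma nat_window_cases:
 fixes n i :: nat
 obtains "n < i" | "n = i" | "n = Suc i" | m where "n = Suc (Suc m)" "i <= m"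
proof -
 have "n < i | n = i | n = Suc i | (\<exists>m. n = Suc (Suc m) & i <= m)"
  by presburger
 thus thesis using that by blast
qed

lemma ins_ins:
 assumes "i <= j"
 shows "ins (Suc (Suc j)) x y (ins i x' y' s) = ins i x' y' (ins j x y s)"
proof (rule ext)
 fix n
 show "ins (Suc (Suc j)) x y (ins i x' y' s) n = ins i x' y' (ins j x y s) n"
 proof (cases n i rule: nat_window_cases)
  case (4 m)
  show ?thesis
  proof (cases m j rule: nat_window_cases)
   case 1 with 4 show ?thesis by simp
  next
   case 2 with 4 show ?thesis by simp
  next
   case 3 with 4 show ?thesis by simp
  next
   case (4 k)
   with \<open>n = Suc (Suc m)\<close> \<open>i <= j\<close> show ?thesis by simp
  qed
 qed (use \<open>i <= j\<close> in simp_all)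
qed

lemma del_del: "i <= j ==> del i (del (Suc (Suc j)) s) = del j (del i s)"
 by (rule ext) (auto simp: del_def)

lemma del_ins_right:
 assumes "i <= j"
 shows "del (Suc (Suc j)) (ins i x y s) = ins i x y (del j s)"
proof (rule ext)
 fix n
 show "del (Suc (Suc j)) (ins i x y s) n = ins i x y (del j s) n"
 proof (cases n i rule: nat_window_cases)
  case (4 m)
  thus ?thesis by (cases "m < j") simp_all
 qed (use \<open>i <= j\<close> in simp_all)
qed

lemma del_ins_left:
 assumes "i <= j"
 shows "del i (ins (Suc (Suc j)) x y s) = ins j x y (del i s)"
proof (rule ext)
 fix n
 show "del i (ins (Suc (Suc j)) x y s) n = ins j x y (del i s) n"
 proof (cases "n < i")
  case False
  thus ?thesis using \<open>i <= j\<close> by (cases n j rule: nat_window_cases) simp_all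
 qed (use \<open>i <= j\<close> in simp_all)
qed

lemmas del_ins_far = del_ins_right del_ins_left

lemma upd_ins: "j < i ==> (ins i x y s)(j := z) = ins i x y (s(j := z))"
 "i <= j ==> (ins i x y s)(Suc (Suc j) := z) = ins i x y (s(j := z))"
 by (rule ext; auto simp: ins_def)+

lemma upd_del: "j < i ==> (del i s)(j := z) = del i (s(j := z))"
 "i <= j ==> (del i s)(j := z) = del i (s(Suc (Suc j) := z))"
 by (rule ext; auto simp: del_def)+

lemma not_A0 [simp]: "x ~= A0 \<longleftrightarrow> x = A1" "x ~= A1 \<longleftrightarrow> x = A0"
 by (cases x; simp)+

lemma not_A [simp]: "A0 ~= x \<longleftrightarrow> x = A1" "A1 ~= x \<longleftrightarrow> x = A0"
 by (cases x; simp)+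

section \<open>Circle value, zigzag relations and commutation at a distance\<close>

lemma cap_cup_same: "q ~= 0 ==> cap q i * cup q i = (- q - inverse q) *. 1"
 by (rule lop_eqI) (simp add: ap_cap ap_cup algebra_simps)

lemma cap_cup_Suc: "q ~= 0 ==> cap q i * cup q (Suc i) = 1"
 by (rule lop_eqI) (auto simp: ap_cap ap_cup del_ins_Suc fun_upd_idem)

lemma cap_Suc_cup: "q ~= 0 ==> cap q (Suc i) * cup q i = 1"
 by (rule lop_eqI) (auto simp: ap_cap ap_cup del_Suc_ins fun_upd_idem)

lemma cap_cup_far: "i + 2 <= j ==> cap q i * cup q j = cup q (j - 2) * cap q i"
proof (rule lop_eqI)
 fix f s assume ij: "i + 2 <= j"
 then obtain k where k: "j = Suc (Suc k)" "i <= k" by (auto simp: le_iff_add)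
 show "ap (cap q i * cup q j) f s = ap (cup q (j - 2) * cap q i) f s"
  using k by (auto simp: ap_cap ap_cup del_ins_far algebra_simps)
qed

lemma cap_far_cup: "i + 2 <= j ==> cap q j * cup q i = cup q i * cap q (j - 2)"
proof (rule lop_eqI)
 fix f s assume ij: "i + 2 <= j"
 then obtain k where k: "j = Suc (Suc k)" "i <= k" by (auto simp: le_iff_add)
 show "ap (cap q j * cup q i) f s = ap (cup q i * cap q (j - 2)) f s"
  using k by (auto simp: ap_cap ap_cup del_ins_far algebra_simps)
qed

lemma cap_cap_far: "i + 2 <= j ==> cap q i * cap q j = cap q (j - 2) * cap q i"
proof (rule lop_eqI)
 fix f s assume ij: "i + 2 <= j"
 then obtain k where k: "j = Suc (Suc k)" "i <= k" by (auto simp: le_iff_add)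
 show "ap (cap q i * cap q j) f s = ap (cap q (j - 2) * cap q i) f s"
  using k by (auto simp: ap_cap ins_ins algebra_simps)
qed

lemma cup_cup_far: "i + 2 <= j ==> cup q j * cup q i = cup q i * cup q (j - 2)"
proof (rule lop_eqI)
 fix f s assume ij: "i + 2 <= j"
 then obtain k where k: "j = Suc (Suc k)" "i <= k" by (auto simp: le_iff_add)
 show "ap (cup q j * cup q i) f s = ap (cup q i * cup q (j - 2)) f s"
  using k by (auto simp: ap_cup del_del)
qed

lemma cap_site_left: "j < i ==> cap q i * site M j = site M j * cap q i"
 by (rule lop_eqI) (auto simp: ap_cap ap_site upd_ins algebra_simps)

lemma cap_site_right: "i <= j ==> cap q i * site M (Suc (Suc j)) = site M j * cap q i"
 by (rule lop_eqI) (auto simp: ap_cap ap_site upd_ins algebra_simps)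

lemma cup_site_left: "j < i ==> site M j * cup q i = cup q i * site M j"
 by (rule lop_eqI) (auto simp: ap_cup ap_site upd_del algebra_simps)

lemma cup_site_right: "i <= j ==> site M (Suc (Suc j)) * cup q i = cup q i * site M j"
 by (rule lop_eqI) (auto simp: ap_cup ap_site upd_del algebra_simps)

lemma site_commute: "i ~= j ==> site M i * site M' j = site M' j * site M i"
 by (rule lop_eqI) (auto simp: ap_site fun_upd_twist algebra_simps)

text \<open>Products are kept nested to the right by \<open>massoc\<close>. This turns a rule for a
  product of two factors into one that also applies when further factors follow; most calculations
  use a rule together with its \<open>mult3\<close> form.\<close>

lemma mult3: "x * y = z ==> x * (y * w) = z * (w::lop)"
 by (metis massoc)

section \<open>Quantum integers at a root of unity of odd order\<close>

locale odd_root =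
 fixes r N :: nat
 assumes r_ge: "3 <= r" and r_odd: "odd r" and r_Suc: "r = Suc N"
begin

abbreviation q :: complex where "q \<equiv> qroot r"
abbreviation iq :: complex where "iq \<equiv> inverse (qroot r)"
abbreviation qi :: "nat => complex" where "qi \<equiv> qint r"
abbreviation br :: "nat => complex" where "br \<equiv> qbrace r"
abbreviation br' :: "nat => complex" where "br' \<equiv> qbrace' r"

lemma q_nz [simp]: "q ~= 0"
 by (simp add: qroot_def)

lemma q_cis: "q = cis (2 * pi / real r)"
 by (simp add: qroot_def cis_conv_exp mult_ac)

lemma q_pow_eq_1: "q ^ k = 1 \<longleftrightarrow> r dvd k"
proof
 assume "q ^ k = 1"
 hence "cis (real k * (2 * pi / real r)) = 1"
  by (simp add: q_cis DeMoivre)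
 hence "cos (real k * (2 * pi / real r)) = 1"
  by (metis cis.sel(1) one_complex.sel(1))
 then obtain n :: int where "real k * (2 * pi / real r) = of_int n * 2 * pi"
  by (auto simp: cos_one_2pi_int)
 hence "real k = of_int n * real r"
  using r_ge by (simp add: field_simps)
 hence "int k = n * int r"
  by (metis of_int_eq_iff of_int_mult of_int_of_nat_eq)
 thus "r dvd k"
  by (metis dvd_triv_right int_dvd_int_iff)
next
 assume "r dvd k"
 then obtain l where "k = r * l" ..
 hence "q ^ k = (q ^ r) ^ l" by (simp add: power_mult)
 moreover have "q ^ r = cis (2 * pi)"
  using r_ge by (simp add: q_cis DeMoivre)
 ultimately show "q ^ k = 1" by simp
qed

lemma q_pow_r [simp]: "q ^ r = 1"
 by (simp add: q_pow_eq_1)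

lemma q_pow_mod: "q ^ (k mod r) = q ^ k"
proof -
 have "q ^ k = q ^ (r * (k div r) + k mod r)" by simp
 also have "... = q ^ (k mod r)" by (simp only: power_add power_mult q_pow_r) simp
 finally show ?thesis ..
qed

text \<open>Oddness of \<open>r\<close> enters here: 2 is invertible modulo \<open>r\<close>, so
  \<open>q^2\<close> is again a primitive \<open>r\<close>-th root of unity.\<close>

lemma r_dvd_double: "r dvd 2 * k \<longleftrightarrow> r dvd k"
 using r_odd by (simp add: coprime_dvd_mult_right_iff coprime_commute)

lemma q2_pow_eq_1: "q ^ (2 * k) = 1 \<longleftrightarrow> r dvd k"
 by (simp add: q_pow_eq_1 r_dvd_double)

lemma br_eq_0: "br k = 0 \<longleftrightarrow> r dvd k"
proof -
 have "br k = 0 \<longleftrightarrow> q ^ k * q ^ k = 1"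
  by (simp add: qbrace_def field_simps)
 also have "... \<longleftrightarrow> r dvd k"
  by (simp add: q2_pow_eq_1 power_add[symmetric] mult_2[symmetric])
 finally show ?thesis .
qed

lemma br1_nz [simp]: "br (Suc 0) ~= 0"
 using r_ge by (simp add: br_eq_0)

lemma qi_eq_0: "qi k = 0 \<longleftrightarrow> r dvd k"
 using br1_nz by (simp add: qint_def br_eq_0)

lemma qi_nz: "0 < k ==> k < r ==> qi k ~= 0"
 by (auto simp: qi_eq_0 dest: dvd_imp_le)

lemma qi_0 [simp]: "qi 0 = 0" and qi_1 [simp]: "qi (Suc 0) = 1"
 by (simp_all add: qint_def) (simp add: qbrace_def)

lemma qi_2: "qi 2 = q + iq"
proof -
 have "br 2 = (q + iq) * br 1"
  by (simp add: qbrace_def power2_eq_square field_simps)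
 thus ?thesis by (simp add: qint_def)
qed

lemma qi_rec: "qi (k + 2) + qi k = qi 2 * qi (Suc k)"
proof -
 have "br (k + 2) + br k = (q + iq) * br (Suc k)"
  by (simp add: qbrace_def field_simps power2_eq_square)
 moreover have "qi (k + 2) + qi k = (br (k + 2) + br k) / br 1"
  by (simp only: qint_def add_divide_distrib)
 ultimately show ?thesis by (simp add: qi_2) (simp add: qint_def)
qed

lemma br'_rec: "br' (k + 2) + br' k = qi 2 * br' (Suc k)"
 by (simp add: qbrace'_def qi_2 field_simps power2_eq_square)

lemma br_add_r: "br (r + k) = br k" and br'_add_r: "br' (r + k) = br' k"
 by (simp_all add: qbrace_def qbrace'_def power_add power_inverse)

lemma qi_add_r: "qi (r + k) = qi k"
 by (simp add: qint_def br_add_r)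

lemma q_pow_diff:
 assumes "k <= r" shows "q ^ (r - k) = iq ^ k"
proof -
 have "q ^ (r - k) * q ^ k = 1"
  using assms by (simp flip: power_add)
 thus ?thesis by (simp add: field_simps)
qed

text \<open>These reflections drive the pairing of \<open>k\<close> with \<open>r - k\<close>:
  \<open>[k]\<close> changes its sign while \<open>{k}'\<close> does not.\<close>

lemma br_diff_r: "k <= r ==> br (r - k) = - br k" and br'_diff_r: "k <= r ==> br' (r - k) = br' k"
 by (simp_all add: qbrace_def qbrace'_def q_pow_diff power_inverse[of q "r - k"]) (simp_all add: power_inverse)

lemma qi_diff_r: "k <= r ==> qi (r - k) = - qi k"
 by (simp add: qint_def br_diff_r)

section \<open>The Temperley--Lieb algebra as operators\<close>

abbreviation "cp \<equiv> cap q"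
abbreviation "cu \<equiv> cup q"

definition tU :: "nat => lop" where "tU i = cu i * cp i"

text \<open>Replaces the statement that an operator is an endomorphism of the first \<open>m\<close>
  strands tensored with the identity: it commutes with everything that happens further
  right.\<close>

definition loc :: "nat => lop => bool" where
 "loc m y \<longleftrightarrow> (\<forall>i\<ge>m. cp i * y = y * cp i & cu i * y = y * cu i & (\<forall>M. site M i * y = y * site M i))"

inductive TLa :: "nat => lop => bool" for m where
 one: "TLa m 1"
| gen: "i + 2 <= m ==> TLa m (tU i)"
| add: "TLa m x ==> TLa m y ==> TLa m (x + y)"
| mult: "TLa m x ==> TLa m y ==> TLa m (x * y)"
| scale: "TLa m x ==> TLa m (c *. x)"

lemma TLa_mono: "TLa m x ==> m <= n ==> TLa n x"
 by (induction rule: TLa.induct) (auto intro: TLa.intros)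

lemma loc_mono: "loc m x ==> m <= n ==> loc n x"
 by (auto simp: loc_def)

lemma loc_one: "loc m 1" by (simp add: loc_def)
lemma loc_add: "loc m x ==> loc m y ==> loc m (x + y)" by (simp add: loc_def algebra_simps)
lemma loc_diff: "loc m x ==> loc m y ==> loc m (x - y)" by (simp add: loc_def algebra_simps)
lemma loc_scale: "loc m x ==> loc m (c *. x)" by (simp add: loc_def)
lemma loc_mult: "loc m x ==> loc m y ==> loc m (x * y)"
 unfolding loc_def by (metis massoc)

lemma loc_site: "i < m ==> loc m (site M i)"
 unfolding loc_def
 by (auto simp: cap_site_left cup_site_left site_commute)

lemma loc_U: "i + 2 <= m ==> loc m (tU i)"
 unfolding loc_def tU_def
proof (intro allI impI)
 fix j assume "i + 2 <= m" "m <= j"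
 then obtain k where k: "j = Suc (Suc k)" "i <= k"
  using that[of "j - 2"] \<open>i + 2 <= m\<close> \<open>m <= j\<close> by auto
 have cps: "cp (Suc (Suc k)) * cu i = cu i * cp k" "cp i * cp (Suc (Suc k)) = cp k * cp i"
  "cp i * cu (Suc (Suc k)) = cu k * cp i" "cu (Suc (Suc k)) * cu i = cu i * cu k"
  using cap_far_cup[of i j] cap_cap_far[of i j] cap_cup_far[of i j] cup_cup_far[of i j] k by auto
 have "cp j * (cu i * cp i) = cu i * cp i * cp j"
  by (simp add: k(1) mult3[OF cps(1)] cps(2)[symmetric] massoc)
 moreover have "cu j * (cu i * cp i) = cu i * cp i * cu j"
  by (simp add: k(1) mult3[OF cps(4)] cps(3)[symmetric] massoc)
 moreover have "site M j * (cu i * cp i) = cu i * cp i * site M j" for M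
  by (simp add: k(1) mult3[OF cup_site_right[OF k(2)]] cap_site_right[OF k(2), symmetric] massoc)
 ultimately show "cp j * (cu i * cp i) = cu i * cp i * cp j & cu j * (cu i * cp i) = cu i * cp i * cu j \<and>
    (\<forall>M. site M j * (cu i * cp i) = cu i * cp i * site M j)"
  by blast
qed

lemma TLa_loc: "TLa m y ==> loc m y"
 by (induction rule: TLa.induct) (auto intro: loc_one loc_U loc_add loc_mult loc_scale)

lemma loc_cap: "loc m y ==> m <= i ==> cp i * y = y * cp i"
 and loc_cup: "loc m y ==> m <= i ==> cu i * y = y * cu i"
 by (auto simp: loc_def)

lemmas cc_same = cap_cup_same[OF q_nz]
lemmas cc_up = cap_cup_Suc[OF q_nz]
lemmas cc_down = cap_Suc_cup[OF q_nz]

lemma cc_same': "cp i * cu i = - (qi 2 *. 1)"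
 by (simp add: cc_same qi_2 smult_diff_left smult_add_left)

subsection \<open>Jones--Wenzl idempotents\<close>

fun jf :: "nat => lop" where
 "jf 0 = 1"
| "jf (Suc 0) = 1"
| "jf (Suc (Suc k)) = jf (Suc k) + (qi (Suc k) / qi (Suc (Suc k))) *. (jf (Suc k) * (tU k * jf (Suc k)))"

declare jf.simps(3) [simp del]

lemma jf_TLa: "TLa m (jf m)"
proof (induction m rule: jf.induct)
 case (3 k)
 have "TLa (Suc (Suc k)) (jf (Suc k))" using TLa_mono[OF 3(1)] by simp
 thus ?case by (auto simp: jf.simps intro!: TLa.intros)
qed (auto intro: TLa.intros)

lemma jf_loc: "m <= n ==> loc n (jf m)"
 using TLa_loc[OF jf_TLa] loc_mono by blast

text \<open>The properties need each other, hence one induction. The partial trace of the previous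
  idempotent is the scalar whose inverse (up to sign) is the recursion coefficient, so under the
  newest cap the two terms of the recursion cancel; that in turn gives idempotence and the next
  partial trace.\<close>

lemma jf_main:
 "Suc m < r ==> jf (Suc m) * jf (Suc m) = jf (Suc m) \<and>
   (\<forall>i. Suc i <= m --> cp i * jf (Suc m) = 0 & jf (Suc m) * cu i = 0) \<and>
   jf (Suc m) * jf m = jf (Suc m) & jf m * jf (Suc m) = jf (Suc m) \<and>
   cp m * (jf (Suc m) * cu m) = - (qi (Suc (Suc m)) / qi (Suc m)) *. jf m"
proof (induction m)
 case 0
 show ?case by (simp add: cc_same' numeral_2_eq_2)
next
 case (Suc m)
 define p where "p = jf (Suc m)"
 define c where "c = qi (Suc m) / qi (Suc (Suc m))"
 have nz: "qi (Suc m) ~= 0" "qi (Suc (Suc m)) ~= 0"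
  using Suc.prems by (simp_all add: qi_nz)
 have IH: "p * p = p" "!!i. Suc i <= m ==> cp i * p = 0" "!!i. Suc i <= m ==> p * cu i = 0"
  "p * jf m = p" "jf m * p = p" "cp m * (p * cu m) = - (qi (Suc (Suc m)) / qi (Suc m)) *. jf m"
  using Suc unfolding p_def by auto
 have f2: "jf (Suc (Suc m)) = p + c *. (p * (cu m * (cp m * p)))"
  by (simp add: p_def c_def tU_def massoc jf.simps)
 have locm: "cp m * jf m = jf m * cp m" "cu m * jf m = jf m * cu m"
  using jf_loc[of m m] by (simp_all add: loc_cap loc_cup)
 have loc1: "cp (Suc m) * p = p * cp (Suc m)" "cu (Suc m) * p = p * cu (Suc m)"
  using jf_loc[of "Suc m" "Suc m"] by (simp_all add: loc_cap loc_cup p_def)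
 have coef: "c * (qi (Suc (Suc m)) / qi (Suc m)) = 1"
  using nz by (simp add: c_def)
 have p3: "p * (p * w) = p * w" for w using IH(1) by (rule mult3)
 have k1: "cp m * (p * (cu m * w)) = - (qi (Suc (Suc m)) / qi (Suc m)) *. (jf m * w)" for w
  using mult3[OF IH(6), of w] by (simp add: massoc)
 have jfcp: "jf m * (cp m * p) = cp m * p"
  using locm(1) IH(5) by (metis massoc)
 have pcup: "p * (cu m * jf m) = p * cu m"
  using locm(2) IH(4) by (metis massoc)
 have cap_new: "cp m * jf (Suc (Suc m)) = 0"
  using coef by (simp add: f2 distrib_left k1 jfcp)
 have cup_new: "jf (Suc (Suc m)) * cu m = 0"
  using coef by (simp add: f2 distrib_right massoc IH(6) pcup)
 have abs: "jf (Suc (Suc m)) * p = jf (Suc (Suc m))" "p * jf (Suc (Suc m)) = jf (Suc (Suc m))"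
  by (simp_all add: f2 distrib_left distrib_right massoc p3 IH(1))
 have caps: "cp i * jf (Suc (Suc m)) = 0 & jf (Suc (Suc m)) * cu i = 0" if "Suc i <= Suc m" for i
 proof (cases "i = m")
  case True thus ?thesis using cap_new cup_new by simp
 next
  case False
  hence "cp i * p = 0" "p * cu i = 0" using IH that by auto
  thus ?thesis using abs by (metis massoc mult_zero_left mult_zero_right)
 qed
 have idem: "jf (Suc (Suc m)) * jf (Suc (Suc m)) = jf (Suc (Suc m))"
 proof -
  have "jf (Suc (Suc m)) * jf (Suc (Suc m)) = jf (Suc (Suc m)) * (p + c *. (p * (cu m * (cp m * p))))"
   by (simp only: f2)
  also have "... = jf (Suc (Suc m))"
   using abs cup_new mult3[OF abs(1)] mult3[OF cup_new] by (simp add: distrib_left)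
  finally show ?thesis .
 qed
 have "cp (Suc m) * (jf (Suc (Suc m)) * cu (Suc m)) = cp (Suc m) * (p * cu (Suc m)) +
   c *. (cp (Suc m) * (p * (cu m * (cp m * (p * cu (Suc m))))))"
  by (simp add: f2 distrib_left distrib_right massoc)
 also have "cp (Suc m) * (p * cu (Suc m)) = - (qi 2) *. p"
  using loc1(1) cc_same'[of "Suc m"] by (metis (no_types, lifting) massoc mult.right_neutral mult_minus_right smult_simps(1) smult_simps(8))
 also have "cp (Suc m) * (p * (cu m * (cp m * (p * cu (Suc m))))) = p * ((cp (Suc m) * cu m) * ((cp m * cu (Suc m)) * p))"
  using loc1 by (metis massoc)
 also have "... = p" by (simp add: cc_up cc_down IH(1))
 also have "- (qi 2) *. p + c *. p = (- (qi 2) + c) *. p" by (simp only: smult_add_left)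
 also have "- qi 2 + c = - (qi (Suc (Suc (Suc m))) / qi (Suc (Suc m)))"
 proof -
  have "qi (Suc (Suc (Suc m))) = qi 2 * qi (Suc (Suc m)) - qi (Suc m)"
   using qi_rec[of "Suc m"] by (simp add: algebra_simps)
  from this[unfolded numeral_2_eq_2] show ?thesis
   unfolding c_def using nz by (simp add: diff_divide_distrib numeral_2_eq_2)
 qed
 finally show ?case using idem caps abs by (auto simp: p_def)
qed

lemma jf_idem: "m < r ==> jf m * jf m = jf m"
 using jf_main[of "m - 1"] by (cases m) auto

lemma jf_cap: "i + 2 <= m ==> m < r ==> cp i * jf m = 0"
 and jf_cup: "i + 2 <= m ==> m < r ==> jf m * cu i = 0"
 using jf_main[of "m - 1"] by (cases m; auto)+

lemma jf_ptr: "Suc m < r ==> cp m * (jf (Suc m) * cu m) = - (qi (Suc (Suc m)) / qi (Suc m)) *. jf m"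
 using jf_main[of m] by auto

lemma jf_abs: "m <= n ==> n < r ==> jf n * jf m = jf n & jf m * jf n = jf n"
proof (induction n)
 case (Suc n)
 show ?case
 proof (cases "m = Suc n")
  case True thus ?thesis using Suc.prems jf_idem by auto
 next
  case False
  hence "jf n * jf m = jf n" "jf m * jf n = jf n" using Suc by auto
  thus ?thesis using jf_main[of n] Suc.prems by (metis massoc)
 qed
qed simp

subsection \<open>Cups and caps on the top Jones--Wenzl idempotent\<close>

abbreviation F :: lop where "F \<equiv> jf N"

text \<open>\<open>k\<close> nested cups around the right end of the strands carrying
  \<open>F\<close>: left legs at \<open>N - k, ..., N - 1\<close>, right legs at
  \<open>N, ..., N + k - 1\<close>. With the mirror image \<open>Ca\<close> they give the two halves
  \<open>Ak k\<close> and \<open>Bk k\<close> of \<open>h\<close> on \<open>N + k\<close>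
  strands.\<close>

primrec Cu :: "nat => lop" where
 "Cu 0 = 1" | "Cu (Suc k) = Cu k * cu (N - Suc k)"

primrec Ca :: "nat => lop" where
 "Ca 0 = 1" | "Ca (Suc k) = cp (N - Suc k) * Ca k"

definition Ak :: "nat => lop" where "Ak k = F * Cu k"
definition Bk :: "nat => lop" where "Bk k = Ca k * F"

lemma N_lt [simp]: "N < r" and N_ge: "2 <= N" and N_even: "even N"
 using r_ge r_odd by (simp_all add: r_Suc)

lemma F_idem [simp]: "F * F = F" "F * (F * x) = F * x"
 using jf_idem[of N] by (simp_all add: mult3)

lemma Ca_far:
 assumes "j <= N" "N + j <= i"
 shows "Ca j * cu i = cu (i - 2 * j) * Ca j & Ca j * cp i = cp (i - 2 * j) * Ca j \<and>
  Ca j * site M i = site M (i - 2 * j) * Ca j"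
 using assms
proof (induction j)
 case (Suc j)
 define x where "x = N - Suc j"
 define y where "y = i - 2 * Suc j"
 have y: "i - 2 * j = Suc (Suc y)" "x <= y" using Suc.prems by (auto simp: x_def y_def)
 have IH: "Ca j * cu i = cu (Suc (Suc y)) * Ca j" "Ca j * cp i = cp (Suc (Suc y)) * Ca j"
  "Ca j * site M i = site M (Suc (Suc y)) * Ca j"
  using Suc y by auto
 have S: "cp x * cu (Suc (Suc y)) = cu y * cp x" "cp x * cp (Suc (Suc y)) = cp y * cp x"
  "cp x * site M (Suc (Suc y)) = site M y * cp x"
  using y cap_cup_far[of x "Suc (Suc y)"] cap_cap_far[of x "Suc (Suc y)"] cap_site_right[of x y] by auto
 thus ?case
  unfolding Ca.simps x_def[symmetric] y_def[symmetric]
  by (simp add: massoc IH mult3[OF S(1)] mult3[OF S(2)] mult3[OF S(3)])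
qed simp

lemma Cu_far:
 assumes "j <= N" "N + j <= i"
 shows "cu i * Cu j = Cu j * cu (i - 2 * j) & cp i * Cu j = Cu j * cp (i - 2 * j) \<and>
  site M i * Cu j = Cu j * site M (i - 2 * j)"
 using assms
proof (induction j)
 case (Suc j)
 define x where "x = N - Suc j"
 define y where "y = i - 2 * Suc j"
 have y: "i - 2 * j = Suc (Suc y)" "x <= y" using Suc.prems by (auto simp: x_def y_def)
 have IH: "cu i * Cu j = Cu j * cu (Suc (Suc y))" "cp i * Cu j = Cu j * cp (Suc (Suc y))"
  "site M i * Cu j = Cu j * site M (Suc (Suc y))"
  using Suc y by auto
 have S: "cu (Suc (Suc y)) * cu x = cu x * cu y" "cp (Suc (Suc y)) * cu x = cu x * cp y"
  "site M (Suc (Suc y)) * cu x = cu x * site M y"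
  using y cup_cup_far[of x "Suc (Suc y)"] cap_far_cup[of x "Suc (Suc y)"] cup_site_right[of x y] by auto
 thus ?case
  unfolding Cu.simps x_def[symmetric] y_def[symmetric]
  by (simp add: massoc mult3[OF IH(1)] mult3[OF IH(2)] mult3[OF IH(3)] S)
qed simp

lemma F_loc: "N <= i ==> cp i * F = F * cp i" "N <= i ==> cu i * F = F * cu i"
 using jf_loc[of N N] loc_cap loc_cup by auto

text \<open>The outermost cap of \<open>Ca (Suc j)\<close> has its right leg at
  \<open>N + j\<close>, where the added cup begins; pulling this strand straight removes
  both.\<close>

lemma Ca_cu: "j < N ==> Ca (Suc j) * cu (N + j) = Ca j"
 and Cu_cp: "j < N ==> cp (N + j) * Cu (Suc j) = Cu j"
proof -
 assume j: "j < N"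
 hence N: "N + j - 2 * j = Suc (N - Suc j)" by simp
 have "Ca j * cu (N + j) = cu (Suc (N - Suc j)) * Ca j" using Ca_far[of j "N + j"] j by (simp only: N)
 thus "Ca (Suc j) * cu (N + j) = Ca j"
  by (simp add: massoc mult3[OF cc_up])
 have "cp (N + j) * Cu j = Cu j * cp (Suc (N - Suc j))" using Cu_far[of j "N + j"] j by (simp only: N)
 from mult3[OF this] show "cp (N + j) * Cu (Suc j) = Cu j"
  by (simp add: massoc cc_down)
qed

lemma Bk_cu: "j < N ==> Bk (Suc j) * cu (N + j) = Bk j"
 using Ca_cu[of j] F_loc(2)[of "N + j"] unfolding Bk_def by (metis le_add1 massoc)

lemma Ak_cp: "j < N ==> cp (N + j) * Ak (Suc j) = Ak j"
 using Cu_cp[of j] F_loc(1)[of "N + j"] unfolding Ak_def by (metis le_add1 massoc)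

lemma Bk_cp: "j <= N ==> Bk j * cp (N + j) = cp (N - j) * Bk j"
 using Ca_far[of j "N + j"] F_loc(1)[of "N + j"] unfolding Bk_def
 by (metis le_add1 massoc le_refl add_diff_cancel_right diff_diff_left mult_2)

lemma Ak_cu: "j <= N ==> cu (N + j) * Ak j = Ak j * cu (N - j)"
 using Cu_far[of j "N + j"] F_loc(2)[of "N + j"] unfolding Ak_def
 by (metis le_add1 massoc le_refl add_diff_cancel_right diff_diff_left mult_2)

lemma Bk_Suc: "Bk (Suc j) = cp (N - Suc j) * Bk j"
 by (simp add: Bk_def massoc)

lemma Ak_Suc: "Ak (Suc j) = Ak j * cu (N - Suc j)"
 by (simp add: Ak_def massoc)

lemma Ca_jf: "m + j <= N ==> jf m * Ca j = Ca j * jf m"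
 and Cu_jf: "m + j <= N ==> jf m * Cu j = Cu j * jf m"
proof (induction j)
 case (Suc j)
 case 1
 have "jf m * cp (N - Suc j) = cp (N - Suc j) * jf m" using jf_loc[of m m] 1 by (simp add: loc_cap)
 from mult3[OF this] show ?case using Suc 1 by (simp add: massoc)
next
 case (Suc j)
 case 2
 have "jf m * cu (N - Suc j) = cu (N - Suc j) * jf m" using jf_loc[of m m] 2 by (simp add: loc_cup)
 moreover have "jf m * Cu j = Cu j * jf m" using Suc 2 by simp
 ultimately show ?case by (simp add: massoc mult3[of "jf m" "Cu j"])
qed simp_all

text \<open>The strands to the left of the nested arcs may carry a smaller idempotent, since it
  slides along them into \<open>F\<close> and is absorbed there.\<close>

lemma Bk_jf: "m + j <= N ==> jf m * Bk j = Bk j" "m + j <= N ==> Bk j * jf m = Bk j"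
 and Ak_jf: "m + j <= N ==> jf m * Ak j = Ak j" "m + j <= N ==> Ak j * jf m = Ak j"
 unfolding Ak_def Bk_def using Ca_jf[of m j] Cu_jf[of m j] jf_abs[of m N]
 by (metis N_lt add_leD1 massoc)+

lemma Bk_F [simp]: "Bk j * F = Bk j" "Bk 0 = F" "Ak 0 = F" "F * Ak j = Ak j"
 "Bk j * (F * x) = Bk j * x" "F * (Ak j * x) = Ak j * x"
 by (simp_all add: Bk_def Ak_def massoc)

text \<open>The innermost cap and the innermost cup close the last strand of \<open>F\<close>, and
  this partial trace contains the factor \<open>[r] = 0\<close>. It is the source of
  \<open>h * h = 0\<close> and of all vanishing traces below.\<close>

lemma Bk_Ak:
 assumes "0 < j" "0 < k" shows "Bk j * Ak k = 0"
proof -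
 \<comment> \<open>The innermost cap is the factor applied first, the innermost cup the one applied
   last, so these are the factors adjacent to \<open>F\<close>.\<close>
 have "\<exists>X. Ca (Suc i) = X * cp (N - 1)" for i
 proof (induction i)
  case (Suc i)
  then obtain X where "Ca (Suc i) = X * cp (N - 1)" ..
  hence "Ca (Suc (Suc i)) = cp (N - Suc (Suc i)) * X * cp (N - 1)"
   by (simp only: Ca.simps(2)[of "Suc i"] massoc)
  thus ?case by blast
 qed (auto intro: exI[of _ 1])
 then obtain X where X: "Ca j = X * cp (N - 1)" using assms by (metis gr0_implies_Suc)
 have "\<exists>Y. Cu (Suc i) = cu (N - 1) * Y" for i
 proof (induction i)
  case (Suc i)
  then obtain Y where "Cu (Suc i) = cu (N - 1) * Y" ..
  hence "Cu (Suc (Suc i)) = cu (N - 1) * (Y * cu (N - Suc (Suc i)))"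
   by (simp only: Cu.simps(2)[of "Suc i"] massoc)
  thus ?case by blast
 qed (auto intro: exI[of _ 1])
 then obtain Y where Y: "Cu k = cu (N - 1) * Y" using assms by (metis gr0_implies_Suc)
 have "cp (N - 1) * (F * cu (N - 1)) = 0"
 proof -
  obtain m where m: "N = Suc m" using N_ge by (cases N) auto
  have "r = Suc (Suc m)" using m r_Suc by simp
  hence "qi (Suc (Suc m)) = 0" using qi_eq_0[of r] by simp
  thus ?thesis using jf_ptr[of m] m r_Suc by simp
 qed
 hence "X * (cp (N - 1) * (F * cu (N - 1))) * Y = 0" by simp
 thus ?thesis by (simp add: Bk_def Ak_def X Y massoc)
qed

end

context odd_root
begin

subsection \<open>The idempotents beyond the top Jones--Wenzl idempotent\<close>

text \<open>\<open>jh k\<close> and \<open>jg k\<close> are the morphisms \<open>h\<close> and \<open>g\<close> on \<open>r - 1 + k\<close> strands; modulo the period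
 \<open>r\<close> of the quantum integers, the indices \<open>m\<close> and \<open>m + 1\<close> become \<open>k - 1\<close> and \<open>k\<close>.\<close>

definition jh :: "nat => lop" where
 "jh k = ((- 1) ^ Suc k * qi k) *. (Ak k * Bk k)"

fun jg :: "nat => lop" where
 "jg 0 = F"
| "jg (Suc 0) = F"
| "jg (Suc (Suc 0)) = F - F * (tU N * jh 1) - jh 1 * (tU N * F) - qi 2 *. (jh 1 * (tU N * jh 1))"
| "jg (Suc (Suc (Suc i))) = jg (Suc (Suc i))
   + (qi (Suc i) / qi (Suc (Suc i))) *. (jg (Suc (Suc i)) * (tU (N + Suc i) * jg (Suc (Suc i))))
   - (2 / (qi (Suc (Suc i)))^2) *. (jg (Suc (Suc i)) * (tU (N + Suc i) * jh (Suc (Suc i))))"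

declare jg.simps(3,4) [simp del]

lemma loc_AB:
 assumes "k <= N" shows "loc (N + k) (Ak k * Bk k)"
 unfolding loc_def
proof (intro allI impI)
 fix i assume i: "N + k <= i"
 have FF: "cp i * F = F * cp i" "cu i * F = F * cu i" "site M i * F = F * site M i"
  "cp (i - 2 * k) * Ca k = Ca k * cp i" "cu (i - 2 * k) * Ca k = Ca k * cu i"
  "site M (i - 2 * k) * Ca k = Ca k * site M i" for M
  using jf_loc[of N N] i Ca_far[of k i] assms by (auto simp: loc_def)
 note Cu_far[OF assms i]
 note CF = this[THEN conjunct1] this[THEN conjunct2, THEN conjunct1] this[THEN conjunct2, THEN conjunct2]
 have 1: "cp i * (Ak k * Bk k) = Ak k * Bk k * cp i"
  by (simp add: Ak_def Bk_def massoc FF mult3[OF FF(1)] mult3[OF CF(2)] mult3[OF FF(4)])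
 have 2: "cu i * (Ak k * Bk k) = Ak k * Bk k * cu i"
  by (simp add: Ak_def Bk_def massoc FF mult3[OF FF(2)] mult3[OF CF(1)] mult3[OF FF(5)])
 have 3: "site M i * (Ak k * Bk k) = Ak k * Bk k * site M i" for M
  by (simp add: Ak_def Bk_def massoc FF mult3[OF FF(3)] mult3[OF CF(3)] mult3[OF FF(6)])
 show "cp i * (Ak k * Bk k) = Ak k * Bk k * cp i & cu i * (Ak k * Bk k) = Ak k * Bk k * cu i \<and>
   (\<forall>M. site M i * (Ak k * Bk k) = Ak k * Bk k * site M i)"
  using 1 2 3 by blast
qed

lemma jh_loc: "k <= N ==> loc (N + k) (jh k)"
 unfolding jh_def by (intro loc_scale loc_AB)

lemma jg_loc: "k <= N ==> loc (N + k) (jg k)"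
proof (induction k rule: jg.induct)
 case 1 show ?case using jf_loc[of N N] by simp
next
 case 2 show ?case using jf_loc[of N "Suc N"] by simp
next
 case 3
 have "loc (N + Suc (Suc 0)) F" "loc (N + Suc (Suc 0)) (jh 1)" "loc (N + Suc (Suc 0)) (tU N)"
  using jf_loc[of N "N + Suc (Suc 0)"] jh_loc[of 1] loc_mono[of "N + 1" "jh 1"] N_ge by (auto intro: loc_U)
 thus ?case by (auto simp: jg.simps intro!: loc_diff loc_mult loc_scale)
next
 case (4 i)
 have "loc (N + Suc (Suc (Suc i))) (jg (Suc (Suc i)))" "loc (N + Suc (Suc (Suc i))) (jh (Suc (Suc i)))"
  "loc (N + Suc (Suc (Suc i))) (tU (N + Suc i))"
  using 4 jh_loc[of "Suc (Suc i)"] loc_mono[of "N + Suc (Suc i)" _ "N + Suc (Suc (Suc i))"]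
  by (auto intro: loc_U)
 thus ?case by (auto simp: jg.simps intro!: loc_diff loc_mult loc_scale loc_add)
qed

text \<open>Closing the last strand straightens the outermost arc of either half, leaving the
  shorter \<open>Ak\<close> and \<open>Bk\<close>; only sign and quantum integer in front
  change.\<close>

lemma jh_ptr:
 "Suc j < N ==> cp (N + Suc j) * (jh (Suc (Suc j)) * cu (N + Suc j)) = - (qi (Suc (Suc j)) / qi (Suc j)) *. jh (Suc j)"
proof -
 assume j: "Suc j < N"
 have nz: "qi (Suc j) ~= 0" using j N_lt by (intro qi_nz) linarith+
 have "cp (N + Suc j) * (jh (Suc (Suc j)) * cu (N + Suc j)) = ((- 1) ^ Suc (Suc (Suc j)) * qi (Suc (Suc j))) *.
   ((cp (N + Suc j) * Ak (Suc (Suc j))) * (Bk (Suc (Suc j)) * cu (N + Suc j)))"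
  by (simp only: jh_def smult_simps massoc)
 also have "... = ((- 1) ^ Suc (Suc (Suc j)) * qi (Suc (Suc j))) *. (Ak (Suc j) * Bk (Suc j))"
  using Ak_cp[of "Suc j"] Bk_cu[of "Suc j"] j by simp
 also have "... = - (qi (Suc (Suc j)) / qi (Suc j)) *. jh (Suc j)"
  using nz by (simp add: jh_def mult_ac)
 finally show ?thesis .
qed

lemma jh_1: "jh (Suc 0) = Ak (Suc 0) * Bk (Suc 0)"
 by (simp add: jh_def)

lemma jh_ptr_1: "cp N * (jh (Suc 0) * cu N) = F"
proof -
 have "cp N * (jh (Suc 0) * cu N) = (cp N * Ak (Suc 0)) * (Bk (Suc 0) * cu N)"
  by (simp only: jh_1 massoc)
 also have "... = F" using Ak_cp[of 0] Bk_cu[of 0] N_ge by simp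
 finally show ?thesis .
qed

text \<open>The invariants of the recursion, for \<open>g = jg (i + 2)\<close>.\<close>

definition g_inv :: "nat => lop => bool" where
 "g_inv i g \<longleftrightarrow> g * g = g \<and>
   Bk (Suc (Suc i)) * g = Bk (Suc (Suc i)) & g * Ak (Suc (Suc i)) = Ak (Suc (Suc i)) \<and>
   Bk (Suc i) * g = Bk (Suc i) - jf (N - i) * Bk (Suc i) \<and>
   g * Ak (Suc i) = Ak (Suc i) - Ak (Suc i) * jf (N - i) \<and>
   g * jg (Suc i) = g & jg (Suc i) * g = g \<and>
   cp (N + Suc i) * (g * cu (N + Suc i)) = - (qi (Suc (Suc i)) / qi (Suc i)) *. jg (Suc i)
    - (2 / (qi (Suc i))^2) *. jh (Suc i) \<and>
   g * cu (N + i) = 0"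

text \<open>After \<open>h\<close> is split into \<open>A\<close> and \<open>B\<close>, everything
  takes place in a small set of relations (\<open>R\<close>) between \<open>F\<close>,
  \<open>A\<close>, \<open>B\<close> and the cups and caps at \<open>N\<close> and
  \<open>N + 1\<close>, which serves as a rewrite system.\<close>

lemma g_inv_0: "g_inv 0 (jg (Suc (Suc 0)))"
proof -
 define g where "g = jg (Suc (Suc 0))"
 define A where "A = Ak (Suc 0)"
 define B where "B = Bk (Suc 0)"
 define h where "h = A * B"
 have N0: "0 < N" "N < r" using N_ge by auto
 have h_loc: "loc (Suc N) h"
  using jh_loc[of "Suc 0"] N_ge by (simp add: jh_1 h_def A_def B_def)
 have R: "F * A = A" "B * F = B" "B * A = 0" "B * cu N = F" "cp N * A = F" "cp N * F = F * cp N"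
  "F * cu N = cu N * F" "cp N * cu N = - (qi 2 *. 1)" "cp (Suc N) * cu N = 1" "cp N * cu (Suc N) = 1"
  "cp (Suc N) * h = h * cp (Suc N)" "cp (Suc N) * F = F * cp (Suc N)" "cp (Suc N) * cu (Suc N) = - (qi 2 *. 1)"
  "F * h = h" "h * F = h" "h * h = 0" "h * cu (Suc N) = cu (Suc N) * h" "F * cu (Suc N) = cu (Suc N) * F"
  using Bk_Ak[of 1 1] Bk_cu[of 0] Ak_cp[of 0] F_loc[of N] F_loc[of "Suc N"] N0 cc_same'[of N] cc_same'[of "Suc N"]
   cc_down[of N] cc_up[of N] loc_cap[OF h_loc, of "Suc N"] loc_cup[OF h_loc, of "Suc N"]
  by (simp_all add: A_def B_def h_def massoc mult3[of "Bk (Suc 0)" "Ak (Suc 0)" 0] mult3[of F "Ak (Suc 0)" "Ak (Suc 0)"])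
 note R3 = R[THEN mult3]
 have g: "g = F - cu N * (F * B) - A * (F * cp N) - qi 2 *. (A * (F * B))"
  by (simp add: g_def jg.simps jh_1 tU_def massoc R R3 flip: A_def B_def)
 \<comment> \<open>The same element with \<open>A\<close> and \<open>B\<close> recombined into
   \<open>h\<close>: in this form every factor commutes or straightens with the cap and cup at
   \<open>Suc N\<close>.\<close>
 have g': "g = F - cu N * (cp N * h) - h * (cu N * cp N) - qi 2 *. (h * (cu N * (cp N * h)))"
  by (simp add: g h_def massoc R(1-8) R3(1-8))
 have gc: "g * cu N = 0"
  by (simp add: g left_diff_distrib right_diff_distrib massoc R R3)
 have gA: "g * A = A - A * F"
  by (simp add: g left_diff_distrib massoc R R3)
 have Bg: "B * g = B - F * B"
  by (simp add: g right_diff_distrib R R3)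
 have gF: "g * F = g" "F * g = g"
  by (simp_all add: g left_diff_distrib right_diff_distrib massoc R R3)
 have gg: "g * g = g"
 proof -
  have "g * g = g * F - g * cu N * (F * B) - g * A * (F * cp N) - qi 2 *. (g * A * (F * B))"
   by (subst (2) g) (simp add: right_diff_distrib massoc)
  also have "... = g" by (simp add: gc gF gA left_diff_distrib massoc)
  finally show ?thesis .
 qed
 have caps: "cp (N - Suc (Suc 0)) * F = 0" "F * cu (N - Suc (Suc 0)) = 0"
  using jf_cap[of "N - 2" N] jf_cup[of "N - 2" N] N_ge by (simp_all add: numeral_2_eq_2)
 have B2: "Bk (Suc (Suc 0)) * g = Bk (Suc (Suc 0))"
  using Bk_Suc[of "Suc 0"] Bg mult3[OF caps(1)]
  by (simp add: massoc right_diff_distrib B_def)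
 have A2: "g * Ak (Suc (Suc 0)) = Ak (Suc (Suc 0))"
  using Ak_Suc[of "Suc 0"] mult3[OF gA] caps(2)
  by (simp add: left_diff_distrib A_def massoc)
 have ptr: "cp (Suc N) * (g * cu (Suc N)) = - (qi 2 *. F) - 2 *. h"
 proof -
  have "cp (Suc N) * (g * cu (Suc N)) = - (qi 2 *. F) - h - h"
   by (simp add: g' left_diff_distrib right_diff_distrib massoc R(8-) R3(8-)
     del: smult_simps(8))
  thus ?thesis using smult_add_left[of 1 1 h] by (simp add: algebra_simps)
 qed
 show ?thesis
  unfolding g_inv_def using gg B2 A2 Bg gA gF ptr gc
  by (simp add: jh_1 flip: g_def A_def B_def) (simp add: h_def numeral_2_eq_2)
qed

lemma g_inv_Suc:
 assumes i: "Suc (Suc i) < N" and inv: "g_inv i (jg (Suc (Suc i)))"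
 shows "g_inv (Suc i) (jg (Suc (Suc (Suc i))))"
proof -
 define g where "g = jg (Suc (Suc i))"
 define p where "p = jg (Suc i)"
 define h where "h = jh (Suc (Suc i))"
 define h' where "h' = jh (Suc i)"
 define A where "A = Ak (Suc (Suc i))"
 define B where "B = Bk (Suc (Suc i))"
 define A' where "A' = Ak (Suc i)"
 define B' where "B' = Bk (Suc i)"
 define X where "X = cu (N + Suc i)"
 define Y where "Y = cp (N + Suc i)"
 define c where "c = qi (Suc i) / qi (Suc (Suc i))"
 define d where "d = 2 / (qi (Suc (Suc i)))^2"
 define G where "G = jg (Suc (Suc (Suc i)))"
 define \<sigma> where "\<sigma> = (- 1) ^ Suc (Suc (Suc i)) * qi (Suc (Suc i))"
 define n where "n = N - Suc (Suc i)"
 have nN: "N - Suc i = Suc n" "N - i = Suc (Suc n)" "Suc (Suc n) <= N" "Suc (Suc n) < r"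
  using i r_Suc by (auto simp: n_def)
 have lt: "Suc i < r" "Suc (Suc i) < r" using i N_lt by linarith+
 have nz: "qi (Suc i) ~= 0" "qi (Suc (Suc i)) ~= 0"
  using lt by (simp_all add: qi_nz)
 have h: "h = \<sigma> *. (A * B)" by (simp only: h_def jh_def \<sigma>_def A_def B_def)
 have locs: "loc (N + Suc (Suc i)) g" "loc (N + Suc (Suc i)) h" "loc (N + Suc i) p" "loc (N + Suc i) h'"
  using i jg_loc[of "Suc (Suc i)"] jh_loc[of "Suc (Suc i)"] jg_loc[of "Suc i"] jh_loc[of "Suc i"]
  by (simp_all only: g_def h_def p_def h'_def)
 define a where "a = qi (Suc (Suc i)) / qi (Suc i)"
 define b where "b = 2 / (qi (Suc i))^2"
 \<comment> \<open>These make the new element annihilate the cup \<open>X\<close>: the first cancels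
   the multiples of \<open>p\<close>, the second the multiples of \<open>h'\<close>.\<close>
 have coef: "c * a = 1" "d * a = c * b"
  using nz by (simp_all add: a_def b_def c_def d_def field_simps power2_eq_square)
 have hp: "Y * (h * X) = - a *. h'"
  using jh_ptr[of i] i unfolding h_def h'_def X_def Y_def a_def by simp
 have IH: "g * g = g" "B * g = B" "g * A = A" "B' * g = B' - jf (Suc (Suc n)) * B'"
  "g * A' = A' - A' * jf (Suc (Suc n))" "g * p = g" "p * g = g"
  "Y * (g * X) = - a *. p - b *. h'"
  using inv unfolding g_inv_def nN by (simp_all only: a_def b_def g_def p_def h'_def A_def B_def A'_def B'_def X_def Y_def)
 have R: "B * X = B'" "Y * A = A'" "X * p = p * X" "X * h' = h' * X" "B' * A' = 0" "B * A = 0" "B' * A = 0" "B * A' = 0"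
  using Bk_cu[of "Suc i"] Ak_cp[of "Suc i"] Bk_Ak i loc_cup[OF locs(3), of "N + Suc i"] loc_cup[OF locs(4), of "N + Suc i"]
  by (simp_all add: B_def A_def B'_def A'_def X_def Y_def)
 have R': "h * g = h" "g * h = h"
  using mult3[OF IH(3), of B] IH(2) by (simp_all add: h massoc)
 note I3 = IH[THEN mult3] and R3 = R[THEN mult3] R'[THEN mult3]
 have G: "G = g + c *. (g * (X * (Y * g))) - d *. (g * (X * (Y * h)))"
  by (simp add: G_def jg.simps g_def h_def c_def d_def tU_def X_def Y_def massoc)
 have GX: "G * X = 0"
  by (simp add: G left_diff_distrib right_diff_distrib distrib_right distrib_left massoc IH I3 R R3 hp smult_diff_right coef)
 have Gg: "G * g = G" "g * G = G"
  by (simp_all add: G left_diff_distrib right_diff_distrib distrib_right distrib_left massoc IH I3 R' R3)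
 have GG: "G * G = G"
 proof -
  have "G * G = G * g + c *. (G * g * X * (Y * g)) - d *. (G * g * X * (Y * h))"
   by (subst (2) G) (simp add: right_diff_distrib distrib_left massoc)
  thus ?thesis by (simp add: Gg GX massoc)
 qed
 \<comment> \<open>The Jones--Wenzl recursion at the left end has a coefficient with indices near
   \<open>r\<close>; by \<open>[r - l] = - [l]\<close> it equals the ratio \<open>a\<close> from the
   partial trace at the right end. This coincidence lets the invariant reproduce itself.\<close>
 define c2 where "c2 = qi (Suc n) / qi (Suc (Suc n))"
 have "Suc n = r - Suc (Suc i)" "Suc (Suc n) = r - Suc i" using i r_Suc by (auto simp: n_def)
 hence c2: "c2 = a"
  using lt qi_diff_r[of "Suc (Suc i)"] qi_diff_r[of "Suc i"] by (simp add: c2_def a_def)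
 have f2: "jf (Suc (Suc n)) = jf (Suc n) + a *. (jf (Suc n) * (cu n * (cp n * jf (Suc n))))"
  by (simp add: jf.simps tU_def massoc flip: c2 c2_def)
 have S: "cp (Suc n) * jf (Suc n) = jf (Suc n) * cp (Suc n)" "jf (Suc n) * cu (Suc n) = cu (Suc n) * jf (Suc n)"
  "jf (Suc n) * B' = B'" "A' * jf (Suc n) = A'" "cp (Suc n) * cu n = 1" "cp n * cu (Suc n) = 1"
  "cp n * B' = B" "A' * cu n = A" "B' * Y = cp (Suc n) * B'" "X * A' = A' * cu (Suc n)"
  using jf_loc[of "Suc n" "Suc n"] loc_cap[of "Suc n" "jf (Suc n)"] loc_cup[of "Suc n" "jf (Suc n)"]
   Bk_jf[of "Suc n" "Suc i"] Ak_jf[of "Suc n" "Suc i"] i Bk_Suc[of "Suc i"] Ak_Suc[of "Suc i"]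
   Bk_cp[of "Suc i"] Ak_cu[of "Suc i"] nN
  by (simp_all add: A'_def A_def B'_def B_def X_def Y_def cc_up cc_down n_def)
 note S3 = S[THEN mult3]
 \<comment> \<open>The cap slides along \<open>B'\<close> to the left end. There the defect
   \<open>jf (Suc (Suc n))\<close> is opened by its recursion: its leading term cancels and the
   remaining one gains a nested cap, turning \<open>B'\<close> into \<open>B\<close>.\<close>
 have BYg: "B' * (Y * g) = - (a *. (jf (Suc n) * B))"
 proof -
  have "B' * (Y * g) = cp (Suc n) * (B' * g)" by (simp add: S3 massoc)
  also have "... = cp (Suc n) * B' - cp (Suc n) * ((jf (Suc n) + a *. (jf (Suc n) * (cu n * (cp n * jf (Suc n))))) * B')"
   by (simp only: IH right_diff_distrib f2)
  also have "... = - (a *. (jf (Suc n) * B))"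
   by (simp add: distrib_left distrib_right massoc S S3)
  finally show ?thesis .
 qed
 have BYh: "B' * (Y * h) = 0"
  by (simp add: h S3 R3 massoc)
 have gXA: "g * (X * A') = - (a *. (A * jf (Suc n)))"
 proof -
  have "g * (X * A') = (g * A') * cu (Suc n)" by (simp add: S massoc)
  also have "... = A' * cu (Suc n) - A' * ((jf (Suc n) + a *. (jf (Suc n) * (cu n * (cp n * jf (Suc n))))) * cu (Suc n))"
   by (simp only: IH left_diff_distrib f2 massoc)
  also have "... = - (a *. (A * jf (Suc n)))"
  proof -
   have "A' * (cu (Suc n) * jf (Suc n)) = A' * cu (Suc n)"
    by (metis S(2) S(4) massoc)
   thus ?thesis by (simp add: distrib_left distrib_right massoc S S3)
  qed
  finally show ?thesis .
 qed
 have BG: "B * G = B - jf (Suc n) * B"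
  by (simp add: G right_diff_distrib distrib_left IH I3 R R3 BYg BYh coef)
 have GA: "G * A = A - A * jf (Suc n)"
  by (simp add: G left_diff_distrib distrib_right massoc IH I3 R R3 gXA h coef)
 define n' where "n' = N - Suc (Suc (Suc i))"
 have n': "n = Suc n'" using i by (simp add: n'_def n_def)
 have caps: "cp n' * jf (Suc n) = 0" "jf (Suc n) * cu n' = 0"
  using jf_cap[of n' "Suc n"] jf_cup[of n' "Suc n"] nN n' by auto
 have B3: "Bk (Suc (Suc (Suc i))) * G = Bk (Suc (Suc (Suc i)))"
  using Bk_Suc[of "Suc (Suc i)"] BG mult3[OF caps(1)]
  by (simp add: massoc right_diff_distrib flip: n'_def B_def)
 have A3: "G * Ak (Suc (Suc (Suc i))) = Ak (Suc (Suc (Suc i)))"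
  using Ak_Suc[of "Suc (Suc i)"] mult3[OF GA] caps(2)
  by (simp add: left_diff_distrib massoc flip: n'_def A_def)
 have T: "cp (N + Suc (Suc i)) * X = 1" "Y * cu (N + Suc (Suc i)) = 1"
  "cp (N + Suc (Suc i)) * g = g * cp (N + Suc (Suc i))" "cp (N + Suc (Suc i)) * h = h * cp (N + Suc (Suc i))"
  "g * cu (N + Suc (Suc i)) = cu (N + Suc (Suc i)) * g" "h * cu (N + Suc (Suc i)) = cu (N + Suc (Suc i)) * h"
  "cp (N + Suc (Suc i)) * cu (N + Suc (Suc i)) = - (qi 2 *. 1)"
  using loc_cap[OF locs(1)] loc_cap[OF locs(2)] loc_cup[OF locs(1)] loc_cup[OF locs(2)]
  by (simp_all add: X_def Y_def cc_up cc_down cc_same')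
 note T3 = T[THEN mult3]
 have ptr: "cp (N + Suc (Suc i)) * (G * cu (N + Suc (Suc i))) = - (qi (Suc (Suc (Suc i))) / qi (Suc (Suc i))) *. g - d *. h"
 proof -
  have "cp (N + Suc (Suc i)) * (G * cu (N + Suc (Suc i))) = - (qi 2 *. g) + c *. g - d *. h"
   by (simp add: G left_diff_distrib right_diff_distrib distrib_right distrib_left massoc T T3 IH R' del: add_Suc_right)
  also have "- (qi 2 *. g) + c *. g = (- qi 2 + c) *. g"
   by (simp add: smult_diff_left)
  also have "- qi 2 + c = - (qi (Suc (Suc (Suc i))) / qi (Suc (Suc i)))"
  proof -
   have "qi (Suc (Suc (Suc i))) = qi 2 * qi (Suc (Suc i)) - qi (Suc i)"
    using qi_rec[of "Suc i"] by (simp add: algebra_simps)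
   from this[unfolded numeral_2_eq_2] show ?thesis
    unfolding c_def using nz by (simp add: diff_divide_distrib numeral_2_eq_2)
  qed
  finally show ?thesis .
 qed
 show ?thesis
  unfolding g_inv_def nN
  using GG B3 A3 BG GA Gg ptr GX
  by (simp only: G_def g_def h_def A_def B_def d_def X_def)
qed

lemma g_inv: "Suc (Suc i) <= N ==> g_inv i (jg (Suc (Suc i)))"
 by (induction i) (auto intro: g_inv_0 g_inv_Suc)

lemma jg_induct_cases:
 assumes "0 < k" "k <= N"
 obtains "k = Suc 0" | i where "k = Suc (Suc i)" "g_inv i (jg k)"
 using assms g_inv by (metis Suc_pred' not0_implies_Suc not_gr_zero)

lemma jg_idem: "0 < k ==> k <= N ==> jg k * jg k = jg k"
 by (erule (1) jg_induct_cases) (simp_all add: g_inv_def)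

lemma Bk_jg: "0 < k ==> k <= N ==> Bk k * jg k = Bk k"
 and Ak_jg: "0 < k ==> k <= N ==> jg k * Ak k = Ak k"
 by (erule (1) jg_induct_cases, simp_all add: g_inv_def)+

lemma jh_jg: "0 < k ==> k <= N ==> jh k * jg k = jh k"
 and jg_jh: "0 < k ==> k <= N ==> jg k * jh k = jh k"
 using mult3[OF Ak_jg] Bk_jg by (simp_all add: jh_def massoc)

lemma jh_sq: "0 < k ==> jh k * jh k = 0"
 using mult3[OF Bk_Ak[of k k]] by (simp add: jh_def massoc)

lemma jg_F: "0 < k ==> k <= N ==> F * jg k = jg k & jg k * F = jg k"
proof (induction k)
 case (Suc k)
 show ?case
 proof (cases k)
  case (Suc i)
  hence "F * jg k = jg k" "jg k * F = jg k" "jg (Suc k) * jg k = jg (Suc k)" "jg k * jg (Suc k) = jg (Suc k)"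
   using Suc.IH Suc.prems g_inv[of i] by (auto simp: g_inv_def)
  thus ?thesis by (metis massoc)
 qed simp
qed simp

lemma jh_F: "F * jh k = jh k" "jh k * F = jh k"
 by (simp_all add: jh_def massoc mult3[of F "Ak k" "Ak k"])

lemma jg_cup: "Suc (Suc i) <= N ==> jg (Suc (Suc i)) * cu (N + i) = 0"
 and jg_step: "Suc (Suc i) <= N ==> jg (Suc (Suc i)) * jg (Suc i) = jg (Suc (Suc i))"
  "Suc (Suc i) <= N ==> jg (Suc i) * jg (Suc (Suc i)) = jg (Suc (Suc i))"
 using g_inv[of i] by (auto simp: g_inv_def)

text \<open>By the Jones--Wenzl recursion at the left end, the defect
  \<open>Bk (Suc i) - jf (N - i) * Bk (Suc i)\<close> in the invariant is a multiple of
  \<open>Bk\<close> with one more nested cap, so multiplying by the next \<open>g\<close> lengthens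
  \<open>h\<close>.\<close>

lemma jh_step:
 assumes i: "Suc (Suc i) <= N"
 shows "jh (Suc i) * jg (Suc (Suc i)) = jh (Suc (Suc i))" "jg (Suc (Suc i)) * jh (Suc i) = jh (Suc (Suc i))"
proof -
 define n where "n = N - Suc (Suc i)"
 have nN: "N - i = Suc (Suc n)" using i by (auto simp: n_def)
 have lt: "Suc i < r" "Suc (Suc i) < r" using i N_lt by linarith+
 have nz: "qi (Suc i) ~= 0" "qi (Suc (Suc i)) ~= 0"
  using lt by (simp_all add: qi_nz)
 have "Suc n = r - Suc (Suc i)" "Suc (Suc n) = r - Suc i" using i r_Suc by (auto simp: n_def)
 hence c2: "qi (Suc n) / qi (Suc (Suc n)) = qi (Suc (Suc i)) / qi (Suc i)"
  using lt qi_diff_r[of "Suc (Suc i)"] qi_diff_r[of "Suc i"] by simp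
 have f2: "jf (N - i) = jf (Suc n) + (qi (Suc (Suc i)) / qi (Suc i)) *. (jf (Suc n) * (cu n * (cp n * jf (Suc n))))"
  by (simp add: nN jf.simps tU_def massoc c2)
 have S: "jf (Suc n) * Bk (Suc i) = Bk (Suc i)" "Ak (Suc i) * jf (Suc n) = Ak (Suc i)"
  "cp n * Bk (Suc i) = Bk (Suc (Suc i))" "Ak (Suc i) * cu n = Ak (Suc (Suc i))"
  using i Bk_jf[of "Suc n" "Suc i"] Ak_jf[of "Suc n" "Suc i"] Bk_Suc[of "Suc i"] Ak_Suc[of "Suc i"]
  by (auto simp: n_def)
 note S3 = S[THEN mult3]
 have ff: "Bk (Suc i) - jf (N - i) * Bk (Suc i) = - (qi (Suc (Suc i)) / qi (Suc i)) *. (jf (Suc n) * (cu n * Bk (Suc (Suc i))))"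
  "Ak (Suc i) - Ak (Suc i) * jf (N - i) = - (qi (Suc (Suc i)) / qi (Suc i)) *. (Ak (Suc (Suc i)) * (cp n * jf (Suc n)))"
  by (simp_all add: f2 distrib_left distrib_right massoc S S3)
 show "jh (Suc i) * jg (Suc (Suc i)) = jh (Suc (Suc i))"
 proof -
  have "jh (Suc i) * jg (Suc (Suc i)) = ((- 1) ^ Suc (Suc i) * qi (Suc i)) *. (Ak (Suc i) * (Bk (Suc i) - jf (N - i) * Bk (Suc i)))"
   using g_inv[OF i] by (simp add: jh_def g_inv_def massoc)
  thus ?thesis unfolding ff using nz by (simp add: S S3 jh_def mult_ac)
 qed
 show "jg (Suc (Suc i)) * jh (Suc i) = jh (Suc (Suc i))"
 proof -
  have "jg (Suc (Suc i)) * jh (Suc i) = ((- 1) ^ Suc (Suc i) * qi (Suc i)) *. ((Ak (Suc i) - Ak (Suc i) * jf (N - i)) * Bk (Suc i))"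
   using g_inv[OF i] by (simp add: jh_def g_inv_def massoc[symmetric])
  thus ?thesis unfolding ff using nz by (simp add: S S3 jh_def mult_ac massoc)
 qed
qed

text \<open>\<open>k\<close> nested caps placed directly after the first \<open>N\<close> strands,
  that is, the middle part of \<open>t'\<close>; \<open>Dm\<close> is the mirror image. Together
  they close \<open>k\<close> strands on the right.\<close>

primrec Cm :: "nat => lop" where
 "Cm 0 = 1" | "Cm (Suc k) = Cm k * cp (N + k)"

primrec Dm :: "nat => lop" where
 "Dm 0 = 1" | "Dm (Suc k) = cu (N + k) * Dm k"

text \<open>The step of \<open>jg_full_ptr\<close>: the numerator that arises when the contributions
  of \<open>g\<close> and \<open>h\<close> to a partial trace are put together.\<close>

lemma br'_qi: "qi (Suc k) * br' k - 2 = qi k * br' (Suc k)"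
proof -
 have "br (Suc k) * br' k - 2 * br 1 = br k * br' (Suc k)"
  by (simp add: qbrace_def qbrace'_def algebra_simps flip: power_mult_distrib)
 hence "(br (Suc k) * br' k - 2 * br 1) / br 1 = br k * br' (Suc k) / br 1" by simp
 thus ?thesis by (simp add: qint_def diff_divide_distrib)
qed

lemma jh_full_ptr: "0 < k ==> k <= N ==> Cm k * (jh k * Dm k) = ((- 1) ^ Suc k * qi k) *. F"
proof (induction k)
 case (Suc k)
 show ?case
 proof (cases k)
  case 0 thus ?thesis using jh_ptr_1 by (simp add: massoc)
 next
  case (Suc i)
  have nz: "qi (Suc i) ~= 0" using Suc Suc.prems N_lt by (intro qi_nz) linarith+
  have "Cm (Suc k) * (jh (Suc k) * Dm (Suc k)) = Cm k * ((cp (N + k) * (jh (Suc k) * cu (N + k))) * Dm k)"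
   by (simp add: massoc)
  also have "... = - (qi (Suc k) / qi k) *. (Cm k * (jh k * Dm k))"
   using jh_ptr[of i] Suc Suc.prems by simp
  also have "... = ((- 1) ^ Suc (Suc k) * qi (Suc k)) *. F"
   using Suc.IH Suc Suc.prems nz by (simp add: mult_ac)
  finally show ?thesis .
 qed
qed simp

text \<open>Strands are closed one at a time. Each partial trace of \<open>g\<close> also throws off
  a multiple of \<open>h\<close>, whose own trace is known, and the combined coefficient is
  \<open>{k}'\<close>.\<close>

lemma jg_full_ptr: "0 < k ==> k <= N ==> Cm k * (jg k * Dm k) = ((- 1) ^ k * br' k) *. F"
proof (induction k)
 case (Suc k)
 show ?case
 proof (cases k)
  case 0
  thus ?thesis
   using F_loc(1)[of N] mult3[OF F_loc(1)[of N]] cc_same'[of N]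
   by (simp add: massoc qi_2 qbrace'_def smult_diff_left smult_add_left right_diff_distrib)
 next
  case (Suc i)
  have nz: "qi k ~= 0" using Suc Suc.prems N_lt by (intro qi_nz) linarith+
  have "Cm (Suc k) * (jg (Suc k) * Dm (Suc k)) = Cm k * ((cp (N + k) * (jg (Suc k) * cu (N + k))) * Dm k)"
   by (simp add: massoc)
  also have "... = - (qi (Suc k) / qi k) *. (Cm k * (jg k * Dm k)) - (2 / (qi k)^2) *. (Cm k * (jh k * Dm k))"
   using g_inv[of i] Suc Suc.prems by (simp add: g_inv_def left_diff_distrib right_diff_distrib)
  also have "... = (- (qi (Suc k) / qi k) * ((- 1) ^ k * br' k) - (2 / (qi k)^2) * ((- 1) ^ Suc k * qi k)) *. F"
   using Suc.IH Suc Suc.prems jh_full_ptr[of k] by (simp only: smult_diff_left) simp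
  also have "- (qi (Suc k) / qi k) * ((- 1) ^ k * br' k) - (2 / (qi k)^2) * ((- 1) ^ Suc k * qi k)
    = (- 1) ^ Suc k * ((qi (Suc k) * br' k - 2) / qi k)"
   using nz by (simp add: field_simps power2_eq_square)
  also have "(qi (Suc k) * br' k - 2) / qi k = br' (Suc k)"
   using nz by (simp add: br'_qi)
  finally show ?thesis .
 qed
qed simp

end

section \<open>The action of the quantum group on words\<close>

definition munit :: "xbasis => xbasis => nat => lop" where
 "munit a b i = site (%x y. if x = a & y = b then 1 else 0) i"

lemma ap_munit: "ap (munit a b i) f s = (if s i = a then f (s(i := b)) else 0)"
 by (cases b) (auto simp: munit_def ap_site)

lemma munit_munit: "munit a b i * munit c d i = (if b = c then munit a d i else 0)"
 by (rule lop_eqI) (auto simp: ap_munit)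

lemma munit_commute: "i ~= j ==> munit a b i * munit c d j = munit c d j * munit a b i"
 by (simp add: munit_def site_commute)

lemma munit_one: "munit A0 A0 i + munit A1 A1 i = 1"
 by (rule lop_eqI) (auto simp: ap_munit fun_upd_idem)

lemma ins_del: "ins i x y (del i s) = s(i := x, Suc i := y)"
proof (rule ext)
 fix n show "ins i x y (del i s) n = (s(i := x, Suc i := y)) n"
  by (cases n i rule: nat_window_cases) simp_all
qed

lemma cup_cap_munit:
 assumes "q ~= 0"
 shows "cup q i * cap q i = - (q *. (munit A0 A0 i * munit A1 A1 (Suc i)))
  - inverse q *. (munit A1 A1 i * munit A0 A0 (Suc i))
  + munit A0 A1 i * munit A1 A0 (Suc i) + munit A1 A0 i * munit A0 A1 (Suc i)"
proof (rule lop_eqI)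
 fix f s
 have ins: "ins i A1 A0 (del i s) = s(i := A1, Suc i := A0)" "ins i A0 A1 (del i s) = s(i := A0, Suc i := A1)"
  by (simp_all add: ins_del)
 show "ap (cup q i * cap q i) f s = ap (- (q *. (munit A0 A0 i * munit A1 A1 (Suc i)))
  - inverse q *. (munit A1 A1 i * munit A0 A0 (Suc i))
  + munit A0 A1 i * munit A1 A0 (Suc i) + munit A1 A0 i * munit A0 A1 (Suc i)) f s"
  using assms by (auto simp: ap_cup ap_cap ap_munit ins fun_upd_idem right_diff_distrib)
qed

context odd_root
begin

definition sK :: "nat => lop" where
 "sK i = site (%x y. if x = y then if x = A0 then q else iq else 0) i"
definition sL :: "nat => lop" where
 "sL i = site (%x y. if x = y then if x = A0 then iq else q else 0) i"
abbreviation sE :: "nat => lop" where "sE \<equiv> munit A0 A1"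
abbreviation sF :: "nat => lop" where "sF \<equiv> munit A1 A0"

text \<open>The iterated coproduct, one letter at a time, acting on \<open>n\<close> letters from
  position \<open>i\<close>; \<open>Lo\<close> is the inverse of \<open>Ko\<close>. The starting
  position is a parameter because the left and the right half of a bent strand are later treated
  separately.\<close>

primrec Ko :: "nat => nat => lop" where
 "Ko i 0 = 1" | "Ko i (Suc n) = Ko i n * sK (i + n)"
primrec Lo :: "nat => nat => lop" where
 "Lo i 0 = 1" | "Lo i (Suc n) = Lo i n * sL (i + n)"
primrec Eo :: "nat => nat => lop" where
 "Eo i 0 = 0" | "Eo i (Suc n) = Eo i n * sK (i + n) + sE (i + n)"
primrec Fo :: "nat => nat => lop" where
 "Fo i 0 = 0" | "Fo i (Suc n) = Lo i n * sF (i + n) + Fo i n"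

lemma sK_munit: "sK i = q *. munit A0 A0 i + iq *. munit A1 A1 i"
 and sL_munit: "sL i = iq *. munit A0 A0 i + q *. munit A1 A1 i"
 by (rule lop_eqI, simp add: ap_munit ap_site sK_def sL_def fun_upd_idem)+

definition cmt :: "lop => lop => bool" where "cmt x y \<longleftrightarrow> x * y = y * x"

lemma cmtD: "cmt x y ==> x * y = y * x" by (simp add: cmt_def)
lemma cmt_intros: "cmt x 1" "cmt x 0" "cmt x a ==> cmt x b ==> cmt x (a * b)"
 "cmt x a ==> cmt x b ==> cmt x (a + b)" "cmt x a ==> cmt x b ==> cmt x (a - b)"
 "cmt x a ==> cmt x (c *. a)"
 unfolding cmt_def by (auto simp: algebra_simps) (metis massoc)

lemma cmt_X:
 assumes "!!n. k <= n ==> n < k + l ==> cmt y (sK n) & cmt y (sL n) & cmt y (sE n) & cmt y (sF n)"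
 shows "cmt y (Ko k l) & cmt y (Lo k l) & cmt y (Eo k l) & cmt y (Fo k l)"
 using assms by (induction l) (auto intro!: cmt_intros)

lemma cmt_munit: "i ~= j ==> cmt (munit a b i) (munit c d j)"
 by (simp add: cmt_def munit_commute)

lemma cmt_site:
 assumes "i ~= j"
 shows "cmt (site M i) (sK j)" "cmt (site M i) (sL j)" "cmt (site M i) (munit a b j)"
  "cmt (sK i) (site M j)" "cmt (sL i) (site M j)" "cmt (munit a b i) (site M j)"
 using assms by (simp_all add: cmt_def sK_def sL_def munit_def site_commute)

lemma cmt_site_X:
 assumes "j < k | k + l <= j"
 shows "cmt (site M j) (Ko k l)" "cmt (site M j) (Lo k l)" "cmt (site M j) (Eo k l)" "cmt (site M j) (Fo k l)"
proof -
 have "cmt (site M j) (Ko k l) & cmt (site M j) (Lo k l) & cmt (site M j) (Eo k l) & cmt (site M j) (Fo k l)"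
  by (rule cmt_X) (use assms in \<open>auto intro!: cmt_site\<close>)
 thus "cmt (site M j) (Ko k l)" "cmt (site M j) (Lo k l)" "cmt (site M j) (Eo k l)" "cmt (site M j) (Fo k l)"
  by auto
qed

lemma X_add:
 "Ko i (m + n) = Ko i m * Ko (i + m) n" "Lo i (m + n) = Lo i m * Lo (i + m) n"
 "Eo i (m + n) = Eo i m * Ko (i + m) n + Eo (i + m) n"
 "Fo i (m + n) = Lo i m * Fo (i + m) n + Fo i m"
 by (induction n) (auto simp: algebra_simps)

lemma site_rels:
 "sK i * sL i = 1" "sL i * sK i = 1" "sK i * sE i = q *. sE i" "sE i * sK i = iq *. sE i"
 "sK i * sF i = iq *. sF i" "sF i * sK i = q *. sF i" "sE i * sE i = 0" "sF i * sF i = 0"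
 "sL i * sE i = iq *. sE i" "sE i * sL i = q *. sE i"
 "sL i * sF i = q *. sF i" "sF i * sL i = iq *. sF i"
 by (simp_all add: sK_munit sL_munit distrib_left distrib_right munit_munit munit_one)

lemma site_EF: "sE i * sF i - sF i * sE i = (1 / br (Suc 0)) *. (sK i - sL i)"
proof -
 have "sK i - sL i = br (Suc 0) *. (munit A0 A0 i - munit A1 A1 i)"
  by (rule lop_eqI) (simp add: sK_munit sL_munit qbrace_def algebra_simps)
 thus ?thesis using br1_nz by (simp add: munit_munit)
qed

lemma KL: "Ko i n * Lo i n = 1" "Lo i n * Ko i n = 1"
proof (induction n)
 case (Suc n)
 have c: "sK (i + n) * Lo i n = Lo i n * sK (i + n)" "sL (i + n) * Ko i n = Ko i n * sL (i + n)"
  unfolding sK_def sL_def by (intro cmtD cmt_site_X; simp)+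
 { case 1 show ?case
   using Suc by (simp add: massoc mult3[OF c(1)] site_rels) }
 { case 2 show ?case
   using Suc by (simp add: massoc mult3[OF c(2)] site_rels) }
qed simp_all

lemma KE: "Ko i n * Eo i n = q\<^sup>2 *. (Eo i n * Ko i n)"
 and KF: "Fo i n * Ko i n = q\<^sup>2 *. (Ko i n * Fo i n)"
proof (induction n)
 case (Suc n)
 have c: "sK (i + n) * Eo i n = Eo i n * sK (i + n)" "sE (i + n) * Ko i n = Ko i n * sE (i + n)"
  "sF (i + n) * Ko i n = Ko i n * sF (i + n)" "sK (i + n) * Fo i n = Fo i n * sK (i + n)"
  "sK (i + n) * Lo i n = Lo i n * sK (i + n)" "sK (i + n) * Ko i n = Ko i n * sK (i + n)"
  unfolding sK_def munit_def by (intro cmtD cmt_site_X; simp)+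
 note c3 = c[THEN mult3] Suc[THEN mult3] site_rels[THEN mult3]
 have LK: "Ko i n * (Lo i n * x) = x" "Lo i n * (Ko i n * x) = x" for x
  using KL[of i n, THEN mult3] by simp_all
 { case 1 show ?case
   by (simp add: distrib_left distrib_right massoc c c3 site_rels Suc smult_add_right power2_eq_square) }
 { case 2 show ?case
   by (simp add: distrib_left distrib_right massoc c c3 site_rels Suc smult_add_right power2_eq_square LK) }
qed simp_all

lemma LE: "Eo i n * Lo i n = q\<^sup>2 *. (Lo i n * Eo i n)"
 and LF: "Lo i n * Fo i n = q\<^sup>2 *. (Fo i n * Lo i n)"
proof -
 have "Eo i n * Lo i n = Lo i n * (Ko i n * Eo i n) * Lo i n"
  by (simp add: massoc[symmetric] KL)
 thus "Eo i n * Lo i n = q\<^sup>2 *. (Lo i n * Eo i n)"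
  by (simp add: KE massoc KL)
 have "Lo i n * Fo i n = Lo i n * (Fo i n * Ko i n) * Lo i n"
  by (simp add: massoc KL)
 thus "Lo i n * Fo i n = q\<^sup>2 *. (Fo i n * Lo i n)"
  by (simp add: KF massoc[symmetric] KL)
qed

lemma EF: "Eo i n * Fo i n - Fo i n * Eo i n = (1 / br (Suc 0)) *. (Ko i n - Lo i n)"
proof (induction n)
 case (Suc n)
 have c: "sK (i + n) * Eo i n = Eo i n * sK (i + n)" "sF (i + n) * Eo i n = Eo i n * sF (i + n)"
  "sE (i + n) * Fo i n = Fo i n * sE (i + n)" "sK (i + n) * Fo i n = Fo i n * sK (i + n)"
  "sK (i + n) * Lo i n = Lo i n * sK (i + n)" "sE (i + n) * Lo i n = Lo i n * sE (i + n)"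
  unfolding sK_def munit_def by (intro cmtD cmt_site_X; simp)+
 note c3 = c[THEN mult3] site_rels[THEN mult3] mult3[OF LE]
 have "Eo i (Suc n) * Fo i (Suc n) - Fo i (Suc n) * Eo i (Suc n) =
  (Eo i n * Fo i n - Fo i n * Eo i n) * sK (i + n) + Lo i n * (sE (i + n) * sF (i + n) - sF (i + n) * sE (i + n))"
  by (simp add: algebra_simps c c3 LE site_rels power2_eq_square)
 also have "... = (1 / br (Suc 0)) *. (Ko i n * sK (i + n) - Lo i n * sL (i + n))"
  by (simp only: Suc site_EF) (simp add: algebra_simps smult_diff_right)
 finally show ?case by simp
qed simp

subsection \<open>Cups and caps are equivariant\<close>

lemma upd_ins_at: "(ins i x y s)(i := z) = ins i z y s" "(ins i x y s)(Suc i := z) = ins i x z s"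
 by (rule ext; auto simp: ins_def)+

lemma cap_pair:
 "cp i * (sK i * sK (Suc i)) = cp i" "cp i * (sL i * sL (Suc i)) = cp i"
 "cp i * (sE i * sK (Suc i)) = - (cp i * sE (Suc i))" "cp i * (sL i * sF (Suc i)) = - (cp i * sF i)"
 by (rule lop_eqI, simp add: ap_cap ap_munit sK_def sL_def ap_site upd_ins_at, (simp add: field_simps)?)+

lemma del_upd: "del i (s(i := x)) = del i s" "del i (s(Suc i := x)) = del i s"
 by (rule ext; auto simp: del_def)+

lemma cup_pair:
 "sK i * (sK (Suc i) * cu i) = cu i" "sL i * (sL (Suc i) * cu i) = cu i"
 "sE i * (sK (Suc i) * cu i) = - (sE (Suc i) * cu i)" "sL i * (sF (Suc i) * cu i) = - (sF i * cu i)"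
proof -
 show "sK i * (sK (Suc i) * cu i) = cu i"
  by (rule lop_eqI) (auto simp: ap_cup sK_def ap_site del_upd)
 show "sL i * (sL (Suc i) * cu i) = cu i"
  by (rule lop_eqI) (auto simp: ap_cup sL_def ap_site del_upd)
 show "sE i * (sK (Suc i) * cu i) = - (sE (Suc i) * cu i)"
  by (rule lop_eqI) (auto simp: ap_cup sK_def ap_munit ap_site del_upd)
 show "sL i * (sF (Suc i) * cu i) = - (sF i * cu i)"
  by (rule lop_eqI) (auto simp: ap_cup sL_def ap_munit ap_site del_upd)
qed

text \<open>Naturality with respect to cups and caps. It implies commutation with the
  Temperley--Lieb algebra and with \<open>f\<close>, \<open>g\<close>, \<open>h\<close>; the
  generators, the Casimir operator and the projections to a fixed weight are all instances, so each
  of them is treated once.\<close>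

definition capfam :: "(nat => lop) => bool" where
 "capfam X \<longleftrightarrow> (\<forall>j n. j <= n --> cp j * X (Suc (Suc n)) = X n * cp j & X (Suc (Suc n)) * cu j = cu j * X n)"

lemma capfam_site:
 "j <= n ==> cp j * munit a b (Suc (Suc n)) = munit a b n * cp j"
 "j <= n ==> cp j * sK (Suc (Suc n)) = sK n * cp j"
 "j <= n ==> cp j * sL (Suc (Suc n)) = sL n * cp j"
 "j <= n ==> munit a b (Suc (Suc n)) * cu j = cu j * munit a b n"
 "j <= n ==> sK (Suc (Suc n)) * cu j = cu j * sK n"
 "j <= n ==> sL (Suc (Suc n)) * cu j = cu j * sL n"
 by (simp_all add: munit_def sK_def sL_def cap_site_right cup_site_right)

lemma cp_X_left: "cp j * Ko 0 j = Ko 0 j * cp j" "cp j * Lo 0 j = Lo 0 j * cp j"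
  "cp j * Eo 0 j = Eo 0 j * cp j" "cp j * Fo 0 j = Fo 0 j * cp j"
  "Ko 0 j * cu j = cu j * Ko 0 j" "Lo 0 j * cu j = cu j * Lo 0 j"
  "Eo 0 j * cu j = cu j * Eo 0 j" "Fo 0 j * cu j = cu j * Fo 0 j"
proof -
 have "cmt (cp j) (Ko 0 j) & cmt (cp j) (Lo 0 j) & cmt (cp j) (Eo 0 j) & cmt (cp j) (Fo 0 j)"
  by (rule cmt_X) (auto simp: cmt_def munit_def sK_def sL_def cap_site_left)
 moreover have "cmt (cu j) (Ko 0 j) & cmt (cu j) (Lo 0 j) & cmt (cu j) (Eo 0 j) & cmt (cu j) (Fo 0 j)"
  by (rule cmt_X) (auto simp: cmt_def munit_def sK_def sL_def cup_site_left)
 ultimately show "cp j * Ko 0 j = Ko 0 j * cp j" "cp j * Lo 0 j = Lo 0 j * cp j"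
  "cp j * Eo 0 j = Eo 0 j * cp j" "cp j * Fo 0 j = Fo 0 j * cp j"
  "Ko 0 j * cu j = cu j * Ko 0 j" "Lo 0 j * cu j = cu j * Lo 0 j"
  "Eo 0 j * cu j = cu j * Eo 0 j" "Fo 0 j * cu j = cu j * Fo 0 j"
  by (simp_all add: cmt_def)
qed

lemma cap_X: "j <= n ==> cp j * Ko 0 (Suc (Suc n)) = Ko 0 n * cp j & cp j * Lo 0 (Suc (Suc n)) = Lo 0 n * cp j \<and>
  cp j * Eo 0 (Suc (Suc n)) = Eo 0 n * cp j & cp j * Fo 0 (Suc (Suc n)) = Fo 0 n * cp j"
proof (induction n rule: dec_induct)
 case base
 note l3 = cp_X_left(1-4)[THEN mult3]
 show ?case by (simp add: algebra_simps cp_X_left(1-4) l3 cap_pair)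
next
 case (step n)
 hence IH: "cp j * Ko 0 (Suc (Suc n)) = Ko 0 n * cp j" "cp j * Lo 0 (Suc (Suc n)) = Lo 0 n * cp j"
  "cp j * Eo 0 (Suc (Suc n)) = Eo 0 n * cp j" "cp j * Fo 0 (Suc (Suc n)) = Fo 0 n * cp j" by auto
 have u: "Xo 0 (Suc (Suc (Suc n))) = Xo 0 (Suc (Suc n)) ==> True" for Xo :: "nat => nat => lop" ..
 show ?case
  unfolding Ko.simps(2)[of 0 "Suc (Suc n)"] Lo.simps(2)[of 0 "Suc (Suc n)"] Eo.simps(2)[of 0 "Suc (Suc n)"]
   Fo.simps(2)[of 0 "Suc (Suc n)"] add_0 distrib_left
  using step(1) IH[THEN mult3] IH capfam_site[OF step(1)]
  by (simp add: distrib_left distrib_right massoc del: Ko.simps(2) Lo.simps(2) Eo.simps(2) Fo.simps(2))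
    (simp add: distrib_left distrib_right massoc)
qed

lemma cup_X: "j <= n ==> Ko 0 (Suc (Suc n)) * cu j = cu j * Ko 0 n & Lo 0 (Suc (Suc n)) * cu j = cu j * Lo 0 n \<and>
  Eo 0 (Suc (Suc n)) * cu j = cu j * Eo 0 n & Fo 0 (Suc (Suc n)) * cu j = cu j * Fo 0 n"
proof (induction n rule: dec_induct)
 case base
 show ?case by (simp add: algebra_simps cp_X_left(5-8) cup_pair)
next
 case (step n)
 hence IH: "Ko 0 (Suc (Suc n)) * cu j = cu j * Ko 0 n" "Lo 0 (Suc (Suc n)) * cu j = cu j * Lo 0 n"
  "Eo 0 (Suc (Suc n)) * cu j = cu j * Eo 0 n" "Fo 0 (Suc (Suc n)) * cu j = cu j * Fo 0 n" by auto
 show ?case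
  unfolding Ko.simps(2)[of 0 "Suc (Suc n)"] Lo.simps(2)[of 0 "Suc (Suc n)"] Eo.simps(2)[of 0 "Suc (Suc n)"]
   Fo.simps(2)[of 0 "Suc (Suc n)"] add_0
  using IH[THEN mult3] IH capfam_site[OF step(1)]
  by (simp add: distrib_left distrib_right massoc del: Ko.simps(2) Lo.simps(2) Eo.simps(2) Fo.simps(2))
    (simp add: distrib_left distrib_right massoc)
qed

lemma capfam_X: "capfam (Ko 0)" "capfam (Lo 0)" "capfam (Eo 0)" "capfam (Fo 0)"
 unfolding capfam_def using cap_X cup_X by blast+

lemma capfam_TLa:
 assumes "capfam X" "TLa m y" "m <= n"
 shows "cmt (X n) y"
 using assms(2)
proof induction
 case (gen i)
 then obtain l where l: "n = Suc (Suc l)" "i <= l"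
  using assms(3) that[of "n - 2"] by auto
 thus ?case using assms(1) unfolding capfam_def cmt_def tU_def by (metis massoc)
qed (auto intro: cmt_intros)

lemma capfam_CuCa:
 assumes "capfam X" "k <= N" "N + k <= n"
 shows "Ca k * X n = X (n - 2 * k) * Ca k & X n * Cu k = Cu k * X (n - 2 * k)"
 using assms(2,3)
proof (induction k)
 case (Suc k)
 define x where "x = n - 2 * Suc k"
 have x: "n - 2 * k = Suc (Suc x)" "N - Suc k <= x" using Suc.prems by (auto simp: x_def)
 have "cp (N - Suc k) * X (Suc (Suc x)) = X x * cp (N - Suc k)" "X (Suc (Suc x)) * cu (N - Suc k) = cu (N - Suc k) * X x"
  using assms(1) x by (auto simp: capfam_def)
 note S = this this[THEN mult3]
 have IH: "Ca k * X n = X (Suc (Suc x)) * Ca k" "X n * Cu k = Cu k * X (Suc (Suc x))"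
  using Suc x by auto
 show ?case unfolding x_def[symmetric]
  by (simp add: massoc IH IH[THEN mult3] S)
qed simp

lemma capfam_jh:
 assumes "capfam X" "k <= N" "N + k <= n"
 shows "cmt (X n) (jh k)"
proof -
 have F: "X n * F = F * X n"
  using capfam_TLa[OF assms(1) jf_TLa[of N], of n] assms by (simp add: cmt_def)
 have C: "X (n - 2 * k) * Ca k = Ca k * X n" "X n * Cu k = Cu k * X (n - 2 * k)"
  using capfam_CuCa[OF assms] by auto
 have "X n * (Ak k * Bk k) = Ak k * Bk k * X n"
  by (simp add: Ak_def Bk_def massoc F[THEN mult3] C C[THEN mult3] F)
 thus ?thesis by (simp add: cmt_def jh_def)
qed

lemma capfam_jg:
 assumes "capfam X" "k <= N" "N + k <= n"
 shows "cmt (X n) (jg k)"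
 using assms(2,3)
proof (induction k rule: jg.induct)
 case 1 thus ?case using capfam_TLa[OF assms(1) jf_TLa] by simp
next
 case 2 thus ?case using capfam_TLa[OF assms(1) jf_TLa] by simp
next
 case 3
 have "cmt (X n) F" "cmt (X n) (tU N)" "cmt (X n) (jh 1)"
  using 3 capfam_TLa[OF assms(1) jf_TLa[of N], of n] capfam_jh[OF assms(1), of 1 n]
   capfam_TLa[OF assms(1) TLa.gen[of N "N + 2"], of n] by auto
 thus ?case unfolding jg.simps by (intro cmt_intros)
next
 case (4 i)
 have "cmt (X n) (jg (Suc (Suc i)))" "cmt (X n) (tU (N + Suc i))" "cmt (X n) (jh (Suc (Suc i)))"
  using 4 capfam_jh[OF assms(1), of "Suc (Suc i)" n]
   capfam_TLa[OF assms(1) TLa.gen[of "N + Suc i" "N + Suc i + 2"], of n] by auto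
 thus ?case unfolding jg.simps by (intro cmt_intros)
qed

text \<open>Projection to the words with \<open>j\<close> letters \<open>A1\<close> among the first
  \<open>m\<close>, i.e. to a weight space. An integer index lets shifts run past either end, where
  the projection is \<open>0\<close>.\<close>

primrec Pm :: "nat => int => lop" where
 "Pm 0 j = (if j = 0 then 1 else 0)"
| "Pm (Suc m) j = Pm m j * munit A0 A0 m + Pm m (j - 1) * munit A1 A1 m"

lemma cmt_site_Pm: "m <= i ==> cmt (munit a b i) (Pm m j)"
 by (induction m arbitrary: j) (auto intro!: cmt_intros simp: cmt_munit munit_def cmt_site[unfolded munit_def])

lemma Pm_mult: "Pm m i * Pm m j = (if i = j then Pm m i else 0)"
proof (induction m arbitrary: i j)
 case (Suc m)
 have c: "munit a b m * Pm m j = Pm m j * munit a b m" for a b j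
  using cmt_site_Pm by (simp add: cmt_def)
 show ?case
  by (simp add: algebra_simps mult3[OF c] munit_munit mult3[OF Suc.IH] mult3[OF munit_munit])
qed simp

lemma Pm_out: "j < 0 | int m < j ==> Pm m j = 0"
 by (induction m arbitrary: j) auto

lemma Pm_sum: "(\<Sum>j = 0..m. Pm m (int j)) = 1"
proof (induction m)
 case (Suc m)
 have "(\<Sum>j = 0..Suc m. Pm (Suc m) (int j)) = (\<Sum>j = 0..Suc m. Pm m (int j)) * munit A0 A0 m
   + (\<Sum>j = 0..Suc m. Pm m (int j - 1)) * munit A1 A1 m"
  by (simp only: Pm.simps sum.distrib sum_distrib_right)
 also have "(\<Sum>j = 0..Suc m. Pm m (int j)) = 1" using Suc by (simp add: Pm_out)
 also have "(\<Sum>j = 0..Suc m. Pm m (int j - 1)) = 1"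
  unfolding sum.atLeast0_atMost_Suc_shift using Suc by (simp add: Pm_out)
 finally show ?case by (simp add: munit_one)
qed simp

lemma Pm_K: "Ko 0 m * Pm m j = (q powi (int m - 2 * j)) *. Pm m j" "Pm m j * Ko 0 m = (q powi (int m - 2 * j)) *. Pm m j"
 and Pm_L: "Lo 0 m * Pm m j = (q powi (2 * j - int m)) *. Pm m j" "Pm m j * Lo 0 m = (q powi (2 * j - int m)) *. Pm m j"
proof (induction m arbitrary: j)
 case (Suc m)
 have c: "munit a b m * Pm m j = Pm m j * munit a b m" "munit a b m * Ko 0 m = Ko 0 m * munit a b m"
   "munit a b m * Lo 0 m = Lo 0 m * munit a b m" "sK m * Pm m j = Pm m j * sK m" "sL m * Pm m j = Pm m j * sL m" for a b j
  using cmt_site_Pm[of m m, THEN cmtD] cmt_site_X[of m 0 m, folded munit_def, THEN cmtD]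
  by (simp_all add: munit_def cmt_site_X cmtD sK_munit sL_munit distrib_left distrib_right)
 note c3 = c[THEN mult3] Suc[THEN mult3]
 have pw: "q * q powi a = q powi (a + 1)" "iq * q powi a = q powi (a - 1)" for a
  by (simp_all add: power_int_add power_int_diff field_simps)
 have s: "munit a a m * sK m = (if a = A0 then q else iq) *. munit a a m"
  "sK m * munit a a m = (if a = A0 then q else iq) *. munit a a m"
  "munit a a m * sL m = (if a = A0 then iq else q) *. munit a a m"
  "sL m * munit a a m = (if a = A0 then iq else q) *. munit a a m" for a
  by (cases a; simp add: sK_munit sL_munit distrib_left distrib_right munit_munit)+
 { case 1 show ?case
   by (simp add: distrib_left distrib_right massoc c c3 s Suc smult_add_right) (simp add: pw algebra_simps) }
 { case 2 show ?case
   by (simp add: distrib_left distrib_right massoc c c3 s Suc smult_add_right) (simp add: pw algebra_simps) }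
 { case 3 show ?case
   by (simp add: distrib_left distrib_right massoc c c3 s Suc smult_add_right) (simp add: pw algebra_simps) }
 { case 4 show ?case
   by (simp add: distrib_left distrib_right massoc c c3 s Suc smult_add_right) (simp add: pw algebra_simps) }
qed simp_all

lemma Pm_E: "Pm m j * Eo 0 m = Eo 0 m * Pm m (j + 1)"
 and Pm_F: "Fo 0 m * Pm m j = Pm m (j + 1) * Fo 0 m"
proof (induction m arbitrary: j)
 case (Suc m)
 have c: "munit a b m * Pm m j = Pm m j * munit a b m" "munit a b m * Eo 0 m = Eo 0 m * munit a b m"
   "munit a b m * Fo 0 m = Fo 0 m * munit a b m" "munit a b m * Lo 0 m = Lo 0 m * munit a b m"
   "sK m * Pm m j = Pm m j * sK m" for a b j
  using cmt_site_Pm[of m m, THEN cmtD] cmt_site_X[of m 0 m, folded munit_def, THEN cmtD]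
  by (simp_all add: munit_def cmt_site_X cmtD sK_munit sL_munit distrib_left distrib_right)
 note c3 = c[THEN mult3] Suc[THEN mult3] munit_munit[THEN mult3]
 have s: "munit a a m * sK m = (if a = A0 then q else iq) *. munit a a m"
  "sK m * munit a a m = (if a = A0 then q else iq) *. munit a a m" for a
  by (cases a; simp add: sK_munit distrib_left distrib_right munit_munit)+
 { case 1 show ?case
   by (simp add: distrib_left distrib_right massoc c c3 s Suc munit_munit) }
 { case 2 show ?case
   by (simp add: distrib_left distrib_right massoc c c3 s Suc munit_munit Pm_L mult3[OF Pm_L(1)] mult3[OF Pm_L(2)]) }
qed simp_all

subsection \<open>The Casimir operator\<close>

text \<open>\<open>Bo n\<close> is \<open>{1}\<^sup>2\<close> times the Casimir element, acting on the first \<open>n\<close> letters.\<close>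

definition Bo :: "nat => lop" where
 "Bo n = (br 1)^2 *. (Fo 0 n * Eo 0 n) + q *. Ko 0 n + iq *. Lo 0 n"

lemma capfam_mult: "capfam X ==> capfam Y ==> capfam (%n. X n * Y n)"
 unfolding capfam_def by (metis massoc)

lemma capfam_add: "capfam X ==> capfam Y ==> capfam (%n. X n + Y n)"
 by (simp add: capfam_def distrib_left distrib_right)

lemma capfam_smult: "capfam X ==> capfam (%n. c *. X n)"
 by (simp add: capfam_def)

lemma capfam_Bo: "capfam Bo"
 unfolding Bo_def[abs_def] by (intro capfam_add capfam_smult capfam_mult capfam_X)

lemma eq_by_units:
 assumes "i ~= j" "!!a b. x * (munit a a i * munit b b j) = y * (munit a a i * munit b b j)"
 shows "x = y"
proof -
 have "1 = (munit A0 A0 i + munit A1 A1 i) * (munit A0 A0 j + munit A1 A1 j)"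
  by (simp add: munit_one)
 also have "... = munit A0 A0 i * munit A0 A0 j + munit A0 A0 i * munit A1 A1 j
   + munit A1 A1 i * munit A0 A0 j + munit A1 A1 i * munit A1 A1 j"
  by (simp add: algebra_simps)
 finally have one: "1 = munit A0 A0 i * munit A0 A0 j + munit A0 A0 i * munit A1 A1 j
   + munit A1 A1 i * munit A0 A0 j + munit A1 A1 i * munit A1 A1 j" .
 have "x * 1 = y * 1" unfolding one using assms(2) by (simp add: distrib_left)
 thus ?thesis by simp
qed

text \<open>Verified on the four values of the last two letters. Between elements that kill
  \<open>tU m\<close> only the two-term recursion remains, which \<open>{k}'\<close> and
  \<open>[k]\<close> satisfy too; so the Casimir operator on \<open>f\<close> and \<open>g\<close>
  is found without any highest weight vectors.\<close>

lemma Bo_rec: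
 "Bo (Suc (Suc m)) = qi 2 *. Bo (Suc m) - Bo m + tU m * Bo (Suc m) + Bo (Suc m) * tU m - qi 2 *. (Bo m * tU m)"
proof (rule eq_by_units[of m "Suc m"])
 fix a b
 define E where "E = Eo 0 m"
 define F' where "F' = Fo 0 m"
 define K where "K = Ko 0 m"
 define L where "L = Lo 0 m"
 have c: "munit a b m * E = E * munit a b m" "munit a b m * F' = F' * munit a b m"
  "munit a b m * K = K * munit a b m" "munit a b m * L = L * munit a b m"
  "munit a b (Suc m) * E = E * munit a b (Suc m)" "munit a b (Suc m) * F' = F' * munit a b (Suc m)"
  "munit a b (Suc m) * K = K * munit a b (Suc m)" "munit a b (Suc m) * L = L * munit a b (Suc m)"
  "munit a b (Suc m) * munit c d m = munit c d m * munit a b (Suc m)" for a b c d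
  unfolding E_def F'_def K_def L_def by (simp_all add: munit_def cmt_site_X cmtD site_commute)
 note c3 = c[THEN mult3] munit_munit munit_munit[THEN mult3]
 have U: "tU m = - (q *. (munit A0 A0 m * munit A1 A1 (Suc m)))
  - iq *. (munit A1 A1 m * munit A0 A0 (Suc m))
  + munit A0 A1 m * munit A1 A0 (Suc m) + munit A1 A0 m * munit A0 A1 (Suc m)"
  unfolding tU_def by (rule cup_cap_munit) simp
 have b: "br 1 = q - iq" by (simp add: qbrace_def)
 show "Bo (Suc (Suc m)) * (munit a a m * munit b b (Suc m)) =
  (qi 2 *. Bo (Suc m) - Bo m + tU m * Bo (Suc m) + Bo (Suc m) * tU m - qi 2 *. (Bo m * tU m)) * (munit a a m * munit b b (Suc m))"
  unfolding Bo_def b qi_2 U Eo.simps Fo.simps Ko.simps Lo.simps add_0 sK_munit sL_munit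
   E_def[symmetric] F'_def[symmetric] K_def[symmetric] L_def[symmetric]
  by (cases a; cases b; simp add: distrib_left distrib_right left_diff_distrib right_diff_distrib massoc c c3;
    rule lop_eqI, simp add: field_simps power2_eq_square)
qed simp

lemma Bo_jf: "m < r ==> Bo m * jf m = br' (Suc m) *. jf m"
proof (induction m rule: less_induct)
 case (less m)
 consider "m = 0" | "m = Suc 0" | n where "m = Suc (Suc n)" by (metis not0_implies_Suc)
 thus ?case
 proof cases
  case 1
  thus ?thesis by (simp add: Bo_def qbrace'_def smult_add_left)
 next
  case 2
  have "Bo (Suc 0) = br' 2 *. (munit A0 A0 0 + munit A1 A1 0)"
   by (rule lop_eqI) (simp add: Bo_def munit_munit sK_munit sL_munit qbrace'_def qbrace_def field_simps power2_eq_square)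
  with 2 show ?thesis by (simp add: munit_one numeral_2_eq_2)
 next
  case (3 n)
  define f where "f = jf m"
  have a: "jf (Suc n) * f = f" "jf n * f = f" "cp n * f = 0" "tU n * f = 0"
   using jf_abs[of "Suc n" m] jf_abs[of n m] less.prems jf_cap[of n m] 3 by (auto simp: f_def tU_def massoc)
  have b: "Bo k * f = br' (Suc k) *. f" if "k = n | k = Suc n" for k
   using mult3[OF less.IH[of k], of f] a that 3 less.prems by auto
  have "Bo m * f = (qi 2 * br' (Suc (Suc n)) - br' (Suc n)) *. f"
   by (simp add: 3 Bo_rec distrib_right left_diff_distrib massoc a b smult_diff_left)
  also have "qi 2 * br' (Suc (Suc n)) - br' (Suc n) = br' (Suc m)"
   using br'_rec[of "Suc n"] 3 by (simp add: algebra_simps)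
  finally show ?thesis by (simp add: f_def)
 qed
qed

text \<open>The term with \<open>h\<close> is the nilpotent part of the Casimir operator. It is
  created at \<open>k = 1\<close>, where \<open>F\<close> does not kill \<open>tU (N - 1)\<close>
  and \<open>F * tU (N - 1) * F\<close> is \<open>h\<close>; from then on \<open>Bo_rec\<close>
  between two copies of \<open>g\<close> propagates it. The case \<open>k = 0\<close> uses
  \<open>jg 0 = F\<close> as a convention.\<close>

lemma Bo_jg:
 "k <= N ==> Bo (N + k) * jg k = br' k *. jg k - ((br 1)^2 * qi k) *. jh k"
proof (induction k rule: less_induct)
 case (less k)
 consider "k = 0" | "k = Suc 0" | i where "k = Suc (Suc i)" by (metis not0_implies_Suc)
 thus ?case
 proof cases
  case 1
  thus ?thesis using Bo_jf[of N] br'_add_r[of 0] by (simp flip: r_Suc)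
 next
  case 2
  obtain n where n: "N = Suc n" using N_ge by (cases N) auto
  have nN: "N - Suc 0 = n" "n <= N" "n < r" using n N_lt by (auto simp del: N_lt)
  define U where "U = tU n"
  have rec: "Bo (Suc N) = qi 2 *. Bo N - Bo n + U * Bo N + Bo N * U - qi 2 *. (Bo n * U)"
   using Bo_rec[of n] by (simp add: U_def flip: n)
  have h1: "jh (Suc 0) = F * (U * F)"
   by (simp add: jh_1 Ak_def Bk_def U_def tU_def nN(1) massoc)
  have c: "cmt (Bo (Suc N)) F" "cmt (Bo N) F" "cmt (Bo n) (jf n)"
   using capfam_TLa[OF capfam_Bo jf_TLa] by auto
  have BN: "Bo N * F = 2 *. F" "F * Bo N = 2 *. F"
   using Bo_jf[of N] c(2) br'_add_r[of 0] by (simp_all add: cmt_def qbrace'_def flip: r_Suc)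
  have rN: "r - Suc 0 = N" "Suc 0 <= r" using r_ge by (auto simp: r_Suc)
  have bn: "br' N = qi 2" using br'_diff_r[of "Suc 0", unfolded rN] rN(2) by (simp add: qi_2) (simp add: qbrace'_def)
  have Fn: "jf n * F = F" "F * jf n = F" using jf_abs[of n N] nN by auto
  have Bn: "Bo n * F = qi 2 *. F" "F * Bo n = qi 2 *. F"
  proof -
   have 1: "Bo n * jf n = qi 2 *. jf n" "jf n * Bo n = qi 2 *. jf n"
    using Bo_jf[of n] c(3) bn nN(3) by (simp_all add: cmt_def flip: n)
   show "Bo n * F = qi 2 *. F" using mult3[OF 1(1), of F] Fn by simp
   have "(F * jf n) * Bo n = F * (jf n * Bo n)" by (simp only: massoc)
   thus "F * Bo n = qi 2 *. F" using Fn 1 by simp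
  qed
  have "Bo (Suc N) * F = F * (Bo (Suc N) * F)"
   using c(1) by (simp add: cmt_def)
  also have "... = (qi 2 * 2 - qi 2) *. F + (4 - qi 2 * qi 2) *. (F * (U * F))"
   unfolding rec
   by (simp add: distrib_left distrib_right right_diff_distrib left_diff_distrib massoc BN Bn
     mult3[OF BN(2)] mult3[OF Bn(2)], rule lop_eqI, simp add: algebra_simps)
  also have "4 - qi 2 * qi 2 = - ((br 1)^2)"
   by (simp add: qi_2 qbrace_def field_simps power2_eq_square)
  also have "qi 2 * 2 - qi 2 = br' 1" by (simp add: qi_2 qbrace'_def)
  finally show ?thesis by (simp add: 2 h1)
 next
  case (3 i)
  define g where "g = jg k"
  define U where "U = tU (N + i)"
  have kN: "0 < k" "k <= N" "Suc (Suc i) <= N" using less.prems 3 by auto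
  have gg: "g * g = g" using jg_idem kN by (simp add: g_def)
  have gU: "g * U = 0" "g * (U * x) = 0" for x
   using jg_cup[OF kN(3)] mult3[OF jg_cup[OF kN(3)]]
   by (simp_all add: g_def U_def tU_def 3 massoc[symmetric])
  have st: "jg (Suc i) * g = g" "g * jg (Suc i) = g" "jh (Suc i) * g = jh k" "g * jh (Suc i) = jh k"
   using jg_step[OF kN(3)] jh_step[OF kN(3)] by (simp_all add: g_def 3)
  \<comment> \<open>The factor \<open>qi i\<close> covers \<open>i = 0\<close>: there
    \<open>jh 0 = 0\<close> says nothing about \<open>jh k\<close>, but both sides vanish.\<close>
  have sti: "jg i * g = g" "g * jg i = g" "qi i *. (jh i * g) = qi i *. jh k" "qi i *. (g * jh i) = qi i *. jh k"
  proof -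
   have "jg i * g = g & g * jg i = g & qi i *. (jh i * g) = qi i *. jh k & qi i *. (g * jh i) = qi i *. jh k"
   proof (cases i)
    case 0
    thus ?thesis using jg_F[OF kN(1,2)] by (simp add: g_def)
   next
    case (Suc l)
    hence l: "Suc (Suc l) <= N" using kN by simp
    note s2 = jg_step[OF l] jh_step[OF l]
    have "jg i * (jg (Suc i) * g) = jg (Suc i) * g" "(g * jg (Suc i)) * jg i = g * jg (Suc i)"
     "jh i * (jg (Suc i) * g) = jh (Suc i) * g" "(g * jg (Suc i)) * jh i = g * jh (Suc i)"
     using s2 Suc by (simp_all add: massoc mult3)
    thus ?thesis using st by simp
   qed
   thus "jg i * g = g" "g * jg i = g" "qi i *. (jh i * g) = qi i *. jh k" "qi i *. (g * jh i) = qi i *. jh k"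
    by auto
  qed
  have hU: "jh k * U = 0" "jh k * (U * x) = 0" for x
   using jh_jg[OF kN(1,2)] gU by (metis g_def massoc mult_zero_right)+
  have cB: "cmt (Bo (N + j)) (jg j)" if "j <= N" for j
   using capfam_jg[OF capfam_Bo that] by simp
  define d where "d = (br 1)^2"
  have B1: "Bo (N + Suc i) * g = br' (Suc i) *. g - (d * qi (Suc i)) *. jh k"
   "g * Bo (N + Suc i) = br' (Suc i) *. g - (d * qi (Suc i)) *. jh k"
  proof -
   have IH: "Bo (N + Suc i) * jg (Suc i) = br' (Suc i) *. jg (Suc i) - (d * qi (Suc i)) *. jh (Suc i)"
    using less.IH[of "Suc i"] 3 kN by (simp add: d_def)
   have "(Bo (N + Suc i) * jg (Suc i)) * g = br' (Suc i) *. g - (d * qi (Suc i)) *. jh k"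
    unfolding IH by (simp add: left_diff_distrib st)
   thus "Bo (N + Suc i) * g = br' (Suc i) *. g - (d * qi (Suc i)) *. jh k"
    by (simp only: massoc st)
   have "g * (jg (Suc i) * Bo (N + Suc i)) = br' (Suc i) *. g - (d * qi (Suc i)) *. jh k"
   proof -
    have "jg (Suc i) * Bo (N + Suc i) = Bo (N + Suc i) * jg (Suc i)"
     using cB[of "Suc i"] kN by (simp add: cmt_def)
    thus ?thesis unfolding IH by (simp add: right_diff_distrib st)
   qed
   thus "g * Bo (N + Suc i) = br' (Suc i) *. g - (d * qi (Suc i)) *. jh k"
    by (simp only: massoc[symmetric] st)
  qed
  have B0: "Bo (N + i) * g = br' i *. g - (d * qi i) *. jh k"
   "g * Bo (N + i) = br' i *. g - (d * qi i) *. jh k"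
  proof -
   have IH: "Bo (N + i) * jg i = br' i *. jg i - d *. (qi i *. jh i)"
    using less.IH[of i] 3 kN by (simp add: d_def)
   have "(Bo (N + i) * jg i) * g = br' i *. g - d *. (qi i *. (jh i * g))"
    unfolding IH by (simp add: left_diff_distrib sti(1))
   thus "Bo (N + i) * g = br' i *. g - (d * qi i) *. jh k"
    unfolding sti(3) by (simp add: massoc sti)
   have "g * (Bo (N + i) * jg i) = br' i *. g - d *. (qi i *. (g * jh i))"
    unfolding IH by (simp add: right_diff_distrib sti(2))
   moreover have "g * (Bo (N + i) * jg i) = (g * jg i) * Bo (N + i)"
    using cB[of i] kN by (simp add: cmt_def massoc)
   ultimately show "g * Bo (N + i) = br' i *. g - (d * qi i) *. jh k"
    unfolding sti(4) sti(2) by simp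
  qed
  have "Bo (N + k) * g = g * (Bo (N + k) * g)"
   using cB[of k] kN gg by (simp add: cmt_def g_def massoc) (metis massoc)
  also have "... = (qi 2 * br' (Suc i) - br' i) *. g - (d * (qi 2 * qi (Suc i) - qi i)) *. jh k"
   unfolding 3 add_Suc_right Bo_rec[of "N + i"] U_def[symmetric]
   by (simp add: distrib_left distrib_right right_diff_distrib left_diff_distrib massoc B1[simplified] B0
     mult3[OF B1(2)[simplified]] mult3[OF B0(2)] gU hU gg jg_jh[OF kN(1,2), folded g_def] jh_jg[OF kN(1,2), folded g_def],
     rule lop_eqI, simp add: algebra_simps 3)
  also have "qi 2 * br' (Suc i) - br' i = br' k"
   using br'_rec[of i] 3 by (simp add: algebra_simps)
  also have "qi 2 * qi (Suc i) - qi i = qi k"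
   using qi_rec[of i] 3 by (simp add: algebra_simps)
  finally show ?thesis by (simp add: g_def d_def)
 qed
qed

end

context odd_root
begin

subsection \<open>Equivariance of bent operators\<close>

text \<open>Unlike \<open>Cu\<close>, these nested cups start from no strand: \<open>CU m\<close> is
  \<open>coev_m\<close>, and for \<open>w\<close> local to the first \<open>m\<close> letters
  \<open>w * CU m\<close> is \<open>w\<close> bent into a vector.\<close>

primrec CU :: "nat => lop" where
 "CU 0 = 1" | "CU (Suc m) = cu m * CU m"
primrec CA :: "nat => lop" where
 "CA 0 = 1" | "CA (Suc m) = CA m * cp m"

lemma CA_Ca: "k <= N ==> CA (N - k) * Ca k = CA N"
proof (induction k)
 case (Suc k)
 hence "CA (N - k) = CA (N - Suc k) * cp (N - Suc k)"
  by (metis CA.simps(2) Suc_diff_Suc Suc_le_lessD)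
 thus ?case using Suc by (simp add: massoc)
qed simp

lemma CU_Cu: "k <= N ==> Cu k * CU (N - k) = CU N"
proof (induction k)
 case (Suc k)
 hence "CU (N - k) = cu (N - Suc k) * CU (N - Suc k)"
  by (metis CU.simps(2) Suc_diff_Suc Suc_le_lessD)
 thus ?case using Suc by (simp add: massoc)
qed simp

lemma CA_N: "CA N = Ca N" "CU N = Cu N"
 using CA_Ca[of N] CU_Cu[of N] by simp_all

lemma CA_add: "CA (N + k) = CA N * Cm k" "CU (N + k) = Dm k * CU N"
 by (induction k) (simp_all add: massoc)

lemma capfam_CA: "capfam X ==> CA m * X (2 * m) = X 0 * CA m & X (2 * m) * CU m = CU m * X 0"
proof (induction m)
 case (Suc m)
 have S: "cp m * X (Suc (Suc (2 * m))) = X (2 * m) * cp m" "X (Suc (Suc (2 * m))) * cu m = cu m * X (2 * m)"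
  using Suc.prems by (auto simp: capfam_def)
 have "X (2 * Suc m) = X (Suc (Suc (2 * m)))" by simp
 thus ?case using Suc by (simp add: massoc S S[THEN mult3])
   (simp add: massoc[symmetric])
qed simp

lemma capfam_Cm: "capfam X ==> Cm k * X (2 * (N + k)) = X (2 * N) * Cm k"
proof (induction k)
 case (Suc k)
 have S: "cp (N + k) * X (Suc (Suc (2 * (N + k)))) = X (2 * (N + k)) * cp (N + k)"
  using Suc.prems by (auto simp: capfam_def)
 have e: "2 * (N + Suc k) = Suc (Suc (2 * (N + k)))" by simp
 have "Cm (Suc k) * X (2 * (N + Suc k)) = Cm k * (cp (N + k) * X (Suc (Suc (2 * (N + k)))))"
  by (simp only: e Cm.simps massoc)
 also have "... = (Cm k * X (2 * (N + k))) * cp (N + k)" by (simp only: S massoc)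
 also have "... = X (2 * N) * Cm (Suc k)" using Suc by (simp only: Cm.simps massoc)
 finally show ?case .
qed simp

lemma loc_munit: "i < m ==> loc m (munit a b i)"
 by (simp add: munit_def loc_site)

lemma loc_X: "n <= m ==> loc m (Ko 0 n)" "n <= m ==> loc m (Lo 0 n)" "n <= m ==> loc m (Eo 0 n)" "n <= m ==> loc m (Fo 0 n)"
proof -
 have 1: "loc m (sK i)" "loc m (sL i)" if "i < m" for i
  using that by (simp_all add: sK_def sL_def loc_site)
 have 0: "loc m 0" by (simp add: loc_def)
 show K: "n <= m ==> loc m (Ko 0 n)" for n by (induction n) (auto intro!: loc_one loc_mult 1)
 show L: "n <= m ==> loc m (Lo 0 n)" for n by (induction n) (auto intro!: loc_one loc_mult 1)
 show "n <= m ==> loc m (Eo 0 n)" by (induction n) (auto intro!: 0 loc_add loc_mult 1 loc_munit)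
 show "n <= m ==> loc m (Fo 0 n)" by (induction n) (auto intro!: 0 loc_add loc_mult 1 loc_munit L)
qed

lemma loc_Pm: "n <= m ==> loc m (Pm n j)"
proof (induction n arbitrary: j)
 case 0 thus ?case by (auto simp: loc_def)
qed (auto intro!: loc_add loc_mult loc_munit)

lemma loc_tail:
 assumes "loc m w"
 shows "cmt w (Ko m n)" "cmt w (Lo m n)" "cmt w (Eo m n)" "cmt w (Fo m n)"
proof -
 have "cmt w (Ko m n) & cmt w (Lo m n) & cmt w (Eo m n) & cmt w (Fo m n)"
  by (rule cmt_X) (use assms in \<open>auto simp: loc_def cmt_def sK_def sL_def munit_def\<close>)
 thus "cmt w (Ko m n)" "cmt w (Lo m n)" "cmt w (Eo m n)" "cmt w (Fo m n)" by auto
qed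

text \<open>\<open>CU m\<close> is invariant, so a generator acting on its right half can be traded
  for its antipode acting on the left half; \<open>E_tail\<close> and \<open>F_tail\<close> are the
  other two cases.\<close>

lemma K_tail: "Ko m m * CU m = Lo 0 m * CU m" "Lo m m * CU m = Ko 0 m * CU m"
proof -
 have "Ko 0 m * (Ko m m * CU m) = CU m"
  using capfam_CA[OF capfam_X(1), of m] X_add(1)[of 0 m m] by (simp add: massoc mult_2)
 hence "Lo 0 m * (Ko 0 m * (Ko m m * CU m)) = Lo 0 m * CU m" by simp
 thus "Ko m m * CU m = Lo 0 m * CU m" by (simp add: massoc[symmetric] KL)
 have "Lo 0 m * (Lo m m * CU m) = CU m"
  using capfam_CA[OF capfam_X(2), of m] X_add(2)[of 0 m m] by (simp add: massoc mult_2)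
 hence "Ko 0 m * (Lo 0 m * (Lo m m * CU m)) = Ko 0 m * CU m" by simp
 thus "Lo m m * CU m = Ko 0 m * CU m" by (simp add: massoc[symmetric] KL)
qed

lemma E_tail: "Eo m m * CU m = - (Eo 0 m * (Lo 0 m * CU m))"
 and F_tail: "Fo m m * CU m = - (Ko 0 m * (Fo 0 m * CU m))"
proof -
 have "Eo 0 m * (Ko m m * CU m) + Eo m m * CU m = 0"
  using capfam_CA[OF capfam_X(3), of m] X_add(3)[of 0 m m] by (simp add: massoc mult_2 distrib_right)
 thus "Eo m m * CU m = - (Eo 0 m * (Lo 0 m * CU m))"
  by (simp add: K_tail add_eq_0_iff2)
 have "Lo 0 m * (Fo m m * CU m) + Fo 0 m * CU m = 0"
  using capfam_CA[OF capfam_X(4), of m] X_add(4)[of 0 m m] by (simp add: massoc mult_2 distrib_right)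
 hence "Ko 0 m * (Lo 0 m * (Fo m m * CU m)) = - (Ko 0 m * (Fo 0 m * CU m))"
  by (metis (no_types, lifting) add_eq_0_iff2 mult_minus_right)
 thus "Fo m m * CU m = - (Ko 0 m * (Fo 0 m * CU m))"
  by (simp add: massoc[symmetric] KL)
qed

text \<open>The coproduct puts one factor on each half; the one on the right half passes
  \<open>w\<close> by locality and becomes an antipode standing to the right of \<open>w\<close>.
  The result is the adjoint action on operators.\<close>

lemma E_bend:
 assumes "loc m w"
 shows "Eo 0 (2 * m) * (w * CU m) = (Eo 0 m * w - w * Eo 0 m) * (Lo 0 m * CU m)"
proof -
 note c = loc_tail[OF assms, THEN cmtD, THEN sym, THEN mult3]
 show ?thesis
  using X_add(3)[of 0 m m]
  by (simp add: mult_2 distrib_right left_diff_distrib massoc c K_tail E_tail)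
qed

lemma F_bend:
 assumes "loc m w"
 shows "Fo 0 (2 * m) * (w * CU m) = (Fo 0 m * w - Lo 0 m * w * Ko 0 m * Fo 0 m) * CU m"
proof -
 note c = loc_tail[OF assms, THEN cmtD, THEN sym, THEN mult3]
 show ?thesis
  using X_add(4)[of 0 m m]
  by (simp add: mult_2 distrib_right left_diff_distrib massoc c F_tail)
qed

lemma K_bend:
 assumes "loc m w"
 shows "Ko 0 (2 * m) * (w * CU m) = Ko 0 m * (w * (Lo 0 m * CU m))"
  "Lo 0 (2 * m) * (w * CU m) = Lo 0 m * (w * (Ko 0 m * CU m))"
proof -
 note c = loc_tail[OF assms, THEN cmtD, THEN sym, THEN mult3]
 show "Ko 0 (2 * m) * (w * CU m) = Ko 0 m * (w * (Lo 0 m * CU m))"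
  "Lo 0 (2 * m) * (w * CU m) = Lo 0 m * (w * (Ko 0 m * CU m))"
  using X_add(1,2)[of 0 m m]
  by (simp_all add: mult_2 massoc c K_tail)
qed

lemma cap_Pm_base: "cp j * (munit A0 A0 j * munit A0 A0 (Suc j)) = 0" "cp j * (munit A1 A1 j * munit A1 A1 (Suc j)) = 0"
 "cp j * (munit A0 A0 j * munit A1 A1 (Suc j)) + cp j * (munit A1 A1 j * munit A0 A0 (Suc j)) = cp j"
 "munit A0 A0 j * (munit A0 A0 (Suc j) * cu j) = 0" "munit A1 A1 j * (munit A1 A1 (Suc j) * cu j) = 0"
 "munit A0 A0 j * (munit A1 A1 (Suc j) * cu j) + munit A1 A1 j * (munit A0 A0 (Suc j) * cu j) = cu j"
 by (rule lop_eqI; simp add: ap_cap ap_cup ap_munit upd_ins_at fun_upd_idem)+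

lemma cap_Pm:
 "j <= n ==> cp j * Pm (Suc (Suc n)) i = Pm n (i - 1) * cp j & Pm (Suc (Suc n)) i * cu j = cu j * Pm n (i - 1)"
proof (induction n arbitrary: i rule: dec_induct)
 case base
 have l: "cp j * Pm k i = Pm k i * cp j" "Pm k i * cu j = cu j * Pm k i" if "k <= j" for k i
  using loc_Pm[OF that, of i] by (simp_all add: loc_cap loc_cup)
 have e: "Pm (Suc (Suc j)) i = Pm j i * (munit A0 A0 j * munit A0 A0 (Suc j))
   + Pm j (i - 1) * (munit A1 A1 j * munit A0 A0 (Suc j) + munit A0 A0 j * munit A1 A1 (Suc j))
   + Pm j (i - 2) * (munit A1 A1 j * munit A1 A1 (Suc j))"
  by (simp add: algebra_simps)
 have 1: "cp j * (munit A1 A1 j * munit A0 A0 (Suc j) + munit A0 A0 j * munit A1 A1 (Suc j)) = cp j"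
  "(munit A1 A1 j * munit A0 A0 (Suc j) + munit A0 A0 j * munit A1 A1 (Suc j)) * cu j = cu j"
  using cap_Pm_base(3,6)[of j] by (simp_all add: algebra_simps)
 show ?case
  unfolding e using cap_Pm_base(1,2,4,5)[of j] 1 l[OF order_refl] l(1)[OF order_refl, THEN mult3]
  by (simp add: distrib_left[of "cp j"] distrib_right[of _ _ "cu j"] massoc)
next
 case (step n)
 have IH: "cp j * Pm (Suc (Suc n)) i = Pm n (i - 1) * cp j" "Pm (Suc (Suc n)) i * cu j = cu j * Pm n (i - 1)" for i
  using step by auto
 show ?case
  unfolding Pm.simps(2)[of "Suc (Suc n)"] Pm.simps(2)[of n]
  using capfam_site(1,4)[OF step(1)] IH IH[THEN mult3]
  by (simp add: distrib_left distrib_right massoc del: Pm.simps)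
qed

text \<open>A cup contains one \<open>A0\<close> and one \<open>A1\<close>, so it preserves the
  weight \<open>n - 2 j\<close>. The projection to a fixed weight is thus natural, not the one to a
  fixed number of \<open>A1\<close>. Rounding by \<open>div\<close> is harmless, being the same for
  \<open>n\<close> and \<open>n + 2\<close>.\<close>

lemma capfam_Pm: "capfam (%n. Pm n ((int n - w) div 2))"
proof -
 have "(int (Suc (Suc n)) - w) div 2 = (int n - w) div 2 + 1" for n
  by (simp add: algebra_simps)
 thus ?thesis unfolding capfam_def
  using cap_Pm[of _ _ "(int _ - w) div 2 + 1"] by (simp del: Pm.simps)
qed

text \<open>What bending asks of an operator: locality, to pass the right half of
  \<open>CU m\<close>, and commutation with all natural families.\<close>

definition good :: "nat => lop => bool" where
 "good m z \<longleftrightarrow> loc m z & (\<forall>X. capfam X --> cmt (X m) z)"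

lemma good_Pm: "good m z ==> cmt (Pm m j) z"
proof -
 assume "good m z"
 hence "cmt (Pm m ((int m - (int m - 2 * j)) div 2)) z"
  using capfam_Pm[of "int m - 2 * j"] unfolding good_def by blast
 thus ?thesis by simp
qed

lemma good_jg: "k <= N ==> good (N + k) (jg k)" and good_jh: "k <= N ==> good (N + k) (jh k)"
 and good_jf: "good m (jf m)"
 unfolding good_def using capfam_jg capfam_jh capfam_TLa[OF _ jf_TLa] jg_loc jh_loc jf_loc by auto

text \<open>A weight component of the bent \<open>z\<close> divided by the eigenvalue of
  \<open>K\<close> on it. With this normalization \<open>bend_recursion\<close> involves only
  differences of neighbours, at the price of one extra power of the eigenvalue in
  \<open>weight_sum\<close>, which is the \<open>Suc c\<close> in the later divisibility
  conditions.\<close>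

definition bv :: "nat => int => lop => lop" where
 "bv m j z = (q powi (2 * j - int m)) *. (Pm m j * (z * CU m))"

text \<open>The eigenvalue of \<open>q K + q^-1 K^-1\<close> on a weight space, i.e. the difference
  between the rescaled Casimir operator and \<open>{1}^2 F E\<close>.\<close>

definition aw :: "nat => int => complex" where
 "aw m j = q powi (int m - 2 * j + 1) + q powi (2 * j - int m - 1)"

text \<open>The adjoint action of \<open>E\<close> turns the projection at \<open>j\<close> into a
  combination of neighbouring ones, that of \<open>F\<close> does so once more, and
  \<open>F E\<close> and \<open>E F\<close> are then scalars up to \<open>z'\<close> by the Casimir
  relation. The right-hand side is a difference of two consecutive values of one expression, so it
  can be summed.\<close>

lemma bend_recursion:
 assumes z: "good m z" and z': "good m z'" and B: "Bo m * z = \<beta> *. z + \<nu> *. z'"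
 shows "(br 1)^2 *. (Fo 0 (2 * m) * (Eo 0 (2 * m) * (Pm m j * (z * CU m)))) =
   (\<beta> - aw m j) *. (bv m j z - bv m (j - 1) z) - (\<beta> - aw m (j + 1)) *. (bv m (j + 1) z - bv m j z)
   + \<nu> *. ((bv m j z' - bv m (j - 1) z') - (bv m (j + 1) z' - bv m j z'))"
proof -
 define E where "E = Eo 0 m"
 define F' where "F' = Fo 0 m"
 define K where "K = Ko 0 m"
 define L where "L = Lo 0 m"
 define P where "P = Pm m"
 define Q where "Q a = q powi a" for a
 define c1 where "c1 = Q (2 * j - int m)"
 define c2 where "c2 = Q (2 * (j + 1) - int m)"
 have cz: "E * z = z * E" "F' * z = z * F'" "K * z = z * K" "L * z = z * L" "Bo m * z = z * Bo m" "P i * z = z * P i" for i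
  using z good_Pm[OF z] capfam_X capfam_Bo unfolding good_def cmt_def E_def F'_def K_def L_def P_def by blast+
 have rel: "P i * E = E * P (i + 1)" "F' * P i = P (i + 1) * F'" "K * P i = Q (int m - 2 * i) *. P i"
  "P i * K = Q (int m - 2 * i) *. P i" "L * P i = Q (2 * i - int m) *. P i" "P i * L = Q (2 * i - int m) *. P i"
  "E * L = q\<^sup>2 *. (L * E)" for i
  by (simp_all add: P_def E_def F'_def K_def L_def Q_def Pm_E Pm_F Pm_K Pm_L LE)
 have QQ: "Q a * Q b = Q (a + b)" for a b by (simp add: Q_def power_int_add)
 have LE': "L * E = Q (-2) *. (E * L)"
  using rel(7) by (simp add: Q_def power_int_minus field_simps)
 have PF: "P i * F' = F' * P (i - 1)" for i using rel(2)[of "i - 1"] by simp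
 have s1: "Eo 0 (2 * m) * (P j * (z * CU m)) = (E * (c1 *. P j - c2 *. P (j + 1)) * z) * CU m"
 proof -
  have "loc m (P j * z)" using z by (auto simp: good_def P_def intro!: loc_mult loc_Pm)
  from E_bend[OF this] have "Eo 0 (2 * m) * (P j * (z * CU m)) = (E * (P j * z) - P j * z * E) * (L * CU m)"
   by (simp add: massoc E_def L_def)
  also have "... = E * ((P j - P (j + 1)) * L) * z * CU m"
   by (simp add: left_diff_distrib right_diff_distrib massoc cz[symmetric] cz(4)[symmetric, THEN mult3] mult3[OF rel(1)]
     cz(1)[symmetric, THEN mult3])
  also have "(P j - P (j + 1)) * L = c1 *. P j - c2 *. P (j + 1)"
   by (simp add: left_diff_distrib rel c1_def c2_def)
  finally show ?thesis .
 qed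
 define y where "y = E * (c1 *. P j - c2 *. P (j + 1)) * z"
 have ly: "loc m y"
 proof -
  have "loc m E" "loc m (P i)" "loc m z" for i
   using z by (auto simp: E_def P_def good_def intro!: loc_Pm loc_X)
  thus ?thesis unfolding y_def by (intro loc_mult loc_diff loc_scale)
 qed
 have s2: "Fo 0 (2 * m) * (y * CU m) = (F' * y - L * y * K * F') * CU m"
  using F_bend[OF ly] by (simp add: F'_def L_def K_def)
 have s3: "L * y * K * F' = (Q (-2) * c1) *. (E * (F' * (P (j - 1) * z))) - (Q (-2) * c2) *. (E * (F' * (P j * z)))"
 proof -
  have LPK: "L * (P i * (z * (K * F'))) = P i * (z * F')" for i
  proof -
   have "L * (P i * (z * (K * F'))) = (L * (P i * K)) * (z * F')"
    by (simp add: massoc cz(3)[symmetric, THEN mult3])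
   also have "L * (P i * K) = P i" by (simp add: rel QQ) (simp add: Q_def)
   finally show ?thesis .
  qed
  have PzF: "P i * (z * F') = F' * (P (i - 1) * z)" for i
   using cz(2) PF by (metis massoc)
  show ?thesis
   by (simp add: y_def left_diff_distrib right_diff_distrib massoc mult3[OF LE'] LPK PzF mult_ac)
 qed
 have FE: "(br 1)^2 *. (F' * (E * (P i * z))) = (\<beta> - aw m i) *. (P i * z) + \<nu> *. (P i * z')" for i
 proof -
  have "(br 1)^2 *. (F' * (E * (P i * z))) = Bo m * (P i * z) - q *. (K * (P i * z)) - iq *. (L * (P i * z))"
   by (simp add: Bo_def E_def F'_def K_def L_def distrib_right massoc)
  also have "K * (P i * z) = Q (int m - 2 * i) *. (P i * z)"
   by (simp add: rel massoc[symmetric])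
  also have "L * (P i * z) = Q (2 * i - int m) *. (P i * z)"
   by (simp add: rel massoc[symmetric])
  also have "Bo m * (P i * z) = P i * (Bo m * z)"
  proof -
   have "Bo m * P i = P i * Bo m"
   proof -
    have "F' * (E * P i) = P i * (F' * E)"
     using rel(1)[of "i - 1"] PF[of i] by (metis diff_add_cancel massoc)
    thus ?thesis unfolding Bo_def E_def[symmetric] F'_def[symmetric] K_def[symmetric] L_def[symmetric]
     by (simp add: distrib_left distrib_right massoc rel)
   qed
   thus ?thesis by (metis massoc)
  qed
  also have "... = \<beta> *. (P i * z) + \<nu> *. (P i * z')" by (simp add: B distrib_left)
  also have "... - q *. (Q (int m - 2 * i) *. (P i * z)) - iq *. (Q (2 * i - int m) *. (P i * z)) =
   (\<beta> - (q * Q (int m - 2 * i) + iq * Q (2 * i - int m))) *. (P i * z) + \<nu> *. (P i * z')"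
   by (rule lop_eqI) (simp add: algebra_simps)
  also have "q * Q (int m - 2 * i) + iq * Q (2 * i - int m) = aw m i"
   unfolding aw_def Q_def by (simp add: power_int_add power_int_diff field_simps)
  finally show ?thesis .
 qed
 have EFc: "(br 1)^2 *. (E * (F' * (P i * z))) = (\<beta> - aw m (i + 1)) *. (P i * z) + \<nu> *. (P i * z')" for i
 proof -
  have "E * F' = F' * E + (1 / br (Suc 0)) *. (K - L)"
   using EF[of 0 m] by (simp add: E_def F'_def K_def L_def algebra_simps)
  hence "E * (F' * (P i * z)) = F' * (E * (P i * z)) + (1 / br (Suc 0)) *. ((K * P i - L * P i) * z)"
   by (simp add: massoc[symmetric]) (simp add: algebra_simps)
  hence "(br 1)^2 *. (E * (F' * (P i * z))) = (br 1)^2 *. (F' * (E * (P i * z)))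
   + (br 1 * (Q (int m - 2 * i) - Q (2 * i - int m))) *. (P i * z)"
   using br1_nz by (simp add: rel smult_add_right power2_eq_square left_diff_distrib smult_diff_right right_diff_distrib smult_diff_left)
  also have "... = (\<beta> - aw m i + br 1 * (Q (int m - 2 * i) - Q (2 * i - int m))) *. (P i * z) + \<nu> *. (P i * z')"
   unfolding FE by (rule lop_eqI) (simp add: algebra_simps)
  also have "\<beta> - aw m i + br 1 * (Q (int m - 2 * i) - Q (2 * i - int m)) = \<beta> - aw m (i + 1)"
   unfolding aw_def Q_def qbrace_def by (simp add: power_int_add power_int_diff field_simps power2_eq_square)
  finally show ?thesis .
 qed
 have "(br 1)^2 *. (Fo 0 (2 * m) * (Eo 0 (2 * m) * (P j * (z * CU m)))) = (br 1)^2 *. ((F' * y - L * y * K * F') * CU m)"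
  by (simp add: s1 s2 flip: y_def)
 also have "... = (c1 *. ((br 1)^2 *. (F' * (E * (P j * z)))) - c2 *. ((br 1)^2 *. (F' * (E * (P (j + 1) * z))))
   - (Q (-2) * c1) *. ((br 1)^2 *. (E * (F' * (P (j - 1) * z)))) + (Q (-2) * c2) *. ((br 1)^2 *. (E * (F' * (P j * z))))) * CU m"
  unfolding s3 by (simp add: y_def left_diff_distrib right_diff_distrib distrib_right massoc, rule lop_eqI, simp add: algebra_simps)
 also have "Q (-2) * c1 = Q (2 * (j - 1) - int m)" by (simp add: c1_def QQ algebra_simps)
 also have "Q (-2) * c2 = c1" by (simp add: c1_def c2_def QQ algebra_simps)
 finally show ?thesis
  unfolding FE EFc bv_def P_def[symmetric] Q_def[symmetric] c1_def c2_def
  by (simp add: left_diff_distrib right_diff_distrib distrib_right massoc, intro lop_eqI, simp add: algebra_simps)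
qed

end

section \<open>Weight sums\<close>

lemma smult_eq_0: "c *. x = 0 \<longleftrightarrow> c = 0 | x = 0"
 using smult_cancel[of c x 0] by auto

lemma periodic_sum:
 fixes f :: "nat => 'a::comm_monoid_add"
 assumes "!!i. f (i + r) = f i"
 shows "(\<Sum>i<r. f (i + l)) = (\<Sum>i<r. f i)"
proof (induction l)
 case (Suc l)
 have "(\<Sum>i<r. f (i + Suc l)) = (\<Sum>i<r. f (i + l))"
 proof (cases r)
  case (Suc p)
  have "(\<Sum>i<Suc p. f (i + Suc l)) = (\<Sum>i<p. f (Suc i + l)) + f (l + Suc p)"
   by (simp add: add_ac)
  also have "f (l + Suc p) = f (0 + l)" using assms[of l] Suc by simp
  also have "(\<Sum>i<p. f (Suc i + l)) + f (0 + l) = (\<Sum>i<Suc p. f (i + l))"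
   by (simp only: sum.lessThan_Suc_shift add.commute)
  finally show ?thesis using Suc by simp
 qed simp
 thus ?case using Suc by simp
qed simp

context odd_root
begin

definition y :: complex where "y = q\<^sup>2"

abbreviation iy :: complex where "iy \<equiv> inverse y"

lemma y_nz [simp]: "y ~= 0" by (simp add: y_def)

lemma y_pow: "y ^ i = q ^ (2 * i)" by (simp add: y_def power_mult)

lemma y_pow_eq_1: "y ^ i = 1 \<longleftrightarrow> r dvd i"
 by (simp add: y_pow q2_pow_eq_1)

lemma y_pow_r: "y ^ (i + r) = y ^ i"
 using y_pow_eq_1[of r] by (simp add: power_add)

text \<open>The eigenvalue of \<open>K\<close> on the words with \<open>i\<close> letters
  \<open>A1\<close> among \<open>N + k\<close>, written with \<open>q ^ N = q^-1\<close>; it has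
  period \<open>r\<close> in \<open>i\<close>.\<close>

definition wt :: "nat => nat => complex" where
 "wt k i = q ^ k * iq * iy ^ i"

lemma q_powi_N: "q powi (int N + x) = iq * q powi x"
proof -
 have "q powi (int r + x) = q powi x" by (simp add: power_int_add)
 moreover have "int r + x = 1 + (int N + x)" by (simp add: r_Suc)
 moreover have "q powi (1 + (int N + x)) = q * q powi (int N + x)"
  by (subst power_int_add) simp_all
 ultimately have "q * q powi (int N + x) = q powi x" by simp
 thus ?thesis by (simp add: field_simps)
qed

lemma wt_powi: "q powi (int (N + k) - 2 * int i) = wt k i" "q powi (2 * int i - int (N + k)) = inverse (wt k i)"
proof -
 have "q powi (int (N + k) - 2 * int i) = iq * q powi (int k - 2 * int i)"
  using q_powi_N[of "int k - 2 * int i"] by (simp add: algebra_simps)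
 also have "q powi (int k - 2 * int i) = q ^ k * iy ^ i"
 proof -
  have "q powi (int k - int (2 * i)) = q ^ k / q ^ (2 * i)"
   by (subst power_int_diff) (simp_all only: power_int_of_nat, simp)
  thus ?thesis by (simp add: y_pow power_inverse divide_inverse)
 qed
 finally show 1: "q powi (int (N + k) - 2 * int i) = wt k i" by (simp add: wt_def)
 have "2 * int i - int (N + k) = - (int (N + k) - 2 * int i)" by simp
 thus "q powi (2 * int i - int (N + k)) = inverse (wt k i)"
  by (simp only: power_int_minus 1)
qed

lemma wt_nz [simp]: "wt k i ~= 0" by (simp add: wt_def)

lemma wt_period: "wt k (i + r) = wt k i"
 by (simp add: wt_def power_inverse y_pow_r)

lemma wt_pow_sum: "(\<Sum>i<r. (wt k i) ^ e) = (if r dvd e then of_nat r else 0)"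
proof (cases "r dvd e")
 case True
 hence 1: "q ^ e = 1" "iq ^ e = 1" by (simp_all add: q_pow_eq_1 power_inverse)
 have "(wt k i) ^ e = 1" for i
 proof -
  have "(wt k i) ^ e = (q ^ e) ^ k * iq ^ e * (inverse (q ^ e) ^ 2) ^ i"
   by (simp add: wt_def y_def power_mult_distrib power_inverse flip: power_mult) (simp add: mult_ac)
  thus ?thesis using 1 by simp
 qed
 with True show ?thesis by simp
next
 case False
 define x where "x = iy ^ e"
 have "x ~= 1" using False y_pow_eq_1[of e] by (simp add: x_def power_inverse)
 moreover have "x ^ r = 1" using y_pow_eq_1[of "e * r"] by (simp add: x_def power_inverse flip: power_mult)
 ultimately have "(\<Sum>i<r. x ^ i) = 0" by (simp add: sum_gp_strict)
 moreover have "(\<Sum>i<r. (wt k i) ^ e) = (q ^ k * iq) ^ e * (\<Sum>i<r. x ^ i)"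
  unfolding sum_distrib_left
  by (rule sum.cong) (simp_all add: wt_def x_def power_mult_distrib mult.commute flip: power_mult)
 ultimately show ?thesis using False by simp
qed

lemma wt_br: "wt k l * br 1 = q ^ k * iy ^ l - q ^ k * iy ^ Suc l"
 by (simp add: wt_def qbrace_def y_def field_simps power2_eq_square)

lemma wt_sum_gen: "(\<Sum>i<l. wt k i) * br 1 = q ^ k - q ^ k * iy ^ l"
 by (induction l) (simp_all only: sum.lessThan_Suc distrib_right wt_br, simp_all)

lemma wt_sum_low: "(\<Sum>i<k. wt k i) = qi k"
proof -
 from wt_sum_gen[of k k] have "(\<Sum>i<k. wt k i) * br 1 = br k"
  by (simp add: qbrace_def y_def power_inverse power_mult_distrib power2_eq_square field_simps)
 thus ?thesis using br1_nz by (simp add: qint_def field_simps)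
qed

lemma wt_sum_high: "(\<Sum>i=r..N + k. wt k i) = qi k"
proof -
 have "(\<Sum>i=r..N + k. wt k i) = (\<Sum>i<k. wt k (i + r))"
 proof (rule sum.reindex_bij_witness[of _ "%i. i + r" "%i. i - r"])
 qed (auto simp: r_Suc)
 thus ?thesis by (simp add: wt_period wt_sum_low)
qed

lemma wt_sum_mid: "k <= N ==> (\<Sum>i=k..N. wt k i) = - qi k"
proof -
 assume "k <= N"
 have "(\<Sum>i<r. (wt k i) ^ 1) = 0" using wt_pow_sum[of k 1] r_ge by simp
 moreover have "{..<r} = {..<k} Un {k..N}" "{..<k} Int {k..N} = {}" using \<open>k <= N\<close> by (auto simp: r_Suc)
 ultimately have "(\<Sum>i<k. wt k i) + (\<Sum>i=k..N. wt k i) = 0"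
  by (simp add: sum.union_disjoint)
 thus ?thesis by (simp add: wt_sum_low add_eq_0_iff)
qed

text \<open>The first factor vanishes at \<open>i = 0\<close> and \<open>i = r\<close>, the second
  at \<open>i = k\<close>. A solution of the homogeneous first-order recursion is therefore constant
  except for possible jumps at \<open>k\<close> and at \<open>r\<close>.\<close>

lemma aw_factor:
 "br' k - aw (N + k) (int i) = (1 - iy ^ i) * (q ^ k - iq ^ k * y ^ i)"
proof -
 have "aw (N + k) (int i) = q * wt k i + iq * inverse (wt k i)"
  unfolding aw_def using wt_powi[of k i] by (simp add: power_int_add power_int_diff add_diff_eq[symmetric] diff_add_eq)
   (simp add: power_int_diff field_simps)
 also have "... = q ^ k * iy ^ i + iq ^ k * y ^ i"
  by (simp add: wt_def field_simps)
 finally show ?thesis by (simp add: qbrace'_def algebra_simps power_inverse)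
qed

lemma aw_factor_nz:
 assumes "i <= N + k" "k <= N" "0 < i" "i ~= k" "i ~= r"
 shows "br' k - aw (N + k) (int i) ~= 0"
proof -
 have 1: "~ r dvd i"
 proof
  assume "r dvd i"
  then obtain l where l: "i = r * l" ..
  have "i < 2 * r" using assms(1,2) by (simp add: r_Suc)
  hence "l < 2" using l by (metis mult.commute mult_less_cancel2)
  thus False using l assms by (auto simp: less_2_cases_iff)
 qed
 have 2: "y ^ i ~= y ^ k"
 proof
  assume e: "y ^ i = y ^ k"
  show False
  proof (cases "k <= i")
   case True
   hence "y ^ (i - k) = 1" using e by (simp add: power_diff)
   hence "r dvd i - k" by (simp add: y_pow_eq_1)
   moreover have "0 < i - k" "i - k < r" using True assms by (auto simp: r_Suc)
   ultimately show False by (auto dest: dvd_imp_le)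
  next
   case False
   hence "y ^ (k - i) = 1" using e by (simp add: power_diff)
   hence "r dvd k - i" by (simp add: y_pow_eq_1)
   moreover have "0 < k - i" "k - i < r" using False assms by (auto simp: r_Suc)
   ultimately show False by (auto dest: dvd_imp_le)
  qed
 qed
 have "q ^ k - iq ^ k * y ^ i ~= 0"
 proof
  assume "q ^ k - iq ^ k * y ^ i = 0"
  hence "y ^ i = q ^ k * q ^ k" by (simp add: power_inverse field_simps)
  also have "... = y ^ k" by (simp add: y_pow mult_2 power_add)
  finally show False using 2 by simp
 qed
 moreover have "1 - iy ^ i ~= 0" using 1 y_pow_eq_1[of i] by (simp add: power_inverse)
 ultimately show ?thesis by (simp add: aw_factor)
qed

subsection \<open>Sequences that are constant between the exceptional weights\<close>

lemma region_const:
 assumes "k <= N" "!!i. Suc i <= N + k ==> Suc i ~= k ==> Suc i ~= r ==> X (Suc i) = X i"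
 shows "i < k ==> X i = X 0" "k <= i ==> i <= N ==> X i = X k" "r <= i ==> i <= N + k ==> X i = X (N + k)"
proof -
 show "i < k ==> X i = X 0"
 proof (induction i)
  case (Suc i) thus ?case using assms(2)[of i] assms(1) by (simp add: r_Suc)
 qed simp
 show "k <= i ==> i <= N ==> X i = X k"
 proof (induction i rule: dec_induct)
  case (step i) thus ?case using assms(2)[of i] assms(1) by (simp add: r_Suc)
 qed simp
 have H: "r <= i ==> i <= N + k ==> X i = X r" for i
 proof (induction i rule: dec_induct)
  case (step i) thus ?case using assms(2)[of i] assms(1) by (simp add: r_Suc)
 qed simp
 show "r <= i ==> i <= N + k ==> X i = X (N + k)"
  using H[of i] H[of "N + k"] by simp
qed

text \<open>On the three ranges cut out by \<open>k\<close> and \<open>r\<close> the weights sum to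
  \<open>[k]\<close>, \<open>-[k]\<close> and \<open>[k]\<close>. So the weighted total of such a
  sequence determines its middle value from the two end values.\<close>

lemma region_sum:
 assumes "0 < k" "k <= N" "!!i. Suc i <= N + k ==> Suc i ~= k ==> Suc i ~= r ==> X (Suc i) = X i"
 shows "(\<Sum>i=0..N + k. wt k i *. X i) = qi k *. (X 0 - X k + X (N + k))"
proof -
 have rc: "i < k ==> X i = X 0" "k <= i ==> i <= N ==> X i = X k" "r <= i ==> i <= N + k ==> X i = X (N + k)" for i
  using region_const[of k X i] assms(2,3) by blast+
 have "{0..N + k} = {..<k} Un ({k..N} Un {r..N + k})" "{..<k} Int ({k..N} Un {r..N + k}) = {}" "{k..N} Int {r..N + k} = {}"
  using assms by (auto simp: r_Suc)
 hence "(\<Sum>i=0..N + k. wt k i *. X i) = (\<Sum>i<k. wt k i *. X i) + ((\<Sum>i=k..N. wt k i *. X i) + (\<Sum>i=r..N + k. wt k i *. X i))"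
  by (simp add: sum.union_disjoint)
 also have "(\<Sum>i<k. wt k i *. X i) = (\<Sum>i<k. wt k i *. X 0)"
  by (rule sum.cong[OF refl]) (simp only: lessThan_iff, subst rc(1), simp_all)
 also have "(\<Sum>i=k..N. wt k i *. X i) = (\<Sum>i=k..N. wt k i *. X k)"
  by (rule sum.cong[OF refl]) (simp only: atLeastAtMost_iff, subst rc(2), simp_all)
 also have "(\<Sum>i=r..N + k. wt k i *. X i) = (\<Sum>i=r..N + k. wt k i *. X (N + k))"
  by (rule sum.cong[OF refl]) (simp only: atLeastAtMost_iff, subst rc(3), simp_all)
 finally show ?thesis
  by (simp add: sum_smult wt_sum_low wt_sum_mid[OF assms(2)] wt_sum_high smult_distrib algebra_simps)
qed

subsection \<open>The two contractions of a bent operator\<close>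

text \<open>\<open>theta\<close> closes all strands, as in \<open>t\<close>; \<open>rho\<close>
  closes only the middle ones under \<open>jg N\<close>, as in \<open>t'\<close>.\<close>

definition theta :: "nat => nat => lop => lop" where
 "theta k i z = CA (N + k) * bv (N + k) (int i) z"
definition rho :: "nat => nat => lop => lop" where
 "rho k i z = jg N * (Cm k * bv (N + k) (int i) z)"

section \<open>First-order recursions along the weights\<close>

lemma weight_sum:
 assumes "good (N + k) z"
 shows "\<Lambda> * (Ko 0 (N + k) ^ c * (z * CU (N + k))) = (\<Sum>i=0..N + k. (wt k i) ^ Suc c *. (\<Lambda> * bv (N + k) (int i) z))"
proof -
 have KP: "Pm (N + k) (int i) * Ko 0 (N + k) ^ c = (wt k i) ^ c *. Pm (N + k) (int i)" for i c
 proof (induction c)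
  case (Suc c)
  have "Pm (N + k) (int i) * Ko 0 (N + k) = wt k i *. Pm (N + k) (int i)"
   using Pm_K(2)[of "N + k" "int i"] wt_powi(1)[of k i] by simp
  from mult3[OF this] show ?case using Suc by (simp add: power_commutes)
 qed simp
 have "\<Lambda> * (Ko 0 (N + k) ^ c * (z * CU (N + k))) = \<Lambda> * ((\<Sum>i = 0..N + k. Pm (N + k) (int i)) * (Ko 0 (N + k) ^ c * (z * CU (N + k))))"
  by (simp add: Pm_sum)
 also have "... = (\<Sum>i = 0..N + k. \<Lambda> * ((Pm (N + k) (int i) * Ko 0 (N + k) ^ c) * (z * CU (N + k))))"
  by (simp only: sum_distrib_left sum_distrib_right massoc)
 also have "... = (\<Sum>i=0..N + k. (wt k i) ^ Suc c *. (\<Lambda> * bv (N + k) (int i) z))"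
  by (rule sum.cong) (simp_all add: KP bv_def wt_powi(2)[simplified], simp add: field_simps)
 finally show ?thesis .
qed

text \<open>\<open>bend_recursion\<close> telescopes from the lowest weight upwards. What remains is
  a first-order recursion whose inhomogeneity is \<open>F E\<close> acting on the contracted
  vectors.\<close>

lemma bend_sum:
 fixes \<Lambda> :: lop
 assumes z: "good (N + k) z" and z': "good (N + k) z'" and B: "Bo (N + k) * z = br' k *. z + \<nu> *. z'"
 defines "T \<equiv> %j. (br 1)^2 *. (\<Lambda> * (Fo 0 (2 * (N + k)) * (Eo 0 (2 * (N + k)) * (Pm (N + k) j * (z * CU (N + k))))))"
 shows "(br' k - aw (N + k) (int (Suc i))) *. (\<Lambda> * bv (N + k) (int (Suc i)) z - \<Lambda> * bv (N + k) (int i) z)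
   + \<nu> *. (\<Lambda> * bv (N + k) (int (Suc i)) z' - \<Lambda> * bv (N + k) (int i) z') = - (\<Sum>j\<le>i. T (int j))"
proof -
 define D where "D = (%j. (br' k - aw (N + k) j) *. (\<Lambda> * bv (N + k) j z - \<Lambda> * bv (N + k) (j - 1) z)
   + \<nu> *. (\<Lambda> * bv (N + k) j z' - \<Lambda> * bv (N + k) (j - 1) z'))"
 have T: "T j = D j - D (j + 1)" for j
 proof -
  have "T j = \<Lambda> * ((br 1)^2 *. (Fo 0 (2 * (N + k)) * (Eo 0 (2 * (N + k)) * (Pm (N + k) j * (z * CU (N + k))))))"
   by (simp add: T_def)
  also have "... = D j - D (j + 1)"
   unfolding bend_recursion[OF z z' B] D_def by (simp add: right_diff_distrib distrib_left smult_diff_right)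
  finally show ?thesis .
 qed
 have neg: "bv (N + k) j x = 0" if "j < 0" for j x using that by (simp add: bv_def Pm_out)
 \<comment> \<open>One step below the lowest weight all terms vanish, which forces the initial value
   \<open>D 0\<close> to be \<open>0\<close>.\<close>
 have "T (-1) = 0" by (simp add: T_def Pm_out)
 moreover have "D (-1) = 0" by (simp add: D_def neg)
 ultimately have D0: "D 0 = 0" using T[of "-1"] by simp
 have "D (int (Suc i)) = - (\<Sum>j\<le>i. T (int j))"
 proof (induction i)
  case 0 thus ?case using T[of 0] D0 by simp
 next
  case (Suc i)
  have "int (Suc (Suc i)) = int (Suc i) + 1" by simp
  hence "D (int (Suc (Suc i))) = D (int (Suc i)) - T (int (Suc i))"
   using T[of "int (Suc i)"] by (metis diff_diff_eq2 add_diff_cancel_left' diff_add_cancel)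
  thus ?case using Suc by simp
 qed
 thus ?thesis by (simp add: D_def)
qed

text \<open>\<open>ev\<close> is invariant and \<open>F\<close> acts by \<open>0\<close> on no
  letters; this makes the recursion for \<open>theta\<close> homogeneous.\<close>

lemma CA_kill: "CA m * (Fo 0 (2 * m) * x) = 0"
 using mult3[of "CA m" "Fo 0 (2 * m)" 0 x] capfam_CA[OF capfam_X(4), of m] by simp

lemma A_N: "Ak N = F * CU N" "Bk N = CA N * F"
 by (simp_all add: Ak_def Bk_def CA_N)

lemma F_loc_P: "N <= n ==> F * Pm n j = Pm n j * F"
proof -
 assume "N <= n"
 have "cmt (Pm n ((int n - (int n - 2 * j)) div 2)) F"
  by (rule capfam_TLa[OF capfam_Pm jf_TLa \<open>N <= n\<close>])
 thus ?thesis by (simp add: cmt_def)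
qed

lemma F_Cm: "F * Cm k = Cm k * F"
proof (induction k)
 case (Suc k)
 have "cp (N + k) * F = F * cp (N + k)" using F_loc(1)[of "N + k"] by simp
 thus ?case using Suc by (simp add: massoc mult3[of F "Cm k"])
qed simp

lemma r_minus: "r - Suc 0 = N" "Suc 0 <= r"
 using r_ge by (simp_all add: r_Suc)

lemma qi_N: "qi N = -1" and br'_N: "br' N = q + iq"
 using qi_diff_r[OF r_minus(2)] br'_diff_r[OF r_minus(2)]
 unfolding r_minus by simp_all (simp add: qbrace'_def)

lemma jhN: "jh N = Ak N * Bk N"
proof -
 show ?thesis using N_even qi_N by (simp add: jh_def)
qed

text \<open>On the bent vector \<open>K\<close> acts trivially, so \<open>{1}^2 F E\<close> is the
  Casimir operator minus \<open>q + q^-1\<close>. Under \<open>jg N\<close> this scalar cancels and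
  the nilpotent part \<open>h\<close> is left, which for \<open>k = N\<close> factors through
  \<open>ev\<close>. Hence \<open>theta\<close>, times \<open>Ak N\<close>, drives the recursion for
  \<open>rho\<close>.\<close>

lemma bend_inhom:
 assumes z: "good (N + k) z" and F: "F * z = z"
 shows "(br 1)^2 *. (jg N * Cm k * (Fo 0 (2 * (N + k)) * (Eo 0 (2 * (N + k)) * (Pm (N + k) j * (z * CU (N + k))))))
  = (br 1)^2 *. (Ak N * (CA (N + k) * (Pm (N + k) j * (z * CU (N + k)))))"
proof -
 define v where "v = Pm (N + k) j * (z * CU (N + k))"
 have N2: "2 * N = N + N" by simp
 have lw: "loc (N + k) (Pm (N + k) j * z)" using z by (auto simp: good_def intro!: loc_mult loc_Pm)
 have KL1: "Ko 0 (2 * (N + k)) * v = v" "Lo 0 (2 * (N + k)) * v = v"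
 proof -
  have cz: "cmt (Ko 0 (N + k)) z" "cmt (Lo 0 (N + k)) z"
   using z capfam_X(1,2) by (auto simp: good_def)
  have cc: "Ko 0 (N + k) * (Pm (N + k) j * z) = (Pm (N + k) j * z) * Ko 0 (N + k)"
   "Lo 0 (N + k) * (Pm (N + k) j * z) = (Pm (N + k) j * z) * Lo 0 (N + k)"
  proof -
   have c: "z * Ko 0 (N + k) = Ko 0 (N + k) * z" "z * Lo 0 (N + k) = Lo 0 (N + k) * z"
    using cz by (simp_all add: cmt_def)
   note P3 = Pm_K(1,2)[THEN mult3] Pm_L(1,2)[THEN mult3]
   show "Ko 0 (N + k) * (Pm (N + k) j * z) = (Pm (N + k) j * z) * Ko 0 (N + k)"
    "Lo 0 (N + k) * (Pm (N + k) j * z) = (Pm (N + k) j * z) * Lo 0 (N + k)"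
    by (simp_all add: massoc c P3)
  qed
  have "Ko 0 (2 * (N + k)) * v = Ko 0 (N + k) * ((Pm (N + k) j * z) * (Lo 0 (N + k) * CU (N + k)))"
   using K_bend(1)[OF lw] by (simp add: v_def massoc)
  also have "... = (Pm (N + k) j * z) * (Ko 0 (N + k) * Lo 0 (N + k)) * CU (N + k)"
   using cc(1) by (metis massoc)
  finally show "Ko 0 (2 * (N + k)) * v = v" by (simp add: KL v_def massoc)
  have "Lo 0 (2 * (N + k)) * v = Lo 0 (N + k) * ((Pm (N + k) j * z) * (Ko 0 (N + k) * CU (N + k)))"
   using K_bend(2)[OF lw] by (simp add: v_def massoc)
  also have "... = (Pm (N + k) j * z) * (Lo 0 (N + k) * Ko 0 (N + k)) * CU (N + k)"
   using cc(2) by (metis massoc)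
  finally show "Lo 0 (2 * (N + k)) * v = v" by (simp add: KL v_def massoc)
 qed
 have Fv: "F * v = v"
  using F F_loc_P[of "N + k" j] by (simp add: v_def massoc[symmetric]) (simp add: massoc)
 have cN: "cmt (X (2 * N)) (jg N)" if "capfam X" for X
  using capfam_jg[OF that, of N "2 * N"] by simp
 have mv: "jg N * (Cm k * (X (2 * (N + k)) * w)) = X (2 * N) * (jg N * (Cm k * w))" if "capfam X" for X w
  using capfam_Cm[OF that, of k] cN[OF that] unfolding cmt_def by (metis massoc)
 have "(br 1)^2 *. (jg N * (Cm k * (Fo 0 (2 * (N + k)) * (Eo 0 (2 * (N + k)) * v))))
   = jg N * (Cm k * (Bo (2 * (N + k)) * v)) - (q + iq) *. (jg N * (Cm k * v))"
  by (simp add: Bo_def distrib_left distrib_right massoc KL1 KL1[simplified] smult_add_left)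
 also have "jg N * (Cm k * (Bo (2 * (N + k)) * v)) = Bo (N + N) * jg N * (Cm k * v)"
  by (simp only: mv[OF capfam_Bo] massoc N2)
 also have "Bo (N + N) * jg N = (q + iq) *. jg N + (br 1)^2 *. jh N"
  using Bo_jg[of N] qi_N br'_N by simp
 finally have "(br 1)^2 *. (jg N * (Cm k * (Fo 0 (2 * (N + k)) * (Eo 0 (2 * (N + k)) * v)))) = (br 1)^2 *. (jh N * (Cm k * v))"
  by (simp add: distrib_right massoc)
 also have "jh N * (Cm k * v) = Ak N * (CA N * (Cm k * (F * v)))"
  using mult3[OF F_Cm[of k], of v] by (simp add: jhN A_N massoc)
 finally show ?thesis unfolding Fv by (simp only: CA_add(1) massoc v_def)
qed

lemma theta_step:
 assumes "good (N + k) z" "good (N + k) z'" "Bo (N + k) * z = br' k *. z + \<nu> *. z'"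
 shows "(br' k - aw (N + k) (int (Suc i))) *. (theta k (Suc i) z - theta k i z)
   + \<nu> *. (theta k (Suc i) z' - theta k i z') = 0"
 using bend_sum[OF assms, where \<Lambda> = "CA (N + k)" and i = i] unfolding theta_def[symmetric] CA_kill by simp

lemma rho_step:
 assumes "good (N + k) z" "good (N + k) z'" "Bo (N + k) * z = br' k *. z + \<nu> *. z'" "F * z = z"
 shows "(br' k - aw (N + k) (int (Suc i))) *. (rho k (Suc i) z - rho k i z)
   + \<nu> *. (rho k (Suc i) z' - rho k i z') = - ((br 1)^2 *. (\<Sum>j\<le>i. wt k j *. (Ak N * theta k j z)))"
proof -
 have "CA (N + k) * (Pm (N + k) (int j) * (z * CU (N + k))) = wt k j *. theta k j z" for j
  by (simp add: theta_def bv_def wt_powi(2)[simplified])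
 thus ?thesis
  using bend_sum[OF assms(1-3), where \<Lambda> = "jg N * Cm k" and i = i]
  unfolding bend_inhom[OF assms(1,4)] by (simp add: rho_def massoc smult_sum)
qed

text \<open>\<open>h\<close> factors through \<open>N - k\<close> strands, and the cups preserve the
  weight; the weights excluded here do not occur on \<open>N - k\<close> strands.\<close>

lemma jh_out:
 assumes "k <= N" "i < k | N < i"
 shows "Pm (N + k) (int i) * jh k = 0"
proof -
 define w where "w = int (N + k) - 2 * int i"
 have "Pm (N + k) ((int (N + k) - w) div 2) * Cu k = Cu k * Pm (N + k - 2 * k) ((int (N + k - 2 * k) - w) div 2)"
  using capfam_CuCa[OF capfam_Pm[of w] assms(1), of "N + k"] by simp
 moreover have "(int (N + k) - w) div 2 = int i" by (simp add: w_def)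
 moreover have "N + k - 2 * k = N - k" by simp
 moreover have "(int (N - k) - w) div 2 = int i - int k" using assms(1) by (simp add: w_def of_nat_diff)
 moreover have "Pm (N - k) (int i - int k) = 0" using assms by (auto intro!: Pm_out)
 ultimately have "Pm (N + k) (int i) * Cu k = 0" by simp
 hence "Pm (N + k) (int i) * (F * (Cu k * Bk k)) = 0"
  using F_loc_P[of "N + k" "int i"] by (metis le_add1 massoc mult_zero_left mult_zero_right)
 thus ?thesis by (simp add: jh_def Ak_def massoc)
qed

text \<open>Constant words contain no pair of different letters, so no cup reaches them. On extremal
  weights \<open>f\<close> and \<open>g\<close> therefore act as the identity and \<open>h\<close>
  as \<open>0\<close>, which supplies the boundary values of the recursions.\<close>

lemma P_ext_cup:
 assumes "i + 2 <= m" "j = 0 | j = int m" shows "Pm m j * cu i = 0"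
proof -
 obtain n where n: "m = Suc (Suc n)" "i <= n" using assms(1) that[of "m - 2"] by auto
 thus ?thesis using cap_Pm[OF n(2), of j] assms(2) by (auto simp: Pm_out simp del: Pm.simps)
qed

lemma P_ext_jf: "l <= m ==> j = 0 | j = int m ==> Pm m j * jf l = Pm m j"
proof (induction l rule: jf.induct)
 case (3 l)
 hence 1: "Pm m j * jf (Suc l) = Pm m j" "Pm m j * cu l = 0" using P_ext_cup[of l m j] by auto
 show ?case
  by (simp add: jf.simps tU_def distrib_left massoc 1 1[THEN mult3])
qed simp_all

lemma P_ext_jh: "0 < k ==> k <= N ==> N + k <= m ==> j = 0 | j = int m ==> Pm m j * jh k = 0"
proof -
 assume a: "0 < k" "k <= N" "N + k <= m" "j = 0 | j = int m"
 have "Pm m j * Cu (Suc i) = 0" if "Suc i <= N" for i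
  using that
 proof (induction i)
  case 0
  thus ?case using P_ext_cup[of "N - 1" m j] a by simp
 next
  case (Suc i)
  hence "Pm m j * Cu (Suc i) * cu (N - Suc (Suc i)) = 0" by simp
  thus ?case by (simp only: Cu.simps(2)[of "Suc i"] massoc)
 qed
 hence "Pm m j * Cu k = 0" using a by (cases k) auto
 moreover have "Pm m j * F = Pm m j" using P_ext_jf[of N m j] a by simp
 ultimately show ?thesis
  by (simp add: jh_def Ak_def massoc mult3[of "Pm m j" F] mult3[of "Pm m j" "Cu k"])
qed

lemma P_ext_jg: "k <= N ==> N + k <= m ==> j = 0 | j = int m ==> Pm m j * jg k = Pm m j"
proof (induction k rule: jg.induct)
 case 3
 have 1: "Pm m j * F = Pm m j" "Pm m j * jh 1 = 0" "Pm m j * cu N = 0"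
  using 3 P_ext_jf[of N m j] P_ext_jh[of 1 m j] P_ext_cup[of N m j] by auto
 show ?case by (simp add: jg.simps(3) tU_def right_diff_distrib massoc 1[simplified] 1[simplified, THEN mult3])
next
 case (4 i)
 have 1: "Pm m j * jg (Suc (Suc i)) = Pm m j" "Pm m j * cu (N + Suc i) = 0"
  using 4 P_ext_cup[of "N + Suc i" m j] by auto
 show ?case by (simp add: jg.simps(4) tU_def right_diff_distrib distrib_left massoc 1[simplified] 1[simplified, THEN mult3])
qed (use P_ext_jf in auto)

lemma cp_n_cu: "cp m * (munit A0 A0 m * cu m) = - (q *. 1)" "cp m * (munit A1 A1 m * cu m) = - (iq *. 1)"
 by (rule lop_eqI; simp add: ap_cap ap_cup ap_munit upd_ins_at fun_upd_idem)+

lemma Pm_bend_step: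
 "cp m * (Pm (Suc m) 0 * cu m) = - q *. Pm m 0" "cp m * (Pm (Suc m) (int (Suc m)) * cu m) = - iq *. Pm m (int m)"
proof -
 have l: "cp m * (Pm m i * x) = Pm m i * (cp m * x)" for i x
  using loc_Pm[of m m i] mult3[OF loc_cap[OF loc_Pm[of m m i] order_refl]] by (simp add: massoc)
 show "cp m * (Pm (Suc m) 0 * cu m) = - q *. Pm m 0" "cp m * (Pm (Suc m) (int (Suc m)) * cu m) = - iq *. Pm m (int m)"
  by (simp_all add: Pm_out massoc l cp_n_cu)
qed

lemma Pm_bend:
 "CA m * (Pm m 0 * CU m) = (- q) ^ m *. 1" "CA m * (Pm m (int m) * CU m) = (- iq) ^ m *. 1"
proof (induction m)
 case (Suc m)
 { case 1
  have "CA (Suc m) * (Pm (Suc m) 0 * CU (Suc m)) = CA m * ((cp m * (Pm (Suc m) 0 * cu m)) * CU m)"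
   by (simp only: CA.simps CU.simps massoc)
  also have "... = - q *. (CA m * (Pm m 0 * CU m))" unfolding Pm_bend_step by simp
  finally show ?case using Suc(1) by simp }
 { case 2
  have "CA (Suc m) * (Pm (Suc m) (int (Suc m)) * CU (Suc m)) = CA m * ((cp m * (Pm (Suc m) (int (Suc m)) * cu m)) * CU m)"
   by (simp only: CA.simps CU.simps massoc)
  also have "... = - iq *. (CA m * (Pm m (int m) * CU m))" unfolding Pm_bend_step by simp
  finally show ?case using Suc(2) by simp }
qed simp_all

lemma Pm_bend_k:
 "Cm k * (Pm (N + k) 0 * Dm k) = (- q) ^ k *. Pm N 0"
 "Cm k * (Pm (N + k) (int (N + k)) * Dm k) = (- iq) ^ k *. Pm N (int N)"
proof (induction k)
 case (Suc k)
 { case 1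
  have "Cm (Suc k) * (Pm (N + Suc k) 0 * Dm (Suc k)) = Cm k * ((cp (N + k) * (Pm (Suc (N + k)) 0 * cu (N + k))) * Dm k)"
   by (simp only: Cm.simps Dm.simps massoc add_Suc_right)
  also have "... = - q *. (Cm k * (Pm (N + k) 0 * Dm k))"
   unfolding Pm_bend_step by simp
  finally show ?case using Suc(1) by simp }
 { case 2
  have "Cm (Suc k) * (Pm (N + Suc k) (int (N + Suc k)) * Dm (Suc k)) =
   Cm k * ((cp (N + k) * (Pm (Suc (N + k)) (int (Suc (N + k))) * cu (N + k))) * Dm k)"
   by (simp only: Cm.simps Dm.simps massoc add_Suc_right)
  also have "... = - iq *. (Cm k * (Pm (N + k) (int (N + k)) * Dm k))"
   unfolding Pm_bend_step by simp
  finally show ?case using Suc(2) by simp }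
qed simp_all

lemma q_N: "q ^ N = iq"
proof -
 have "q * q ^ N = 1" using q_pow_r unfolding r_Suc by simp
 thus ?thesis by (simp add: field_simps)
qed

lemma wt_ends: "wt k 0 = q ^ (N + k)" "wt k (N + k) = iq ^ (N + k)"
proof -
 show "wt k 0 = q ^ (N + k)" by (simp add: wt_def power_add q_N)
 have "iy ^ (N + k) = iq ^ (N + k) * iq ^ (N + k)"
  by (simp add: y_def power_inverse power_mult_distrib power2_eq_square)
 also have "q ^ k * iq * \<dots> = q ^ k * iq ^ k * (iq * iq ^ N) * iq ^ (N + k)"
  by (simp add: power_add mult_ac)
 also have "iq * iq ^ N = 1" by (simp add: power_inverse q_N)
 finally show "wt k (N + k) = iq ^ (N + k)"
  by (simp add: wt_def power_inverse)
qed

lemma sgn_N: "(- 1 :: complex) ^ (N + k) = (- 1) ^ k"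
 using N_even by (simp add: power_add)

lemma theta_ends:
 assumes "Pm (N + k) 0 * z = Pm (N + k) 0" "Pm (N + k) (int (N + k)) * z = Pm (N + k) (int (N + k))"
 shows "theta k 0 z = (- 1) ^ k *. 1" "theta k (N + k) z = (- 1) ^ k *. 1"
proof -
 have e: "inverse (q ^ (N + k)) * (- q) ^ (N + k) = (- 1) ^ k" "inverse (iq ^ (N + k)) * (- iq) ^ (N + k) = (- 1) ^ k"
  by (simp_all only: power_minus[of q] power_minus[of "iq"] sgn_N) (simp_all add: power_inverse)
 show "theta k 0 z = (- 1) ^ k *. 1"
  using assms(1)[THEN mult3] Pm_bend(1)[of "N + k"] wt_powi(2)[of 0 k] e(1)
  by (simp add: theta_def bv_def wt_ends(1) massoc wt_powi(2)[simplified, of 0 k])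
 show "theta k (N + k) z = (- 1) ^ k *. 1"
  using assms(2)[THEN mult3] Pm_bend(2)[of "N + k"] e(2) wt_powi(2)[of "N + k" k]
  by (simp only: theta_def bv_def wt_ends(2) massoc) simp
qed

lemma theta_sum: "good (N + k) z ==> (\<Sum>i=0..N + k. wt k i *. theta k i z) = CA (N + k) * (z * CU (N + k))"
 using weight_sum[of k z "CA (N + k)" 0] by (simp add: theta_def)

lemma rho_sum: "good (N + k) z ==> (\<Sum>i=0..N + k. wt k i *. rho k i z) = jg N * (Cm k * (z * CU (N + k)))"
 using weight_sum[of k z "jg N * Cm k" 0] by (simp add: rho_def massoc)

lemma Bo_jh: "0 < k ==> k <= N ==> Bo (N + k) * jh k = br' k *. jh k"
proof -
 assume k: "0 < k" "k <= N"
 have "Bo (N + k) * (jg k * jh k) = br' k *. jh k"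
  using mult3[OF Bo_jg[OF k(2)], of "jh k"] k by (simp add: left_diff_distrib jg_jh jh_sq)
 thus ?thesis using k by (simp add: jg_jh)
qed

lemma Bo_jg': "k <= N ==> Bo (N + k) * jg k = br' k *. jg k + (- ((br 1)^2 * qi k)) *. jh k"
 using Bo_jg by simp

lemma bend_jh: "0 < k ==> k <= N ==> Cm k * (jh k * CU (N + k)) = ((- 1) ^ Suc k * qi k) *. Ak N"
 using mult3[OF jh_full_ptr[of k], of "CU N"]
 by (simp add: CA_add A_N massoc)

lemma bend_jg: "0 < k ==> k <= N ==> Cm k * (jg k * CU (N + k)) = ((- 1) ^ k * br' k) *. Ak N"
 using mult3[OF jg_full_ptr[of k], of "CU N"]
 by (simp add: CA_add A_N massoc)

text \<open>Closing the remaining \<open>N\<close> strands composes \<open>Bk N\<close> with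
  \<open>Ak N\<close>, which is \<open>0\<close>.\<close>

lemma CA_bend: assumes "Cm k * (z * CU (N + k)) = c *. Ak N" shows "CA (N + k) * (z * CU (N + k)) = 0"
proof -
 have "CA (N + k) * (z * CU (N + k)) = c *. (CA N * Ak N)"
  using assms by (simp add: CA_add(1) massoc)
 also have "CA N * Ak N = Bk N * Ak N" by (simp add: A_N massoc)
 also have "... = 0" using Bk_Ak[of N N] N_ge by simp
 finally show ?thesis by simp
qed

section \<open>Both contractions evaluated on \<open>h\<close> and on \<open>g\<close>\<close>

context
 fixes k assumes k: "0 < k" "k <= N"
begin

lemma qik_nz: "qi k ~= 0"
 using k N_lt by (intro qi_nz) linarith+

lemma goods: "good (N + k) (jh k)" "good (N + k) (jg k)"
 using k good_jh good_jg by auto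

text \<open>Constant on the three ranges, \<open>0\<close> on the outer two by
  \<open>jh_out\<close>; the weighted total is a closed trace and vanishes, so the middle value does
  too.\<close>

lemma theta_jh: "i <= N + k ==> theta k i (jh k) = 0"
proof -
 assume i: "i <= N + k"
 have st: "theta k (Suc i) (jh k) = theta k i (jh k)" if "Suc i <= N + k" "Suc i ~= k" "Suc i ~= r" for i
  using theta_step[of k "jh k" "jh k" 0 i] goods Bo_jh[OF k] aw_factor_nz[OF that(1) k(2) _ that(2,3)]
  by (simp add: smult_eq_0)
 have out: "theta k j (jh k) = 0" if "j < k | N < j" for j
  using mult3[OF jh_out[OF k(2) that], of "CU (N + k)"] by (simp add: theta_def bv_def)
 have "CA (N + k) * (jh k * CU (N + k)) = 0" by (rule CA_bend[OF bend_jh[OF k]])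
 hence "qi k *. (theta k 0 (jh k) - theta k k (jh k) + theta k (N + k) (jh k)) = 0"
  using region_sum[of k "%i. theta k i (jh k)", OF k st] theta_sum[OF goods(1)] by simp
 hence "theta k k (jh k) = 0"
  using smult_cancel[of "qi k" "theta k k (jh k)" 0] qik_nz out[of 0] out[of "N + k"] k by simp
 thus ?thesis
  using region_const(2)[of k "%i. theta k i (jh k)" i, OF k(2) st] out[of i] by (cases "i < k | N < i") auto
qed

text \<open>Since \<open>theta\<close> vanishes on \<open>h\<close>, this recursion is homogeneous
  as well. The weighted total is now the partial trace of \<open>h\<close>, which fixes the middle
  value.\<close>

lemma rho_jh: "i <= N + k ==> rho k i (jh k) = (if k <= i & i <= N then (- 1) ^ k *. Ak N else 0)"
proof -
 assume i: "i <= N + k"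
 have st: "rho k (Suc i) (jh k) = rho k i (jh k)" if "Suc i <= N + k" "Suc i ~= k" "Suc i ~= r" for i
 proof -
  have "(\<Sum>j\<le>i. wt k j *. (Ak N * theta k j (jh k))) = 0"
   using that by (intro sum.neutral) (auto simp: theta_jh)
  thus ?thesis
   using rho_step[of k "jh k" "jh k" 0 i] goods Bo_jh[OF k] aw_factor_nz[OF that(1) k(2) _ that(2,3)] jh_F
   by (simp add: smult_eq_0)
 qed
 have out: "rho k j (jh k) = 0" if "j < k | N < j" for j
  using mult3[OF jh_out[OF k(2) that], of "CU (N + k)"] by (simp add: rho_def bv_def)
 have "jg N * Ak N = Ak N" using Ak_jg[of N] N_ge by simp
 hence "qi k *. (rho k 0 (jh k) - rho k k (jh k) + rho k (N + k) (jh k)) = ((- 1) ^ Suc k * qi k) *. Ak N"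
  using region_sum[of k "%i. rho k i (jh k)", OF k st] rho_sum[OF goods(1)] bend_jh[OF k] by simp
 hence "qi k *. rho k k (jh k) = qi k *. ((- 1) ^ k *. Ak N)"
  using out[of 0] out[of "N + k"] k by (simp add: mult.commute)
 hence "rho k k (jh k) = (- 1) ^ k *. Ak N"
  by (rule smult_cancel) (rule qik_nz)
 thus ?thesis
  using region_const(2)[of k "%i. rho k i (jh k)" i, OF k(2) st] out[of i] by (cases "i < k | N < i") auto
qed

text \<open>The end values come from extremal weights, and the vanishing closed trace makes the
  middle value their sum. The two indicator functions cover two overlapping full periods of weights,
  \<open>0..N\<close> and \<open>k..N + k\<close>.\<close>

lemma theta_jg: "i <= N + k ==> theta k i (jg k) = (((if i <= N then 1 else 0) + (if k <= i then 1 else 0)) * (- 1) ^ k) *. 1"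
proof -
 assume i: "i <= N + k"
 have st: "theta k (Suc i) (jg k) = theta k i (jg k)" if "Suc i <= N + k" "Suc i ~= k" "Suc i ~= r" for i
  using theta_step[OF goods(2,1) Bo_jg'[OF k(2)], of i] aw_factor_nz[OF that(1) k(2) _ that(2,3)] that(1)
   theta_jh[of "Suc i"] theta_jh[of i]
  by (simp add: smult_eq_0)
 note ends = theta_ends[OF P_ext_jg[OF k(2) order_refl, of 0] P_ext_jg[OF k(2) order_refl, of "int (N + k)"], simplified]
 have "CA (N + k) * (jg k * CU (N + k)) = 0" by (rule CA_bend[OF bend_jg[OF k]])
 hence "qi k *. (theta k 0 (jg k) - theta k k (jg k) + theta k (N + k) (jg k)) = 0"
  using region_sum[of k "%i. theta k i (jg k)", OF k st] theta_sum[OF goods(2)] by simp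
 hence "theta k 0 (jg k) - theta k k (jg k) + theta k (N + k) (jg k) = 0"
  using smult_cancel[of "qi k" "theta k 0 (jg k) - theta k k (jg k) + theta k (N + k) (jg k)" 0] qik_nz by simp
 hence mid: "theta k k (jg k) = (2 * (- 1) ^ k) *. 1"
  unfolding ends using smult_add_left[of "(-1)^k" "(-1)^k" 1] by (simp add: algebra_simps)
 have "i < k | (k <= i & i <= N) | r <= i" using r_Suc by linarith
 then consider "i < k" | "k <= i" "i <= N" | "r <= i" by blast
 thus ?thesis
 proof cases
  case 1
  thus ?thesis using region_const(1)[of k "%i. theta k i (jg k)" i, OF k(2) st] ends k by simp
 next
  case 2
  thus ?thesis using region_const(2)[of k "%i. theta k i (jg k)" i, OF k(2) st] mid by simp
 next
  case 3
  thus ?thesis using region_const(3)[of k "%i. theta k i (jg k)" i, OF k(2) st] ends k i by (simp add: r_Suc)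
 qed
qed

end

subsection \<open>The weight functions of the bent operators\<close>

text \<open>The weight profile of \<open>rho\<close> for \<open>k = 0\<close>, continued
  periodically: the building block from which the profile of \<open>g\<close> is assembled in
  \<open>Fm\<close>.\<close>

definition TT :: "nat => lop" where "TT i = rho 0 (i mod r) F"

lemma TT_period: "TT (i + r) = TT i" by (simp add: TT_def)

lemma goodF: "good (N + 0) F" using good_jf[of N] by simp

lemma Bo_F: "Bo (N + 0) * F = br' 0 *. F + 0 *. F"
 using Bo_jg[of 0] by simp

lemma theta_F: "i <= N ==> theta 0 i F = 1"
proof -
 have st: "theta 0 (Suc j) F = theta 0 j F" if "Suc j <= N + 0" "Suc j ~= 0" "Suc j ~= r" for j
  using theta_step[OF goodF goodF Bo_F, of j] aw_factor_nz[OF that(1) _ _ that(2,3)] by (simp add: smult_eq_0)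
 have "theta 0 0 F = 1"
  using theta_ends(1)[of 0 F] P_ext_jf[of N N 0] P_ext_jf[of N N "int N"] by simp
 moreover assume "i <= N"
 ultimately show ?thesis
  using region_const(2)[of 0 "%i. theta 0 i F" i] st by simp
qed

text \<open>All \<open>theta\<close> values are \<open>1\<close> here, so the inhomogeneity is a
  geometric sum; it cancels one of the two factors of \<open>aw_factor\<close> and leaves a simple
  pole. The hypothesis excludes the wrap-around of the period, where the recursion gives no
  information.\<close>

lemma TT_step:
 assumes "y ^ Suc i ~= 1"
 shows "TT (Suc i) = TT i - (br 1 / (1 - y ^ Suc i)) *. Ak N"
proof -
 define j where "j = i mod r"
 have nd: "~ r dvd Suc i" using assms y_pow_eq_1 by blast
 hence j: "Suc i mod r = Suc j" "Suc j <= N"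
 proof -
  have "Suc i mod r ~= 0" using nd by (simp add: dvd_eq_mod_eq_0)
  thus "Suc i mod r = Suc j" unfolding j_def by (simp add: mod_Suc split: if_splits)
  hence "Suc j < r" using r_ge mod_less_divisor[of r "Suc i"] by simp
  thus "Suc j <= N" by (simp add: r_Suc)
 qed
 have yj: "y ^ Suc i = y ^ Suc j"
 proof -
  have "y ^ n = y ^ (n mod r)" for n
  proof -
   have "y ^ n = y ^ (r * (n div r) + n mod r)" by simp
   also have "... = y ^ (n mod r)" using y_pow_eq_1[of r] by (simp only: power_add power_mult) simp
   finally show ?thesis .
  qed
  from this[of "Suc i"] show ?thesis using j by simp
 qed
 define u where "u = y ^ Suc j"
 have u: "u ~= 1" "u ~= 0" using assms yj by (auto simp: u_def)
 have "(\<Sum>l\<le>j. wt 0 l *. (Ak N * theta 0 l F)) = (\<Sum>l<Suc j. wt 0 l) *. Ak N"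
  using j(2) by (simp only: lessThan_Suc_atMost flip: sum_smult) (intro sum.cong, auto simp: theta_F)
 also have "(\<Sum>l<Suc j. wt 0 l) = (1 - inverse u) / br 1"
 proof -
  have "(\<Sum>l<Suc j. wt 0 l) * br 1 = 1 - inverse u"
   unfolding wt_sum_gen by (simp add: u_def power_inverse)
  thus ?thesis using br1_nz by (metis One_nat_def nonzero_eq_divide_eq)
 qed
 finally have s: "(\<Sum>l\<le>j. wt 0 l *. (Ak N * theta 0 l F)) = ((1 - inverse u) / br 1) *. Ak N" .
 have "((1 - inverse u) * (1 - u)) *. (rho 0 (Suc j) F - rho 0 j F) = - (br 1)\<^sup>2 *. (((1 - inverse u) / br 1) *. Ak N)"
  using rho_step[OF goodF goodF Bo_F, of j] aw_factor[of 0 "Suc j"] unfolding s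
  by (simp add: u_def power_inverse del: of_nat_Suc power_Suc)
 also have "... = ((1 - inverse u) * (1 - u)) *. (- (br 1 / (1 - u)) *. Ak N)"
 proof -
  have "- (br 1)\<^sup>2 * ((1 - inverse u) / br 1) = - (br 1 * (1 - inverse u))"
   by (simp add: power2_eq_square)
  also have "... = ((1 - inverse u) * (1 - u)) * - (br 1 / (1 - u))"
   using u by (simp add: mult_ac)
  finally show ?thesis by (simp only: smult_simps(3))
 qed
 finally have "rho 0 (Suc j) F - rho 0 j F = - (br 1 / (1 - u)) *. Ak N"
  by (rule smult_cancel) (use u in simp)
 hence "rho 0 (Suc j) F = rho 0 j F - (br 1 / (1 - u)) *. Ak N"
  by (simp add: algebra_simps)
 thus ?thesis using j yj by (simp add: TT_def u_def flip: j_def)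
qed

text \<open>No closed form is needed: \<open>Ssum 1\<close> is known as a trace and fixes the total
  in \<open>rho_jg\<close>, the others cancel between \<open>k\<close> and
  \<open>r - k\<close>.\<close>

definition Ssum :: "nat => lop" where "Ssum e = (\<Sum>i<r. (iy ^ i) ^ e *. TT i)"

lemma Ssum_1: "iq *. Ssum 1 = Ak N"
proof -
 have "(\<Sum>i = 0..N + 0. wt 0 i *. rho 0 i F) = jg N * Ak N"
  using rho_sum[OF goodF] by (simp add: A_N)
 also have "... = Ak N" using Ak_jg[of N] N_ge by simp
 also have "{0..N + 0} = {..<r}" by (auto simp: r_Suc)
 finally show ?thesis
  by (simp add: Ssum_def smult_sum wt_def TT_def)
qed

text \<open>An ansatz: one copy of \<open>TT\<close> on each of the two periods seen in
  \<open>theta_jg\<close>. The shift by \<open>r - k\<close> moves the pole of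
  \<open>TT_step\<close> to the zero of the second factor of \<open>aw_factor\<close>; the additive
  constants are chosen so that the end values become \<open>TT 0\<close> and
  \<open>TT N\<close>.\<close>

definition Fm :: "nat => nat => lop" where
 "Fm k i = (if i <= N then TT (i + (r - k)) + (TT 0 - TT (r - k)) else 0)
   + (if k <= i then TT i + (TT N - TT (k - 1)) else 0)"

lemma shift_sum: "k <= N ==> (!!i. f (i + r) = f i) ==> (\<Sum>i=k..N + k. f i) = (\<Sum>i<r. (f i :: 'z::comm_monoid_add))"
proof -
 assume "k <= N" and f: "!!i. f (i + r) = f i"
 have "(\<Sum>i=k..N + k. f i) = (\<Sum>i<r. f (i + k))"
  by (rule sum.reindex_bij_witness[of _ "%i. i + k" "%i. i - k"]) (auto simp: r_Suc)
 thus ?thesis using periodic_sum[of f r k] f by simp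
qed

text \<open>Each copy runs over one full period, so shifting the index gives a scalar multiple of
  the same \<open>Ssum e\<close>, while the additive constants are weighted by a power sum of roots
  of unity.\<close>

lemma Fm_sum:
 assumes "k <= N"
 shows "(\<Sum>i=0..N + k. (wt k i) ^ e *. Fm k i) = ((iq ^ Suc k) ^ e + (q ^ k * iq) ^ e) *. Ssum e
   + (if r dvd e then of_nat r else 0) *. (TT 0 + TT N - TT (r - k) - TT (k - 1))"
proof -
 define \<delta> :: complex where "\<delta> = (if r dvd e then of_nat r else 0)"
 have w: "(wt k i) ^ e = (q ^ k * iq) ^ e * (iy ^ i) ^ e" for i
  by (simp add: wt_def power_mult_distrib)
 have yp: "(iy ^ (i + r)) ^ e = (iy ^ i) ^ e" for i
  by (simp add: power_inverse y_pow_r)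
 have 1: "(\<Sum>i=0..N + k. if i <= N then (wt k i) ^ e *. (TT (i + (r - k)) + (TT 0 - TT (r - k))) else 0)
  = (iq ^ Suc k) ^ e *. Ssum e + \<delta> *. (TT 0 - TT (r - k))"
 proof -
  have "(\<Sum>i=0..N + k. if i <= N then (wt k i) ^ e *. (TT (i + (r - k)) + (TT 0 - TT (r - k))) else 0)
   = (\<Sum>i<r. (wt k i) ^ e *. (TT (i + (r - k)) + (TT 0 - TT (r - k))))"
   by (rule sum.mono_neutral_cong_right) (auto simp: r_Suc)
  also have "... = (\<Sum>i<r. (wt k i) ^ e *. TT (i + (r - k))) + \<delta> *. (TT 0 - TT (r - k))"
   by (simp add: smult_add_right sum.distrib sum_smult wt_pow_sum \<delta>_def)
  also have "(\<Sum>i<r. (wt k i) ^ e *. TT (i + (r - k))) = (\<Sum>i<r. (iq ^ Suc k) ^ e *. ((iy ^ (i + (r - k))) ^ e *. TT (i + (r - k))))"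
  proof (rule sum.cong[OF refl])
   fix i
   have "iy ^ r = 1" using y_pow_eq_1[of r] by (simp add: power_inverse)
   moreover have "iy ^ (r - k) * iy ^ k = iy ^ r"
    using assms r_Suc by (simp flip: power_add)
   ultimately have "iy ^ (r - k) * iy ^ k = 1" by simp
   hence "iy ^ (r - k) = y ^ k" by (simp add: power_inverse field_simps)
   hence "iq ^ Suc k * iy ^ (i + (r - k)) = iq ^ Suc k * q ^ k * q ^ k * iy ^ i"
    by (simp add: power_add y_pow mult_2)
   also have "... = wt k i" by (simp add: wt_def power_inverse)
   finally have "(iq ^ Suc k) ^ e * (iy ^ (i + (r - k))) ^ e = (wt k i) ^ e"
    by (simp only: flip: power_mult_distrib)
   thus "(wt k i) ^ e *. TT (i + (r - k)) = (iq ^ Suc k) ^ e *. ((iy ^ (i + (r - k))) ^ e *. TT (i + (r - k)))"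
    by (simp del: power_Suc)
  qed
  also have "... = (iq ^ Suc k) ^ e *. (\<Sum>i<r. (iy ^ (i + (r - k))) ^ e *. TT (i + (r - k)))"
   by (simp only: smult_sum)
  also have "(\<Sum>i<r. (iy ^ (i + (r - k))) ^ e *. TT (i + (r - k))) = Ssum e"
   unfolding Ssum_def by (rule periodic_sum) (simp only: yp TT_period)
  finally show ?thesis .
 qed
 have 2: "(\<Sum>i=0..N + k. if k <= i then (wt k i) ^ e *. (TT i + (TT N - TT (k - 1))) else 0)
  = (q ^ k * iq) ^ e *. Ssum e + \<delta> *. (TT N - TT (k - 1))"
 proof -
  have "(\<Sum>i=0..N + k. if k <= i then (wt k i) ^ e *. (TT i + (TT N - TT (k - 1))) else 0)
   = (\<Sum>i=k..N + k. (wt k i) ^ e *. (TT i + (TT N - TT (k - 1))))"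
   by (rule sum.mono_neutral_cong_right) auto
  also have "... = (\<Sum>i<r. (wt k i) ^ e *. (TT i + (TT N - TT (k - 1))))"
   by (rule shift_sum[OF assms]) (simp add: wt_period TT_period)
  also have "... = (\<Sum>i<r. (q ^ k * iq) ^ e *. ((iy ^ i) ^ e *. TT i)) + \<delta> *. (TT N - TT (k - 1))"
   by (simp add: smult_add_right sum.distrib sum_smult wt_pow_sum \<delta>_def) (simp only: w smult_simps)
  finally show ?thesis by (simp only: Ssum_def smult_sum)
 qed
 have "(\<Sum>i=0..N + k. (wt k i) ^ e *. Fm k i) =
  (\<Sum>i=0..N + k. if i <= N then (wt k i) ^ e *. (TT (i + (r - k)) + (TT 0 - TT (r - k))) else 0) +
  (\<Sum>i=0..N + k. if k <= i then (wt k i) ^ e *. (TT i + (TT N - TT (k - 1))) else 0)"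
  unfolding sum.distrib[symmetric] by (rule sum.cong) (auto simp: Fm_def smult_add_right)
 thus ?thesis unfolding 1 2 \<delta>_def[symmetric]
  by (simp add: smult_distrib algebra_simps)
qed

context
 fixes k assumes k: "0 < k" "k <= N"
begin

lemma theta_partial:
 "l <= r + k ==> (\<Sum>j<l. wt k j * ((if j <= N then 1 else 0) + (if k <= j then 1 else 0))) * br 1
  = (if l <= r then q ^ k * (1 - iy ^ l) else 0) + (if k <= l then q ^ k * (iy ^ k - iy ^ l) else 0)"
proof (induction l)
 case 0 thus ?case using k by simp
next
 case (Suc l)
 have yr: "iy ^ r = 1" using y_pow_eq_1[of r] by (simp add: power_inverse)
 have "(\<Sum>j<Suc l. wt k j * ((if j <= N then 1 else 0) + (if k <= j then 1 else 0))) * br 1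
  = (if l <= r then q ^ k * (1 - iy ^ l) else 0) + (if k <= l then q ^ k * (iy ^ k - iy ^ l) else 0)
   + ((if l <= N then 1 else 0) + (if k <= l then 1 else 0)) * (wt k l * br 1)"
  by (subst sum.lessThan_Suc, subst distrib_right, subst Suc.IH) (use Suc.prems in simp, simp only: mult_ac)
 also have "... = (if Suc l <= r then q ^ k * (1 - iy ^ Suc l) else 0) + (if k <= Suc l then q ^ k * (iy ^ k - iy ^ Suc l) else 0)"
 proof -
  have 1: "(if l <= r then q ^ k * (1 - iy ^ l) else 0) + (if l <= N then 1 else 0) * (wt k l * br 1)
   = (if Suc l <= r then q ^ k * (1 - iy ^ Suc l) else 0)"
  proof (cases "l = r")
   case True thus ?thesis using yr r_Suc by simp
  next
   case False
   hence "l <= r \<longleftrightarrow> l <= N" by (auto simp: r_Suc)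
   thus ?thesis unfolding wt_br by (simp add: r_Suc algebra_simps del: power_Suc)
  qed
  have 2: "(if k <= l then q ^ k * (iy ^ k - iy ^ l) else 0) + (if k <= l then 1 else 0) * (wt k l * br 1)
   = (if k <= Suc l then q ^ k * (iy ^ k - iy ^ Suc l) else 0)"
  proof (cases "k = Suc l")
   case True thus ?thesis by simp
  next
   case False
   hence "k <= Suc l \<longleftrightarrow> k <= l" by auto
   thus ?thesis unfolding wt_br by (simp add: algebra_simps del: power_Suc)
  qed
  show ?thesis unfolding 1[symmetric] 2[symmetric] by (simp only: distrib_right add_ac)
 qed
 finally show ?case .
qed

lemma rho_jg_ends: "rho k 0 (jg k) = (- 1) ^ k *. TT 0" "rho k (N + k) (jg k) = (- 1) ^ k *. TT N"
proof -
 have p: "Pm (N + k) 0 * jg k = Pm (N + k) 0" "Pm (N + k) (int (N + k)) * jg k = Pm (N + k) (int (N + k))"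
  "Pm N 0 * F = Pm N 0" "Pm N (int N) * F = Pm N (int N)"
  using P_ext_jg[OF k(2) order_refl] P_ext_jf[of N N] by auto
 have w: "q powi (2 * int i - int (N + l)) = inverse (wt l i)" for i l using wt_powi(2) by blast
 have a: "rho k 0 (jg k) = inverse (wt k 0) *. (jg N * ((Cm k * (Pm (N + k) 0 * Dm k)) * CU N))"
  unfolding rho_def bv_def using w[of 0 k] mult3[OF p(1)] by (simp add: CA_add(2) massoc)
 have a0: "TT 0 = inverse (wt 0 0) *. (jg N * (Pm N 0 * CU N))"
  unfolding TT_def rho_def bv_def using w[of 0 0] mult3[OF p(3)] by (simp add: massoc)
 have "inverse (wt k 0) * (- q) ^ k = (- 1) ^ k * inverse (wt 0 0)"
  by (simp add: wt_ends power_add power_minus[of q] field_simps)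
 thus "rho k 0 (jg k) = (- 1) ^ k *. TT 0"
  unfolding a a0 Pm_bend_k by simp
 have b: "rho k (N + k) (jg k) = inverse (wt k (N + k)) *. (jg N * ((Cm k * (Pm (N + k) (int (N + k)) * Dm k)) * CU N))"
  unfolding rho_def bv_def w using mult3[OF p(2)] by (simp only: CA_add(2) massoc smult_simps)
 have b0: "TT N = inverse (wt 0 (N + 0)) *. (jg N * (Pm N (int N) * CU N))"
  unfolding TT_def rho_def bv_def using w[of N 0] mult3[OF p(4)] by (simp add: massoc)
 have "inverse (wt k (N + k)) * (- iq) ^ k = (- 1) ^ k * inverse (wt 0 (N + 0))"
  unfolding wt_ends(2) power_add by (subst power_minus) (simp add: power_inverse)
 thus "rho k (N + k) (jg k) = (- 1) ^ k *. TT N"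
  unfolding b b0 Pm_bend_k by simp
qed

lemma rho_jg_step:
 assumes "Suc i <= N + k" "Suc i ~= k" "Suc i ~= r"
 shows "rho k (Suc i) (jg k) = rho k i (jg k)
  - ((- 1) ^ k * br 1 * ((if Suc i <= N then 1 / (1 - y ^ Suc i * iy ^ k) else 0) + (if k < Suc i then 1 / (1 - y ^ Suc i) else 0))) *. Ak N"
proof -
 define u where "u = y ^ Suc i"
 define p where "p = q ^ k"
 define v where "v = (if Suc i <= N then 1 / (1 - u * inverse (p * p)) else 0) + (if k < Suc i then 1 / (1 - u) else 0)"
 have yk: "y ^ k = p * p" by (simp add: p_def y_pow mult_2 power_add)
 have p: "p ~= 0" by (simp add: p_def)
 have nz: "(1 - inverse u) * (p - inverse p * u) ~= 0"
  using aw_factor_nz[OF assms(1) k(2) _ assms(2,3)] unfolding aw_factor by (simp add: u_def p_def power_inverse)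
 hence "1 - inverse u ~= 0" "p - inverse p * u ~= 0" by auto
 moreover have "u ~= 0" by (simp add: u_def)
 ultimately have u: "u ~= 1" "u ~= 0" "u ~= p * p"
  using p by auto
 have S: "(\<Sum>j\<le>i. wt k j *. (Ak N * theta k j (jg k))) = ((- 1) ^ k * (\<Sum>j<Suc i. wt k j * ((if j <= N then 1 else 0) + (if k <= j then 1 else 0)))) *. Ak N"
  unfolding lessThan_Suc_atMost sum_distrib_left sum_smult[symmetric]
  by (rule sum.cong) (use assms(1) in \<open>simp_all add: theta_jg[OF k] mult_ac\<close>)
 define s where "s = (\<Sum>j<Suc i. wt k j * ((if j <= N then 1 else 0) + (if k <= j then 1 else 0)))"
 have "Suc i <= r + k" using assms(1) r_Suc by simp
 from theta_partial[OF this]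
 have "s * br 1 = (if Suc i <= r then p * (1 - inverse u) else 0) + (if k <= Suc i then p * (inverse (p * p) - inverse u) else 0)"
  unfolding s_def by (simp add: p_def u_def power_inverse yk[unfolded p_def] del: power_Suc)
 also have "... = (if Suc i <= N then p * (1 - inverse u) else 0) + (if k < Suc i then p * (inverse (p * p) - inverse u) else 0)"
  using assms(2,3) r_Suc by (intro arg_cong2[of _ _ _ _ "(+)"]) auto
 \<comment> \<open>A partial fraction decomposition: each indicator contributes a truncated
   geometric sum that cancels one factor, leaving the pole of the corresponding copy in
   \<open>Fm\<close>.\<close>
 also have "... = ((1 - inverse u) * (p - inverse p * u)) * v"
 proof -
  have 1: "((1 - inverse u) * (p - inverse p * u)) * (1 / (1 - u * inverse (p * p))) = p * (1 - inverse u)"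
   using p u by (simp add: field_simps)
  have 2: "((1 - inverse u) * (p - inverse p * u)) * (1 / (1 - u)) = p * (inverse (p * p) - inverse u)"
   using p u by (simp add: field_simps)
  show ?thesis unfolding v_def 1[symmetric] 2[symmetric] by (auto simp: distrib_left)
 qed
 finally have s: "s * br 1 = ((1 - inverse u) * (p - inverse p * u)) * v" .
 have "rho k (Suc i) (jh k) = rho k i (jh k)"
  using assms k rho_jh[OF k, of "Suc i"] rho_jh[OF k, of i] by (auto simp: r_Suc)
 hence "((1 - inverse u) * (p - inverse p * u)) *. (rho k (Suc i) (jg k) - rho k i (jg k)) = - ((br 1)^2 *. (((- 1) ^ k * s) *. Ak N))"
  using rho_step[OF goods(2,1)[OF k] Bo_jg'[OF k(2)], of i] jg_F[OF k] unfolding S s_def[symmetric] aw_factor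
  by (simp add: u_def p_def power_inverse del: power_Suc of_nat_Suc)
 also have "... = ((1 - inverse u) * (p - inverse p * u)) *. (- ((- 1) ^ k * br 1 * v) *. Ak N)"
 proof -
  have "- ((br 1)^2 * ((- 1) ^ k * s)) = - ((- 1) ^ k * br 1 * (s * br 1))" by (simp add: power2_eq_square mult_ac)
  also have "... = ((1 - inverse u) * (p - inverse p * u)) * - ((- 1) ^ k * br 1 * v)"
   unfolding s by (simp add: mult_ac)
  finally show ?thesis by (metis smult_simps(3,8))
 qed
 finally have "rho k (Suc i) (jg k) - rho k i (jg k) = - ((- 1) ^ k * br 1 * v) *. Ak N"
  by (rule smult_cancel) (rule nz)
 hence "rho k (Suc i) (jg k) = rho k i (jg k) - ((- 1) ^ k * br 1 * v) *. Ak N"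
  by (simp add: algebra_simps)
 thus ?thesis by (simp only: v_def u_def yk power_inverse)
qed

lemma Fm_step:
 assumes "Suc i <= N + k" "Suc i ~= k" "Suc i ~= r"
 shows "Fm k (Suc i) = Fm k i
  - (br 1 * ((if Suc i <= N then 1 / (1 - y ^ Suc i * iy ^ k) else 0) + (if k < Suc i then 1 / (1 - y ^ Suc i) else 0))) *. Ak N"
proof -
 have nz: "(1 - iy ^ Suc i) * (q ^ k - iq ^ k * y ^ Suc i) ~= 0"
  using aw_factor_nz[OF assms(1) k(2) _ assms(2,3)] unfolding aw_factor by simp
 have y1: "y ^ Suc i ~= 1" using nz by (auto simp: power_inverse simp del: power_Suc)
 have yl: "y ^ (r - k) = iy ^ k"
 proof -
  have "y ^ (r - k) * y ^ k = 1" using k r_Suc y_pow_eq_1[of r] by (simp flip: power_add)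
  thus ?thesis by (simp add: power_inverse field_simps)
 qed
 have yil: "y ^ Suc (i + (r - k)) = y ^ Suc i * iy ^ k" by (simp add: power_add yl)
 have y2: "y ^ Suc (i + (r - k)) ~= 1"
 proof
  assume "y ^ Suc (i + (r - k)) = 1"
  hence "y ^ Suc i = y ^ k"
   unfolding yil by (simp add: power_inverse field_simps del: power_Suc)
  also have "... = q ^ k * q ^ k" by (simp add: y_pow mult_2 power_add)
  finally have "iq ^ k * y ^ Suc i = q ^ k" by (simp add: power_inverse del: power_Suc)
  thus False using nz by simp
 qed
 have 1: "(if Suc i <= N then TT (Suc i + (r - k)) + (TT 0 - TT (r - k)) else 0) =
  (if i <= N then TT (i + (r - k)) + (TT 0 - TT (r - k)) else 0) - (br 1 * (if Suc i <= N then 1 / (1 - y ^ Suc i * iy ^ k) else 0)) *. Ak N"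
 proof -
  have "TT (Suc i + (r - k)) = TT (i + (r - k)) - (br 1 / (1 - y ^ Suc i * iy ^ k)) *. Ak N"
   using TT_step[OF y2] unfolding yil by simp
  moreover have "i <= N \<longleftrightarrow> Suc i <= N" using assms(3) r_Suc by auto
  ultimately show ?thesis by simp
 qed
 have 2: "(if k <= Suc i then TT (Suc i) + (TT N - TT (k - 1)) else 0) =
  (if k <= i then TT i + (TT N - TT (k - 1)) else 0) - (br 1 * (if k < Suc i then 1 / (1 - y ^ Suc i) else 0)) *. Ak N"
  using TT_step[OF y1] assms(2) by (auto simp del: power_Suc)
 show ?thesis unfolding Fm_def 1 2 by (simp add: distrib_left smult_add_left algebra_simps del: power_Suc)
qed

text \<open>The difference from the ansatz satisfies the homogeneous recursion, vanishes at both
  ends and has weighted total \<open>0\<close> by \<open>Ssum_1\<close> and the partial trace of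
  \<open>g\<close>; by \<open>region_sum\<close> it vanishes.\<close>

lemma rho_jg: "i <= N + k ==> rho k i (jg k) = (- 1) ^ k *. Fm k i"
proof -
 assume i: "i <= N + k"
 define D where "D = (%i. rho k i (jg k) - (- 1) ^ k *. Fm k i)"
 have st: "D (Suc j) = D j" if "Suc j <= N + k" "Suc j ~= k" "Suc j ~= r" for j
  unfolding D_def rho_jg_step[OF that] Fm_step[OF that] by (simp add: smult_diff_right mult_ac del: power_Suc)
 have D0: "D 0 = 0" using k by (simp add: D_def rho_jg_ends Fm_def)
 have "N + k = (k - 1) + r" using k r_Suc by simp
 hence "TT (N + k) = TT (k - 1)" by (simp only: TT_period)
 hence Dm: "D (N + k) = 0" using k by (simp add: D_def rho_jg_ends Fm_def)
 have sm: "(\<Sum>i=0..N + k. wt k i *. Fm k i) = br' k *. Ak N"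
 proof -
  have "(\<Sum>i=0..N + k. wt k i *. Fm k i) = (iq ^ Suc k + q ^ k * iq) *. Ssum 1"
   using Fm_sum[OF k(2), of 1] r_ge by simp
  also have "... = br' k *. (iq *. Ssum 1)"
   by (simp add: qbrace'_def algebra_simps)
  finally show ?thesis unfolding Ssum_1 .
 qed
 have "(\<Sum>i=0..N + k. wt k i *. D i) = (\<Sum>i=0..N + k. wt k i *. rho k i (jg k)) - (- 1) ^ k *. (\<Sum>i=0..N + k. wt k i *. Fm k i)"
  by (simp add: D_def smult_diff_right sum_subtractf smult_sum mult_ac)
 also have "(\<Sum>i=0..N + k. wt k i *. rho k i (jg k)) = ((- 1) ^ k * br' k) *. Ak N"
  using rho_sum[OF goods(2)[OF k]] bend_jg[OF k] Ak_jg[of N] N_ge by simp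
 finally have "(\<Sum>i=0..N + k. wt k i *. D i) = 0" unfolding sm by simp
 hence "qi k *. D k = 0"
  using region_sum[of k D, OF k st] D0 Dm by simp
 hence Dk: "D k = 0" using qik_nz[OF k] by (simp add: smult_eq_0)
 have "i < k | (k <= i & i <= N) | r <= i" using r_Suc by linarith
 hence "D i = 0"
  using region_const[of k D i, OF k(2) st] D0 Dm Dk i by auto
 thus ?thesis by (simp add: D_def)
qed

end

subsection \<open>The Kirby color on bent operators\<close>

text \<open>The morphism of the color with index \<open>N + k\<close>, without its source
  idempotent, on the bent \<open>w\<close>. As \<open>N\<close> is even and quantum integers have
  period \<open>r\<close>, its coefficients become \<open>(-1) ^ k\<close>, \<open>{k}'\<close> and
  \<open>[k]\<close>.\<close>

definition Om :: "nat => lop => lop" where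
 "Om k w = (- 1) ^ k *. ((br' k / 2) *. (Ak N * (CA (N + k) * (w * CU (N + k)))) - qi k *. (jg N * (Cm k * (w * CU (N + k)))))"

lemma Om_jh:
 assumes k: "0 < k" "k <= N"
 shows "Om k (Ko 0 (N + k) ^ c * jh k) = (- (qi k * (\<Sum>i=k..N. (wt k i) ^ Suc c))) *. Ak N"
proof -
 note g = goods[OF k]
 have 1: "CA (N + k) * (Ko 0 (N + k) ^ c * (jh k * CU (N + k))) = 0"
  unfolding weight_sum[OF g(1)] theta_def[symmetric] by (intro sum.neutral) (auto simp: theta_jh[OF k])
 have "jg N * Cm k * (Ko 0 (N + k) ^ c * (jh k * CU (N + k))) = (\<Sum>i=0..N + k. (wt k i) ^ Suc c *. rho k i (jh k))"
  unfolding weight_sum[OF g(1)] by (simp add: rho_def massoc)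
 also have "... = (\<Sum>i=k..N. (wt k i) ^ Suc c *. ((- 1) ^ k *. Ak N))"
  by (rule sum.mono_neutral_cong_right) (auto simp: rho_jh[OF k])
 also have "... = ((- 1) ^ k * (\<Sum>i=k..N. (wt k i) ^ Suc c)) *. Ak N"
  unfolding sum_smult by (simp add: mult.commute)
 finally show ?thesis
  by (simp add: Om_def massoc 1 del: power_Suc) (simp add: mult_ac)
qed

lemma Om_jg:
 assumes k: "0 < k" "k <= N"
 shows "Om k (Ko 0 (N + k) ^ c * jg k) = ((if r dvd Suc c then of_nat r else 0) * br' k) *. Ak N
  - qi k *. (((iq ^ Suc k) ^ Suc c + (q ^ k * iq) ^ Suc c) *. Ssum (Suc c)
   + (if r dvd Suc c then of_nat r else 0) *. (TT 0 + TT N - TT (r - k) - TT (k - 1)))"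
proof -
 note g = goods[OF k]
 define \<delta> :: complex where "\<delta> = (if r dvd Suc c then of_nat r else 0)"
 have "CA (N + k) * (Ko 0 (N + k) ^ c * (jg k * CU (N + k))) = (\<Sum>i=0..N + k. (wt k i) ^ Suc c *. theta k i (jg k))"
  unfolding weight_sum[OF g(2)] by (simp add: theta_def)
 also have "... = (\<Sum>i=0..N + k. ((- 1) ^ k * ((if i <= N then (wt k i) ^ Suc c else 0) + (if k <= i then (wt k i) ^ Suc c else 0))) *. 1)"
  by (rule sum.cong) (auto simp: theta_jg[OF k] mult_ac)
 also have "... = ((- 1) ^ k * ((\<Sum>i=0..N + k. if i <= N then (wt k i) ^ Suc c else 0) + (\<Sum>i=0..N + k. if k <= i then (wt k i) ^ Suc c else 0))) *. 1"
  unfolding sum_smult by (simp only: sum_distrib_left[symmetric] sum.distrib)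
 also have "(\<Sum>i=0..N + k. if i <= N then (wt k i) ^ Suc c else 0) = (\<Sum>i<r. (wt k i) ^ Suc c)"
  by (rule sum.mono_neutral_cong_right) (auto simp: r_Suc)
 also have "(\<Sum>i=0..N + k. if k <= i then (wt k i) ^ Suc c else 0) = (\<Sum>i=k..N + k. (wt k i) ^ Suc c)"
  by (rule sum.mono_neutral_cong_right) auto
 also have "(\<Sum>i=k..N + k. (wt k i) ^ Suc c) = (\<Sum>i<r. (wt k i) ^ Suc c)"
  by (rule shift_sum[OF k(2)]) (simp only: wt_period)
 finally have 1: "CA (N + k) * (Ko 0 (N + k) ^ c * (jg k * CU (N + k))) = ((- 1) ^ k * (2 * \<delta>)) *. 1"
  unfolding wt_pow_sum \<delta>_def[symmetric] by simp
 have "jg N * Cm k * (Ko 0 (N + k) ^ c * (jg k * CU (N + k))) = (\<Sum>i=0..N + k. (wt k i) ^ Suc c *. rho k i (jg k))"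
  unfolding weight_sum[OF g(2)] by (simp add: rho_def massoc)
 also have "... = (- 1) ^ k *. (\<Sum>i=0..N + k. (wt k i) ^ Suc c *. Fm k i)"
  unfolding smult_sum by (rule sum.cong) (auto simp: rho_jg[OF k] mult_ac)
 finally have 2: "jg N * (Cm k * (Ko 0 (N + k) ^ c * (jg k * CU (N + k)))) = (- 1) ^ k *. (\<Sum>i=0..N + k. (wt k i) ^ Suc c *. Fm k i)"
  by (simp only: massoc)
 have "Om k (Ko 0 (N + k) ^ c * jg k) = (\<delta> * br' k) *. Ak N - qi k *. (\<Sum>i=0..N + k. (wt k i) ^ Suc c *. Fm k i)"
 proof -
  define s :: complex where "s = (- 1) ^ k"
  have ss: "s * s = 1" by (simp add: s_def flip: power_mult_distrib)
  have c: "s * (br' k / 2 * (s * (2 * \<delta>))) = (s * s) * (\<delta> * br' k)" "s * (qi k * s) = (s * s) * qi k"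
   by (simp_all add: mult_ac)
  show ?thesis
   unfolding Om_def massoc 1 2 s_def[symmetric]
   by (simp only: smult_simps mult_1_right smult_diff_right c ss mult_1_left)
 qed
 thus ?thesis unfolding Fm_sum[OF k(2)] \<delta>_def .
qed

lemma r_diff: "0 < k ==> k <= N ==> 0 < r - k & r - k <= N & k <= r & r - (r - k) = k"
 by (auto simp: r_Suc)

lemma q_pow_comp: "k <= r ==> iq ^ Suc (r - k) = q ^ k * iq & q ^ (r - k) * iq = iq ^ Suc k"
proof -
 assume "k <= r"
 hence "q ^ (r - k) * q ^ k = 1" by (simp flip: power_add)
 hence 1: "q ^ (r - k) = iq ^ k" by (simp add: power_inverse field_simps)
 hence "iq ^ (r - k) = q ^ k" by (simp add: power_inverse)
 with 1 show ?thesis by (simp add: mult.commute)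
qed

text \<open>Replacing \<open>k\<close> by \<open>r - k\<close> negates \<open>[k]\<close> and swaps
  the two powers in front of \<open>Ssum\<close>, so all these sums and the constants
  \<open>TT 0 + TT N\<close> cancel. The traces give \<open>2 {k}'\<close>; the remaining jumps at
  \<open>k\<close> and \<open>r - k\<close> are known from \<open>TT_step\<close> and take away one
  \<open>{k}'\<close>.\<close>

theorem Om_pair_g:
 assumes k: "0 < k" "k <= N"
 shows "Om k (Ko 0 (N + k) ^ c * jg k) + Om (r - k) (Ko 0 (N + (r - k)) ^ c * jg (r - k)) =
  ((if r dvd Suc c then of_nat r else 0) * br' k) *. Ak N"
proof -
 define \<delta> :: complex where "\<delta> = (if r dvd Suc c then of_nat r else 0)"
 define u where "u = y ^ k"
 note rk = r_diff[OF k]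
 have "k < r" using k N_lt by linarith
 hence y0: "~ r dvd k" using k by (meson nat_dvd_not_less)
 hence u: "u ~= 1" "u ~= 0" using y_pow_eq_1[of k] by (auto simp: u_def)
 have "y ^ (r - k) * y ^ k = 1" using rk y_pow_eq_1[of r] by (simp flip: power_add)
 hence iu: "y ^ (r - k) = inverse u" by (simp add: u_def field_simps)
 have T1: "TT k = TT (k - 1) - (br 1 / (1 - u)) *. Ak N"
  using TT_step[of "k - 1"] k u by (simp add: u_def)
 have T2: "TT (r - k) = TT (r - k - 1) - (br 1 / (1 - inverse u)) *. Ak N"
 proof -
  have s: "Suc (r - k - 1) = r - k" using rk by linarith
  have "inverse u ~= 1" using u by simp
  thus ?thesis using TT_step[of "r - k - 1", unfolded s iu] by simp
 qed
 have q': "qi (r - k) = - qi k" "br' (r - k) = br' k" using rk qi_diff_r br'_diff_r by auto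
 have "br k * (u + 1) = br' k * (u - 1)"
 proof -
  define a b where "a = q ^ k" and "b = iq ^ k"
  have ab: "a * b = 1" by (simp add: a_def b_def power_inverse)
  have "u = a * a" by (simp add: a_def u_def y_def power2_eq_square power_mult_distrib)
  hence "br k * (u + 1) - br' k * (u - 1) = 2 * a * (1 - a * b)"
   unfolding qbrace_def qbrace'_def a_def[symmetric] b_def[symmetric] by (simp add: algebra_simps)
  thus ?thesis unfolding ab by simp
 qed
 hence e: "qi k * br 1 * ((u + 1) / (u - 1)) = br' k"
  using u br1_nz by (simp add: qint_def field_simps)
 have f: "1 / (1 - inverse u) - 1 / (1 - u) = (u + 1) / (u - 1)"
 proof -
  have "1 / (1 - inverse u) = u / (u - 1)" using u by (simp add: field_simps)
  moreover have "1 / (1 - u) = - (1 / (u - 1))" by (metis minus_diff_eq minus_divide_right)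
  ultimately show ?thesis by (simp add: add_divide_distrib)
 qed
 have "Om k (Ko 0 (N + k) ^ c * jg k) + Om (r - k) (Ko 0 (N + (r - k)) ^ c * jg (r - k)) =
  (2 * (\<delta> * br' k)) *. Ak N - (qi k * \<delta>) *. ((TT k - TT (k - 1)) - (TT (r - k) - TT (r - k - 1)))"
  unfolding Om_jg[OF k] Om_jg[OF rk[THEN conjunct1] rk[THEN conjunct2, THEN conjunct1]] \<delta>_def[symmetric]
  using q' rk q_pow_comp[of k]
  by (simp only: simp_thms) (rule lop_eqI, simp add: algebra_simps del: power_Suc)
 also have "(TT k - TT (k - 1)) - (TT (r - k) - TT (r - k - 1)) = (br 1 * (1 / (1 - inverse u) - 1 / (1 - u))) *. Ak N"
  unfolding T1 T2 by (simp add: right_diff_distrib smult_diff_left)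
 also have "(2 * (\<delta> * br' k)) *. Ak N - (qi k * \<delta>) *. \<dots> = (2 * (\<delta> * br' k) - \<delta> * (qi k * br 1 * (1 / (1 - inverse u) - 1 / (1 - u)))) *. Ak N"
  by (simp only: smult_simps smult_diff_left mult_ac)
 also have "... = (\<delta> * br' k) *. Ak N" unfolding f e by simp
 finally show ?thesis unfolding \<delta>_def .
qed

text \<open>The nilpotent part sees, for either morphism, only a part of the weights; the two parts
  fit together to one full period. The prefactors are the coefficients of \<open>h\<close> in the
  Casimir operator.\<close>

theorem Om_pair_h:
 assumes k: "0 < k" "k <= N"
 shows "(- ((br 1)^2 * qi k)) *. Om k (Ko 0 (N + k) ^ c * jh k)
  + (- ((br 1)^2 * qi (r - k))) *. Om (r - k) (Ko 0 (N + (r - k)) ^ c * jh (r - k)) =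
  ((if r dvd Suc c then of_nat r else 0) * (br k)^2) *. Ak N"
proof -
 note rk = r_diff[OF k]
 have q': "qi (r - k) = - qi k" using rk qi_diff_r by auto
 define S where "S = (\<Sum>i=k..N. (wt k i) ^ Suc c)"
 define S' where "S' = (\<Sum>i=r - k..N. (wt (r - k) i) ^ Suc c)"
 \<comment> \<open>Shifting by \<open>r - k\<close> carries the range \<open>r - k..N\<close> to
   \<open>0..k - 1\<close>, the complement of \<open>k..N\<close> in one period.\<close>
 have "S' = (\<Sum>i<k. (wt k i) ^ Suc c)"
  unfolding S'_def
 proof (rule sum.reindex_bij_witness[of _ "%i. i + (r - k)" "%i. i - (r - k)"])
  fix i assume i: "i \<in> {r - k..N}"
  define j where "j = i - (r - k)"
  have ij: "i = (r - k) + j" using i by (simp add: j_def)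
  have "iy ^ (r - k) = iq ^ (r - k) * iq ^ (r - k)"
   by (simp add: y_def power_inverse power_mult_distrib power2_eq_square)
  hence "wt (r - k) i = q ^ (r - k) * iq * (iq ^ (r - k) * iq ^ (r - k)) * iy ^ j"
   by (simp add: wt_def ij power_add)
  also have "... = iq ^ Suc (r - k) * iy ^ j"
   by (simp add: power_inverse)
  also have "... = wt k j" using q_pow_comp[of k] rk by (simp only: wt_def)
  finally show "wt k (i - (r - k)) ^ Suc c = wt (r - k) i ^ Suc c" by (simp add: j_def)
 qed (use k r_Suc in auto)
 moreover have "{..<r} = {..<k} Un {k..N}" "{..<k} Int {k..N} = {}" using k by (auto simp: r_Suc)
 ultimately have S: "S + S' = (if r dvd Suc c then of_nat r else 0)"
  using wt_pow_sum[of k "Suc c"] by (simp only: S_def sum.union_disjoint finite_lessThan finite_atLeastAtMost add.commute)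
 have "(- ((br 1)^2 * qi k)) *. Om k (Ko 0 (N + k) ^ c * jh k)
  + (- ((br 1)^2 * qi (r - k))) *. Om (r - k) (Ko 0 (N + (r - k)) ^ c * jh (r - k)) = ((br 1 * qi k)^2 * (S + S')) *. Ak N"
  unfolding Om_jh[OF k] Om_jh[OF rk[THEN conjunct1] rk[THEN conjunct2, THEN conjunct1]] S_def[symmetric] S'_def[symmetric] q'
  by (rule lop_eqI) (simp add: algebra_simps power2_eq_square)
 also have "br 1 * qi k = br k" using br1_nz by (simp add: qint_def)
 finally show ?thesis unfolding S by (simp add: mult.commute)
qed

theorem Om_zero:
 "Ak N * (CA N * (Ko 0 N ^ c * (F * CU N))) = (if r dvd Suc c then of_nat r else 0) *. Ak N"
proof -
 have "CA (N + 0) * (Ko 0 (N + 0) ^ c * (F * CU (N + 0))) = (\<Sum>i=0..N + 0. (wt 0 i) ^ Suc c *. theta 0 i F)"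
  unfolding weight_sum[OF goodF] by (simp add: theta_def)
 also have "... = (\<Sum>i<r. (wt 0 i) ^ Suc c *. 1)"
 proof (rule sum.cong)
  show "{0..N + 0} = {..<r}" by (auto simp: r_Suc)
  fix i assume "i \<in> {..<r}"
  hence "i <= N" using r_Suc by auto
  thus "(wt 0 i) ^ Suc c *. theta 0 i F = (wt 0 i) ^ Suc c *. 1" by (simp only: theta_F)
 qed
 also have "... = (if r dvd Suc c then of_nat r else 0) *. 1"
  unfolding sum_smult wt_pow_sum ..
 finally show ?thesis by simp
qed

end

section \<open>Composition of planar tangles\<close>

subsection \<open>Two matchings\<close>

definition matching :: "('a \<times> 'a) set => bool" where
 "matching M \<longleftrightarrow> sym M & irrefl M & single_valued M"

text \<open>Remove one matched pair after the other; each contributes an even amount.\<close>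

lemma even_matched_sum:
 fixes f :: "'a => nat"
 assumes "finite S" "matching M" "S <= Domain M" "!!x y. (x, y) \<in> M ==> x \<in> S ==> y \<in> S"
  "!!x y. (x, y) \<in> M ==> x \<in> S ==> even (f x + f y)"
 shows "even (sum f S)"
 using assms(1,3-)
proof (induction S rule: finite_psubset_induct)
 case (psubset S)
 show ?case
 proof (cases "S = {}")
  case False
  then obtain x where x: "x \<in> S" by blast
  then obtain y where y: "(x, y) \<in> M" using psubset.prems by blast
  have xy: "y \<in> S" "x ~= y" "(y, x) \<in> M"
   using x y psubset.prems assms(2) by (auto simp: matching_def irrefl_def dest: symD)
  have sv: "(u, v) \<in> M ==> (u, w) \<in> M ==> v = w" and sy: "(u, v) \<in> M ==> (v, u) \<in> M" for u v w
   using assms(2) by (auto simp: matching_def dest: single_valuedD symD)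
  have "even (sum f (S - {x, y}))"
  proof (rule psubset.IH)
   show "S - {x, y} \<subset> S" using x by blast
   show "S - {x, y} <= Domain M" using psubset.prems by blast
   fix u v assume uv: "(u, v) \<in> M" "u \<in> S - {x, y}"
   have "v ~= x" using uv sv[of x u y] sy[OF uv(1)] y by blast
   moreover have "v ~= y" using uv sv[of y u x] sy[OF uv(1)] xy by blast
   ultimately show "v \<in> S - {x, y}" using uv psubset.prems by blast
   show "even (f u + f v)" using uv psubset.prems by blast
  qed
  moreover have "sum f S = (f x + f y) + sum f (S - {x, y})"
  proof -
   have "S = insert x (insert y (S - {x, y}))" using x xy by blast
   hence "sum f S = sum f (insert x (insert y (S - {x, y})))" by simp
   also have "... = (f x + f y) + sum f (S - {x, y})"
    using xy psubset.hyps by (subst sum.insert; simp)+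
   finally show ?thesis .
  qed
  ultimately show ?thesis using psubset.prems(3)[OF y x] by presburger
 qed simp
qed

locale two_matchings =
 fixes M :: "bool => ('a \<times> 'a) set"
 assumes matching: "matching (M b)" and fin: "finite (M b)"
begin

definition G where "G = M False Un M True"

text \<open>The union of two matchings consists of cycles and paths, and these points are the ends
  of the paths. For glued tangles they are the endpoints of the composite.\<close>

definition outer where "outer x \<longleftrightarrow> (x \<in> Domain (M False)) ~= (x \<in> Domain (M True))"

lemma sym_M: "(x, y) \<in> M b ==> (y, x) \<in> M b"
 using matching[of b] by (auto simp: matching_def dest: symD)

lemma sv_M: "(x, y) \<in> M b ==> (x, z) \<in> M b ==> y = z"
 using matching[of b] by (auto simp: matching_def dest: single_valuedD)

lemma G_iff: "(x, y) \<in> G \<longleftrightarrow> (\<exists>b. (x, y) \<in> M b)"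
 unfolding G_def by (metis (full_types) UnE UnI1 UnI2)

lemma sym_G: "sym G"
 using sym_M by (auto simp: sym_def G_def)

lemma sym_Gs: "(x, y) \<in> G\<^sup>* ==> (y, x) \<in> G\<^sup>*"
 using sym_rtrancl[OF sym_G] by (rule symD)

inductive_set steps where
 steps: "(x, y) \<in> M b ==> ((x, b), (y, ~ b)) \<in> steps"

lemma stepsD: "(p, (y, b)) \<in> steps ==> \<exists>w. p = (w, ~ b) & (w, y) \<in> M (~ b)"
 by (cases p) (auto elim: steps.cases)

lemma sv_steps: "single_valued steps"
 by (auto simp: single_valued_def elim!: steps.cases dest: sv_M)

text \<open>From an outer point the walk that follows the two matchings alternately is deterministic,
 exhausts the component, and stops at the first further outer point.\<close>

lemma walk:
 assumes x: "x \<in> Domain (M b0)" "x \<notin> Domain (M (~ b0))" and y: "(x, y) \<in> G\<^sup>*"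
 shows "\<exists>b. ((x, b0), (y, b)) \<in> steps\<^sup>*"
 using y
proof induction
 case (step y z)
 then obtain b where b: "((x, b0), (y, b)) \<in> steps\<^sup>*" by blast
 from step obtain c where c: "(y, z) \<in> M c" by (auto simp: G_iff)
 show ?case
 proof (cases "c = b")
  case True
  thus ?thesis using b steps[OF c] by (meson rtrancl.rtrancl_into_rtrancl)
 next
  case False
  hence cb: "c = (~ b)" by blast
  from b show ?thesis
  proof (cases rule: rtranclE)
   case base
   thus ?thesis using x c cb by auto
  next
   case (step p)
   then obtain w where "p = (w, ~ b)" "(w, y) \<in> M (~ b)" using stepsD by blast
   hence "z = w" using sv_M[of y z c w] c cb sym_M by blast
   thus ?thesis using step \<open>p = _\<close> by blast
  qed
 qed
qed blast

lemma outer_unique: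
 assumes "outer x" "(x, y) \<in> G\<^sup>*" "(x, z) \<in> G\<^sup>*" "outer y" "outer z" "y ~= x" "z ~= x"
 shows "y = z"
proof -
 obtain b0 where b0: "x \<in> Domain (M b0)" "x \<notin> Domain (M (~ b0))"
  using assms(1) unfolding outer_def by (metis (full_types))
 have *: "\<exists>b. ((x, b0), (w, b)) \<in> steps\<^sup>* & w \<notin> Domain (M b)" if w: "(x, w) \<in> G\<^sup>*" "outer w" "w ~= x" for w
 proof -
  obtain b where b: "((x, b0), (w, b)) \<in> steps\<^sup>*" using walk[OF b0 w(1)] by blast
  hence "w \<in> Domain (M (~ b))"
  proof (cases rule: rtranclE)
   case (step p)
   then obtain v where "(v, w) \<in> M (~ b)" using stepsD by blast
   thus ?thesis using sym_M by blast
  qed (use w in auto)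
  thus ?thesis using b w(2) unfolding outer_def by (metis (full_types))
 qed
 obtain b where b: "((x, b0), (y, b)) \<in> steps\<^sup>*" "y \<notin> Domain (M b)"
  using *[OF assms(2,4,6)] by blast
 obtain c where c: "((x, b0), (z, c)) \<in> steps\<^sup>*" "z \<notin> Domain (M c)"
  using *[OF assms(3,5,7)] by blast
 have stop: "p = t" if "(p, t) \<in> steps\<^sup>*" "fst p \<notin> Domain (M (snd p))" for p t
  using that by (induction rule: converse_rtrancl_induct) (auto elim!: steps.cases)
 from single_valued_confluent[OF sv_steps b(1) c(1)] show ?thesis
  using stop[of "(y, b)" "(z, c)"] stop[of "(z, c)" "(y, b)"] b c by auto
qed

lemma fin_comp: "finite (G\<^sup>* `` {x})"
proof -
 have "finite G" using fin by (simp add: G_def)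
 hence "finite (insert x (Range G))" by (simp add: finite_Range)
 moreover have "G\<^sup>* `` {x} <= insert x (Range G)" by (auto elim: rtranclE)
 ultimately show ?thesis by (rule rev_finite_subset)
qed

lemma comp_closed: "(y, z) \<in> M b ==> y \<in> G\<^sup>* `` {x} ==> z \<in> G\<^sup>* `` {x}"
 using G_iff[of y z] by (blast intro: rtrancl_into_rtrancl)

lemma even_comp: "even (card (G\<^sup>* `` {x} Int Domain (M b)))"
proof -
 have "even (\<Sum>y\<in>G\<^sup>* `` {x} Int Domain (M b). 1 :: nat)"
 proof (rule even_matched_sum[OF _ matching])
  show "finite (G\<^sup>* `` {x} Int Domain (M b))" using fin_comp by (rule finite_Int[OF disjI1])
  fix y z assume yz: "(y, z) \<in> M b" "y \<in> G\<^sup>* `` {x} Int Domain (M b)"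
  thus "z \<in> G\<^sup>* `` {x} Int Domain (M b)" using comp_closed[OF yz(1), of x] sym_M[OF yz(1)] by (meson DomainI IntE IntI)
 qed simp_all
 thus ?thesis by simp
qed

text \<open>Either matching covers an even number of points of a component, so the number of points
  covered by exactly one of them is even and a second end exists; it is unique because the walk is
  deterministic.\<close>

lemma outer_partner:
 assumes x: "outer x"
 shows "\<exists>!y. y ~= x & outer y & (x, y) \<in> G\<^sup>*"
proof -
 define C where "C = G\<^sup>* `` {x}"
 have f: "finite C" using fin_comp by (simp add: C_def)
 define A B where "A = C Int Domain (M False)" and "B = C Int Domain (M True)"
 have "even (card A)" "even (card B)" using even_comp by (auto simp: A_def B_def C_def)
 moreover have "card A = card (A Int B) + card (A - B)" "card B = card (A Int B) + card (B - A)"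
  using f by (metis A_def B_def finite_Int card_Int_Diff Int_commute)+
 moreover have "card ((A - B) Un (B - A)) = card (A - B) + card (B - A)"
  by (rule card_Un_disjoint) (use f in \<open>auto simp: A_def B_def\<close>)
 ultimately have e: "even (card ((A - B) Un (B - A)))" by presburger
 have o: "(A - B) Un (B - A) = {y \<in> C. outer y}" by (auto simp: A_def B_def outer_def)
 have "x \<in> {y \<in> C. outer y}" using x by (simp add: C_def)
 hence "\<exists>y\<in>{y \<in> C. outer y}. y ~= x"
 proof (rule contrapos_pp)
  assume "~ (\<exists>y\<in>{y \<in> C. outer y}. y ~= x)"
  hence "{y \<in> C. outer y} = {x} | x \<notin> {y \<in> C. outer y}" by blast
  thus "x \<notin> {y \<in> C. outer y}" using e unfolding o by auto
 qed
 thus ?thesis using outer_unique[OF x] by (auto simp: C_def)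
qed

end

lemma four_points_even:
 fixes a b c d :: nat
 assumes "~ (a < c & c < b & b < d)" "~ (a < d & d < b & b < c)" "~ (b < c & c < a & a < d)"
  "~ (b < d & d < a & a < c)" "~ (c < a & a < d & d < b)" "~ (d < a & a < c & c < b)"
  "~ (c < b & b < d & d < a)" "~ (d < b & b < c & c < a)"
  "a ~= c" "a ~= d" "b ~= c" "b ~= d"
 shows "even ((if a < c then 1 else 0) + (if b < c then 1 else 0)
   + ((if a < d then 1 else 0) + (if b < d then 1 else 0)) :: nat)"
proof -
 have "c < a" if "~ a < c" using that assms(9) by linarith
 moreover have "d < a" if "~ a < d" using that assms(10) by linarith
 moreover have "c < b" if "~ b < c" using that assms(11) by linarith
 moreover have "d < b" if "~ b < d" using that assms(12) by linarith
 ultimately show ?thesis using assms(1-8)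
  by (cases "a < c"; cases "b < c"; cases "a < d"; cases "b < d") simp_all
qed

definition noncrossing :: "('a => nat) => ('a \<times> 'a) set => bool" where
 "noncrossing f A \<longleftrightarrow> (\<forall>a b c d. (a, b) \<in> A --> (c, d) \<in> A --> ~ (f a < f c & f c < f b & f b < f d))"

lemma noncrossingD: "noncrossing f A ==> (a, b) \<in> A ==> (c, d) \<in> A ==> ~ (f a < f c & f c < f b & f b < f d)"
 unfolding noncrossing_def by blast

text \<open>The points of two disjoint unions of arcs of a planar matching interleave evenly.\<close>

lemma even_interleave:
 fixes pos :: "'a => nat"
 assumes "finite S" "finite T" "matching M" "S <= Domain M" "T <= Domain M" "S Int T = {}"
  and S: "!!x y. (x, y) \<in> M ==> x \<in> S ==> y \<in> S" and T: "!!x y. (x, y) \<in> M ==> x \<in> T ==> y \<in> T"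
  and inj: "inj_on pos (S Un T)"
  and nc: "noncrossing pos M"
 shows "even (\<Sum>x\<in>S. \<Sum>y\<in>T. if pos x < pos y then 1 else 0 :: nat)"
proof (rule even_matched_sum[OF assms(1,3,4) S])
 fix a b assume ab: "(a, b) \<in> M" "a \<in> S"
 have "even (\<Sum>y\<in>T. (if pos a < pos y then 1 else 0) + (if pos b < pos y then 1 else 0) :: nat)"
 proof (rule even_matched_sum[OF assms(2,3,5) T])
  fix c d assume cd: "(c, d) \<in> M" "c \<in> T"
  have m: "(b, a) \<in> M" "(d, c) \<in> M" using assms(3) ab cd by (auto simp: matching_def dest: symD)
  have st: "b \<in> S" "d \<in> T" using S T ab cd by blast+
  have n: "pos x ~= pos y" if "x \<in> S" "y \<in> T" for x y
   using that inj assms(6) by (auto dest!: inj_onD)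
  show "even ((if pos a < pos c then 1 else 0) + (if pos b < pos c then 1 else 0)
   + ((if pos a < pos d then 1 else 0) + (if pos b < pos d then 1 else 0)) :: nat)"
   by (rule four_points_even[OF noncrossingD[OF nc ab(1) cd(1)] noncrossingD[OF nc ab(1) m(2)]
    noncrossingD[OF nc m(1) cd(1)] noncrossingD[OF nc m] noncrossingD[OF nc cd(1) ab(1)]
    noncrossingD[OF nc m(2) ab(1)] noncrossingD[OF nc cd(1) m(1)] noncrossingD[OF nc m(2) m(1)]
    n[OF ab(2) cd(2)] n[OF ab(2) st(2)] n[OF st(1) cd(2)] n[OF st]])
 qed
 thus "even ((\<Sum>y\<in>T. if pos a < pos y then 1 else 0) + (\<Sum>y\<in>T. if pos b < pos y then 1 else 0 :: nat))"
  by (simp add: sum.distrib)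
qed

subsection \<open>Closure of planar tangles\<close>

definition planar :: "nat => nat => (endpt \<times> endpt) set => bool" where
 "planar m n A \<longleftrightarrow> A <= endpts m n \<times> endpts m n & matching A & Domain A = endpts m n \<and>
   noncrossing (bdpos m n) A"

lemma planar_tangles_eq: "planar_tangles m n = {Tangle m n A | A. planar m n A}"
proof -
 have *: "single_valued A & Domain A = endpts m n \<longleftrightarrow> (\<forall>x\<in>endpts m n. \<exists>!y. (x, y) \<in> A)"
  if "A <= endpts m n \<times> endpts m n" for A
 proof
  assume "single_valued A & Domain A = endpts m n"
  thus "\<forall>x\<in>endpts m n. \<exists>!y. (x, y) \<in> A" unfolding single_valued_def by blast
 next
  assume a: "\<forall>x\<in>endpts m n. \<exists>!y. (x, y) \<in> A"
  hence "Domain A = endpts m n" using that by blast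
  moreover have "single_valued A"
   unfolding single_valued_def
  proof (intro allI impI)
   fix x y z assume "(x, y) \<in> A" "(x, z) \<in> A"
   moreover hence "x \<in> endpts m n" using that by blast
   ultimately show "y = z" using a by blast
  qed
  ultimately show "single_valued A & Domain A = endpts m n" by blast
 qed
 have N: "noncrossing (bdpos m n) A \<longleftrightarrow>
   ~ (\<exists>(a, b)\<in>A. \<exists>(c, d)\<in>A. bdpos m n a < bdpos m n c & bdpos m n c < bdpos m n b & bdpos m n b < bdpos m n d)" for A
  unfolding noncrossing_def by fast
 have "planar m n A \<longleftrightarrow> A <= endpts m n \<times> endpts m n & sym A & irrefl A \<and>
   (\<forall>x\<in>endpts m n. \<exists>!y. (x, y) \<in> A) \<and>
   ~ (\<exists>(a, b)\<in>A. \<exists>(c, d)\<in>A. bdpos m n a < bdpos m n c & bdpos m n c < bdpos m n b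
     & bdpos m n b < bdpos m n d)" for A
  unfolding planar_def matching_def using *[of A, unfolded atomize_imp] N[of A] by argo
 thus ?thesis unfolding planar_tangles_def by presburger
qed

lemma planarD:
 assumes "planar m n A"
 shows "A <= endpts m n \<times> endpts m n" "matching A" "Domain A = endpts m n" "noncrossing (bdpos m n) A"
 using assms unfolding planar_def by blast+

lemma finite_endpts[simp]: "finite (endpts m n)" by (simp add: endpts_def)

lemma inj_bdpos: "inj_on (bdpos m n) (endpts m n)"
 by (auto simp: inj_on_def endpts_def bdpos_def)

lemma mem_endpts: "(i, a) \<in> endpts m n \<longleftrightarrow> i = 0 & a < m | i = 1 & a < n"
 by (auto simp: endpts_def)

text \<open>A count of increasing pairs, of which only the parity matters: two chords cross iff
  their ends interleave an odd number of times.\<close>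

definition below :: "nat set => nat set => nat" where
 "below X Y = (\<Sum>x\<in>X. \<Sum>y\<in>Y. if x < y then 1 else 0)"

lemma below_swap: "finite X ==> finite Y ==> X Int Y = {} ==> below X Y + below Y X = card X * card Y"
proof -
 assume a: "finite X" "finite Y" "X Int Y = {}"
 have "below Y X = (\<Sum>x\<in>X. \<Sum>y\<in>Y. if y < x then 1 else 0)"
  unfolding below_def by (rule sum.swap)
 hence "below X Y + below Y X = (\<Sum>x\<in>X. \<Sum>y\<in>Y. (if x < y then 1 else 0) + (if y < x then 1 else 0))"
  by (simp add: below_def sum.distrib)
 also have "... = (\<Sum>x\<in>X. \<Sum>y\<in>Y. 1)"
  by (intro sum.cong refl) (use a in \<open>auto simp: not_less_iff_gr_or_eq\<close>)
 finally show ?thesis by simp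
qed

lemma levels_sum:
 fixes X0 :: "nat set"
 assumes "finite X0" "finite X1"
 shows "sum f ({0::nat} \<times> X0 Un {1} \<times> X1) = (\<Sum>x\<in>X0. f (0, x)) + (\<Sum>x\<in>X1. f (1, x) :: nat)"
proof -
 have "sum f ({0} \<times> X0) = (\<Sum>x\<in>X0. f (0, x))" "sum f ({1} \<times> X1) = (\<Sum>x\<in>X1. f (1, x))"
  by (rule sum.reindex_bij_witness[of _ "%x. (_, x)" snd]; auto)+
 thus ?thesis using assms by (subst sum.union_disjoint) auto
qed

text \<open>Around the boundary, the top endpoints come after all bottom endpoints and in reversed
  order; this explains the mixed product and the swapped arguments in the last term.\<close>

lemma levels_interleave:
 assumes "X0 <= {..<m}" "Y0 <= {..<m}" "X1 <= {..<n}" "Y1 <= {..<n}"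
 shows "(\<Sum>x\<in>{0} \<times> X0 Un {1} \<times> X1. \<Sum>y\<in>{0} \<times> Y0 Un {1} \<times> Y1. if bdpos m n x < bdpos m n y then 1 else 0 :: nat)
  = below X0 Y0 + card X0 * card Y1 + below Y1 X1"
proof -
 have f: "finite X0" "finite Y0" "finite X1" "finite Y1"
  using assms by (auto intro: finite_subset)
 have 1: "(\<Sum>x\<in>X0. \<Sum>y\<in>Y1. if bdpos m n (0, x) < bdpos m n (1, y) then 1 else 0 :: nat) = (\<Sum>x\<in>X0. \<Sum>y\<in>Y1. 1)"
  by (intro sum.cong refl) (use assms in \<open>auto simp: bdpos_def\<close>)
 have 2: "(\<Sum>x\<in>X1. \<Sum>y\<in>Y0. if bdpos m n (1, x) < bdpos m n (0, y) then 1 else 0 :: nat) = (\<Sum>x\<in>X1. \<Sum>y\<in>Y0. 0)"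
  by (intro sum.cong refl) (use assms in \<open>auto simp: bdpos_def\<close>)
 have "(\<Sum>x\<in>X1. \<Sum>y\<in>Y1. if bdpos m n (1, x) < bdpos m n (1, y) then 1 else 0 :: nat) = (\<Sum>x\<in>X1. \<Sum>y\<in>Y1. if y < x then 1 else 0)"
 proof (intro sum.cong refl)
  fix x y assume "x \<in> X1" "y \<in> Y1"
  hence "x < n" "y < n" using assms by auto
  hence "bdpos m n (1, x) < bdpos m n (1, y) \<longleftrightarrow> y < x" by (auto simp: bdpos_def)
  thus "(if bdpos m n (1, x) < bdpos m n (1, y) then 1 else 0) = (if y < x then 1 else 0 :: nat)" by simp
 qed
 also have "... = below Y1 X1" unfolding below_def by (rule sum.swap)
 finally have 3: "(\<Sum>x\<in>X1. \<Sum>y\<in>Y1. if bdpos m n (1, x) < bdpos m n (1, y) then 1 else 0 :: nat) = below Y1 X1" .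
 have 0: "(\<Sum>x\<in>X0. \<Sum>y\<in>Y0. if bdpos m n (0, x) < bdpos m n (0, y) then 1 else 0 :: nat) = below X0 Y0"
  by (simp add: bdpos_def below_def)
 show ?thesis
  unfolding levels_sum[OF f(1,3)] levels_sum[OF f(2,4)] sum.distrib 0 1 2 3 by simp
qed

text \<open>The glued picture has three levels: \<open>lift1\<close> embeds the upper tangle,
  \<open>lift2\<close> the endpoints of the composite.\<close>

definition lift1 :: "endpt => endpt" where "lift1 = (%(i, a). (Suc i, a))"

definition lift2 :: "endpt => endpt" where "lift2 = (%(i, a). (2 * i, a))"

lemma lift_simps[simp]: "lift1 (i, a) = (Suc i, a)" "lift2 (i, a) = (2 * i, a)"
 by (simp_all add: lift1_def lift2_def)

lemma inj_lift: "inj lift1" "inj lift2"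
 by (auto simp: inj_def lift1_def lift2_def)

lemma lift_image: "lift1 ` endpts k n = {1} \<times> {..<k} Un {2} \<times> {..<n}"
 "lift2 ` endpts m n = {0} \<times> {..<m} Un {2} \<times> {..<n}"
proof -
 have *: "f ` ({i} \<times> X) = {j} \<times> X" if "!!a. f (i, a) = (j, a)" for f and i j :: nat and X :: "nat set"
  by (auto simp: that image_iff)
 show "lift1 ` endpts k n = {1} \<times> {..<k} Un {2} \<times> {..<n}" "lift2 ` endpts m n = {0} \<times> {..<m} Un {2} \<times> {..<n}"
  unfolding endpts_def image_Un by (simp_all add: *[of lift1 0 1] *[of lift1 1 2, simplified] *[of lift2 0 0] *[of lift2 1 2, simplified])
qed

lemma glue_eq: "glue (Tangle k n A) (Tangle m k A') = A' Un map_prod lift1 lift1 ` A"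
 by (force simp: glue_def)

lemma matching_image:
 assumes "matching A" "A <= E \<times> E" "inj_on t E"
 shows "matching (map_prod t t ` A)" "Domain (map_prod t t ` A) = t ` Domain A"
proof -
 have m: "sym A" "irrefl A" "single_valued A" using assms(1) by (auto simp: matching_def)
 have "sym (map_prod t t ` A)" using m(1) by (fastforce simp: sym_def)
 moreover have "irrefl (map_prod t t ` A)"
  unfolding irrefl_def
 proof (intro allI notI)
  fix a assume "(a, a) \<in> map_prod t t ` A"
  then obtain x y where xy: "(x, y) \<in> A" "t x = t y" by auto
  hence "x = y" using assms(2,3) by (meson SigmaD1 SigmaD2 inj_onD subsetD)
  thus False using xy m(2) by (simp add: irrefl_def)
 qed
 moreover have "single_valued (map_prod t t ` A)"
  unfolding single_valued_def
 proof (intro allI impI)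
  fix a b c assume "(a, b) \<in> map_prod t t ` A" "(a, c) \<in> map_prod t t ` A"
  then obtain x y x' z where xy: "(x, y) \<in> A" "(x', z) \<in> A" "t x = t x'" "b = t y" "c = t z" by auto
  hence "x = x'" using assms(2,3) by (meson SigmaD1 inj_onD subsetD)
  thus "b = c" using xy m(3) by (auto dest: single_valuedD)
 qed
 ultimately show "matching (map_prod t t ` A)" by (simp add: matching_def)
 show "Domain (map_prod t t ` A) = t ` Domain A" by force
qed

locale stacking =
 fixes m k n :: nat and A' A :: "(endpt \<times> endpt) set"
 assumes A': "planar m k A'" and A: "planar k n A"
begin

abbreviation "Gl \<equiv> glue (Tangle k n A) (Tangle m k A')"

definition MM where "MM b = (if b then map_prod lift1 lift1 ` A else A')"

lemma Dom: "Domain (MM False) = endpts m k" "Domain (MM True) = lift1 ` endpts k n"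
 using planarD(3)[OF A'] planarD(3)[OF A] by (auto simp: MM_def image_iff Domain_iff) force+

sublocale two_matchings MM
proof
 fix b
 have "inj_on lift1 (endpts k n)" using inj_lift(1) by (rule inj_on_subset) simp
 from matching_image(1)[OF planarD(2)[OF A] planarD(1)[OF A] this] show "matching (MM b)"
  using planarD(2)[OF A'] by (simp add: MM_def)
 have "finite A'" "finite A" using planarD(1)[OF A'] planarD(1)[OF A] by (meson finite_SigmaI finite_endpts finite_subset)+
 thus "finite (MM b)" by (simp add: MM_def)
qed

lemma G_eq: "G = Gl" by (simp add: G_def MM_def glue_eq)

lemma outer_iff: "outer x \<longleftrightarrow> x \<in> lift2 ` endpts m n"
 unfolding outer_def Dom lift_image by (cases x) (auto simp: mem_endpts)

definition St where "St = {(x, y). x \<in> endpts m n & y \<in> endpts m n & x ~= y & (lift2 x, lift2 y) \<in> G\<^sup>*}"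

lemma Field_Gl: "Field Gl <= {0} \<times> {..<m} Un {1} \<times> {..<k} Un {2} \<times> {..<n}"
 using planarD(1)[OF A'] planarD(1)[OF A] by (auto simp: glue_eq Field_def endpts_def)

lemma stack_St: "stack (Tangle k n A) (Tangle m k A') = Tangle m n St"
proof -
 have *: "((i, a), (j, b)) \<in> Gl\<^sup>+ \<longleftrightarrow> ((i, a), (j, b)) \<in> G\<^sup>* & (i div 2, a) \<in> endpts m n & (j div 2, b) \<in> endpts m n"
  if "i \<in> {0, 2}" "j \<in> {0, 2}" "(i, a) ~= (j, b)" for i j a b
 proof
  assume t: "((i, a), (j, b)) \<in> Gl\<^sup>+"
  hence "(i, a) \<in> Field Gl" "(j, b) \<in> Field Gl"
   using trancl_domain[of Gl] trancl_range[of Gl] unfolding Field_def by blast+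
  thus "((i, a), (j, b)) \<in> G\<^sup>* & (i div 2, a) \<in> endpts m n & (j div 2, b) \<in> endpts m n"
   using t that subsetD[OF Field_Gl, of "(i, a)"] subsetD[OF Field_Gl, of "(j, b)"]
   by (auto simp: G_eq mem_endpts)
 next
  assume "((i, a), (j, b)) \<in> G\<^sup>* & (i div 2, a) \<in> endpts m n & (j div 2, b) \<in> endpts m n"
  thus "((i, a), (j, b)) \<in> Gl\<^sup>+" using that(3) by (auto simp: G_eq rtrancl_eq_or_trancl)
 qed
 have "arcs (stack (Tangle k n A) (Tangle m k A')) = St"
 proof (intro set_eqI iffI)
  fix p assume "p \<in> arcs (stack (Tangle k n A) (Tangle m k A'))"
  then obtain i a j b where p: "p = ((i div 2, a), (j div 2, b))" "i \<in> {0, 2}" "j \<in> {0, 2}"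
   "(i, a) ~= (j, b)" "((i, a), (j, b)) \<in> Gl\<^sup>+" unfolding stack_def tangle.sel by blast
  hence e: "(i, a) = lift2 (i div 2, a)" "(j, b) = lift2 (j div 2, b)" by auto
  show "p \<in> St" using *[OF p(2-4)] p e unfolding St_def by (metis (mono_tags, lifting) case_prodI mem_Collect_eq)
 next
  fix p assume "p \<in> St"
  then obtain x y where "p = (x, y)" and xy: "x \<in> endpts m n" "y \<in> endpts m n" "x ~= y" "(lift2 x, lift2 y) \<in> G\<^sup>*"
   unfolding St_def by blast
  moreover obtain i a where "x = (i, a)" by (cases x)
  moreover obtain j b where "y = (j, b)" by (cases y)
  ultimately have p: "p = ((i, a), (j, b))" "(i, a) \<in> endpts m n" "(j, b) \<in> endpts m n" "(i, a) ~= (j, b)"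
   "((2 * i, a), (2 * j, b)) \<in> G\<^sup>*" by simp_all
  have i: "2 * i \<in> {0, 2}" "2 * j \<in> {0, 2}" using p by (auto simp: mem_endpts)
  have "((2 * i, a), (2 * j, b)) \<in> Gl\<^sup>+" using *[of "2 * i" "2 * j" a b] i p by auto
  moreover have "p = ((2 * i div 2, a), (2 * j div 2, b))" "(2 * i, a) ~= (2 * j, b)" using p by auto
  ultimately show "p \<in> arcs (stack (Tangle k n A) (Tangle m k A'))"
   using i unfolding stack_def tangle.sel mem_Collect_eq
   by (intro exI[of _ "2 * i"] exI[of _ a] exI[of _ "2 * j"] exI[of _ b] conjI)
 qed
 moreover have "stack (Tangle k n A) (Tangle m k A') = Tangle m n (arcs (stack (Tangle k n A) (Tangle m k A')))"
  by (simp only: stack_def tangle.sel)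
 ultimately show ?thesis by (simp only:)
qed

lemma matching_St: "matching St" "Domain St = endpts m n"
proof -
 have "sym St" using sym_Gs by (auto simp: sym_def St_def)
 moreover have "irrefl St" by (auto simp: irrefl_def St_def)
 moreover have "single_valued St"
  unfolding single_valued_def
 proof (intro allI impI)
  fix x y z assume "(x, y) \<in> St" "(x, z) \<in> St"
  hence "lift2 y = lift2 z"
   by (intro outer_unique[of "lift2 x"]) (auto simp: St_def outer_iff dest: injD[OF inj_lift(2)])
  thus "y = z" using inj_lift(2) by (auto dest: injD)
 qed
 ultimately show "matching St" by (simp add: matching_def)
 have "\<exists>y. (x, y) \<in> St" if x: "x \<in> endpts m n" for x
 proof -
  have "outer (lift2 x)" using x by (auto simp: outer_iff)
  then obtain z where z: "z ~= lift2 x" "outer z" "(lift2 x, z) \<in> G\<^sup>*" using outer_partner by blast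
  then obtain y where "y \<in> endpts m n" "z = lift2 y" by (auto simp: outer_iff)
  hence "x ~= y & (lift2 x, lift2 y) \<in> G\<^sup>*" using z by auto
  thus ?thesis using \<open>y \<in> _\<close> x by (intro exI[of _ y]) (simp add: St_def)
 qed
 thus "Domain St = endpts m n" by (auto simp: St_def)
qed

definition level where "level x i = {a. (i, a) \<in> G\<^sup>* `` {lift2 x}}"

lemma comp_sub: "x \<in> endpts m n ==> level x 0 <= {..<m} & level x 1 <= {..<k} & level x 2 <= {..<n}"
proof -
 assume x: "x \<in> endpts m n"
 have "p \<in> {0} \<times> {..<m} Un {1} \<times> {..<k} Un {2} \<times> {..<n}" if "(lift2 x, p) \<in> G\<^sup>*" for p
  using that
 proof (cases rule: rtranclE)
  case base
  thus ?thesis using x by (auto simp: endpts_def)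
 next
  case (step y)
  thus ?thesis using Field_Gl by (auto simp: G_eq Field_def)
 qed
 thus ?thesis by (fastforce simp: level_def)
qed

lemma card_levels: "finite X ==> finite Y ==> (i :: nat) ~= j ==> card ({i} \<times> X Un {j} \<times> Y) = card X + card (Y :: nat set)"
 by (subst card_Un_disjoint) (auto simp: card_cartesian_product)

lemma level_even:
 assumes "x \<in> endpts m n"
 shows "even (card (level x 0) + card (level x 1))" "even (card (level x 1) + card (level x 2))"
proof -
 have l: "level x 0 <= {..<m}" "level x 1 <= {..<k}" "level x 2 <= {..<n}" using comp_sub[OF assms] by auto
 have f: "finite (level x 0)" "finite (level x 1)" "finite (level x 2)"
  using l by (auto intro: finite_subset)
 have "G\<^sup>* `` {lift2 x} Int Domain (MM False) = {0} \<times> level x 0 Un {1} \<times> level x 1"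
  using l unfolding Dom by (auto simp: level_def endpts_def)
 thus "even (card (level x 0) + card (level x 1))"
  using even_comp[of "lift2 x" False] f card_levels[of _ _ 0 1] by simp
 have "G\<^sup>* `` {lift2 x} Int Domain (MM True) = {1} \<times> level x 1 Un {2} \<times> level x 2"
  using l unfolding Dom lift_image by (auto simp: level_def)
 thus "even (card (level x 1) + card (level x 2))"
  using even_comp[of "lift2 x" True] f card_levels[of _ _ 1 2] by simp
qed

text \<open>Two crossing arcs of the composite would interleave an odd number of times. Their
  components are unions of arcs in both factors, where \<open>even_interleave\<close> gives even
  counts; adding the two counts, the contributions of the glued level cancel modulo 2.\<close>

lemma St_planar: "planar m n St"
proof -
 have "noncrossing (bdpos m n) St"
  unfolding noncrossing_def
 proof (intro allI impI notI)
  fix a b c d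
  assume st: "(a, b) \<in> St" "(c, d) \<in> St"
   and pos: "bdpos m n a < bdpos m n c & bdpos m n c < bdpos m n b & bdpos m n b < bdpos m n d"
  have e: "a \<in> endpts m n" "b \<in> endpts m n" "c \<in> endpts m n" "d \<in> endpts m n" using st by (auto simp: St_def)
  have ab: "(lift2 a, lift2 b) \<in> G\<^sup>*" "(lift2 c, lift2 d) \<in> G\<^sup>*" using st by (auto simp: St_def)
  have out: "x = a | x = b" if "x \<in> endpts m n" "(lift2 a, lift2 x) \<in> G\<^sup>*" for x
  proof (rule ccontr)
   assume n: "~ (x = a | x = b)"
   hence "(a, x) \<in> St" using that e by (auto simp: St_def)
   thus False using n st matching_St(1) by (auto simp: matching_def dest: single_valuedD)
  qed
  have out': "x = c | x = d" if "x \<in> endpts m n" "(lift2 c, lift2 x) \<in> G\<^sup>*" for x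
  proof (rule ccontr)
   assume n: "~ (x = c | x = d)"
   hence "(c, x) \<in> St" using that e by (auto simp: St_def)
   thus False using n st matching_St(1) by (auto simp: matching_def dest: single_valuedD)
  qed
  have nac: "(lift2 a, lift2 c) \<notin> G\<^sup>*" using out[OF e(3)] pos by auto
  have dj: "G\<^sup>* `` {lift2 a} Int G\<^sup>* `` {lift2 c} = {}"
  proof (rule ccontr)
   assume "G\<^sup>* `` {lift2 a} Int G\<^sup>* `` {lift2 c} ~= {}"
   then obtain z where "(lift2 a, z) \<in> G\<^sup>*" "(lift2 c, z) \<in> G\<^sup>*" by blast
   thus False using nac rtrancl_trans[OF _ sym_Gs] by blast
  qed
  define p q where "p = level a" and "q = level c"
  have l: "p 0 <= {..<m}" "p 1 <= {..<k}" "p 2 <= {..<n}" "q 0 <= {..<m}" "q 1 <= {..<k}" "q 2 <= {..<n}"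
   using comp_sub[OF e(1)] comp_sub[OF e(3)] by (auto simp: p_def q_def)
  have f: "finite (p 0)" "finite (p 1)" "finite (p 2)" "finite (q 0)" "finite (q 1)" "finite (q 2)"
   using l by (auto intro: finite_subset)
  have pq: "p i Int q i = {}" for i using dj by (auto simp: p_def q_def level_def)
  have "even (\<Sum>x\<in>{0::nat} \<times> p 0 Un {1} \<times> p 1. \<Sum>y\<in>{0::nat} \<times> q 0 Un {1} \<times> q 1. if bdpos m k x < bdpos m k y then 1 else 0 :: nat)"
  proof (rule even_interleave[where M = A'])
   show "{0::nat} \<times> p 0 Un {1} \<times> p 1 <= Domain A'" "{0::nat} \<times> q 0 Un {1} \<times> q 1 <= Domain A'"
    using l by (auto simp: planarD(3)[OF A'] endpts_def)
   show "inj_on (bdpos m k) ({0::nat} \<times> p 0 Un {1} \<times> p 1 Un ({0::nat} \<times> q 0 Un {1} \<times> q 1))"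
    by (rule inj_on_subset[OF inj_bdpos]) (use l in \<open>auto simp: endpts_def\<close>)
   fix x y assume xy: "(x, y) \<in> A'"
   hence M: "(x, y) \<in> MM False" by (simp add: MM_def)
   have y: "y \<in> endpts m k" using xy planarD(1)[OF A'] by auto
   show "x \<in> {0::nat} \<times> p 0 Un {1} \<times> p 1 ==> y \<in> {0::nat} \<times> p 0 Un {1} \<times> p 1"
    using comp_closed[OF M, of "lift2 a"] y by (cases y) (auto simp: p_def level_def mem_endpts)
   show "x \<in> {0::nat} \<times> q 0 Un {1} \<times> q 1 ==> y \<in> {0::nat} \<times> q 0 Un {1} \<times> q 1"
    using comp_closed[OF M, of "lift2 c"] y by (cases y) (auto simp: q_def level_def mem_endpts)
  qed (use f pq planarD[OF A'] in auto)
  hence 1: "even (below (p 0) (q 0) + card (p 0) * card (q 1) + below (q 1) (p 1))"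
   unfolding levels_interleave[OF l(1,4,2,5)] .
  have "even (\<Sum>x\<in>{0::nat} \<times> p 1 Un {1} \<times> p 2. \<Sum>y\<in>{0::nat} \<times> q 1 Un {1} \<times> q 2. if bdpos k n x < bdpos k n y then 1 else 0 :: nat)"
  proof (rule even_interleave[where M = A])
   show "{0::nat} \<times> p 1 Un {1} \<times> p 2 <= Domain A" "{0::nat} \<times> q 1 Un {1} \<times> q 2 <= Domain A"
    using l by (auto simp: planarD(3)[OF A] endpts_def)
   show "inj_on (bdpos k n) ({0::nat} \<times> p 1 Un {1} \<times> p 2 Un ({0::nat} \<times> q 1 Un {1} \<times> q 2))"
    by (rule inj_on_subset[OF inj_bdpos]) (use l in \<open>auto simp: endpts_def\<close>)
   fix x y assume xy: "(x, y) \<in> A"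
   hence M: "(lift1 x, lift1 y) \<in> MM True" by (force simp: MM_def)
   have y: "y \<in> endpts k n" using xy planarD(1)[OF A] by auto
   show "x \<in> {0::nat} \<times> p 1 Un {1} \<times> p 2 ==> y \<in> {0::nat} \<times> p 1 Un {1} \<times> p 2"
    using comp_closed[OF M, of "lift2 a"] y by (cases y) (auto simp: p_def level_def mem_endpts numeral_2_eq_2)
   show "x \<in> {0::nat} \<times> q 1 Un {1} \<times> q 2 ==> y \<in> {0::nat} \<times> q 1 Un {1} \<times> q 2"
    using comp_closed[OF M, of "lift2 c"] y by (cases y) (auto simp: q_def level_def mem_endpts numeral_2_eq_2)
  qed (use f pq planarD[OF A] in auto)
  hence 2: "even (below (p 1) (q 1) + card (p 1) * card (q 2) + below (q 2) (p 2))"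
   unfolding levels_interleave[OF l(2,5,3,6)] .
  \<comment> \<open>The glued points are read in opposite orders by the two factors, so the two
    counts are complementary.\<close>
  have 3: "below (p 1) (q 1) + below (q 1) (p 1) = card (p 1) * card (q 1)"
   by (rule below_swap) (use f pq in auto)
  have 4: "even (card (p 0) + card (p 1))" "even (card (q 1) + card (q 2))"
   using level_even[OF e(1)] level_even[OF e(3)] by (simp_all add: p_def q_def)
  have "even (card (p 0)) = even (card (p 1))" "even (card (q 1)) = even (card (q 2))"
   using 4 by auto
  moreover have "even (below (p 1) (q 1)) = (even (below (q 1) (p 1)) = even (card (p 1) * card (q 1)))"
   using 3 by (metis even_add)
  ultimately have 5: "even (below (p 0) (q 0) + card (p 0) * card (q 2) + below (q 2) (p 2))"
   using 1 2 by (auto simp: even_add even_mult_iff)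
  have S: "{0::nat} \<times> p 0 Un {1} \<times> p 2 = {a, b}"
  proof (intro set_eqI iffI)
   fix x assume "x \<in> {0::nat} \<times> p 0 Un {1} \<times> p 2"
   thus "x \<in> {a, b}" using l out[of x] by (auto simp: p_def level_def mem_endpts)
  next
   fix x assume "x \<in> {a, b}"
   thus "x \<in> {0::nat} \<times> p 0 Un {1} \<times> p 2" using e ab by (cases x) (auto simp: p_def level_def mem_endpts)
  qed
  have T: "{0::nat} \<times> q 0 Un {1} \<times> q 2 = {c, d}"
  proof (intro set_eqI iffI)
   fix x assume "x \<in> {0::nat} \<times> q 0 Un {1} \<times> q 2"
   thus "x \<in> {c, d}" using l out'[of x] by (auto simp: q_def level_def mem_endpts)
  next
   fix x assume "x \<in> {c, d}"
   thus "x \<in> {0::nat} \<times> q 0 Un {1} \<times> q 2" using e ab by (cases x) (auto simp: q_def level_def mem_endpts)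
  qed
  have "a ~= b" "c ~= d" using st by (auto simp: St_def)
  moreover have "even (\<Sum>x\<in>{a, b}. \<Sum>y\<in>{c, d}. if bdpos m n x < bdpos m n y then 1 else 0 :: nat)"
   using 5 unfolding levels_interleave[OF l(1,4,3,6), symmetric] S T .
  ultimately show False using pos by simp
 qed
 thus ?thesis using matching_St by (auto simp: planar_def St_def)
qed

text \<open>Arcs of a composite form a perfect matching, so it is enough to exhibit connected pairs
  at all endpoints. Circles are excluded by connecting each glued point to an outer level.\<close>

lemma stack_eqI:
 assumes C: "!!x. x \<in> endpts m n ==> \<exists>y. (x, y) \<in> C"
  "!!x y. (x, y) \<in> C ==> x \<in> endpts m n & y \<in> endpts m n & x ~= y & (lift2 x, lift2 y) \<in> Gl\<^sup>*"
  and circ: "!!a. a < k ==> \<exists>z. fst z ~= 1 & ((1, a), z) \<in> Gl\<^sup>*"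
 shows "stack (Tangle k n A) (Tangle m k A') = Tangle m n C & circles (Tangle k n A) (Tangle m k A') = 0"
proof
 have "C <= St" using C(2) by (auto simp: St_def G_eq)
 moreover have "St <= C"
 proof
  fix p assume p: "p \<in> St"
  obtain x y where xy: "p = (x, y)" by (cases p)
  then obtain y' where y': "(x, y') \<in> C" using C(1)[of x] p by (auto simp: St_def)
  hence "y' = y" using \<open>C <= St\<close> p xy matching_St(1) by (auto simp: matching_def dest: single_valuedD)
  thus "p \<in> C" using y' xy by simp
 qed
 ultimately show "stack (Tangle k n A) (Tangle m k A') = Tangle m n C" by (simp add: stack_St)
 have "{S. \<exists>a < k. S = Gl\<^sup>* `` {(1, a)} & S <= {1} \<times> UNIV} = {}"
  using circ by fastforce
 thus "circles (Tangle k n A) (Tangle m k A') = 0" by (simp add: circles_def)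
qed

end

section \<open>Planarity of juxtaposition, rotation and the elementary tangles\<close>

lemma noncrossing_mono:
 assumes "noncrossing g A" "!!x y. x \<in> Field A ==> y \<in> Field A ==> f x < f y ==> g x < g y"
 shows "noncrossing f A"
 unfolding noncrossing_def
proof (intro allI impI notI)
 fix a b c d assume ab: "(a, b) \<in> A" "(c, d) \<in> A" and "f a < f c & f c < f b & f b < f d"
 hence "g a < g c & g c < g b & g b < g d"
  using assms(2) FieldI1[OF ab(1)] FieldI2[OF ab(1)] FieldI1[OF ab(2)] FieldI2[OF ab(2)] by blast
 thus False using noncrossingD[OF assms(1) ab] by blast
qed

lemma noncrossing_Un:
 assumes "noncrossing f A" "noncrossing f B" "!!x. x \<in> Field A ==> f x < l | h <= f x" "!!x. x \<in> Field B ==> l <= f x & f x < h"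
 shows "noncrossing f (A Un B)"
 unfolding noncrossing_def
proof (intro allI impI notI)
 fix a b c d assume ab: "(a, b) \<in> A Un B" "(c, d) \<in> A Un B" and x: "f a < f c & f c < f b & f b < f d"
 consider "(a, b) \<in> A" "(c, d) \<in> A" | "(a, b) \<in> A" "(c, d) \<in> B" | "(a, b) \<in> B" "(c, d) \<in> A" | "(a, b) \<in> B" "(c, d) \<in> B"
  using ab by blast
 thus False
 proof cases
  case 1 thus False using noncrossingD[OF assms(1)] x by blast
 next
  case 2
  have "f b < l | h <= f b" "l <= f c" "f d < h"
   using assms(3)[OF FieldI2[OF 2(1)]] assms(4)[OF FieldI1[OF 2(2)]] assms(4)[OF FieldI2[OF 2(2)]] by auto
  thus False using x by linarith
 next
  case 3
  have "f c < l | h <= f c" "l <= f a" "f b < h"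
   using assms(3)[OF FieldI1[OF 3(2)]] assms(4)[OF FieldI1[OF 3(1)]] assms(4)[OF FieldI2[OF 3(1)]] by auto
  thus False using x by linarith
 next
  case 4 thus False using noncrossingD[OF assms(2)] x by blast
 qed
qed

lemma noncrossing_image: "noncrossing (%x. f (t x)) A ==> noncrossing f (map_prod t t ` A)"
 unfolding noncrossing_def by fastforce

lemma noncrossing_rainbow: "(!!x y. (x, y) \<in> A ==> f x + f y = s) ==> noncrossing f A"
 unfolding noncrossing_def
proof (intro allI impI notI)
 fix a b c d assume r: "!!x y. (x, y) \<in> A ==> f x + f y = s" and "(a, b) \<in> A" "(c, d) \<in> A"
  and "f a < f c & f c < f b & f b < f d"
 thus False using r[of a b] r[of c d] by linarith
qed

lemma matching_Un:
 assumes "matching A" "matching B" "Domain A Int Domain B = {}"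
 shows "matching (A Un B)"
proof -
 have "sym (A Un B)" using assms by (auto simp: matching_def sym_def)
 moreover have "irrefl (A Un B)" using assms by (auto simp: matching_def irrefl_def)
 moreover have "single_valued (A Un B)" using assms unfolding matching_def single_valued_def by blast
 ultimately show ?thesis by (simp add: matching_def)
qed

definition bshift :: "nat => nat => endpt => endpt" where
 "bshift m n = (%(i, a). (i, a + (if i = 0 then m else n)))"

definition turn :: "nat => nat => endpt => endpt" where
 "turn m n = (%(i, a). if i = 0 then (1, m - 1 - a) else (0, n - 1 - a))"

lemma image_pairs: "{(t x, t y) | x y. (x, y) \<in> A} = map_prod t t ` A"
 by force

lemma beside_eq: "beside (Tangle m n A) (Tangle m' n' A')
  = Tangle (m + m') (n + n') (A Un map_prod (bshift m n) (bshift m n) ` A')"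
 unfolding beside_def Let_def tangle.sel image_pairs bshift_def ..

lemma rotate_eq: "rotate_tangle (Tangle m n A) = Tangle n m (map_prod (turn m n) (turn m n) ` A)"
 unfolding rotate_tangle_def Let_def tangle.sel image_pairs turn_def ..

lemma planar_Field: "planar m n A ==> Field A <= endpts m n"
 using planarD(1) by (fastforce simp: Field_def)

text \<open>Along the boundary the second tangle occupies one interval, inserted between the bottom
  and the top of the first.\<close>

lemma planar_beside:
 assumes "planar m n A" "planar m' n' A'"
 shows "planar (m + m') (n + n') (A Un map_prod (bshift m n) (bshift m n) ` A')"
proof -
 let ?s = "bshift m n" and ?p = "bdpos (m + m') (n + n')"
 note A = planarD[OF assms(1)] and A' = planarD[OF assms(2)]
 have i: "inj_on ?s (endpts m' n')" by (auto simp: inj_on_def bshift_def split: if_splits)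
 note im = matching_image[OF A'(2,1) i]
 have d: "endpts m n Int ?s ` endpts m' n' = {}" by (auto simp: endpts_def bshift_def)
 have sub: "?s ` endpts m' n' <= endpts (m + m') (n + n')" "endpts m n <= endpts (m + m') (n + n')"
  by (auto simp: endpts_def bshift_def)
 have u: "endpts (m + m') (n + n') <= endpts m n Un ?s ` endpts m' n'"
 proof
  fix x assume x: "x \<in> endpts (m + m') (n + n')"
  show "x \<in> endpts m n Un ?s ` endpts m' n'"
  proof (cases "x \<in> endpts m n")
   case False
   obtain i a where ia: "x = (i, a)" by (cases x)
   hence "x = ?s (i, a - (if i = 0 then m else n))" "(i, a - (if i = 0 then m else n)) \<in> endpts m' n'"
    using x False by (auto simp: mem_endpts bshift_def)
   thus ?thesis by blast
  qed simp
 qed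
 have p1: "?p x = (if bdpos m n x < m then bdpos m n x else bdpos m n x + (m' + n'))" if "x \<in> endpts m n" for x
  using that by (cases x) (auto simp: bdpos_def mem_endpts)
 have p2: "?p (?s x) = m + bdpos m' n' x" "bdpos m' n' x < m' + n'" if "x \<in> endpts m' n'" for x
  using that by (cases x; auto simp: bdpos_def mem_endpts bshift_def)+
 have F: "Field A <= endpts m n" "Field A' <= endpts m' n'" using planar_Field assms by auto
 have F': "x \<in> ?s ` endpts m' n'" if "x \<in> Field (map_prod ?s ?s ` A')" for x
  using that F(2) unfolding Field_def by auto
 have "noncrossing ?p (A Un map_prod ?s ?s ` A')"
 proof (rule noncrossing_Un[where l = m and h = "m + (m' + n')"])
  show "noncrossing ?p A"
  proof (rule noncrossing_mono[OF A(4)])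
   fix x y assume "x \<in> Field A" "y \<in> Field A" "?p x < ?p y"
   thus "bdpos m n x < bdpos m n y"
    using p1[OF subsetD[OF F(1) \<open>x \<in> _\<close>]] p1[OF subsetD[OF F(1) \<open>y \<in> _\<close>]] by (simp split: if_splits)
  qed
  show "noncrossing ?p (map_prod ?s ?s ` A')"
  proof (rule noncrossing_image, rule noncrossing_mono[OF A'(4)])
   fix x y assume "x \<in> Field A'" "y \<in> Field A'" "?p (?s x) < ?p (?s y)"
   thus "bdpos m' n' x < bdpos m' n' y"
    using p2(1)[OF subsetD[OF F(2) \<open>x \<in> _\<close>]] p2(1)[OF subsetD[OF F(2) \<open>y \<in> _\<close>]] by linarith
  qed
  fix x
  show "?p x < m | m + (m' + n') <= ?p x" if "x \<in> Field A"
   using p1[OF subsetD[OF F(1) that]] by (auto split: if_splits)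
  show "x \<in> Field (map_prod ?s ?s ` A') ==> m <= ?p x & ?p x < m + (m' + n')"
   using F'[of x] by (auto simp: p2)
 qed
 moreover have "matching (A Un map_prod ?s ?s ` A')"
  by (rule matching_Un[OF A(2) im(1)]) (use d in \<open>simp add: A(3) A'(3) im(2)\<close>)
 moreover have "Domain (A Un map_prod ?s ?s ` A') = endpts (m + m') (n + n')"
  unfolding Domain_Un_eq im(2) A(3) A'(3) using sub u by blast
 moreover have "A Un map_prod ?s ?s ` A' <= endpts (m + m') (n + n') \<times> endpts (m + m') (n + n')"
 proof -
  have "map_prod ?s ?s ` A' <= ?s ` endpts m' n' \<times> ?s ` endpts m' n'" using A'(1) by auto
  thus ?thesis using A(1) sub by blast
 qed
 ultimately show ?thesis unfolding planar_def by (intro conjI)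
qed

text \<open>Rotation by a half turn shifts the boundary positions cyclically, so four interleaving
  points stay interleaving up to a cyclic change of the starting point.\<close>

lemma rotated_crossing:
 fixes m n :: nat
 defines "f \<equiv> %x. if x < m then x + n else x - m"
 assumes "a < m + n" "b < m + n" "c < m + n" "d < m + n" "f a < f c & f c < f b & f b < f d"
 shows "(a < c & c < b & b < d) | (c < b & b < d & d < a) | (b < d & d < a & a < c) | (d < a & a < c & c < b)"
proof -
 have w: "y < m" if "x < m" "f x < f y" "y < m + n" for x y
  using that by (simp add: f_def split: if_splits)
 have mono: "x < y" if "f x < f y" "x < m \<longleftrightarrow> y < m" for x y
  using that by (auto simp: f_def split: if_splits)
 have s: "f a < f c" "f c < f b" "f b < f d" "f a < f b" "f c < f d" "f a < f d" using assms(6) by auto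
 consider "a < m" "c < m" "b < m" "d < m" | "~ a < m" "c < m" "b < m" "d < m" | "~ a < m" "~ c < m" "b < m" "d < m"
  | "~ a < m" "~ c < m" "~ b < m" "d < m" | "~ a < m" "~ c < m" "~ b < m" "~ d < m"
  using w[OF _ s(1) assms(4)] w[OF _ s(2) assms(3)] w[OF _ s(3) assms(5)] by blast
 thus ?thesis
  by cases (use mono[OF s(1)] mono[OF s(2)] mono[OF s(3)] mono[OF s(4)] mono[OF s(5)] mono[OF s(6)] in \<open>simp; linarith\<close>)+
qed

lemma planar_rotate:
 assumes "planar m n A"
 shows "planar n m (map_prod (turn m n) (turn m n) ` A)"
proof -
 let ?t = "turn m n"
 note A = planarD[OF assms]
 have i: "inj_on ?t (endpts m n)" by (auto simp: inj_on_def turn_def endpts_def)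
 note im = matching_image[OF A(2,1) i]
 have "?t ` endpts m n = endpts n m"
 proof (intro set_eqI iffI)
  fix x assume "x \<in> ?t ` endpts m n" thus "x \<in> endpts n m" by (auto simp: turn_def endpts_def)
 next
  fix x assume x: "x \<in> endpts n m"
  obtain i a where ia: "x = (i, a)" by (cases x)
  have "x = ?t (turn n m x)" "turn n m x \<in> endpts m n" using x ia by (auto simp: turn_def mem_endpts)
  thus "x \<in> ?t ` endpts m n" by blast
 qed
 note im' = im(2)[unfolded A(3) this]
 have p: "bdpos n m (?t x) = (if bdpos m n x < m then bdpos m n x + n else bdpos m n x - m)" "bdpos m n x < m + n"
  if "x \<in> endpts m n" for x
  using that by (cases x; auto simp: bdpos_def mem_endpts turn_def)+
 have "noncrossing (%x. bdpos n m (?t x)) A"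
  unfolding noncrossing_def
 proof (intro allI impI notI)
  fix a b c d
  assume ab: "(a, b) \<in> A" "(c, d) \<in> A"
   and x: "bdpos n m (?t a) < bdpos n m (?t c) & bdpos n m (?t c) < bdpos n m (?t b) & bdpos n m (?t b) < bdpos n m (?t d)"
  have e: "a \<in> endpts m n" "b \<in> endpts m n" "c \<in> endpts m n" "d \<in> endpts m n" using ab A(1) by auto
  have s: "(b, a) \<in> A" "(d, c) \<in> A" using ab A(2) by (auto simp: matching_def dest: symD)
  note nc = noncrossingD[OF A(4) ab] noncrossingD[OF A(4) ab(2) s(1)] noncrossingD[OF A(4) s] noncrossingD[OF A(4) s(2) ab(1)]
  show False
   using rotated_crossing[of "bdpos m n a" m n "bdpos m n b" "bdpos m n c" "bdpos m n d"]
    x nc p(2)[OF e(1)] p(2)[OF e(2)] p(2)[OF e(3)] p(2)[OF e(4)]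
   unfolding p(1)[OF e(1)] p(1)[OF e(2)] p(1)[OF e(3)] p(1)[OF e(4)] by argo
 qed
 hence "noncrossing (bdpos n m) (map_prod ?t ?t ` A)" by (rule noncrossing_image)
 moreover have "map_prod ?t ?t ` A <= endpts n m \<times> endpts n m"
  using A(1) \<open>?t ` endpts m n = endpts n m\<close> by fastforce
 ultimately show ?thesis using im(1) im' by (simp add: planar_def)
qed

lemma arcs_ev: "ev_tangle m = Tangle (2 * m) 0 {((0, i), (0, j)) | i j. i + j + 1 = 2 * m}"
proof -
 have "sym_arcs {((0 :: nat, i), (0 :: nat, 2 * m - 1 - i)) | i. i < m} = {((0, i), (0, j)) | i j. i + j + 1 = 2 * m}" (is "?L = ?R")
 proof (intro set_eqI iffI)
  fix x assume "x \<in> ?L" thus "x \<in> ?R" by (auto simp: sym_arcs_def)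
 next
  fix x assume "x \<in> ?R"
  then obtain i j where x: "x = ((0, i), (0, j))" "i + j + 1 = 2 * m" by blast
  show "x \<in> ?L"
  proof (cases "i < m")
   case True
   hence "j = 2 * m - 1 - i" using x by linarith
   thus ?thesis using x True by (auto simp: sym_arcs_def)
  next
   case False
   hence "i = 2 * m - 1 - j" "j < m" using x by linarith+
   thus ?thesis using x by (auto simp: sym_arcs_def)
  qed
 qed
 thus ?thesis by (simp add: ev_tangle_def)
qed

lemma arcs_coev: "coev_tangle m = Tangle 0 (2 * m) {((1, i), (1, j)) | i j. i + j + 1 = 2 * m}"
proof -
 have "sym_arcs {((1 :: nat, i), (1 :: nat, 2 * m - 1 - i)) | i. i < m} = {((1, i), (1, j)) | i j. i + j + 1 = 2 * m}" (is "?L = ?R")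
 proof (intro set_eqI iffI)
  fix x assume "x \<in> ?L" thus "x \<in> ?R" by (auto simp: sym_arcs_def)
 next
  fix x assume "x \<in> ?R"
  then obtain i j where x: "x = ((1, i), (1, j))" "i + j + 1 = 2 * m" by blast
  show "x \<in> ?L"
  proof (cases "i < m")
   case True
   hence "j = 2 * m - 1 - i" using x by linarith
   thus ?thesis using x True by (auto simp: sym_arcs_def)
  next
   case False
   hence "i = 2 * m - 1 - j" "j < m" using x by linarith+
   thus ?thesis using x by (auto simp: sym_arcs_def)
  qed
 qed
 thus ?thesis by (simp add: coev_tangle_def)
qed

lemma arcs_id: "id_tangle m = Tangle m m {((i, a), (1 - i, a)) | i a. i < 2 & a < m}"
proof -
 have "sym_arcs {((0 :: nat, i), (1 :: nat, i)) | i. i < m} = {((i, a), (1 - i, a)) | i a. i < 2 & a < m}"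
  by (auto simp: sym_arcs_def less_2_cases_iff)
 thus ?thesis by (simp add: id_tangle_def)
qed

lemma planar_ev: "planar (2 * m) 0 {((0, i), (0, j)) | i j. i + j + 1 = 2 * m}"
proof -
 let ?A = "{((0 :: nat, i), (0 :: nat, j)) | i j. i + j + 1 = 2 * m}"
 have "noncrossing (bdpos (2 * m) 0) ?A"
  by (rule noncrossing_rainbow[of _ _ "2 * m - 1"]) (auto simp: bdpos_def)
 moreover have "matching ?A"
 proof -
  have "sym ?A" by (rule symI) auto
  moreover have "irrefl ?A" unfolding irrefl_def by clarsimp presburger
  moreover have "single_valued ?A" unfolding single_valued_def by auto
  ultimately show ?thesis by (simp add: matching_def)
 qed
 moreover have "x \<in> Domain ?A" if xin: "x \<in> endpts (2 * m) 0" for x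
 proof -
  obtain i where "x = (0, i)" "i < 2 * m" using xin by (cases x) (auto simp: mem_endpts)
  hence "(x, (0, 2 * m - 1 - i)) \<in> ?A" by auto
  thus ?thesis by blast
 qed
 moreover have "?A <= endpts (2 * m) 0 \<times> endpts (2 * m) 0" by (auto simp: endpts_def)
 ultimately show ?thesis unfolding planar_def by blast
qed

lemma planar_coev: "planar 0 (2 * m) {((1, i), (1, j)) | i j. i + j + 1 = 2 * m}"
proof -
 let ?A = "{((1 :: nat, i), (1 :: nat, j)) | i j. i + j + 1 = 2 * m}"
 have "noncrossing (bdpos 0 (2 * m)) ?A"
  by (rule noncrossing_rainbow[of _ _ "2 * m - 1"]) (auto simp: bdpos_def)
 moreover have "matching ?A"
 proof -
  have "sym ?A" by (rule symI) auto
  moreover have "irrefl ?A" unfolding irrefl_def by clarsimp presburger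
  moreover have "single_valued ?A" unfolding single_valued_def by auto
  ultimately show ?thesis by (simp add: matching_def)
 qed
 moreover have "x \<in> Domain ?A" if xin: "x \<in> endpts 0 (2 * m)" for x
 proof -
  obtain i where "x = (1, i)" "i < 2 * m" using xin by (cases x) (auto simp: mem_endpts)
  hence "(x, (1, 2 * m - 1 - i)) \<in> ?A" by auto
  thus ?thesis by blast
 qed
 moreover have "?A <= endpts 0 (2 * m) \<times> endpts 0 (2 * m)" by (auto simp: endpts_def)
 ultimately show ?thesis unfolding planar_def by blast
qed

lemma planar_id: "planar m m {((i, a), (1 - i, a)) | i a. i < 2 & a < m}"
proof -
 let ?A = "{((i :: nat, a), (1 - i, a)) | i a. i < 2 & a < m}"
 have "noncrossing (bdpos m m) ?A"
  by (rule noncrossing_rainbow[of _ _ "2 * m - 1"]) (auto simp: bdpos_def less_2_cases_iff)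
 moreover have "matching ?A"
 proof -
  have "sym ?A" by (rule symI) (auto simp: less_2_cases_iff)
  moreover have "irrefl ?A" unfolding irrefl_def by auto presburger
  moreover have "single_valued ?A" unfolding single_valued_def by auto
  ultimately show ?thesis by (simp add: matching_def)
 qed
 moreover have "Domain ?A = endpts m m" by (auto simp: endpts_def less_2_cases_iff Domain_iff)
 moreover have "?A <= endpts m m \<times> endpts m m" by (auto simp: endpts_def less_2_cases_iff)
 ultimately show ?thesis unfolding planar_def by blast
qed

subsection \<open>Linear extension\<close>

lemma lookup_fscale[simp]: "lkp (fscale c v) x = c * lkp v x"
 by (simp add: fscale_def Poly_Mapping.map.rep_eq when_def)

lemma lookup_bvec: "lkp (bvec x) y = (if x = y then 1 else 0)"
 by (simp add: bvec_def lookup_single when_def)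

lemma lookup_sum_pm: "lkp (sum f S) x = (\<Sum>i\<in>S. lkp (f i) x)"
 by (induction S rule: infinite_finite_induct) (simp_all add: lookup_add)

lemma fscale_simps[simp]: "fscale c 0 = 0" "fscale 0 v = 0" "fscale 1 v = v" "fscale c (fscale d v) = fscale (c * d) v"
 by (rule poly_mapping_eqI; simp)+

lemma fscale_add: "fscale c (v + w) = fscale c v + fscale c w"
 by (rule poly_mapping_eqI) (simp add: lookup_add algebra_simps)

lemma fscale_add_left: "fscale (c + d) v = fscale c v + fscale d v"
 by (rule poly_mapping_eqI) (simp add: lookup_add algebra_simps)

lemma fscale_minus: "fscale (- 1) v = - v"
 by (rule poly_mapping_eqI) simp

lemma fscale_sum: "fscale c (sum f S) = (\<Sum>x\<in>S. fscale c (f x))"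
 by (rule poly_mapping_eqI) (simp add: lookup_sum_pm sum_distrib_left)

lemma lext_superset: "finite S ==> pkeys v <= S ==> lext f v = (\<Sum>x\<in>S. fscale (lkp v x) (f x))"
 unfolding lext_def by (rule sum.mono_neutral_left) (auto simp: in_keys_iff)

lemma lext_bvec[simp]: "lext f (bvec x) = f x"
proof -
 have "pkeys (bvec x) <= {x}" by (simp add: bvec_def)
 from lext_superset[OF _ this, of f] show ?thesis by (simp add: lookup_bvec)
qed

lemma lext_add: "lext f (v + w) = lext f v + lext f w"
proof -
 let ?S = "pkeys v Un pkeys w"
 have "pkeys (v + w) <= ?S" by (rule keys_add)
 thus ?thesis
  by (simp add: lext_superset[of ?S] lookup_add fscale_add_left sum.distrib)
qed

lemma lext_fscale: "lext f (fscale c v) = fscale c (lext f v)"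
proof -
 have "pkeys (fscale c v) <= pkeys v" by (auto simp: in_keys_iff)
 thus ?thesis
  by (simp add: lext_superset[of "pkeys v"] fscale_sum)
qed

lemma lext_zero[simp]: "lext f 0 = 0" by (simp add: lext_def)

lemma lext_fun_add: "lext (%x. f x + g x) v = lext f v + lext g v"
 by (simp add: lext_def fscale_add sum.distrib)

lemma lext_fun_fscale: "lext (%x. fscale c (f x)) v = fscale c (lext f v)"
 by (simp add: lext_def fscale_sum mult.commute)

lemma lext2_linear:
 "lext2 f (v + v') w = lext2 f v w + lext2 f v' w" "lext2 f v (w + w') = lext2 f v w + lext2 f v w'"
 "lext2 f (fscale c v) w = fscale c (lext2 f v w)" "lext2 f v (fscale c w) = fscale c (lext2 f v w)"
 "lext2 f 0 w = 0" "lext2 f v 0 = 0"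
 by (simp_all add: lext2_def lext_add lext_fscale lext_fun_add lext_fun_fscale) (simp add: lext_def)

lemma lext2_bvec[simp]: "lext2 f (bvec x) (bvec y) = f x y"
 by (simp add: lext2_def)

lemma vec_expand: "v = (\<Sum>x\<in>pkeys v. fscale (lkp v x) (bvec x))"
proof (rule poly_mapping_eqI)
 fix k
 have "(\<Sum>x\<in>pkeys v. lkp v x * (if x = k then 1 else 0)) = lkp v k"
  by (simp add: in_keys_iff if_distrib[of "(*) _"] cong: if_cong)
 thus "lkp v k = lkp (\<Sum>x\<in>pkeys v. fscale (lkp v x) (bvec x)) k"
  by (simp add: lookup_sum_pm lookup_bvec)
qed

lemma fspan_zero[simp]: "0 \<in> fspan B" by (simp add: fspan_def)

lemma fspan_add: "v \<in> fspan B ==> w \<in> fspan B ==> v + w \<in> fspan B"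
 unfolding fspan_def using keys_add[of v w] by auto

lemma fspan_fscale: "v \<in> fspan B ==> fscale c v \<in> fspan B"
 unfolding fspan_def by (auto simp: in_keys_iff)

lemma fspan_diff: "v \<in> fspan B ==> w \<in> fspan B ==> v - w \<in> fspan B"
 using fspan_add[of v B "fscale (- 1) w"] fspan_fscale[of w B "- 1"] by (simp add: fscale_minus)

lemma fspan_bvec[simp]: "bvec x \<in> fspan B \<longleftrightarrow> x \<in> B" by (simp add: fspan_def bvec_def)

lemma fspan_sum: "(!!x. x \<in> S ==> f x \<in> fspan B) ==> sum f S \<in> fspan B"
 by (induction S rule: infinite_finite_induct) (auto intro: fspan_add)

lemma fspan_lext: "v \<in> fspan B ==> (!!x. x \<in> B ==> f x \<in> fspan B') ==> lext f v \<in> fspan B'"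
 unfolding lext_def by (rule fspan_sum, rule fspan_fscale) (auto simp: fspan_def)

lemma fspan_induct [consumes 1, case_names zero add]:
 assumes "v \<in> fspan B" "P 0" "!!v c x. v \<in> fspan B ==> P v ==> x \<in> B ==> P (fscale c (bvec x) + v)"
 shows "P v"
proof -
 have *: "P (\<Sum>x\<in>S. fscale (lkp v x) (bvec x))" if "finite S" "S <= B" for S
  using that
 proof (induction S rule: finite_induct)
  case (insert x S)
  have "(\<Sum>x\<in>S. fscale (lkp v x) (bvec x)) \<in> fspan B"
   by (rule fspan_sum, rule fspan_fscale) (use insert in auto)
  thus ?case using insert assms(3) by simp
 qed (simp add: assms(2))
 have "P (\<Sum>x\<in>pkeys v. fscale (lkp v x) (bvec x))"
  by (rule *) (use assms(1) in \<open>auto simp: fspan_def\<close>)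
 thus ?thesis by (simp only: vec_expand[symmetric])
qed

subsection \<open>The Temperley--Lieb category\<close>

lemma TL_induct [consumes 1, case_names zero add]:
 assumes "u \<in> TL m n" "P 0"
  "!!u c A. u \<in> TL m n ==> P u ==> planar m n A ==> P (fscale c (bvec (Tangle m n A)) + u)"
 shows "P u"
 using assms(1) unfolding TL_def
 by (induction rule: fspan_induct) (use assms(2,3) in \<open>auto simp: TL_def planar_tangles_eq\<close>)

lemma bvec_TL: "planar m n A ==> bvec (Tangle m n A) \<in> TL m n"
 by (simp add: TL_def planar_tangles_eq)

lemma TL_comp: "v \<in> TL k n ==> u \<in> TL m k ==> tl_comp r v u \<in> TL m n"
 unfolding tl_comp_def lext2_def TL_def
proof (rule fspan_lext, assumption, rule fspan_lext, assumption)
 fix D D' assume "D \<in> planar_tangles k n" "D' \<in> planar_tangles m k"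
 then obtain A A' where D: "D = Tangle k n A" "D' = Tangle m k A'" "planar k n A" "planar m k A'"
  by (auto simp: planar_tangles_eq)
 interpret stacking m k n A' A using D by unfold_locales auto
 show "(if bottoms D = tops D' then fscale ((- qroot r - inverse (qroot r)) ^ circles D D') (bvec (stack D D')) else 0)
  \<in> fspan (planar_tangles m n)"
  using St_planar by (auto intro!: fspan_fscale simp: D stack_St planar_tangles_eq)
qed

lemma TL_tensor: "u \<in> TL m n ==> v \<in> TL m' n' ==> u \<otimes>\<^sub>T v \<in> TL (m + m') (n + n')"
 unfolding tl_tensor_def lext2_def TL_def
 by (rule fspan_lext, assumption, rule fspan_lext, assumption)
  (auto simp: planar_tangles_eq beside_eq planar_beside)

lemma TL_rot: "u \<in> TL m n ==> tl_rot u \<in> TL n m"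
 unfolding tl_rot_def TL_def
 by (rule fspan_lext, assumption) (auto simp: planar_tangles_eq rotate_eq planar_rotate)

lemma TL_id[simp]: "tl_id m \<in> TL m m" "tl_ev m \<in> TL (2 * m) 0" "tl_coev m \<in> TL 0 (2 * m)"
 unfolding tl_id_def tl_ev_def tl_coev_def arcs_id arcs_ev arcs_coev
 using bvec_TL planar_id planar_ev planar_coev by blast+

lemma TL_lin: "u \<in> TL m n ==> v \<in> TL m n ==> u + v \<in> TL m n" "u \<in> TL m n ==> fscale c u \<in> TL m n"
 "u \<in> TL m n ==> v \<in> TL m n ==> u - v \<in> TL m n" "0 \<in> TL m n"
 unfolding TL_def by (simp_all add: fspan_add fspan_fscale fspan_diff)

lemma tl_tensor_bvec: "bvec D \<otimes>\<^sub>T bvec D' = bvec (beside D D')"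
 by (simp add: tl_tensor_def)

lemma tl_comp_lin: "tl_comp r (u + u') v = tl_comp r u v + tl_comp r u' v" "tl_comp r u (v + v') = tl_comp r u v + tl_comp r u v'"
 "tl_comp r (fscale c u) v = fscale c (tl_comp r u v)" "tl_comp r u (fscale c v) = fscale c (tl_comp r u v)"
 "tl_comp r 0 v = 0" "tl_comp r u 0 = 0"
 unfolding tl_comp_def lext2_linear by (rule refl)+

lemma tl_tensor_lin: "(u + u') \<otimes>\<^sub>T v = u \<otimes>\<^sub>T v + u' \<otimes>\<^sub>T v" "u \<otimes>\<^sub>T (v + v') = u \<otimes>\<^sub>T v + u \<otimes>\<^sub>T v'"
 "fscale c u \<otimes>\<^sub>T v = fscale c (u \<otimes>\<^sub>T v)" "u \<otimes>\<^sub>T fscale c v = fscale c (u \<otimes>\<^sub>T v)"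
 "0 \<otimes>\<^sub>T v = 0" "u \<otimes>\<^sub>T 0 = 0"
 unfolding tl_tensor_def lext2_linear by (rule refl)+

context stacking
begin

lemma edge: "(x, y) \<in> A ==> (lift1 x, lift1 y) \<in> Gl" "(x, y) \<in> A' ==> (x, y) \<in> Gl"
 by (force simp: glue_eq)+

lemma Gl_sym: "(x, y) \<in> Gl\<^sup>* ==> (y, x) \<in> Gl\<^sup>*"
 using sym_Gs unfolding G_eq .

end

section \<open>Explicit composites: nested cups and caps, bending of a tangle\<close>

lemma comp_bvec:
 assumes "planar m k A'" "planar k n A" and C: "!!x. x \<in> endpts m n ==> \<exists>y. (x, y) \<in> C"
  "!!x y. (x, y) \<in> C ==> x \<in> endpts m n & y \<in> endpts m n & x ~= y & (lift2 x, lift2 y) \<in> (glue (Tangle k n A) (Tangle m k A'))\<^sup>*"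
  and circ: "!!a. a < k ==> \<exists>z. fst z ~= 1 & ((1, a), z) \<in> (glue (Tangle k n A) (Tangle m k A'))\<^sup>*"
 shows "tl_comp r (bvec (Tangle k n A)) (bvec (Tangle m k A')) = bvec (Tangle m n C)"
proof -
 interpret stacking m k n A' A using assms by unfold_locales auto
 show ?thesis using stack_eqI[OF C circ] by (simp add: tl_comp_def)
qed

lemma arcs_bend:
 "beside (id_tangle m) (beside (coev_tangle 1) (id_tangle m)) = Tangle (2 * m) (2 * Suc m)
  (arcs (beside (id_tangle m) (beside (coev_tangle 1) (id_tangle m))))"
 "beside (id_tangle m) (beside (ev_tangle 1) (id_tangle m)) = Tangle (2 * Suc m) (2 * m)
  (arcs (beside (id_tangle m) (beside (ev_tangle 1) (id_tangle m))))"
 by (simp_all add: beside_def id_tangle_def coev_tangle_def ev_tangle_def Let_def)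

lemma planar_bend:
 "planar (2 * m) (2 * Suc m) (arcs (beside (id_tangle m) (beside (coev_tangle 1) (id_tangle m))))"
 "planar (2 * Suc m) (2 * m) (arcs (beside (id_tangle m) (beside (ev_tangle 1) (id_tangle m))))"
 unfolding arcs_id arcs_coev arcs_ev beside_eq tangle.sel
 using planar_beside[OF planar_id[of m] planar_beside[OF planar_coev[of 1] planar_id[of m]]]
  planar_beside[OF planar_id[of m] planar_beside[OF planar_ev[of 1] planar_id[of m]]]
 by (simp_all add: mult_2)

lemma arcs_besideI: "(x, y) \<in> arcs D ==> (x, y) \<in> arcs (beside D D')"
 "(x, y) \<in> arcs D' ==> (bshift (bottoms D) (tops D) x, bshift (bottoms D) (tops D) y) \<in> arcs (beside D D')"
 by (cases D; cases D'; force simp: beside_eq)+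

lemma in_arcs_id: "a < m ==> ((0, a), (1, a)) \<in> arcs (id_tangle m)" "a < m ==> ((1, a), (0, a)) \<in> arcs (id_tangle m)"
 by (auto simp: arcs_id)

text \<open>The functor is prescribed only on the single cup and cap. Creating the innermost arc
  last reduces nested cups to it; \<open>tl_ev_Suc\<close> does the same for caps.\<close>

lemma tl_coev_Suc: "tl_coev (Suc m) = tl_comp r (tl_id m \<otimes>\<^sub>T tl_coev 1 \<otimes>\<^sub>T tl_id m) (tl_coev m)"
proof -
 define B where "B = arcs (beside (id_tangle m) (beside (coev_tangle 1) (id_tangle m)))"
 define A' where "A' = {((1 :: nat, i), (1 :: nat, j)) | i j. i + j + 1 = 2 * m}"
 define C where "C = {((1 :: nat, i), (1 :: nat, j)) | i j. i + j + 1 = 2 * Suc m}"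
 interpret stacking 0 "2 * m" "2 * Suc m" A' B
  by unfold_locales (use planar_coev planar_bend(1) in \<open>auto simp: A'_def B_def\<close>)
 have "((0, i), (1, i)) \<in> B" if "i < m" for i
  unfolding B_def by (rule arcs_besideI(1), rule in_arcs_id(1)[OF that])
 from edge(1)[OF this] have 1: "((1, i), (2, i)) \<in> Gl" if "i < m" for i
  using that by (simp add: numeral_2_eq_2)
 have "((0, m + l), (1, m + 2 + l)) \<in> B" if "l < m" for l
  using arcs_besideI(2)[OF arcs_besideI(2)[OF in_arcs_id(1)[OF that], of "coev_tangle 1"], of "id_tangle m"]
  by (simp add: B_def bshift_def id_tangle_def coev_tangle_def add_ac)
 from edge(1)[OF this] have 2: "((1, m + l), (2, m + 2 + l)) \<in> Gl" if "l < m" for l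
  using that by (simp add: numeral_2_eq_2)
 have "((1, 0), (1, 1)) \<in> arcs (coev_tangle 1)" by (auto simp: arcs_coev)
 from arcs_besideI(2)[OF arcs_besideI(1)[OF this], of "id_tangle m" "id_tangle m"]
 have "((1, m), (1, Suc m)) \<in> B" by (simp add: B_def bshift_def id_tangle_def add_ac)
 from edge(1)[OF this] have 3: "((2, m), (2, Suc m)) \<in> Gl" by (simp add: numeral_2_eq_2)
 have 4: "((1, i), (1, j)) \<in> Gl" if "i + j + 1 = 2 * m" for i j
  by (rule edge(2)) (use that in \<open>auto simp: A'_def\<close>)
 have main: "((2, i), (2, j)) \<in> Gl\<^sup>*" if ij: "i + j + 1 = 2 * Suc m" "i <= m" for i j
 proof (cases "i = m")
  case True thus ?thesis using 3 ij by auto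
 next
  case False
  define l where "l = m - 1 - i"
  have l: "l < m" "i + (m + l) + 1 = 2 * m" "j = m + 2 + l" "i < m" using False ij by (auto simp: l_def)
  have "((2, i), (1, i)) \<in> Gl\<^sup>*" using 1[OF l(4)] by (rule Gl_sym[OF r_into_rtrancl])
  also have "((1, i), (1, m + l)) \<in> Gl" using 4[OF l(2)] .
  also have "((1, m + l), (2, j)) \<in> Gl" using 2[OF l(1)] l(3) by simp
  finally show ?thesis .
 qed
 have "tl_comp r (bvec (Tangle (2 * m) (2 * Suc m) B)) (bvec (Tangle 0 (2 * m) A')) = bvec (Tangle 0 (2 * Suc m) C)"
 proof (rule comp_bvec[OF A' A])
  fix x assume "x \<in> endpts 0 (2 * Suc m)"
  then obtain i where i: "x = (1, i)" "i < 2 * Suc m" by (cases x) (auto simp: mem_endpts)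
  hence "(x, (1, 2 * Suc m - 1 - i)) \<in> C" by (auto simp: C_def)
  thus "\<exists>y. (x, y) \<in> C" ..
 next
  fix x y assume "(x, y) \<in> C"
  then obtain i j where ij: "x = (1, i)" "y = (1, j)" "i + j + 1 = 2 * Suc m" by (auto simp: C_def)
  have "((2, i), (2, j)) \<in> Gl\<^sup>*"
  proof (cases "i <= m")
   case False
   hence "j + i + 1 = 2 * Suc m" "j <= m" using ij(3) by arith+
   thus ?thesis using main Gl_sym by blast
  qed (use main ij in blast)
  moreover have "i ~= j" using ij(3) by presburger
  ultimately show "x \<in> endpts 0 (2 * Suc m) & y \<in> endpts 0 (2 * Suc m) & x ~= y & (lift2 x, lift2 y) \<in> Gl\<^sup>*"
   using ij by (simp add: mem_endpts)
 next
  fix a assume a: "a < 2 * m"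
  show "\<exists>z. fst z ~= 1 & ((1, a), z) \<in> Gl\<^sup>*"
  proof (cases "a < m")
   case True thus ?thesis using 1[OF True] by (intro exI[of _ "(2, a)"]) auto
  next
   case False thus ?thesis using 2[of "a - m"] a by (intro exI[of _ "(2, m + 2 + (a - m))"]) auto
  qed
 qed
 moreover have "bvec (Tangle (2 * m) (2 * Suc m) B) = tl_id m \<otimes>\<^sub>T tl_coev 1 \<otimes>\<^sub>T tl_id m"
  by (simp only: B_def tl_id_def tl_coev_def tl_tensor_bvec arcs_bend(1)[of m, symmetric])
 moreover have "bvec (Tangle 0 (2 * m) A') = tl_coev m" "bvec (Tangle 0 (2 * Suc m) C) = tl_coev (Suc m)"
  by (simp_all only: tl_coev_def arcs_coev A'_def C_def)
 ultimately show ?thesis by simp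
qed

lemma tl_ev_Suc: "tl_ev (Suc m) = tl_comp r (tl_ev m) (tl_id m \<otimes>\<^sub>T tl_ev 1 \<otimes>\<^sub>T tl_id m)"
proof -
 define B where "B = arcs (beside (id_tangle m) (beside (ev_tangle 1) (id_tangle m)))"
 define A' where "A' = {((0 :: nat, i), (0 :: nat, j)) | i j. i + j + 1 = 2 * m}"
 define C where "C = {((0 :: nat, i), (0 :: nat, j)) | i j. i + j + 1 = 2 * Suc m}"
 interpret stacking "2 * Suc m" "2 * m" 0 B A'
  by unfold_locales (use planar_ev planar_bend(2) in \<open>auto simp: A'_def B_def\<close>)
 have "((0, i), (1, i)) \<in> B" if "i < m" for i
  unfolding B_def by (rule arcs_besideI(1), rule in_arcs_id(1)[OF that])
 from edge(2)[OF this] have 1: "((0, i), (1, i)) \<in> Gl" if "i < m" for i using that .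
 have "((0, m + 2 + l), (1, m + l)) \<in> B" if "l < m" for l
  using arcs_besideI(2)[OF arcs_besideI(2)[OF in_arcs_id(1)[OF that], of "ev_tangle 1"], of "id_tangle m"]
  by (simp add: B_def bshift_def id_tangle_def ev_tangle_def add_ac)
 from edge(2)[OF this] have 2: "((0, m + 2 + l), (1, m + l)) \<in> Gl" if "l < m" for l using that .
 have "((0, 0), (0, 1)) \<in> arcs (ev_tangle 1)" by (auto simp: arcs_ev)
 from arcs_besideI(2)[OF arcs_besideI(1)[OF this], of "id_tangle m" "id_tangle m"]
 have "((0, m), (0, Suc m)) \<in> B" by (simp add: B_def bshift_def id_tangle_def add_ac)
 from edge(2)[OF this] have 3: "((0, m), (0, Suc m)) \<in> Gl" .
 have 4: "((1, i), (1, j)) \<in> Gl" if "i + j + 1 = 2 * m" for i j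
  using edge(1)[of "(0, i)" "(0, j)"] that by (auto simp: A'_def)
 have main: "((0, i), (0, j)) \<in> Gl\<^sup>*" if ij: "i + j + 1 = 2 * Suc m" "i <= m" for i j
 proof (cases "i = m")
  case True thus ?thesis using 3 ij by auto
 next
  case False
  define l where "l = m - 1 - i"
  have l: "l < m" "i + (m + l) + 1 = 2 * m" "j = m + 2 + l" "i < m" using False ij by (auto simp: l_def)
  have "((0, i), (1, i)) \<in> Gl\<^sup>*" using 1[OF l(4)] by (rule r_into_rtrancl)
  also have "((1, i), (1, m + l)) \<in> Gl" using 4[OF l(2)] .
  also have "((1, m + l), (0, j)) \<in> Gl\<^sup>*" using Gl_sym[OF r_into_rtrancl[OF 2[OF l(1)]]] l(3) by simp
  finally show ?thesis .
 qed
 have "tl_comp r (bvec (Tangle (2 * m) 0 A')) (bvec (Tangle (2 * Suc m) (2 * m) B)) = bvec (Tangle (2 * Suc m) 0 C)"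
 proof (rule comp_bvec[OF A' A])
  fix x assume "x \<in> endpts (2 * Suc m) 0"
  then obtain i where i: "x = (0, i)" "i < 2 * Suc m" by (cases x) (auto simp: mem_endpts)
  hence "(x, (0, 2 * Suc m - 1 - i)) \<in> C" by (auto simp: C_def)
  thus "\<exists>y. (x, y) \<in> C" ..
 next
  fix x y assume "(x, y) \<in> C"
  then obtain i j where ij: "x = (0, i)" "y = (0, j)" "i + j + 1 = 2 * Suc m" by (auto simp: C_def)
  have "((0, i), (0, j)) \<in> Gl\<^sup>*"
  proof (cases "i <= m")
   case False
   hence "j + i + 1 = 2 * Suc m" "j <= m" using ij(3) by arith+
   thus ?thesis using main Gl_sym by blast
  qed (use main ij in blast)
  moreover have "i ~= j" using ij(3) by presburger
  ultimately show "x \<in> endpts (2 * Suc m) 0 & y \<in> endpts (2 * Suc m) 0 & x ~= y & (lift2 x, lift2 y) \<in> Gl\<^sup>*"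
   using ij by (simp add: mem_endpts)
 next
  fix a assume a: "a < 2 * m"
  show "\<exists>z. fst z ~= 1 & ((1, a), z) \<in> Gl\<^sup>*"
  proof (cases "a < m")
   case True thus ?thesis using Gl_sym[OF r_into_rtrancl[OF 1[OF True]]] by (intro exI[of _ "(0, a)"]) auto
  next
   case False
   hence "((0, m + 2 + (a - m)), (1, a)) \<in> Gl" using 2[of "a - m"] a by simp
   thus ?thesis using Gl_sym[OF r_into_rtrancl] by (intro exI[of _ "(0, m + 2 + (a - m))"]) auto
  qed
 qed
 moreover have "bvec (Tangle (2 * Suc m) (2 * m) B) = tl_id m \<otimes>\<^sub>T tl_ev 1 \<otimes>\<^sub>T tl_id m"
  by (simp only: B_def tl_id_def tl_ev_def tl_tensor_bvec arcs_bend(2)[of m, symmetric])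
 moreover have "bvec (Tangle (2 * m) 0 A') = tl_ev m" "bvec (Tangle (2 * Suc m) 0 C) = tl_ev (Suc m)"
  by (simp_all only: tl_ev_def arcs_ev A'_def C_def)
 ultimately show ?thesis by simp
qed

text \<open>Where an endpoint goes when the bottom edge is swung around the right side up to the
  top.\<close>

definition flip :: "nat => endpt => endpt" where
 "flip m = (%(i, a). if i = 0 then (1, 2 * m - 1 - a) else (1, a))"

text \<open>Both sides of \<open>tl_bend\<close> have this shape; \<open>p\<close> says where the
  endpoints of the given tangle sit inside the large one.\<close>

lemma bend_comp:
 assumes B: "planar m m B" and A: "planar (2 * m) (2 * m) A"
  and p: "!!x y. (x, y) \<in> B ==> (p x, p y) \<in> A"
  and q: "!!z. z \<in> endpts m m ==> (lift2 (flip m z), lift1 (p z)) \<in> (glue (Tangle (2 * m) (2 * m) A) (coev_tangle m))\<^sup>*"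
  and circ: "!!a. a < 2 * m ==> \<exists>b<2 * m. ((0, b), (1, b)) \<in> A & (a = b | a + b + 1 = 2 * m)"
 shows "tl_comp r (bvec (Tangle (2 * m) (2 * m) A)) (tl_coev m) = bvec (Tangle 0 (2 * m) (map_prod (flip m) (flip m) ` B))"
proof -
 define A' where "A' = {((1 :: nat, i), (1 :: nat, j)) | i j. i + j + 1 = 2 * m}"
 interpret stacking 0 "2 * m" "2 * m" A' A
  by unfold_locales (use planar_coev A in \<open>auto simp: A'_def\<close>)
 have co: "coev_tangle m = Tangle 0 (2 * m) A'" by (simp add: arcs_coev A'_def)
 note q = q[unfolded co]
 have i: "inj_on (flip m) (endpts m m)" by (auto simp: inj_on_def flip_def endpts_def)
 have im: "flip m z \<in> endpts 0 (2 * m)" if "z \<in> endpts m m" for z using that by (auto simp: flip_def endpts_def)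
 have "tl_comp r (bvec (Tangle (2 * m) (2 * m) A)) (bvec (Tangle 0 (2 * m) A')) = bvec (Tangle 0 (2 * m) (map_prod (flip m) (flip m) ` B))"
 proof (rule comp_bvec[OF A' A])
  fix x assume "x \<in> endpts 0 (2 * m)"
  then obtain a where a: "x = (1, a)" "a < 2 * m" by (cases x) (auto simp: mem_endpts)
  have "\<exists>z\<in>endpts m m. x = flip m z"
  proof (cases "a < m")
   case True thus ?thesis using a by (intro bexI[of _ "(1, a)"]) (auto simp: flip_def mem_endpts)
  next
   case False thus ?thesis using a by (intro bexI[of _ "(0, 2 * m - 1 - a)"]) (auto simp: flip_def mem_endpts)
  qed
  then obtain z where z: "z \<in> Domain B" "x = flip m z" using planarD(3)[OF B] by blast
  then obtain w where "(z, w) \<in> B" by blast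
  hence "(x, flip m w) \<in> map_prod (flip m) (flip m) ` B" using z by force
  thus "\<exists>y. (x, y) \<in> map_prod (flip m) (flip m) ` B" ..
 next
  fix x y assume "(x, y) \<in> map_prod (flip m) (flip m) ` B"
  then obtain z w where zw: "(z, w) \<in> B" "x = flip m z" "y = flip m w" by auto
  have e: "z \<in> endpts m m" "w \<in> endpts m m" using zw planarD(1)[OF B] by auto
  have "(z, z) \<notin> B" using planarD(2)[OF B] unfolding matching_def irrefl_def by blast
  hence "z ~= w" using zw(1) by blast
  hence "x ~= y" using zw e i by (auto dest: inj_onD)
  have "(lift2 x, lift1 (p z)) \<in> Gl\<^sup>*" using q[OF e(1)] zw by simp
  also have "(lift1 (p z), lift1 (p w)) \<in> Gl" using edge(1)[OF p[OF zw(1)]] .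
  also have "(lift1 (p w), lift2 y) \<in> Gl\<^sup>*" using Gl_sym[OF q[OF e(2)]] zw by simp
  finally show "x \<in> endpts 0 (2 * m) & y \<in> endpts 0 (2 * m) & x ~= y & (lift2 x, lift2 y) \<in> Gl\<^sup>*"
   using \<open>x ~= y\<close> zw im[OF e(1)] im[OF e(2)] by simp
 next
  fix a assume "a < 2 * m"
  then obtain b where b: "b < 2 * m" "((0, b), (1, b)) \<in> A" "a = b | a + b + 1 = 2 * m" using circ by blast
  have 1: "((1, b), (2, b)) \<in> Gl" using edge(1)[OF b(2)] by (simp add: numeral_2_eq_2)
  have "((1, a), (1, b)) \<in> Gl" if "a + b + 1 = 2 * m" by (rule edge(2)) (use that in \<open>auto simp: A'_def\<close>)
  hence "((1, a), (2, b)) \<in> Gl\<^sup>*" using b(3) 1 by (meson converse_rtrancl_into_rtrancl r_into_rtrancl)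
  thus "\<exists>z. fst z ~= 1 & ((1, a), z) \<in> Gl\<^sup>*" by (intro exI[of _ "(2, b)"]) simp
 qed
 thus ?thesis by (simp add: tl_coev_def co)
qed

text \<open>A tangle on the left legs of nested cups can be slid over to the right legs, arriving
  rotated. This removes the rotated factor of the source idempotent \<open>g\<close> tensor rotated
  \<open>g\<close> once it is applied to \<open>coev_m\<close>.\<close>

lemma tl_bend:
 assumes "u \<in> TL m m"
 shows "tl_comp r (tl_id m \<otimes>\<^sub>T tl_rot u) (tl_coev m) = tl_comp r (u \<otimes>\<^sub>T tl_id m) (tl_coev m)"
proof (rule TL_induct[OF assms, of "%u. tl_comp r (tl_id m \<otimes>\<^sub>T tl_rot u) (tl_coev m) = tl_comp r (u \<otimes>\<^sub>T tl_id m) (tl_coev m)"])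
 show "tl_comp r (tl_id m \<otimes>\<^sub>T tl_rot 0) (tl_coev m) = tl_comp r (0 \<otimes>\<^sub>T tl_id m) (tl_coev m)"
  by (simp add: tl_rot_def tl_tensor_lin tl_comp_lin)
next
 fix u c B
 assume IH: "tl_comp r (tl_id m \<otimes>\<^sub>T tl_rot u) (tl_coev m) = tl_comp r (u \<otimes>\<^sub>T tl_id m) (tl_coev m)"
  and B: "planar m m B"
 define D where "D = Tangle m m B"
 have pl: "planar (2 * m) (2 * m) (arcs (beside D (id_tangle m)))" "planar (2 * m) (2 * m) (arcs (beside (id_tangle m) (rotate_tangle D)))"
  using planar_beside[OF B planar_id[of m]] planar_beside[OF planar_id[of m] planar_rotate[OF B]]
  by (simp_all add: D_def arcs_id beside_eq rotate_eq mult_2)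
 have eq: "beside D (id_tangle m) = Tangle (2 * m) (2 * m) (arcs (beside D (id_tangle m)))"
  "beside (id_tangle m) (rotate_tangle D) = Tangle (2 * m) (2 * m) (arcs (beside (id_tangle m) (rotate_tangle D)))"
  by (simp_all add: D_def beside_def id_tangle_def rotate_tangle_def Let_def)
 have co: "((1, a), (1, b)) \<in> glue T (coev_tangle m)" if "a + b + 1 = 2 * m" for a b T
  using that by (auto simp: glue_def arcs_coev)
 have gl: "(lift1 x, lift1 y) \<in> glue (Tangle (2 * m) (2 * m) A) (coev_tangle m)" if "(x, y) \<in> A" for x y A
  unfolding arcs_coev glue_eq using that by force
 have bs: "((0, a), (1, a)) \<in> arcs (beside D (id_tangle m))" "((1, a), (0, a)) \<in> arcs (beside D (id_tangle m))" if "m <= a" "a < 2 * m" for a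
  using arcs_besideI(2)[OF in_arcs_id(1)[of "a - m" m], of D] arcs_besideI(2)[OF in_arcs_id(2)[of "a - m" m], of D] that
  by (simp_all add: bshift_def D_def)
 have bs': "((0, a), (1, a)) \<in> arcs (beside (id_tangle m) (rotate_tangle D))" "((1, a), (0, a)) \<in> arcs (beside (id_tangle m) (rotate_tangle D))" if "a < m" for a
  using in_arcs_id[OF that] by (auto intro: arcs_besideI(1))
 have 1: "tl_comp r (bvec (beside D (id_tangle m))) (tl_coev m) = bvec (Tangle 0 (2 * m) (map_prod (flip m) (flip m) ` B))"
 proof (subst eq(1), rule bend_comp[OF B pl(1), of "%x. x"])
  fix x y assume "(x, y) \<in> B" thus "(x, y) \<in> arcs (beside D (id_tangle m))" by (auto simp: D_def intro: arcs_besideI(1))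
 next
  fix z assume z: "z \<in> endpts m m"
  then consider a where "z = (0, a)" "a < m" | a where "z = (1, a)" "a < m" by (cases z) (auto simp: mem_endpts)
  thus "(lift2 (flip m z), lift1 z) \<in> (glue (Tangle (2 * m) (2 * m) (arcs (beside D (id_tangle m)))) (coev_tangle m))\<^sup>*"
  proof cases
   case 1
   have "((2, 2 * m - 1 - a), (1, 2 * m - 1 - a)) \<in> glue (Tangle (2 * m) (2 * m) (arcs (beside D (id_tangle m)))) (coev_tangle m)"
    using gl[OF bs(2)[of "2 * m - 1 - a"]] 1 by (simp add: numeral_2_eq_2)
   moreover have "((1, 2 * m - 1 - a), (1, a)) \<in> glue (Tangle (2 * m) (2 * m) (arcs (beside D (id_tangle m)))) (coev_tangle m)"
    by (rule co) (use 1 in auto)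
   moreover have "lift2 (flip m z) = (2, 2 * m - 1 - a)" "lift1 z = (1, a)" using 1 by (auto simp: flip_def)
   ultimately show ?thesis by (simp only:)
  next
   case 2 thus ?thesis by (simp add: flip_def numeral_2_eq_2)
  qed
 next
  fix a assume a: "a < 2 * m"
  show "\<exists>b<2 * m. ((0, b), (1, b)) \<in> arcs (beside D (id_tangle m)) & (a = b | a + b + 1 = 2 * m)"
  proof (cases "a < m")
   case True thus ?thesis using bs(1)[of "2 * m - 1 - a"] by (intro exI[of _ "2 * m - 1 - a"]) auto
  next
   case False thus ?thesis using bs(1)[of a] a by (intro exI[of _ a]) auto
  qed
 qed
 have 2: "tl_comp r (bvec (beside (id_tangle m) (rotate_tangle D))) (tl_coev m) = bvec (Tangle 0 (2 * m) (map_prod (flip m) (flip m) ` B))"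
 proof (subst eq(2), rule bend_comp[OF B pl(2), of "%x. bshift m m (turn m m x)"])
  fix x y assume "(x, y) \<in> B"
  hence "(turn m m x, turn m m y) \<in> arcs (rotate_tangle D)" by (force simp: D_def rotate_eq)
  from arcs_besideI(2)[OF this, of "id_tangle m"]
  show "(bshift m m (turn m m x), bshift m m (turn m m y)) \<in> arcs (beside (id_tangle m) (rotate_tangle D))"
   by (simp add: id_tangle_def)
 next
  fix z assume z: "z \<in> endpts m m"
  then consider a where "z = (0, a)" "a < m" | a where "z = (1, a)" "a < m" by (cases z) (auto simp: mem_endpts)
  thus "(lift2 (flip m z), lift1 (bshift m m (turn m m z))) \<in> (glue (Tangle (2 * m) (2 * m) (arcs (beside (id_tangle m) (rotate_tangle D)))) (coev_tangle m))\<^sup>*"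
  proof cases
   case 2
   have "((2, a), (1, a)) \<in> glue (Tangle (2 * m) (2 * m) (arcs (beside (id_tangle m) (rotate_tangle D)))) (coev_tangle m)"
    using gl[OF bs'(2)[of a]] 2 by (simp add: numeral_2_eq_2)
   moreover have "((1, a), (1, 2 * m - 1 - a)) \<in> glue (Tangle (2 * m) (2 * m) (arcs (beside (id_tangle m) (rotate_tangle D)))) (coev_tangle m)"
    by (rule co) (use 2 in auto)
   moreover have "lift2 (flip m z) = (2, a)" "lift1 (bshift m m (turn m m z)) = (1, 2 * m - 1 - a)"
    using 2 by (auto simp: flip_def turn_def bshift_def)
   ultimately show ?thesis by (simp only:)
  next
   case 1
   hence "lift2 (flip m z) = lift1 (bshift m m (turn m m z))"
    by (auto simp: flip_def turn_def bshift_def)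
   thus ?thesis by simp
  qed
 next
  fix a assume a: "a < 2 * m"
  show "\<exists>b<2 * m. ((0, b), (1, b)) \<in> arcs (beside (id_tangle m) (rotate_tangle D)) & (a = b | a + b + 1 = 2 * m)"
  proof (cases "a < m")
   case True thus ?thesis using bs'(1)[of a] a by (intro exI[of _ a]) auto
  next
   case False thus ?thesis using bs'(1)[of "2 * m - 1 - a"] a by (intro exI[of _ "2 * m - 1 - a"]) auto
  qed
 qed
 have "tl_comp r (tl_id m \<otimes>\<^sub>T tl_rot (bvec D)) (tl_coev m) = tl_comp r (bvec D \<otimes>\<^sub>T tl_id m) (tl_coev m)"
  using 1 2 by (simp add: tl_rot_def tl_id_def tl_tensor_bvec)
 thus "tl_comp r (tl_id m \<otimes>\<^sub>T tl_rot (fscale c (bvec (Tangle m m B)) + u)) (tl_coev m)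
   = tl_comp r ((fscale c (bvec (Tangle m m B)) + u) \<otimes>\<^sub>T tl_id m) (tl_coev m)"
  using IH by (simp add: D_def tl_rot_def lext_add lext_fscale tl_tensor_lin tl_comp_lin)
qed

section \<open>Linear maps between tensor powers as operators on infinite words\<close>

definition words :: "nat => xbasis list set" where "words m = {w. length w = m}"

definition pre :: "nat => (nat => xbasis) => xbasis list" where "pre n s = map s [0..<n]"

definition dr :: "nat => (nat => xbasis) => nat => xbasis" where "dr n s = (%i. s (i + n))"

definition app :: "xbasis list => (nat => xbasis) => nat => xbasis" where
 "app t s = (%i. if i < length t then t ! i else s (i - length t))"

lemma UNIV_xbasis: "(UNIV :: xbasis set) = {A0, A1}"
 using xbasis.exhaust by auto

lemma finite_words[simp]: "finite (words m)"
proof -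
 have "finite (UNIV :: xbasis set)" by (simp add: UNIV_xbasis)
 from finite_lists_length_eq[OF this, of m] show ?thesis by (simp add: words_def)
qed

lemma words_0: "words 0 = {[]}" by (auto simp: words_def)

lemma Xpow_words: "Xpow m = fspan (words m)" by (simp add: Xpow_def words_def)

lemma pre_words[simp]: "pre n s \<in> words n" "length (pre n s) = n" by (simp_all add: pre_def words_def)

lemma pre_dr_app[simp]: "length t = m ==> pre m (app t s) = t" "length t = m ==> dr m (app t s) = s"
 "app (pre m s) (dr m s) = s"
 by (auto simp: pre_def app_def dr_def intro!: nth_equalityI)

lemma app_app: "app t (app t' s) = app (t @ t') s"
 by (rule ext) (auto simp: app_def nth_append)

lemma app_Nil[simp]: "app [] s = s" "dr 0 s = s" "pre 0 s = []"
 by (auto simp: app_def dr_def pre_def)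

lemma pre_add: "pre (m + n) s = pre m s @ pre n (dr m s)"
 by (rule nth_equalityI) (auto simp: pre_def dr_def nth_append)

lemma dr_add: "dr n (dr m s) = dr (m + n) s"
 by (simp add: dr_def add_ac)

text \<open>The bridge from maps between tensor powers to the operator ring: the map acts on an
  initial segment of the word and leaves the infinite rest alone.\<close>

definition mop :: "nat => nat => (xvec => xvec) => lop" where
 "mop m n \<phi> = Lop (%f s. \<Sum>t\<in>words m. lkp (\<phi> (bvec t)) (pre n s) * f (app t (dr n s)))"

lemma ap_mop: "ap (mop m n \<phi>) f s = (\<Sum>t\<in>words m. lkp (\<phi> (bvec t)) (pre n s) * f (app t (dr n s)))"
proof -
 have "clinear (%f s. \<Sum>t\<in>words m. lkp (\<phi> (bvec t)) (pre n s) * f (app t (dr n s)))"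
  by (simp add: clinear_def distrib_left sum.distrib sum_distrib_left mult.left_commute)
 thus ?thesis by (simp add: mop_def Lop_inverse)
qed

lift_definition shift :: "nat => lop => lop" is "%m T f s. T (%s'. f (app (pre m s) s')) (dr m s)"
 by (auto simp: clinear_def)

lemma ap_shift: "ap (shift m T) f s = ap T (%s'. f (app (pre m s) s')) (dr m s)"
 by transfer simp

lemma shift_simps: "shift m 1 = 1" "shift m (x * y) = shift m x * shift m y" "shift m (x + y) = shift m x + shift m y"
 "shift m (c *. x) = c *. shift m x" "shift 0 x = x"
 by (rule lop_eqI, simp add: ap_shift)+

lemma shift_shift: "shift m (shift n x) = shift (m + n) x"
 by (rule lop_eqI) (simp add: ap_shift app_app pre_add dr_add)

lemma app_ins: "app (pre m s) (ins i x y s') = ins (m + i) x y (app (pre m s) s')"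
 by (rule ext) (auto simp: app_def ins_def)

lemma app_del: "del (m + i) s = app (pre m s) (del i (dr m s))"
 by (rule ext) (auto simp: app_def del_def pre_def dr_def)

lemma shift_cap: "shift m (cap q i) = cap q (m + i)"
 by (rule lop_eqI) (simp add: ap_shift ap_cap app_ins)

lemma dr_nth: "dr m s i = s (m + i)" by (simp add: dr_def add.commute)

lemma shift_cup: "shift m (cup q i) = cup q (m + i)"
 by (rule lop_eqI) (simp add: ap_shift ap_cup app_del[symmetric] dr_nth)

lemma mop_cong: "(!!t. t \<in> words m ==> \<phi> (bvec t) = \<psi> (bvec t)) ==> mop m n \<phi> = mop m n \<psi>"
 by (rule lop_eqI) (simp add: ap_mop)

text \<open>Testing on the indicator function of one infinite word reads off a matrix coefficient,
  so passing to operators loses nothing.\<close>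

lemma mop_eqD:
 assumes "mop m n \<phi> = mop m n \<psi>" "t \<in> words m" "\<phi> (bvec t) \<in> Xpow n" "\<psi> (bvec t) \<in> Xpow n"
 shows "\<phi> (bvec t) = \<psi> (bvec t)"
proof (rule poly_mapping_eqI)
 fix w
 let ?z = "%i :: nat. A0" and ?f = "%s. if s = app t (%i. A0) then 1 else 0 :: complex"
 show "lkp (\<phi> (bvec t)) w = lkp (\<psi> (bvec t)) w"
 proof (cases "length w = n")
  case True
  have inj: "app t' ?z = app t ?z \<longleftrightarrow> t' = t" if "t' \<in> words m" for t'
  proof
   assume "app t' ?z = app t ?z"
   hence "pre m (app t' ?z) = pre m (app t ?z)" by (simp only:)
   thus "t' = t" using that assms(2) by (simp add: words_def)
  qed simp
  have "(\<Sum>t'\<in>words m. lkp (\<chi> (bvec t')) w * (if app t' ?z = app t ?z then 1 else 0))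
   = lkp (\<chi> (bvec t)) w" for \<chi> :: "xvec => xvec"
  proof -
   have "(\<Sum>t'\<in>words m. lkp (\<chi> (bvec t')) w * (if app t' ?z = app t ?z then 1 else 0))
    = (\<Sum>t'\<in>words m. if t' = t then lkp (\<chi> (bvec t')) w else 0)"
    by (rule sum.cong) (auto simp: inj)
   thus ?thesis using assms(2) by simp
  qed
  moreover have "ap (mop m n \<phi>) ?f (app w ?z) = ap (mop m n \<psi>) ?f (app w ?z)" by (simp only: assms(1))
  ultimately show ?thesis using True by (simp add: ap_mop)
 next
  case False
  hence "w \<notin> pkeys (\<phi> (bvec t))" "w \<notin> pkeys (\<psi> (bvec t))"
   using assms(3,4) by (auto simp: Xpow_def fspan_def)
  thus ?thesis by (simp add: in_keys_iff)
 qed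
qed

lemma Xpow_expand: "z \<in> Xpow m ==> z = (\<Sum>t\<in>words m. fscale (lkp z t) (bvec t))"
 using lext_superset[of "words m" z bvec] vec_expand[of z]
 by (simp add: Xpow_words fspan_def lext_def)

lemma flinear_sum:
 assumes "flinear (Xpow m) W f" "finite S" "!!t. t \<in> S ==> g t \<in> Xpow m" "f 0 = 0"
 shows "f (\<Sum>t\<in>S. fscale (c t) (g t)) = (\<Sum>t\<in>S. fscale (c t) (f (g t)))"
 using assms(2,3)
proof (induction S rule: finite_induct)
 case (insert x S)
 have "(\<Sum>t\<in>S. fscale (c t) (g t)) \<in> Xpow m" "fscale (c x) (g x) \<in> Xpow m"
  unfolding Xpow_words by (rule fspan_sum, rule fspan_fscale) (use insert in \<open>auto simp: Xpow_words fspan_fscale\<close>)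
 thus ?case using insert assms(1) by (simp add: flinear_def)
qed (simp add: assms(4))

lemma flinear_0: "flinear (Xpow m) W f ==> f 0 = 0"
 unfolding flinear_def Xpow_words using fspan_zero by (metis fscale_simps(2))

lemma flinear_expand:
 assumes "flinear (Xpow m) W f" "z \<in> Xpow m"
 shows "f z = (\<Sum>t\<in>words m. fscale (lkp z t) (f (bvec t)))"
proof -
 have "f z = f (\<Sum>t\<in>words m. fscale (lkp z t) (bvec t))" using Xpow_expand[OF assms(2)] by simp
 also have "... = (\<Sum>t\<in>words m. fscale (lkp z t) (f (bvec t)))"
  by (rule flinear_sum[OF assms(1)]) (auto simp: Xpow_words flinear_0[OF assms(1)])
 finally show ?thesis .
qed

lemma mop_comp:
 assumes "flinear (Xpow k) W \<psi>" "!!t. t \<in> words m ==> \<phi> (bvec t) \<in> Xpow k"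
 shows "mop m n (%z. \<psi> (\<phi> z)) = mop k n \<psi> * mop m k \<phi>"
proof (rule lop_eqI)
 fix f s
 have "ap (mop k n \<psi> * mop m k \<phi>) f s = (\<Sum>t'\<in>words k. \<Sum>t\<in>words m.
   lkp (\<psi> (bvec t')) (pre n s) * (lkp (\<phi> (bvec t)) t' * f (app t (dr n s))))"
  unfolding ap_simps ap_mop sum_distrib_left by (intro sum.cong refl) (auto simp: words_def)
 also have "... = (\<Sum>t\<in>words m. \<Sum>t'\<in>words k.
   lkp (\<psi> (bvec t')) (pre n s) * (lkp (\<phi> (bvec t)) t' * f (app t (dr n s))))"
  by (rule sum.swap)
 also have "... = ap (mop m n (%z. \<psi> (\<phi> z))) f s"
  unfolding ap_mop
 proof (rule sum.cong[OF refl])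
  fix t assume "t \<in> words m"
  note E = flinear_expand[OF assms(1) assms(2)[OF this]]
  show "(\<Sum>t'\<in>words k. lkp (\<psi> (bvec t')) (pre n s) * (lkp (\<phi> (bvec t)) t' * f (app t (dr n s))))
   = lkp (\<psi> (\<phi> (bvec t))) (pre n s) * f (app t (dr n s))"
   unfolding E lookup_sum_pm lookup_fscale sum_distrib_right by (rule sum.cong) (simp_all add: mult_ac)
 qed
 finally show "ap (mop m n (%z. \<psi> (\<phi> z))) f s = ap (mop k n \<psi> * mop m k \<phi>) f s" by simp
qed

lemma mop_id: "(!!t. t \<in> words m ==> \<phi> (bvec t) = bvec t) ==> mop m m \<phi> = 1"
proof (rule lop_eqI)
 fix f s assume *: "!!t. t \<in> words m ==> \<phi> (bvec t) = bvec t"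
 have "ap (mop m m \<phi>) f s = (\<Sum>t\<in>words m. if t = pre m s then f (app t (dr m s)) else 0)"
  unfolding ap_mop by (rule sum.cong) (auto simp: * lookup_bvec)
 thus "ap (mop m m \<phi>) f s = ap 1 f s" by simp
qed

lemma lookup_xtensor:
 assumes "v \<in> Xpow n" "length x = n + n'" "w \<in> Xpow n'"
 shows "lkp (v \<otimes>\<^sub>X w) x = lkp v (take n x) * lkp w (drop n x)"
proof -
 have k: "pkeys v <= words n" "pkeys w <= words n'"
  using assms by (auto simp: Xpow_words fspan_def)
 have "lkp (v \<otimes>\<^sub>X w) x
  = (\<Sum>s\<in>words n. \<Sum>t\<in>words n'. lkp v s * (lkp w t * (if s @ t = x then 1 else 0)))"
  unfolding xtensor_def lext2_def
  by (simp add: lext_superset[OF finite_words k(1)] lext_superset[OF finite_words k(2)] lookup_sum_pm lookup_bvec sum_distrib_left)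
 also have "... = (\<Sum>s\<in>words n. \<Sum>t\<in>words n'. if t = drop n x then (if s = take n x then lkp v s * lkp w t else 0) else 0)"
  by (intro sum.cong refl) (auto simp: words_def append_eq_conv_conj)
 also have "... = lkp v (take n x) * lkp w (drop n x)"
 proof -
  have "take n x \<in> words n" "drop n x \<in> words n'" using assms(2) by (simp_all add: words_def)
  thus ?thesis by simp
 qed
 finally show ?thesis .
qed

lemma mop_tensor:
 assumes "!!s t. s \<in> words m ==> t \<in> words m' ==> \<chi> (bvec (s @ t)) = \<phi> (bvec s) \<otimes>\<^sub>X \<psi> (bvec t)"
  "!!s. s \<in> words m ==> \<phi> (bvec s) \<in> Xpow n" "!!t. t \<in> words m' ==> \<psi> (bvec t) \<in> Xpow n'"
 shows "mop (m + m') (n + n') \<chi> = mop m n \<phi> * shift m (mop m' n' \<psi>)"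
proof (rule lop_eqI)
 fix f s
 let ?L = lkp
 have "ap (mop m n \<phi> * shift m (mop m' n' \<psi>)) f s = (\<Sum>t\<in>words m. \<Sum>t'\<in>words m'.
   ?L (\<phi> (bvec t)) (pre n s) * (?L (\<psi> (bvec t')) (pre n' (dr n s)) * f (app t (app t' (dr n' (dr n s))))))"
  unfolding ap_simps ap_mop ap_shift sum_distrib_left
  by (intro sum.cong refl) (auto simp: words_def)
 also have "... = (\<Sum>(t, t')\<in>words m \<times> words m'. ?L (\<chi> (bvec (t @ t'))) (pre (n + n') s) * f (app (t @ t') (dr (n + n') s)))"
  unfolding sum.cartesian_product
 proof (rule sum.cong[OF refl])
  fix p assume "p \<in> words m \<times> words m'"
  then obtain t t' where p: "p = (t, t')" "t \<in> words m" "t' \<in> words m'" by auto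
  show "(case p of (t, t') => ?L (\<phi> (bvec t)) (pre n s) * (?L (\<psi> (bvec t')) (pre n' (dr n s)) * f (app t (app t' (dr n' (dr n s))))))
   = (case p of (t, t') => ?L (\<chi> (bvec (t @ t'))) (pre (n + n') s) * f (app (t @ t') (dr (n + n') s)))"
   unfolding p prod.case assms(1)[OF p(2,3)]
   by (subst lookup_xtensor[OF assms(2)[OF p(2)] _ assms(3)[OF p(3)]]) (simp_all add: pre_add app_app dr_add)
 qed
 also have "... = ap (mop (m + m') (n + n') \<chi>) f s"
  unfolding ap_mop
  by (rule sum.reindex_bij_witness[of _ "%x. (take m x, drop m x)" "%(t, t'). t @ t'"]) (auto simp: words_def)
 finally show "ap (mop (m + m') (n + n') \<chi>) f s = ap (mop m n \<phi> * shift m (mop m' n' \<psi>)) f s" by simp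
qed

text \<open>The interchange law: what acts beyond the segment commutes with the map, its offset
  changing from \<open>m\<close> to \<open>n\<close>.\<close>

lemma mop_shift: "mop m n \<phi> * shift m X = shift n X * mop m n \<phi>"
proof (rule lop_eqI)
 fix f s
 have "ap (mop m n \<phi> * shift m X) f s = (\<Sum>t\<in>words m. lkp (\<phi> (bvec t)) (pre n s) * ap X (%s'. f (app t s')) (dr n s))"
  unfolding ap_simps ap_mop ap_shift by (intro sum.cong refl) (auto simp: words_def)
 also have "... = ap X (%s'. \<Sum>t\<in>words m. lkp (\<phi> (bvec t)) (pre n s) * f (app t s')) (dr n s)"
  by (simp add: ap_sum ap_mult)
 also have "... = ap (shift n X * mop m n \<phi>) f s"
  by (simp add: ap_shift ap_mop)
 finally show "ap (mop m n \<phi> * shift m X) f s = ap (shift n X * mop m n \<phi>) f s" .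
qed

lemma take_words: "t \<in> words (m + k) ==> take m t \<in> words m" "t \<in> words (m + k) ==> drop m t \<in> words k"
 by (simp_all add: words_def)

lemma xmap_tensor_bvec: "xmap_tensor m f g (bvec w) = f (bvec (take m w)) \<otimes>\<^sub>X g (bvec (drop m w))"
 by (simp add: xmap_tensor_def)

lemma bvec_Xpow: "t \<in> words m ==> bvec t \<in> Xpow m" by (simp add: Xpow_words)

lemma xtensor_Xpow: "v \<in> Xpow m ==> w \<in> Xpow n ==> v \<otimes>\<^sub>X w \<in> Xpow (m + n)"
 unfolding xtensor_def lext2_def Xpow_words
 by (rule fspan_lext, assumption, rule fspan_lext, assumption) (simp add: words_def)

lemma flinear_lext: "(!!t. t \<in> words m ==> f t \<in> Xpow n) ==> flinear (Xpow m) (Xpow n) (lext f)"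
 unfolding flinear_def by (auto simp: lext_add lext_fscale Xpow_words intro: fspan_lext)

lemma xmap_tensor_left:
 assumes "!!t. t \<in> words m ==> f (bvec t) \<in> Xpow m"
 shows "flinear (Xpow (m + k)) (Xpow (m + k)) (xmap_tensor m f (%z. z))"
  "mop (m + k) (m + k) (xmap_tensor m f (%z. z)) = mop m m f"
proof -
 show "flinear (Xpow (m + k)) (Xpow (m + k)) (xmap_tensor m f (%z. z))"
  unfolding xmap_tensor_def
  by (rule flinear_lext, rule xtensor_Xpow) (auto intro!: assms bvec_Xpow take_words)
 have "mop (m + k) (m + k) (xmap_tensor m f (%z. z)) = mop m m f * shift m (mop k k (%z. z))"
  by (rule mop_tensor) (simp_all add: xmap_tensor_bvec words_def[of m] assms bvec_Xpow)
 thus "mop (m + k) (m + k) (xmap_tensor m f (%z. z)) = mop m m f"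
  by (simp add: mop_id shift_simps)
qed

definition vop :: "nat => xvec => lop" where "vop n z = mop 0 n (%_. z)"

lemma vop_inj: "vop n z = vop n z' ==> z \<in> Xpow n ==> z' \<in> Xpow n ==> z = z'"
 unfolding vop_def using mop_eqD[of 0 n "%_. z" "%_. z'" "[]"] by (simp add: words_0)

lemma vop_map: "flinear (Xpow m) W \<phi> ==> z \<in> Xpow m ==> vop n (\<phi> z) = mop m n \<phi> * vop m z"
 unfolding vop_def using mop_comp[of m W \<phi> 0 "%_. z" n] by simp

lemma vop_lin: "vop n (z + w) = vop n z + vop n w" "vop n (fscale c z) = c *. vop n z"
 by (rule lop_eqI, simp add: vop_def ap_mop words_0 lookup_add algebra_simps)+

section \<open>The functor as a map into the operator ring\<close>

locale op_functor = odd_root r N + tl_functor r \<Phi> for r N \<Phi>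
begin

abbreviation op :: "nat => nat => tl => lop" where "op m n u \<equiv> mop m n (\<Phi> u)"

lemma \<Phi>_Xpow: "u \<in> TL m n ==> z \<in> Xpow m ==> \<Phi> u z \<in> Xpow n"
 using map_linear by (auto simp: flinear_def)

lemma op_comp: "u \<in> TL m k ==> v \<in> TL k n ==> op m n (tl_comp r v u) = op k n v * op m k u"
proof -
 assume u: "u \<in> TL m k" and v: "v \<in> TL k n"
 have "op m n (tl_comp r v u) = mop m n (%z. \<Phi> v (\<Phi> u z))"
  by (rule mop_cong) (simp add: comp[OF u v] bvec_Xpow)
 also have "... = op k n v * op m k u"
  by (rule mop_comp[OF map_linear[OF v]]) (simp add: \<Phi>_Xpow[OF u] bvec_Xpow)
 finally show ?thesis .
qed

lemma op_tensor: "u \<in> TL m n ==> v \<in> TL m' n' ==> op (m + m') (n + n') (u \<otimes>\<^sub>T v) = op m n u * shift m (op m' n' v)"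
proof -
 assume u: "u \<in> TL m n" and v: "v \<in> TL m' n'"
 have b: "bvec (s @ t) = bvec s \<otimes>\<^sub>X bvec t" for s t :: "xbasis list" by (simp add: xtensor_def)
 show ?thesis
 proof (rule mop_tensor)
  fix s t assume "s \<in> words m" "t \<in> words m'"
  thus "\<Phi> (u \<otimes>\<^sub>T v) (bvec (s @ t)) = \<Phi> u (bvec s) \<otimes>\<^sub>X \<Phi> v (bvec t)"
   unfolding b by (intro tensor[OF u v] bvec_Xpow)
 qed (use \<Phi>_Xpow[OF u] \<Phi>_Xpow[OF v] bvec_Xpow in auto)
qed

lemma op_add: "u \<in> TL m n ==> v \<in> TL m n ==> op m n (u + v) = op m n u + op m n v"
 by (rule lop_eqI) (simp add: ap_mop add bvec_Xpow lookup_add algebra_simps sum.distrib)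

lemma op_scale: "u \<in> TL m n ==> op m n (fscale c u) = c *. op m n u"
 by (rule lop_eqI) (simp add: ap_mop scale bvec_Xpow sum_distrib_left mult_ac)

lemma op_diff: "u \<in> TL m n ==> v \<in> TL m n ==> op m n (u - v) = op m n u - op m n v"
proof -
 assume u: "u \<in> TL m n" and v: "v \<in> TL m n"
 have "op m n (u + fscale (- 1) v) = op m n u + (- 1) *. op m n v"
  using u v by (simp only: op_add op_scale TL_lin)
 thus ?thesis by (simp add: fscale_minus)
qed

lemma op_id: "op m m (tl_id m) = 1"
 by (rule mop_id) (simp add: id bvec_Xpow)

text \<open>Faithfulness of the functor brings operator identities back to the category; it is used
  for the idempotent conditions on the color.\<close>

lemma op_inj: "u \<in> TL m n ==> v \<in> TL m n ==> op m n u = op m n v ==> u = v"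
proof -
 assume u: "u \<in> TL m n" and v: "v \<in> TL m n" and e: "op m n u = op m n v"
 show "u = v"
 proof (rule faithful[OF u v])
  fix z assume z: "z \<in> Xpow m"
  have "\<Phi> u (bvec t) = \<Phi> v (bvec t)" if "t \<in> words m" for t
   by (rule mop_eqD[OF e that]) (use that in \<open>simp_all add: \<Phi>_Xpow[OF u] \<Phi>_Xpow[OF v] bvec_Xpow\<close>)
  thus "\<Phi> u z = \<Phi> v z"
   by (simp add: flinear_expand[OF map_linear[OF u] z] flinear_expand[OF map_linear[OF v] z])
 qed
qed

lemma words_2: "words 2 = {[A0, A0], [A0, A1], [A1, A0], [A1, A1]}"
 by (auto simp: words_def length_Suc_conv numeral_2_eq_2)

lemma op_ev1: "op 2 0 (tl_ev 1) = cp 0"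
proof (rule lop_eqI)
 fix f s
 have a: "app [x, y] s = ins 0 x y s" for x y
  by (rule ext) (auto simp: app_def ins_def nth_Cons' numeral_2_eq_2)
 have "ap (op 2 0 (tl_ev 1)) f s = (\<Sum>t\<in>words 2. lkp (X_e r (bvec t)) [] * f (app t s))"
  unfolding ap_mop by (intro sum.cong refl) (simp add: ev bvec_Xpow del: One_nat_def)
 thus "ap (op 2 0 (tl_ev 1)) f s = ap (cp 0) f s"
  by (simp add: words_2 X_e_def a ap_cap lookup_bvec del: One_nat_def)
qed

lemma op_coev1: "op 0 2 (tl_coev 1) = cu 0"
proof (rule lop_eqI)
 fix f s
 have p: "pre 2 s = [s 0, s (Suc 0)]" "dr 2 s = del 0 s" by (auto simp: pre_def dr_def del_def numeral_2_eq_2)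
 show "ap (op 0 2 (tl_coev 1)) f s = ap (cu 0) f s"
  unfolding ap_mop words_0 p
  by (cases "s 0"; cases "s (Suc 0)"; simp add: coev X_c_def lookup_minus lookup_bvec ap_cup del: One_nat_def)
qed

lemma Suc2: "2 <= m ==> Suc (Suc (m - 2)) = m" by linarith

lemma tl_u_TL: "2 <= m ==> tl_u r m \<in> TL m m"
 using TL_tensor[OF TL_id(1)[of "m - 2"] TL_comp[OF TL_id(3)[of 1] TL_id(2)[of 1]]] by (simp add: tl_u_def Suc2 del: One_nat_def)

lemma op_cc: "op 2 2 (tl_comp r (tl_coev 1) (tl_ev 1)) = cu 0 * cp 0"
 using op_comp[of "tl_ev 1" 2 0 "tl_coev 1" 2] TL_id(2,3)[of 1] by (simp add: op_ev1 op_coev1 del: One_nat_def)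

lemma op_tl_u: "2 <= m ==> op m m (tl_u r m) = tU (m - 2)"
 using op_tensor[OF TL_id(1)[of "m - 2"] TL_comp[OF TL_id(3)[of 1] TL_id(2)[of 1]]]
 by (simp add: tl_u_def op_id op_cc shift_simps shift_cap shift_cup tU_def Suc2 del: One_nat_def)

lemma op_tensor_id: "u \<in> TL m n ==> u \<otimes>\<^sub>T tl_id k \<in> TL (m + k) (n + k)" "u \<in> TL m n ==> op (m + k) (n + k) (u \<otimes>\<^sub>T tl_id k) = op m n u"
 using TL_tensor[OF _ TL_id(1)[of k]] op_tensor[OF _ TL_id(1)[of k]] by (auto simp: op_id shift_simps)

lemma op_sandwich:
 assumes "a \<in> TL m m" "b \<in> TL m m" "2 <= m"
 shows "tl_comp r a (tl_comp r (tl_u r m) b) \<in> TL m m"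
  "op m m (tl_comp r a (tl_comp r (tl_u r m) b)) = op m m a * (tU (m - 2) * op m m b)"
proof -
 note u = tl_u_TL[OF assms(3)]
 show "tl_comp r a (tl_comp r (tl_u r m) b) \<in> TL m m" by (intro TL_comp[OF assms(1)] TL_comp[OF u] assms)
 show "op m m (tl_comp r a (tl_comp r (tl_u r m) b)) = op m m a * (tU (m - 2) * op m m b)"
  by (simp only: op_comp[OF TL_comp[OF u assms(2)] assms(1)] op_comp[OF assms(2) u] op_tl_u[OF assms(3)])
qed

lemma op_jf: "jw_f r m \<in> TL m m & op m m (jw_f r m) = jf m"
proof (induction m rule: jf.induct)
 case (3 k)
 note f = op_tensor_id[OF 3(1)[THEN conjunct1], of 1]
 have f1: "jw_f r (Suc k) \<otimes>\<^sub>T tl_id 1 \<in> TL (Suc (Suc k)) (Suc (Suc k))" "op (Suc (Suc k)) (Suc (Suc k)) (jw_f r (Suc k) \<otimes>\<^sub>T tl_id 1) = jf (Suc k)"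
  using f 3 by simp_all
 note s = op_sandwich[OF f1(1) f1(1)]
 show ?case
  using s f1 by (simp add: Let_def op_add op_scale TL_lin jf.simps(3) del: One_nat_def)
qed (simp_all add: op_id)

lemma op_coev: "op 0 (2 * m) (tl_coev m) = CU m"
proof (induction m)
 case 0
 have "coev_tangle 0 = id_tangle 0" by (simp add: coev_tangle_def id_tangle_def)
 thus ?case using op_id[of 0] by (simp add: tl_coev_def tl_id_def)
next
 case (Suc m)
 note t = TL_tensor[OF TL_id(3)[of 1] TL_id(1)[of m]]
 have "op (m + (2 * 0 + m)) (m + (2 * 1 + m)) (tl_id m \<otimes>\<^sub>T tl_coev 1 \<otimes>\<^sub>T tl_id m) = cu m"
  using op_tensor[OF TL_id(1)[of m] t] op_tensor[OF TL_id(3)[of 1] TL_id(1)[of m]]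
  by (simp add: op_id op_coev1[simplified] shift_simps shift_cup)
 moreover have "tl_id m \<otimes>\<^sub>T tl_coev 1 \<otimes>\<^sub>T tl_id m \<in> TL (2 * m) (2 * Suc m)"
  using TL_tensor[OF TL_id(1)[of m] t] by (simp add: mult_2)
 ultimately show ?case
  using op_comp[OF TL_id(3)[of m], of "tl_id m \<otimes>\<^sub>T tl_coev 1 \<otimes>\<^sub>T tl_id m" "2 * Suc m"] Suc
  by (simp add: tl_coev_Suc[of m r] mult_2)
qed

lemma op_ev: "op (2 * m) 0 (tl_ev m) = CA m"
proof (induction m)
 case 0
 have "ev_tangle 0 = id_tangle 0" by (simp add: ev_tangle_def id_tangle_def)
 thus ?case using op_id[of 0] by (simp add: tl_ev_def tl_id_def)
next
 case (Suc m)
 note t = TL_tensor[OF TL_id(2)[of 1] TL_id(1)[of m]]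
 have "op (m + (2 * 1 + m)) (m + (0 + m)) (tl_id m \<otimes>\<^sub>T tl_ev 1 \<otimes>\<^sub>T tl_id m) = cp m"
  using op_tensor[OF TL_id(1)[of m] t] op_tensor[OF TL_id(2)[of 1] TL_id(1)[of m]]
  by (simp add: op_id op_ev1[simplified] shift_simps shift_cap)
 moreover have "tl_id m \<otimes>\<^sub>T tl_ev 1 \<otimes>\<^sub>T tl_id m \<in> TL (2 * Suc m) (2 * m)"
  using TL_tensor[OF TL_id(1)[of m] t] by (simp add: mult_2)
 ultimately show ?case
  using op_comp[of "tl_id m \<otimes>\<^sub>T tl_ev 1 \<otimes>\<^sub>T tl_id m" "2 * Suc m", OF _ TL_id(2)[of m]] Suc
  by (simp add: tl_ev_Suc[of m r] mult_2)
qed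

lemma shift_CU_Suc: "shift a (CU (Suc k)) = shift (Suc a) (CU k) * cu a"
 by (induction k) (simp_all add: shift_simps shift_cup massoc)

lemma shift_CA_Suc: "shift a (CA (Suc k)) = cp a * shift (Suc a) (CA k)"
proof (induction k)
 case (Suc k)
 have "shift a (CA (Suc (Suc k))) = shift a (CA (Suc k)) * cp (a + Suc k)"
  by (simp only: CA.simps shift_simps shift_cap)
 also have "... = cp a * shift (Suc a) (CA k) * cp (Suc a + k)" by (simp only: Suc add_Suc_right add_Suc)
 finally show ?case by (simp add: shift_simps shift_cap massoc)
qed (simp add: shift_simps shift_cap)

lemma shift_CU: "k <= N ==> shift (N - k) (CU k) = Cu k"
proof (induction k)
 case (Suc k)
 hence "Suc (N - Suc k) = N - k" by linarith
 thus ?case using Suc by (simp only: shift_CU_Suc Cu.simps)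
qed (simp add: shift_simps)

lemma shift_CA: "k <= N ==> shift (N - k) (CA k) = Ca k"
proof (induction k)
 case (Suc k)
 hence "Suc (N - Suc k) = N - k" by linarith
 thus ?case using Suc by (simp only: shift_CA_Suc Ca.simps)
qed (simp add: shift_simps)

lemma shift_CA_N: "shift N (CA k) = Cm k"
 by (induction k) (simp_all add: shift_simps shift_cap)

lemma op_jh:
 assumes k: "0 < k" "k <= N"
 shows "jw_h r (N + k) \<in> TL (N + k) (N + k) & op (N + k) (N + k) (jw_h r (N + k)) = jh k"
proof -
 have e: "N + k - r + 1 = k" "2 * r - (N + k) - 2 = N - k" "r - 1 = N" "N + k + 1 = r + k" using k r_Suc by linarith+
 define p where "p = jw_f r N \<otimes>\<^sub>T tl_id k"
 have p: "p \<in> TL (N + k) (N + k)" "op (N + k) (N + k) p = F"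
  using op_tensor_id[of "jw_f r N" N N k] op_jf[of N] by (simp_all add: p_def)
 have c: "tl_comp r (tl_coev k) (tl_ev k) \<in> TL (2 * k) (2 * k)" "op (2 * k) (2 * k) (tl_comp r (tl_coev k) (tl_ev k)) = CU k * CA k"
  using TL_comp[OF TL_id(3) TL_id(2)] op_comp[OF TL_id(2) TL_id(3)] by (simp_all add: op_coev op_ev)
 define m where "m = tl_id (N - k) \<otimes>\<^sub>T tl_comp r (tl_coev k) (tl_ev k)"
 have s: "N - k + 2 * k = N + k" using k by linarith
 have m: "m \<in> TL (N + k) (N + k)" "op (N + k) (N + k) m = Cu k * Ca k"
  using TL_tensor[OF TL_id(1)[of "N - k"] c(1)] op_tensor[OF TL_id(1)[of "N - k"] c(1)] c(2) k
  by (simp_all add: m_def s op_id shift_simps shift_CU shift_CA)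
 note mp = TL_comp[OF m(1) p(1), of r]
 have sgn: "(- 1 :: complex) ^ (r + k) = (- 1) ^ Suc k" using r_odd by (simp add: power_add)
 have "jw_h r (N + k) = fscale ((- 1) ^ Suc k * qi k) (tl_comp r p (tl_comp r m p))"
  unfolding jw_h_def Let_def e p_def[symmetric] m_def[symmetric] sgn qi_add_r ..
 moreover have "op (N + k) (N + k) (tl_comp r p (tl_comp r m p)) = Ak k * Bk k"
  by (simp add: op_comp[OF mp p(1)] op_comp[OF p(1) m(1)] p m Ak_def Bk_def massoc)
 ultimately show ?thesis using TL_comp[OF p(1) mp] by (simp add: op_scale TL_lin jh_def)
qed

lemma jw_g_r: "jw_g r r = jw_f r N \<otimes>\<^sub>T tl_id 1"
proof -
 have "r - 1 = N" using r_Suc by linarith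
 thus ?thesis by (subst jw_g.simps) (simp only: order_refl if_True)
qed

lemma op_jg:
 assumes k: "0 < k" "k <= N"
 shows "jw_g r (N + k) \<in> TL (N + k) (N + k) & op (N + k) (N + k) (jw_g r (N + k)) = jg k"
 using k
proof (induction k rule: jg.induct)
 case 2
 have e: "N + 1 = r" "N + Suc 0 = r" using r_Suc by linarith+
 have "jw_f r N \<otimes>\<^sub>T tl_id 1 \<in> TL (N + 1) (N + 1)" "op (N + 1) (N + 1) (jw_f r N \<otimes>\<^sub>T tl_id 1) = F"
  using op_tensor_id[of "jw_f r N" N N 1] op_jf[of N] by (simp_all only: simp_thms)
 thus ?case unfolding e jw_g_r jg.simps by blast
next
 case 3
 define M where "M = N + 2"
 have e: "N + Suc (Suc 0) = M" "N + 1 = r" "M - 1 = r" "r - 1 = N" "M = r + 1" "M - 2 = N" "N + Suc 0 = r" "2 <= M" using r_Suc by (auto simp: M_def)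
 have "jw_g r r \<in> TL r r" "op r r (jw_g r r) = F"
  unfolding jw_g_r using op_tensor_id[of "jw_f r N" N N 1] op_jf[of N] e(2) by (simp_all only: simp_thms)
 from op_tensor_id[OF this(1), of 1] this(2)
 have g: "jw_g r r \<otimes>\<^sub>T tl_id 1 \<in> TL M M" "op M M (jw_g r r \<otimes>\<^sub>T tl_id 1) = F" using e by simp_all
 have "jw_h r r \<in> TL r r" "op r r (jw_h r r) = jh 1" using op_jh[of 1] N_ge e by simp_all
 from op_tensor_id[OF this(1), of 1] this(2)
 have h: "jw_h r r \<otimes>\<^sub>T tl_id 1 \<in> TL M M" "op M M (jw_h r r \<otimes>\<^sub>T tl_id 1) = jh 1" using e by simp_all
 note s = op_sandwich[OF g(1) h(1) e(8)] op_sandwich[OF h(1) g(1) e(8)] op_sandwich[OF h(1) h(1) e(8)]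
 have "~ M <= r" using e by linarith
 hence j: "jw_g r M = jw_g r r \<otimes>\<^sub>T tl_id 1 - tl_comp r (jw_g r r \<otimes>\<^sub>T tl_id 1) (tl_comp r (tl_u r M) (jw_h r r \<otimes>\<^sub>T tl_id 1))
   - tl_comp r (jw_h r r \<otimes>\<^sub>T tl_id 1) (tl_comp r (tl_u r M) (jw_g r r \<otimes>\<^sub>T tl_id 1))
   - fscale (qint r 2) (tl_comp r (jw_h r r \<otimes>\<^sub>T tl_id 1) (tl_comp r (tl_u r M) (jw_h r r \<otimes>\<^sub>T tl_id 1)))"
 proof -
  have c: "(M <= r) = False" "(M = r + 1) = True" using e by auto
  show ?thesis unfolding jw_g.simps[of r M] Let_def c e(3) if_False if_True ..
 qed
 show ?case
  unfolding e(1) j jg.simps(3)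
  using s g h e(6) by (simp only: op_diff op_scale TL_lin simp_thms)
next
 case (4 i)
 define k where "k = Suc (Suc i)"
 define M where "M = Suc (N + k)"
 have kM: "N + Suc (Suc (Suc i)) = M" "M - 1 = N + k" "M - 2 = N + Suc i" "2 <= M" "0 < k" "k <= N" "~ M <= r" "M ~= r + 1" "M = r + k" "k = Suc (Suc i)"
  using 4 r_Suc by (auto simp: M_def k_def)
 have IH: "jw_g r (N + k) \<in> TL (N + k) (N + k) & op (N + k) (N + k) (jw_g r (N + k)) = jg k"
  using 4 kM by simp
 have g: "jw_g r (N + k) \<otimes>\<^sub>T tl_id 1 \<in> TL M M" "op M M (jw_g r (N + k) \<otimes>\<^sub>T tl_id 1) = jg k"
  using op_tensor_id[OF IH[THEN conjunct1], of 1] IH by (simp_all add: M_def)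
 have h: "jw_h r (N + k) \<otimes>\<^sub>T tl_id 1 \<in> TL M M" "op M M (jw_h r (N + k) \<otimes>\<^sub>T tl_id 1) = jh k"
  using op_tensor_id[OF op_jh[OF kM(5,6), THEN conjunct1], of 1] op_jh[OF kM(5,6)] by (simp_all add: M_def)
 note s = op_sandwich[OF g(1) g(1) kM(4)] op_sandwich[OF g(1) h(1) kM(4)]
 have "qint r (M - 1) = qi (Suc i)" "qint r M = qi k"
 proof -
  have "M - 1 = r + Suc i" using kM by linarith
  thus "qint r (M - 1) = qi (Suc i)" by (simp only: qi_add_r)
  show "qint r M = qi k" using kM(9) by (simp only: qi_add_r)
 qed
 note v = this
 have j: "jw_g r M = jw_g r (N + k) \<otimes>\<^sub>T tl_id 1
   + fscale (qi (Suc i) / qi k) (tl_comp r (jw_g r (N + k) \<otimes>\<^sub>T tl_id 1) (tl_comp r (tl_u r M) (jw_g r (N + k) \<otimes>\<^sub>T tl_id 1)))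
   - fscale (2 / (qi k)^2) (tl_comp r (jw_g r (N + k) \<otimes>\<^sub>T tl_id 1) (tl_comp r (tl_u r M) (jw_h r (N + k) \<otimes>\<^sub>T tl_id 1)))"
 proof -
  have c: "(M <= r) = False" "(M = r + 1) = False" using kM(7,8) by auto
  have v': "qint r (N + k) = qi (Suc i)" using v(1) unfolding kM(2) .
  show ?thesis unfolding jw_g.simps[of r M] Let_def c kM(2) v' v(2) if_False ..
 qed
 have jk: "jg (Suc (Suc (Suc i))) = jg k + (qi (Suc i) / qi k) *. (jg k * (tU (N + Suc i) * jg k))
   - (2 / (qi k)^2) *. (jg k * (tU (N + Suc i) * jh k))" unfolding k_def by (rule jg.simps(4))
 show ?case
  unfolding kM(1) j jk
  using s g h kM(3) by (simp only: op_diff op_add op_scale TL_lin simp_thms)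
qed simp

lemma kc_a_TL: "kc_a r \<in> TL 0 (2 * N)" and op_kc_a: "op 0 (2 * N) (kc_a r) = Ak N"
proof -
 have e: "r - 1 = N" using r_Suc by linarith
 have p: "jw_f r N \<otimes>\<^sub>T tl_id N \<in> TL (2 * N) (2 * N)" "op (2 * N) (2 * N) (jw_f r N \<otimes>\<^sub>T tl_id N) = F"
  using op_tensor_id[of "jw_f r N" N N N] op_jf[of N] by (simp_all add: mult_2)
 show "kc_a r \<in> TL 0 (2 * N)" "op 0 (2 * N) (kc_a r) = Ak N"
  unfolding kc_a_def e using TL_comp[OF p(1) TL_id(3)] op_comp[OF TL_id(3) p(1)] p(2) by (simp_all add: op_coev A_N)
qed

lemma cp_shift: "cp m * shift (m + 2) X = shift m X * cp m"
proof -
 have "cp 0 * shift 2 X = shift 0 X * cp 0" using mop_shift[of 2 0 "\<Phi> (tl_ev 1)" X] by (simp only: op_ev1)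
 hence "shift m (cp 0 * shift 2 X) = shift m (shift 0 X * cp 0)" by simp
 thus ?thesis by (simp only: shift_simps shift_shift shift_cap add_0_right)
qed

lemma snake: "CA m * shift m (CU m) = 1"
proof (induction m)
 case (Suc m)
 have "CA (Suc m) * shift (Suc m) (CU (Suc m)) = CA m * (cp m * shift (m + 2) (CU m)) * cu (Suc m)"
  by (simp only: CA.simps shift_CU_Suc massoc add_2_eq_Suc')
 also have "... = CA m * shift m (CU m) * (cp m * cu (Suc m))"
  by (simp only: cp_shift massoc)
 finally show ?case by (simp add: Suc cc_up)
qed (simp add: shift_simps)

text \<open>By the snake identity, capping off with \<open>CA m\<close> unbends, so an operator on
  the right half is determined by its action on \<open>CU m\<close>.\<close>

lemma shift_CU_inj: "shift m X * CU m = shift m Y * CU m ==> X = Y"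
proof -
 assume e: "shift m X * CU m = shift m Y * CU m"
 have *: "X = CA m * shift m (shift m X * CU m)" for X
 proof -
  have "CA m * shift (2 * m) X = X * CA m" using mop_shift[of "2 * m" 0 "\<Phi> (tl_ev m)" X] by (simp add: op_ev shift_simps)
  hence "CA m * shift m (shift m X * CU m) = X * (CA m * shift m (CU m))"
   by (simp add: shift_simps shift_shift mult_2 flip: massoc)
  thus ?thesis by (simp add: snake)
 qed
 show "X = Y" using *[of X] *[of Y] e by simp
qed

lemma rot_bend: "g \<in> TL m m ==> shift m (op m m (tl_rot g)) * CU m = op m m g * CU m"
proof -
 assume g: "g \<in> TL m m"
 note t = TL_tensor[OF TL_id(1)[of m] TL_rot[OF g]] TL_tensor[OF g TL_id(1)[of m]]
 have "op 0 (2 * m) (tl_comp r (tl_id m \<otimes>\<^sub>T tl_rot g) (tl_coev m)) = op 0 (2 * m) (tl_comp r (g \<otimes>\<^sub>T tl_id m) (tl_coev m))"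
  by (simp only: tl_bend[OF g])
 moreover have "op 0 (2 * m) (tl_comp r (tl_id m \<otimes>\<^sub>T tl_rot g) (tl_coev m)) = shift m (op m m (tl_rot g)) * CU m"
  using op_comp[OF TL_id(3)[of m], of "tl_id m \<otimes>\<^sub>T tl_rot g" "2 * m"] t(1) op_tensor[OF TL_id(1)[of m] TL_rot[OF g]]
  by (simp add: mult_2 op_id op_coev[unfolded mult_2])
 moreover have "op 0 (2 * m) (tl_comp r (g \<otimes>\<^sub>T tl_id m) (tl_coev m)) = op m m g * CU m"
  using op_comp[OF TL_id(3)[of m], of "g \<otimes>\<^sub>T tl_id m" "2 * m"] t(2) op_tensor[OF g TL_id(1)[of m]]
  by (simp add: mult_2 op_id shift_simps op_coev[unfolded mult_2])
 ultimately show ?thesis by simp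
qed

end

section \<open>The small quantum group\<close>

lemma lop_smult_sum: "c *. sum x A = (\<Sum>i\<in>A. c *. x i)"
 by (rule lop_eqI) (simp add: ap_sum_lop sum_distrib_left)

locale qg = odd_root r N + small_quantum_group scale r ge gf gk
 for r N and scale :: "complex => 'u::ring_1 => 'u" and ge gf gk :: 'u
begin

lemmas ss = scale_mult_left scale_mult_right scale_right_distrib scale_right_diff_distrib scale_scale

lemma Kinv_N: "Kinv = gk ^ N" and r_1: "r - 1 = N"
proof -
 show 1: "r - 1 = N" using r_Suc by linarith
 show "Kinv = gk ^ N" unfolding Kinv_def 1 ..
qed

lemma KKinv: "gk * gk ^ N = 1" "gk ^ N * gk = 1"
 using K_order r_Suc by (metis power_Suc, metis power_Suc2)

lemma gk_mod: "gk ^ (c mod r) = gk ^ c"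
 by (metis K_order mult_1 mod_mult_div_eq power_add power_mult power_one mult.right_neutral)

lemma ke: "gk * ge = scale y (ge * gk)" and kf: "gk * gf = scale (iy) (gf * gk)"
proof -
 have "gk * ge = (gk * ge * gk ^ N) * gk" by (simp add: massoc KKinv)
 thus "gk * ge = scale y (ge * gk)" using K_E by (simp only: r_1 ss y_def)
 have "gk * gf = (gk * gf * gk ^ N) * gk" by (simp add: massoc KKinv)
 thus "gk * gf = scale (iy) (gf * gk)" using K_F by (simp only: r_1 ss y_def)
qed

lemma ke_pow: "gk ^ c * ge ^ a = scale (y ^ (c * a)) (ge ^ a * gk ^ c)"
proof -
 have 1: "gk * ge ^ a = scale (y ^ a) (ge ^ a * gk)" for a
 proof (induction a)
  case (Suc a)
  have "gk * ge ^ Suc a = scale y (ge * (gk * ge ^ a))" by (simp add: massoc[symmetric] ke ss)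
  thus ?case by (simp add: Suc ss massoc)
 qed simp
 show ?thesis
 proof (induction c)
  case (Suc c)
  have "gk ^ Suc c * ge ^ a = gk * (gk ^ c * ge ^ a)" by (simp add: massoc)
  also have "... = scale (y ^ (c * a)) ((gk * ge ^ a) * gk ^ c)" by (simp add: Suc ss massoc)
  finally show ?case by (simp add: 1 ss massoc power_add mult.commute)
 qed simp
qed

lemma kf_pow: "gk ^ c * gf ^ a = scale (iy ^ (c * a)) (gf ^ a * gk ^ c)"
proof -
 have 1: "gk * gf ^ a = scale (iy ^ a) (gf ^ a * gk)" for a
 proof (induction a)
  case (Suc a)
  have "gk * gf ^ Suc a = scale (iy) (gf * (gk * gf ^ a))" by (simp add: massoc[symmetric] kf ss)
  thus ?case by (simp add: Suc ss massoc)
 qed simp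
 show ?thesis
 proof (induction c)
  case (Suc c)
  have "gk ^ Suc c * gf ^ a = gk * (gk ^ c * gf ^ a)" by (simp add: massoc)
  also have "... = scale (iy ^ (c * a)) ((gk * gf ^ a) * gk ^ c)" by (simp add: Suc ss massoc)
  finally show ?case by (simp add: 1 ss massoc power_add mult.commute)
 qed simp
qed

lemma y_r: "y ^ r = 1" "iy ^ r = 1" "y ^ (N * a) = iy ^ a" "iy ^ (N * a) = y ^ a"
proof -
 show 1: "y ^ r = 1" using y_pow_eq_1[of r] by simp
 thus "iy ^ r = 1" by (simp add: power_inverse)
 have "y ^ N * y = 1" using 1 r_Suc by (metis power_Suc2)
 hence "y ^ N = iy" by (simp add: field_simps)
 thus "y ^ (N * a) = iy ^ a" "iy ^ (N * a) = y ^ a"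
  by (simp_all add: power_mult power_inverse)
qed

lemma Nke: "gk ^ N * ge ^ a = scale (iy ^ a) (ge ^ a * gk ^ N)" "gk ^ N * gf ^ a = scale (y ^ a) (gf ^ a * gk ^ N)"
 by (simp_all add: ke_pow kf_pow y_r)

subsection \<open>Coordinates\<close>

lemma indep_B: "independent (pbw ` pbw_indices)" and span_B: "span (pbw ` pbw_indices) = UNIV" and inj_B: "inj_on pbw pbw_indices"
 using pbw_independent pbw_span pbw_inj unfolding pbw_def pbw_indices_def by auto

lemma fin_I[simp]: "finite pbw_indices" by (simp add: pbw_indices_def)

lemma lookup_coords: "lkp (coords x) i = (if i \<in> pbw_indices then representation (pbw ` pbw_indices) x (pbw i) else 0)"
 by (simp add: coords_def lookup_sum_pm lookup_single when_def)

lemma coords_lin: "coords (x + z) = coords x + coords z" "coords (scale c x) = fscale c (coords x)"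
 by (rule poly_mapping_eqI, simp add: lookup_coords lookup_add representation_add[OF indep_B] representation_scale[OF indep_B] span_B)+

lemma coords_pbw: "i \<in> pbw_indices ==> coords (pbw i) = bvec i"
 using inj_B by (intro poly_mapping_eqI) (auto simp: lookup_coords lookup_bvec representation_basis[OF indep_B] inj_on_eq_iff)

lemma u_expand: "x = (\<Sum>i\<in>pbw_indices. scale (lkp (coords x) i) (pbw i))"
proof -
 have "(\<Sum>b\<in>pbw ` pbw_indices. scale (representation (pbw ` pbw_indices) x b) b) = x"
  by (rule sum_representation_eq[OF indep_B]) (simp_all add: span_B)
 thus ?thesis by (simp add: sum.reindex[OF inj_B] lookup_coords)
qed

definition linL :: "('u => lop) => bool" where
 "linL T \<longleftrightarrow> (\<forall>x z. T (x + z) = T x + T z) & (\<forall>c x. T (scale c x) = c *. T x)"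

lemma linLD: "linL T ==> T (x + z) = T x + T z" "linL T ==> T (scale c x) = c *. T x"
 by (simp_all add: linL_def)

lemma linL_simps: "linL T ==> T 0 = 0" "linL T ==> T (x - z) = T x - T z"
 "linL T ==> T (sum f S) = (\<Sum>i\<in>S. T (f i))"
proof -
 assume T: "linL T"
 show 0: "T 0 = 0" using linLD(2)[OF T, of 0 0] by simp
 have "T (x + scale (- 1) z) = T x + (- 1) *. T z" using T by (simp only: linLD)
 thus "T (x - z) = T x - T z" by simp
 show "T (sum f S) = (\<Sum>i\<in>S. T (f i))"
  by (induction S rule: infinite_finite_induct) (simp_all add: 0 linLD(1)[OF T])
qed

lemma lin_ext:
 assumes "linL T" "linL T'" "!!a b c. a < r ==> b < r ==> c < r ==> T (ge ^ a * gf ^ b * gk ^ c) = T' (ge ^ a * gf ^ b * gk ^ c)"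
 shows "T x = T' x"
proof -
 have "T (pbw i) = T' (pbw i)" if "i \<in> pbw_indices" for i
  using that assms(3) by (auto simp: pbw_def pbw_indices_def)
 hence "T (\<Sum>i\<in>pbw_indices. scale (lkp (coords x) i) (pbw i)) = T' (\<Sum>i\<in>pbw_indices. scale (lkp (coords x) i) (pbw i))"
  unfolding linL_simps(3)[OF assms(1)] linL_simps(3)[OF assms(2)] linLD(2)[OF assms(1)] linLD(2)[OF assms(2)]
  by (intro sum.cong refl) simp
 thus ?thesis by (simp only: u_expand[symmetric])
qed

subsection \<open>Representations\<close>

text \<open>Defined on PBW coordinates, since the locale provides a basis but no universal property.
  That this is multiplicative for generators satisfying the relations is proved in
  \<open>rhoU_gen\<close> and \<open>rhoU_mult\<close>.\<close>

definition rhoU :: "lop => lop => lop => 'u => lop" where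
 "rhoU e f k x = (\<Sum>(a, b, c)\<in>pbw_indices. lkp (coords x) (a, b, c) *. (e ^ a * (f ^ b * k ^ c)))"

definition isrep :: "lop => lop => lop => bool" where
 "isrep e f k \<longleftrightarrow> e ^ r = 0 & f ^ r = 0 & k ^ r = 1 & k * e = y *. (e * k) & k * f = iy *. (f * k) \<and>
   e * f - f * e = (1 / br 1) *. (k - k ^ N)"

lemma rhoU_lin: "linL (rhoU e f k)"
 unfolding linL_def rhoU_def
 by (auto simp: coords_lin lookup_add smult_distrib sum.distrib lop_smult_sum case_prod_beta)

lemma rhoU_mono:
 assumes "isrep e f k"
 shows "rhoU e f k (ge ^ a * gf ^ b * gk ^ c) = e ^ a * (f ^ b * k ^ c)"
proof (cases "a < r & b < r")
 case True
 have km: "k ^ (c mod r) = k ^ c"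
  using assms unfolding isrep_def by (metis mult_1 mod_mult_div_eq power_add power_mult power_one mult.right_neutral)
 have i: "(a, b, c mod r) \<in> pbw_indices" using True by (auto simp: pbw_indices_def)
 have "rhoU e f k (ge ^ a * gf ^ b * gk ^ c) = rhoU e f k (pbw (a, b, c mod r))"
  by (simp add: pbw_def gk_mod)
 also have "... = (\<Sum>j\<in>pbw_indices. if j = (a, b, c mod r) then e ^ a * (f ^ b * k ^ (c mod r)) else 0)"
  unfolding rhoU_def coords_pbw[OF i]
 proof (rule sum.cong[OF refl])
  fix j
  show "(case j of (a', b', c') => lkp (bvec (a, b, c mod r)) (a', b', c') *. (e ^ a' * (f ^ b' * k ^ c')))
   = (if j = (a, b, c mod r) then e ^ a * (f ^ b * k ^ (c mod r)) else 0)"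
   by (cases "(a, b, c mod r) = j") (auto simp: lookup_bvec case_prod_beta)
 qed
 finally show ?thesis using i by (simp add: km)
next
 case False
 hence "ge ^ a * gf ^ b * gk ^ c = 0 & e ^ a * (f ^ b * k ^ c) = 0"
 proof -
  have "x ^ n = 0" if "x ^ r = 0" "~ n < r" for x :: lop and n
   using that by (metis le_add_diff_inverse mult_zero_left not_less power_add)
  moreover have "x ^ n = 0" if "x ^ r = 0" "~ n < r" for x :: 'u and n
   using that by (metis le_add_diff_inverse mult_zero_left not_less power_add)
  ultimately show ?thesis using False assms E_nilpotent F_nilpotent unfolding isrep_def
   by (metis mult_zero_left mult_zero_right)
 qed
 thus ?thesis by (simp add: linL_simps(1)[OF rhoU_lin])
qed

lemma linL_comp: "linL T ==> linL (%x. T (w * x))" "linL T ==> linL (%x. T (x * w))" "linL T ==> linL (%x. X * T x)" "linL T ==> linL (%x. T x * X)"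
 by (auto simp: linL_def distrib_left distrib_right ss)

lemma lop_k_pow: "isrep e f k ==> k * (e ^ a * (f ^ b * k ^ c)) = (y ^ a * iy ^ b) *. (e ^ a * (f ^ b * k ^ Suc c))"
proof -
 assume R: "isrep e f k"
 have 1: "k * e ^ a = y ^ a *. (e ^ a * k)" for a
 proof (induction a)
  case (Suc a)
  have "k * e ^ Suc a = y *. (e * (k * e ^ a))" using R by (simp add: isrep_def flip: massoc)
  thus ?case by (simp add: Suc massoc)
 qed simp
 have 2: "k * f ^ a = iy ^ a *. (f ^ a * k)" for a
 proof (induction a)
  case (Suc a)
  have "k * f ^ Suc a = iy *. (f * (k * f ^ a))" using R by (simp add: isrep_def flip: massoc)
  thus ?case by (simp add: Suc massoc)
 qed simp
 have "k * (e ^ a * (f ^ b * k ^ c)) = y ^ a *. (e ^ a * ((k * f ^ b) * k ^ c))"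
  by (simp add: 1 massoc[symmetric])
 thus ?thesis by (simp add: 2 massoc)
qed

lemma rhoU_gen:
 assumes R: "isrep e f k"
 shows "rhoU e f k (ge * x) = e * rhoU e f k x" "rhoU e f k (gk * x) = k * rhoU e f k x"
  "rhoU e f k (gf * x) = f * rhoU e f k x"
proof -
 note L = rhoU_lin[of e f k] and m = rhoU_mono[OF R]
 show E: "rhoU e f k (ge * x) = e * rhoU e f k x" for x
 proof (rule lin_ext[of "%x. rhoU e f k (ge * x)" "%x. e * rhoU e f k x"])
  fix a b c
  show "rhoU e f k (ge * (ge ^ a * gf ^ b * gk ^ c)) = e * rhoU e f k (ge ^ a * gf ^ b * gk ^ c)"
   using m[of "Suc a" b c] m[of a b c] by (simp add: massoc)
 qed (intro linL_comp L)+
 show K: "rhoU e f k (gk * x) = k * rhoU e f k x" for x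
 proof (rule lin_ext[of "%x. rhoU e f k (gk * x)" "%x. k * rhoU e f k x"])
  fix a b c
  have "gk * (ge ^ a * gf ^ b * gk ^ c) = gk ^ 1 * ge ^ a * gf ^ b * gk ^ c" by (simp add: massoc)
  also have "... = scale (y ^ a) (ge ^ a * (gk ^ 1 * gf ^ b) * gk ^ c)"
   unfolding ke_pow by (simp add: ss massoc)
  also have "... = scale (y ^ a * iy ^ b) (ge ^ a * gf ^ b * gk ^ Suc c)"
   unfolding kf_pow by (simp add: ss massoc)
  finally have e: "gk * (ge ^ a * gf ^ b * gk ^ c) = scale (y ^ a * iy ^ b) (ge ^ a * gf ^ b * gk ^ Suc c)" .
  show "rhoU e f k (gk * (ge ^ a * gf ^ b * gk ^ c)) = k * rhoU e f k (ge ^ a * gf ^ b * gk ^ c)"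
   unfolding e linLD(2)[OF L] m lop_k_pow[OF R] ..
 qed (intro linL_comp L)+
 have Kp: "rhoU e f k (gk ^ n * x) = k ^ n * rhoU e f k x" for n x
  by (induction n arbitrary: x) (simp_all add: massoc K)
 show "rhoU e f k (gf * x) = f * rhoU e f k x"
 proof (rule lin_ext[of "%x. rhoU e f k (gf * x)" "%x. f * rhoU e f k x"])
  fix a b c
  show "rhoU e f k (gf * (ge ^ a * gf ^ b * gk ^ c)) = f * rhoU e f k (ge ^ a * gf ^ b * gk ^ c)"
  \<comment> \<open>Only \<open>gf\<close> stands on the wrong side of the powers of
    \<open>ge\<close>; each exchange costs terms in \<open>gk\<close>, which the cases proved before
    already handle.\<close>
  proof (induction a)
   case 0
   thus ?case using m[of 0 "Suc b" c] m[of 0 b c] by (simp add: massoc)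
  next
   case (Suc a)
   define z where "z = ge ^ a * gf ^ b * gk ^ c"
   have br1: "br 1 = q - iq" by (simp add: qbrace_def)
   have "gf * ge = ge * gf - scale (1 / br 1) (gk - gk ^ N)"
    using E_F unfolding br1[symmetric] r_1 by (simp add: algebra_simps)
   hence "gf * (ge ^ Suc a * gf ^ b * gk ^ c) = ge * (gf * z) - scale (1 / br 1) (gk * z - gk ^ N * z)"
    unfolding z_def by (simp add: massoc[symmetric] left_diff_distrib) (simp add: massoc ss left_diff_distrib)
   hence "rhoU e f k (gf * (ge ^ Suc a * gf ^ b * gk ^ c)) = e * (f * rhoU e f k z) - (1 / br 1) *. (k * rhoU e f k z - k ^ N * rhoU e f k z)"
    using Suc by (simp add: linL_simps(2)[OF L] linLD(2)[OF L] E K Kp z_def)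
   also have "... = (e * f - (1 / br 1) *. (k - k ^ N)) * rhoU e f k z" by (simp add: left_diff_distrib massoc)
   also have "e * f - (1 / br 1) *. (k - k ^ N) = f * e" using R by (simp add: isrep_def algebra_simps)
   finally show ?case unfolding z_def m by (simp add: massoc)
  qed
 qed (intro linL_comp L)+
qed

lemma rhoU_mult:
 assumes R: "isrep e f k"
 shows "rhoU e f k (x * z) = rhoU e f k x * rhoU e f k z"
proof (rule lin_ext[of "%x. rhoU e f k (x * z)" "%x. rhoU e f k x * rhoU e f k z"])
 note g = rhoU_gen[OF R]
 have p: "rhoU e f k (ge ^ n * x) = e ^ n * rhoU e f k x" "rhoU e f k (gf ^ n * x) = f ^ n * rhoU e f k x" "rhoU e f k (gk ^ n * x) = k ^ n * rhoU e f k x" for n x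
  by (induction n arbitrary: x) (simp_all add: massoc g)
 fix a b c
 show "rhoU e f k (ge ^ a * gf ^ b * gk ^ c * z) = rhoU e f k (ge ^ a * gf ^ b * gk ^ c) * rhoU e f k z"
  unfolding rhoU_mono[OF R] by (simp add: massoc p)
qed (intro linL_comp rhoU_lin)+

lemma rhoU_vals:
 assumes "isrep e f k"
 shows "rhoU e f k ge = e" "rhoU e f k gf = f" "rhoU e f k gk = k" "rhoU e f k 1 = 1" "rhoU e f k Kinv = k ^ N"
 using rhoU_mono[OF assms, of 1 0 0] rhoU_mono[OF assms, of 0 1 0] rhoU_mono[OF assms, of 0 0 1]
  rhoU_mono[OF assms, of 0 0 0] rhoU_mono[OF assms, of 0 0 N] by (simp_all add: Kinv_N)

subsection \<open>The Casimir element\<close>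

text \<open>Rescaled so that the eigenvalues become the numbers \<open>{l}'\<close>.\<close>

definition bb :: 'u where "bb = scale ((br 1)^2) casimir"

lemma br1_nz': "br 1 ~= 0" using br1_nz by simp

lemma bb1: "bb = scale ((br 1)^2) (gf * ge) + scale q gk + scale (iq) (gk ^ N)"
 using br1_nz' by (simp add: bb_def casimir_def ss Kinv_N)

lemma bb2: "bb = scale ((br 1)^2) (ge * gf) + scale (iq) gk + scale q (gk ^ N)"
proof -
 have b: "br 1 = q - iq" by (simp add: qbrace_def)
 have "ge * gf = gf * ge + scale (1 / br 1) (gk - gk ^ N)"
  using E_F unfolding b[symmetric] r_1 by (simp add: algebra_simps)
 hence "scale ((br 1)^2) (ge * gf) = scale ((br 1)^2) (gf * ge) + (scale (br 1) gk - scale (br 1) (gk ^ N))"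
  using br1_nz' by (simp add: ss power2_eq_square)
 thus ?thesis unfolding bb1 b by (simp add: scale_left_diff_distrib algebra_simps)
qed

lemma bb_comm: "bb * ge = ge * bb" "bb * gf = gf * bb" "bb * gk = gk * bb"
proof -
 have n: "gk ^ N * ge = scale (iy) (ge * gk ^ N)" "gk ^ N * gf = scale y (gf * gk ^ N)"
  using Nke[of 1] by simp_all
 have c: "iq * y = q" "q * iy = iq" by (simp_all add: y_def power2_eq_square)
 show "bb * ge = ge * bb"
  by (subst (1) bb2, subst bb1) (simp add: distrib_left distrib_right ss massoc ke n c)
 show "bb * gf = gf * bb"
  by (subst (1) bb1, subst bb2) (simp add: distrib_left distrib_right ss massoc kf n c)
 have "gf * (ge * gk) = gk * (gf * ge)"
  using ke kf by (simp add: massoc[symmetric] ss) (simp add: massoc ke ss)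
 thus "bb * gk = gk * bb"
  by (simp add: bb1 distrib_left distrib_right ss massoc KKinv)
qed

lemma bb_pow_comm: "bb ^ j * ge ^ a = ge ^ a * bb ^ j" "bb ^ j * gf ^ a = gf ^ a * bb ^ j" "bb ^ j * gk ^ a = gk ^ a * bb ^ j"
 by (metis bb_comm(1) power_commuting_commutes, metis bb_comm(2) power_commuting_commutes, metis bb_comm(3) power_commuting_commutes)

text \<open>Up to powers of \<open>K\<close>, multiplication by \<open>bb\<close> raises both
  exponents of \<open>E^a F^a\<close> by one. This is used in both directions: to evaluate powers of
  \<open>bb\<close>, and to express \<open>E^a F^a\<close> through \<open>bb\<close> and
  \<open>K\<close>.\<close>

lemma bb_EF: "bb * (ge ^ a * gf ^ a * gk ^ c) = scale ((br 1)^2) (ge ^ Suc a * gf ^ Suc a * gk ^ c)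
  + scale (iq * iy ^ a) (ge ^ a * gf ^ a * gk ^ (c + 1)) + scale (q * y ^ a) (ge ^ a * gf ^ a * gk ^ (c + N))"
proof -
 have "bb * (ge ^ a * gf ^ a * gk ^ c) = ge ^ a * (bb * (gf ^ a * gk ^ c))"
  using bb_pow_comm(1)[of 1 a] by (simp add: massoc[symmetric])
 also have "bb * (gf ^ a * gk ^ c) = scale ((br 1)^2) (ge * gf ^ Suc a * gk ^ c)
   + scale (iq) ((gk ^ 1 * gf ^ a) * gk ^ c) + scale q ((gk ^ N * gf ^ a) * gk ^ c)"
  by (simp add: bb2 distrib_right ss massoc)
 also have "ge ^ a * \<dots> = scale ((br 1)^2) (ge ^ a * (ge * gf ^ Suc a * gk ^ c))
   + scale (iq * iy ^ a) (ge ^ a * gf ^ a * (gk * gk ^ c)) + scale (q * y ^ a) (ge ^ a * gf ^ a * (gk ^ N * gk ^ c))"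
  unfolding kf_pow[of 1] Nke by (simp add: distrib_left ss massoc)
 also have "ge ^ a * (ge * gf ^ Suc a * gk ^ c) = ge ^ Suc a * gf ^ Suc a * gk ^ c"
  by (simp only: power_Suc2[of ge a] massoc)
 also have "gk * gk ^ c = gk ^ (c + 1)" by simp
 also have "gk ^ N * gk ^ c = gk ^ (c + N)" by (simp only: power_add[symmetric] add.commute)
 finally show ?thesis .
qed

lemma li_simps: "left_integral (x + z) = left_integral x + left_integral z" "left_integral (scale c x) = c * left_integral x"
 "left_integral (x - z) = left_integral x - left_integral z" "left_integral 0 = 0"
proof -
 show a: "left_integral (x + z) = left_integral x + left_integral z" and s: "left_integral (scale c x) = c * left_integral x" for x z c
  by (simp_all add: left_integral_def coords_lin lookup_add algebra_simps)
 show "left_integral (x - z) = left_integral x - left_integral z"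
  using a[of "x - z" z] by simp
 show "left_integral 0 = 0" using s[of 0 0] by simp
qed

lemma li_lin: "linL (%x. left_integral x *. X)"
 by (simp add: linL_def li_simps smult_distrib)

definition kap :: complex where "kap = of_nat r * (qfact r N)^2"

lemma li_mono: "left_integral (ge ^ a * gf ^ b * gk ^ c) = (if a = N & b = N & r dvd Suc c then kap else 0)"
proof (cases "a < r & b < r")
 case True
 have i: "(a, b, c mod r) \<in> pbw_indices" using True by (auto simp: pbw_indices_def)
 have c: "c mod r = N \<longleftrightarrow> r dvd Suc c"
 proof -
  have "Suc (c mod r) = r \<longleftrightarrow> c mod r = N" using r_Suc by linarith
  thus ?thesis by (simp add: dvd_eq_mod_eq_0 mod_Suc)
 qed
 have "left_integral (ge ^ a * gf ^ b * gk ^ c) = left_integral (pbw (a, b, c mod r))"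
  by (simp add: pbw_def gk_mod)
 also have "... = of_nat r * (qfact r N)^2 * (if (a, b, c mod r) = (N, N, N) then 1 else 0)"
  unfolding left_integral_def coords_pbw[OF i] lookup_bvec r_1 ..
 finally show ?thesis using c by (simp add: kap_def)
next
 case False
 have "x ^ n = 0" if "x ^ r = 0" "~ n < r" for x :: 'u and n
  using that by (metis le_add_diff_inverse mult_zero_left not_less power_add)
 note z = this
 have "ge ^ a * gf ^ b * gk ^ c = 0"
 proof (cases "a < r")
  case True
  hence "gf ^ b = 0" using z[OF F_nilpotent] False by blast
  thus ?thesis by simp
 next
  case False
  hence "ge ^ a = 0" using z[OF E_nilpotent] by blast
  thus ?thesis by simp
 qed
 moreover have "~ (a = N & b = N)" using False N_lt by blast
 ultimately show ?thesis by (auto simp: li_simps)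
qed

text \<open>The lower terms of \<open>bb_EF\<close> lose a degree and cannot reach
  \<open>E^N F^N\<close> any more, so only the leading term counts.\<close>

lemma li_bb: "j + a <= N ==> left_integral (bb ^ j * (ge ^ a * gf ^ a * gk ^ c)) = (if j + a = N & r dvd Suc c then (br 1) ^ (2 * j) * kap else 0)"
proof (induction j arbitrary: a c)
 case (Suc j)
 have "bb ^ Suc j * (ge ^ a * gf ^ a * gk ^ c) = bb ^ j * (bb * (ge ^ a * gf ^ a * gk ^ c))"
  by (simp add: power_commutes massoc[symmetric])
 also have "... = scale ((br 1)^2) (bb ^ j * (ge ^ Suc a * gf ^ Suc a * gk ^ c))
  + scale (iq * iy ^ a) (bb ^ j * (ge ^ a * gf ^ a * gk ^ (c + 1))) + scale (q * y ^ a) (bb ^ j * (ge ^ a * gf ^ a * gk ^ (c + N)))"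
  unfolding bb_EF by (simp only: distrib_left ss)
 also have "left_integral \<dots> = (br 1)^2 * left_integral (bb ^ j * (ge ^ Suc a * gf ^ Suc a * gk ^ c))"
 proof -
  have "left_integral (bb ^ j * (ge ^ a * gf ^ a * gk ^ d)) = 0" for d
   using Suc.IH[of a d] Suc.prems by simp
  thus ?thesis by (simp only: li_simps) simp
 qed
 finally have e: "left_integral (bb ^ Suc j * (ge ^ a * gf ^ a * gk ^ c)) = (br 1)^2 * left_integral (bb ^ j * (ge ^ Suc a * gf ^ Suc a * gk ^ c))" .
 have "2 * Suc j = 2 + 2 * j" by simp
 thus ?case unfolding e using Suc.IH[of "Suc a" c] Suc.prems by (simp only: power_add) auto
qed (simp add: li_mono)

end

lemmas lop_add_right = smult_distrib(1) and lop_diff_right = smult_distrib(2)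
 and lop_add_left = smult_distrib(3) and lop_diff_left = smult_distrib(4)

lemma lop_cancel: "c *. x = c *. z ==> c ~= 0 ==> x = z"
proof -
 assume "c *. x = c *. z" "c ~= 0"
 hence "inverse c *. (c *. x) = inverse c *. (c *. z)" by simp
 with \<open>c ~= 0\<close> show "x = z" by simp
qed

section \<open>Residues at the Casimir eigenvalues\<close>

lemma geo_root: "z ^ r = 1 ==> z ~= 1 ==> (\<Sum>l<r. z ^ l) = (0 :: complex)"
 by (simp add: geometric_sum)

text \<open>The powers of \<open>z\<close> are the roots of \<open>1 + x + ... + x^N\<close>;
  evaluate its factorization at \<open>1\<close>.\<close>

lemma root_prod:
 fixes z :: complex
 assumes "z ^ Suc N = 1" "!!j. 0 < j ==> j <= N ==> z ^ j ~= 1"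
 shows "(\<Prod>j\<in>{1..N}. 1 - z ^ j) = of_nat (Suc N)"
proof -
 let ?P = "\<Prod>j\<in>{1..N}. [:- (z ^ j), 1:]" and ?Q = "\<Sum>i\<le>N. monom 1 i :: complex poly"
 have z0: "z ~= 0" using assms(1) by auto
 have inj: "inj_on ((^) z) {1..N}"
 proof (rule linorder_inj_onI)
  fix i j assume ij: "i < j" "i \<in> {1..N}" "j \<in> {1..N}"
  have "z ^ j = z ^ i * z ^ (j - i)" using ij by (simp flip: power_add)
  moreover have "z ^ (j - i) ~= 1" using assms(2)[of "j - i"] ij by simp
  ultimately show "z ^ i ~= z ^ j" using z0 by simp
 qed auto
 have dP: "degree ?P = N" by (subst degree_prod_sum_eq) auto
 have "coeff (\<Prod>j\<in>S. [:- (z ^ j), 1:]) (degree (\<Prod>j\<in>S. [:- (z ^ j), 1:])) = 1" if "finite S" for S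
  using that
 proof (induction S rule: finite_induct)
  case (insert j S)
  have "coeff (\<Prod>j\<in>insert j S. [:- (z ^ j), 1:]) (degree (\<Prod>j\<in>insert j S. [:- (z ^ j), 1:]))
   = coeff [:- (z ^ j), 1:] (degree [:- (z ^ j), 1:]) * coeff (\<Prod>j\<in>S. [:- (z ^ j), 1:]) (degree (\<Prod>j\<in>S. [:- (z ^ j), 1:]))"
   by (simp only: prod.insert[OF insert(1,2)] lead_coeff_mult)
  thus ?case using insert by simp
 qed simp
 hence "coeff ?P (degree ?P) = 1" by blast
 hence cP: "coeff ?P N = 1" unfolding dP .
 have cQ: "coeff ?Q i = (if i <= N then 1 else 0)" for i by (simp add: coeff_sum)
 have dQ: "degree ?Q <= N" by (rule degree_le) (simp add: cQ)
 have "?P = ?Q"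
 proof (rule poly_eqI_degree_lead_coeff[of _ N _ "(^) z ` {1..N}"])
  show "coeff ?P N = coeff ?Q N" by (simp only: cP cQ order_refl if_True)
  show "card ((^) z ` {1..N}) \<ge> N" unfolding card_image[OF inj] by simp
  show "degree ?P <= N" "degree ?Q <= N" using dP dQ by auto
  fix x assume "x \<in> (^) z ` {1..N}"
  then obtain j where j: "x = z ^ j" "1 <= j" "j <= N" by auto
  have "poly ?P x = 0" using j by (auto simp: poly_prod)
  moreover have "poly ?Q x = 0"
  proof -
   have "poly ?Q x = (\<Sum>l<Suc N. x ^ l)" by (simp add: poly_sum poly_monom lessThan_Suc_atMost)
   also have "... = 0"
   proof (rule geo_root)
    have "x ^ Suc N = (z ^ Suc N) ^ j" unfolding j(1) by (simp only: power_mult[symmetric] mult.commute)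
    thus "x ^ Suc N = 1" by (simp add: assms(1) del: power_Suc)
    show "x ~= 1" using assms(2)[of j] j by simp
   qed
   finally show ?thesis .
  qed
  ultimately show "poly ?P x = poly ?Q x" by simp
 qed
 hence "poly ?P 1 = poly ?Q 1" by simp
 thus ?thesis by (simp add: poly_prod poly_sum poly_monom)
qed

lemma poly_pderiv_double: "poly (pderiv ([:- \<beta>, 1:] ^ Suc (Suc n) * X)) (\<beta> :: complex) = 0"
proof -
 have e: "[:- \<beta>, 1:] ^ Suc (Suc n) * X = [:- \<beta>, 1:] * ([:- \<beta>, 1:] * ([:- \<beta>, 1:] ^ n * X))"
  by (simp only: power_Suc massoc)
 have "poly [:- \<beta>, 1:] \<beta> = 0" by simp
 thus ?thesis unfolding e pderiv_mult[of "[:- \<beta>, 1:]"] by (simp only: poly_add poly_mult mult_zero_left add_0)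
qed

context odd_root
begin

lemma q_sum: "(\<Sum>l<r. (q ^ l) ^ m) = (if r dvd m then of_nat r else 0)" "(\<Sum>l<r. (iq ^ l) ^ m) = (if r dvd m then of_nat r else 0)"
proof -
 have 1: "(\<Sum>l<r. (z ^ m) ^ l) = (if r dvd m then of_nat r else 0)" if "z ^ r = 1" "z ^ m = 1 \<longleftrightarrow> r dvd m" for z :: complex
 proof (cases "r dvd m")
  case False
  have "(z ^ m) ^ r = 1" using that(1) by (metis mult.commute power_mult power_one)
  thus ?thesis using False that(2) geo_root by simp
 qed (use that in simp)
 have c: "(z ^ l) ^ m = (z ^ m) ^ l" for z :: complex and l by (simp flip: power_mult add: mult.commute)
 show "(\<Sum>l<r. (q ^ l) ^ m) = (if r dvd m then of_nat r else 0)" "(\<Sum>l<r. (iq ^ l) ^ m) = (if r dvd m then of_nat r else 0)"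
  unfolding c using 1[of q] 1[of "iq"] by (simp_all add: q_pow_eq_1 power_inverse)
qed

text \<open>Chebyshev polynomials in the normalization with \<open>z + 1/z\<close> mapped to
  \<open>z^n + z^-n\<close>; they are monic for positive index and serve as a basis adapted to the
  eigenvalues \<open>{l}'\<close>.\<close>

fun tau :: "nat => complex poly" where
 "tau 0 = [:2:]" | "tau (Suc 0) = [:0, 1:]" | "tau (Suc (Suc n)) = [:0, 1:] * tau (Suc n) - tau n"

lemma tau_poly: "z * w = 1 ==> poly (tau n) (z + w) = z ^ n + w ^ n"
proof (induction n rule: tau.induct)
 case (3 n)
 have "z * w ^ Suc n = w ^ n" "w * z ^ Suc n = z ^ n" using 3(3) by (simp_all add: massoc[symmetric] mult.commute[of w z])
 note c = this
 have "poly (tau (Suc (Suc n))) (z + w) = (z + w) * poly (tau (Suc n)) (z + w) - poly (tau n) (z + w)" by simp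
 also have "... = (z + w) * (z ^ Suc n + w ^ Suc n) - (z ^ n + w ^ n)" by (simp only: 3(1)[OF 3(3)] 3(2)[OF 3(3)])
 also have "... = z * z ^ Suc n + w * w ^ Suc n + (z * w ^ Suc n + w * z ^ Suc n) - (z ^ n + w ^ n)"
  by (simp add: algebra_simps del: power_Suc)
 finally show ?case unfolding c by simp
qed simp_all

lemma tau_pderiv: "z * w = 1 ==> (z - w) * poly (pderiv (tau n)) (z + w) = of_nat n * (z ^ n - w ^ n)"
proof (induction n rule: tau.induct)
 case (3 n)
 have c: "z * w ^ Suc n = w ^ n" "w * z ^ Suc n = z ^ n" using 3(3) by (simp_all add: massoc[symmetric] mult.commute[of w z])
 have "(z - w) * poly (pderiv (tau (Suc (Suc n)))) (z + w) =
  (z - w) * poly (tau (Suc n)) (z + w) + (z + w) * ((z - w) * poly (pderiv (tau (Suc n))) (z + w)) - (z - w) * poly (pderiv (tau n)) (z + w)"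
  by (simp add: pderiv_diff pderiv_mult pderiv_pCons algebra_simps)
 also have "... = (z - w) * (z ^ Suc n + w ^ Suc n) + (z + w) * (of_nat (Suc n) * (z ^ Suc n - w ^ Suc n)) - of_nat n * (z ^ n - w ^ n)"
  using 3 tau_poly[OF 3(3), of "Suc n"] by (simp only:)
 also have "... = of_nat (Suc (Suc n)) * (z * z ^ Suc n - w * w ^ Suc n) + (of_nat (Suc n) - 1) * (w * z ^ Suc n - z * w ^ Suc n) * (1)
   - of_nat n * (z ^ n - w ^ n)"
  by (simp add: algebra_simps del: power_Suc)
 also have "... = of_nat (Suc (Suc n)) * (z * z ^ Suc n - w * w ^ Suc n)" unfolding c by (simp add: algebra_simps)
 finally show ?case by simp
qed (simp_all add: pderiv_pCons)

lemma tau_degree: "degree (tau n) <= n & (0 < n --> coeff (tau n) n = 1)"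
proof (induction n rule: tau.induct)
 case (3 n)
 have d: "degree ([:0, 1:] * tau (Suc n)) <= Suc (Suc n)" using 3 by (simp add: degree_pCons_le)
 have "degree (tau (Suc (Suc n))) <= Suc (Suc n)" unfolding tau.simps(3) using d 3 by (intro degree_diff_le) auto
 moreover have "coeff (tau n) (Suc (Suc n)) = 0" using 3 by (intro coeff_eq_0) auto
 ultimately show ?case using 3 by simp
qed simp_all

text \<open>Up to the factor \<open>r^2\<close>, the sum of the residues of \<open>p / Pp\<close>,
  equivalently the coefficient of degree \<open>N\<close> of \<open>p\<close> modulo
  \<open>Pp\<close>. The derivative accounts for double roots, and the division by 2 for
  \<open>{l}' = {r - l}'\<close> being listed twice.\<close>

definition ze :: "complex poly => complex" where
 "ze p = (\<Sum>l<r. br' l * poly p (br' l) + (br l)^2 * poly (pderiv p) (br' l)) / 2"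

lemma ze_lin: "ze (p + p') = ze p + ze p'" "ze (Polynomial.smult c p) = c * ze p" "ze (p - p') = ze p - ze p'"
 by (simp_all add: ze_def pderiv_add pderiv_diff pderiv_smult sum.distrib[symmetric] sum_subtractf[symmetric] add_divide_distrib[symmetric]
  diff_divide_distrib[symmetric] sum_distrib_left algebra_simps)

text \<open>Summing over the \<open>r\<close>-th roots of unity keeps exponents divisible by
  \<open>r\<close>. The exponent \<open>n + 1\<close> survives only for \<open>n = N\<close>; the
  exponent \<open>n - 1\<close> survives only for \<open>n = 1\<close>, where its coefficient
  \<open>1 - n\<close> is \<open>0\<close>.\<close>

lemma ze_tau:
 assumes n: "n < r"
 shows "ze (tau n) = (if n = N then (of_nat r)^2 else 0)"
proof -
 have t: "br' l * poly (tau n) (br' l) + (br l)^2 * poly (pderiv (tau n)) (br' l) =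
   (1 + of_nat n) * ((q ^ l) ^ Suc n + (iq ^ l) ^ Suc n) + (1 - of_nat n) * (q ^ l * (iq ^ l) ^ n + iq ^ l * (q ^ l) ^ n)" for l
 proof -
  define z w where "z = q ^ l" and "w = iq ^ l"
  have zw: "z * w = 1" by (simp add: z_def w_def power_inverse)
  have b: "br' l = z + w" "br l = z - w" by (simp_all add: qbrace_def qbrace'_def z_def w_def)
  have "br' l * poly (tau n) (br' l) + (br l)^2 * poly (pderiv (tau n)) (br' l)
    = (z + w) * (z ^ n + w ^ n) + (z - w) * ((z - w) * poly (pderiv (tau n)) (z + w))"
   by (simp add: b tau_poly[OF zw] power2_eq_square)
  also have "... = (z + w) * (z ^ n + w ^ n) + (z - w) * (of_nat n * (z ^ n - w ^ n))" by (simp only: tau_pderiv[OF zw])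
  finally show ?thesis unfolding z_def[symmetric] w_def[symmetric] by (simp add: algebra_simps)
 qed
 have s: "(1 - of_nat n) * (\<Sum>l<r. q ^ l * (iq ^ l) ^ n + iq ^ l * (q ^ l) ^ n) = (0 :: complex)"
 proof (cases n)
  case 0
  have "~ r dvd 1" using r_ge by simp
  thus ?thesis using q_sum[of 1] 0 by (simp add: sum.distrib)
 next
  case (Suc m)
  have "q ^ l * (iq ^ l) ^ Suc m = (iq ^ l) ^ m" "iq ^ l * (q ^ l) ^ Suc m = (q ^ l) ^ m" for l
   by (simp_all add: power_inverse)
  hence "(\<Sum>l<r. q ^ l * (iq ^ l) ^ n + iq ^ l * (q ^ l) ^ n) = (\<Sum>l<r. (iq ^ l) ^ m) + (\<Sum>l<r. (q ^ l) ^ m)"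
   unfolding Suc by (simp only: sum.distrib)
  moreover have "m = 0 | ~ r dvd m" using n Suc by (auto dest: dvd_imp_le)
  ultimately show ?thesis using Suc by (auto simp: q_sum)
 qed
 have "(\<Sum>l<r. br' l * poly (tau n) (br' l) + (br l)^2 * poly (pderiv (tau n)) (br' l)) =
   (1 + of_nat n) * ((\<Sum>l<r. (q ^ l) ^ Suc n) + (\<Sum>l<r. (iq ^ l) ^ Suc n))"
  unfolding t sum.distrib[of "%l. (1 + of_nat n) * _ l"] using s by (simp only: sum_distrib_left[symmetric] sum.distrib) simp
 also have "... = (if n = N then 2 * (of_nat r)^2 else 0)"
 proof -
  have "r dvd Suc n \<longleftrightarrow> n = N" using n r_Suc by (auto dest: dvd_imp_le)
  moreover have "(1 + of_nat N :: complex) = of_nat r" unfolding r_Suc by simp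
  ultimately show ?thesis unfolding q_sum by (auto simp: power2_eq_square)
 qed
 finally show ?thesis by (simp add: ze_def)
qed

lemma ze_coeff: "degree p <= n ==> n < r ==> ze p = (of_nat r)^2 * coeff p N"
proof (induction n arbitrary: p)
 case 0
 then obtain c where "p = [:c:]" using degree_0_id[of p] by (metis le_zero_eq)
 hence "p = Polynomial.smult (c / 2) (tau 0)" by simp
 moreover have "0 ~= N" using N_ge by simp
 ultimately show ?case using ze_lin(2)[of "c / 2" "tau 0"] ze_tau[of 0] 0 by (cases N) auto
next
 case (Suc n)
 define c where "c = coeff p (Suc n)"
 define p' where "p' = p - Polynomial.smult c (tau (Suc n))"
 have "degree p' <= Suc n" unfolding p'_def
  using Suc.prems tau_degree[of "Suc n"] by (intro degree_diff_le) (auto intro: order.trans[OF degree_smult_le])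
 moreover have "coeff p' (Suc n) = 0" using tau_degree[of "Suc n"] by (simp add: p'_def c_def)
 ultimately have "degree p' <= n" by (metis le_SucE leading_coeff_0_iff degree_0 le0)
 hence 1: "ze p' = (of_nat r)^2 * coeff p' N" using Suc by simp
 have t: "ze (tau (Suc n)) = (of_nat r)^2 * coeff (tau (Suc n)) N"
 proof (cases "Suc n = N")
  case True
  thus ?thesis using ze_tau[of "Suc n"] tau_degree[of "Suc n"] Suc.prems by simp
 next
  case False
  hence "degree (tau (Suc n)) < N" using tau_degree[of "Suc n"] Suc.prems r_Suc by linarith
  thus ?thesis using ze_tau[of "Suc n"] Suc.prems False by (simp add: coeff_eq_0)
 qed
 have "p = p' + Polynomial.smult c (tau (Suc n))" by (simp add: p'_def)
 thus ?case using 1 t ze_lin(1)[of p' "Polynomial.smult c (tau (Suc n))"] ze_lin(2)[of c "tau (Suc n)"]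
  by (simp add: algebra_simps)
qed

lemma q_pow_inj: "k < r ==> l < r ==> q ^ k = q ^ l ==> k = l"
proof -
 have *: "k = l" if "k <= l" "l < r" "q ^ k = q ^ l" for k l
 proof -
  have "q ^ l = q ^ (k + (l - k))" using that(1) by simp
  hence "q ^ l = q ^ k * q ^ (l - k)" by (simp only: power_add)
  hence "q ^ (l - k) = 1" using that by simp
  hence "r dvd l - k" by (simp add: q_pow_eq_1)
  thus ?thesis using that by (auto dest: dvd_imp_le)
 qed
 show "k < r ==> l < r ==> q ^ k = q ^ l ==> k = l" using *[of k l] *[of l k] by (cases "k <= l") auto
qed

lemma br'_inj: "k < r ==> l < r ==> br' l = br' k ==> l = k | l + k = r"
proof -
 assume kl: "k < r" "l < r" "br' l = br' k"
 have "(q ^ l - q ^ k) * (q ^ l * q ^ k - 1) = q ^ l * q ^ k * (br' l - br' k)"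
  by (simp add: qbrace'_def power_inverse field_simps)
 hence "q ^ l = q ^ k | q ^ (l + k) = 1" using kl by (auto simp: power_add)
 thus ?thesis
 proof
  assume "q ^ l = q ^ k" thus ?thesis using q_pow_inj kl by blast
 next
  assume "q ^ (l + k) = 1"
  then obtain i where i: "l + k = r * i" by (auto simp: q_pow_eq_1)
  hence "r * i < r * 2" using kl by linarith
  hence "i = 0 | i = 1" by auto
  thus ?thesis using i by auto
 qed
qed

definition lin :: "nat => complex poly" where "lin l = [:- br' l, 1:]"

text \<open>Annihilates \<open>bb\<close>, as \<open>pev_Pp\<close> shows. The factors for
  \<open>l\<close> and \<open>r - l\<close> agree, so every root but \<open>2\<close> is
  double.\<close>

definition Pp :: "complex poly" where "Pp = (\<Prod>l<r. lin l)"

lemma double_root: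
 assumes "finite S" "l \<in> S" "r - l \<in> S" "0 < l" "l < r"
 shows "\<exists>X. (\<Prod>l\<in>S. lin l) = [:- br' l, 1:] ^ Suc (Suc 0) * X"
proof -
 have ne: "r - l ~= l" using r_odd assms by (metis add_diff_inverse_nat even_add nat_less_le not_less)
 have "(\<Prod>l\<in>S. lin l) = lin l * (lin (r - l) * (\<Prod>l\<in>S - {l} - {r - l}. lin l))"
  using assms ne by (subst prod.remove[of S l]; simp) (subst prod.remove[of _ "r - l"]; simp)
 also have "lin (r - l) = lin l" using br'_diff_r[of l] assms by (simp add: lin_def)
 finally have "(\<Prod>l\<in>S. lin l) = [:- br' l, 1:] ^ Suc (Suc 0) * (\<Prod>l\<in>S - {l} - {r - l}. lin l)"
  by (simp only: lin_def[of l] power_Suc power_0 mult_1_right massoc)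
 thus ?thesis by blast
qed

lemma ze_root:
 assumes S: "S <= {..<r}" "!!l. 0 < l ==> l \<in> S ==> r - l \<in> S" and l: "l \<in> S"
 shows "br' l * poly ((\<Prod>l\<in>S. lin l) * X) (br' l) + (br l)^2 * poly (pderiv ((\<Prod>l\<in>S. lin l) * X)) (br' l) = 0"
proof -
 have f: "finite S" using S(1) by (rule finite_subset) simp
 have p0: "poly ((\<Prod>l\<in>S. lin l) * X) (br' l) = 0" using l f by (auto simp: poly_prod lin_def)
 show ?thesis
 proof (cases "l = 0")
  case True thus ?thesis using p0 by (simp add: qbrace_def)
 next
  case False
  then obtain Y where "(\<Prod>l\<in>S. lin l) = [:- br' l, 1:] ^ Suc (Suc 0) * Y"
   using double_root[OF f l S(2)[OF _ l]] S(1) l by auto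
  hence "(\<Prod>l\<in>S. lin l) * X = [:- br' l, 1:] ^ Suc (Suc 0) * (Y * X)" by (simp only: massoc)
  thus ?thesis using p0 poly_pderiv_double[of "br' l" 0 "Y * X"] by simp
 qed
qed

lemma ze_Pp: "ze (Pp * X) = 0"
 unfolding ze_def Pp_def using ze_root[of "{..<r}" _ X] by simp

definition Rk :: "nat => nat set" where "Rk k = {l. l < r & br' l = br' k}"

lemma Rk: "k <= N ==> Rk k = (if k = 0 then {0} else {k, r - k})"
proof -
 assume k: "k <= N"
 hence kr: "k < r" "~ r dvd k | k = 0" using r_Suc by (auto dest: dvd_imp_le)
 have "l \<in> Rk k \<longleftrightarrow> l = k | (k ~= 0 & l = r - k)" for l
  using br'_inj[OF kr(1), of l] br'_diff_r[of k] kr(1) unfolding Rk_def by auto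
 thus ?thesis by auto
qed

definition Qk :: "nat => complex poly" where "Qk k = (\<Prod>l\<in>{..<r} - Rk k. lin l)"

lemma Pp_Qk: "Pp = [:- br' k, 1:] ^ card (Rk k) * Qk k"
proof -
 have "Pp = (\<Prod>l\<in>{..<r} - Rk k. lin l) * (\<Prod>l\<in>Rk k. lin l)"
  unfolding Pp_def by (rule prod.subset_diff) (auto simp: Rk_def)
 also have "(\<Prod>l\<in>Rk k. lin l) = (\<Prod>l\<in>Rk k. [:- br' k, 1:])" by (rule prod.cong) (auto simp: Rk_def lin_def)
 finally show ?thesis by (simp add: Qk_def mult.commute)
qed

text \<open>A polynomial that is \<open>1\<close> to high order at \<open>{k}'\<close> and divisible
  by the factors of all other roots; its value at \<open>bb\<close> will be the block
  idempotent.\<close>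

lemma crt: obtains u X Y where "u = Qk k * X" "1 - u = [:- br' k, 1:] ^ Suc (Suc n) * Y"
proof -
 have "poly (Qk k) (br' k) ~= 0" by (auto simp: Qk_def poly_prod lin_def Rk_def)
 define c where "c = poly (Qk k) (br' k)"
 have c: "c ~= 0" using \<open>poly (Qk k) (br' k) ~= 0\<close> by (simp add: c_def)
 define v where "v = 1 - Qk k * [:inverse c:]"
 have "poly v (br' k) = 0" using c by (simp add: v_def c_def)
 hence "[:- br' k, 1:] dvd v" by (simp add: poly_eq_0_iff_dvd)
 then obtain s where s: "v = [:- br' k, 1:] * s" by (auto simp: dvd_def)
 \<comment> \<open>\<open>v\<close> vanishes at \<open>{k}'\<close> and \<open>1 - v\<close> is a
   multiple of \<open>Qk k\<close>; raising \<open>v\<close> to a power increases the order of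
   contact and keeps the divisibility.\<close>
 define u where "u = 1 - v ^ Suc (Suc n)"
 have "u = (1 - v) * (\<Sum>i<Suc (Suc n). v ^ i)" unfolding u_def by (rule one_diff_power_eq)
 also have "1 - v = Qk k * [:inverse c:]" by (simp add: v_def)
 finally have "u = Qk k * ([:inverse c:] * (\<Sum>i<Suc (Suc n). v ^ i))" by (simp only: massoc)
 moreover have "1 - u = [:- br' k, 1:] ^ Suc (Suc n) * s ^ Suc (Suc n)" by (simp only: u_def s power_mult_distrib diff_diff_eq2 add_diff_cancel_left')
 ultimately show ?thesis using that by blast
qed

lemma ze_block:
 assumes k: "k <= N" and u: "u = Qk k * X" "1 - u = [:- br' k, 1:] ^ Suc (Suc n) * Y"
 shows "ze (p * u) = (if k = 0 then poly p 2 else br' k * poly p (br' k) + (br k)^2 * poly (pderiv p) (br' k))"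
proof -
 let ?f = "%l. br' l * poly (p * u) (br' l) + (br l)^2 * poly (pderiv (p * u)) (br' l)"
 have 0: "?f l = 0" if "l \<in> {..<r} - Rk k" for l
 proof -
  have e: "p * u = (\<Prod>l\<in>{..<r} - Rk k. lin l) * (X * p)" by (simp add: u(1) Qk_def mult_ac)
  show ?thesis unfolding e
  proof (rule ze_root[OF _ _ that])
   fix l assume "0 < l" "l \<in> {..<r} - Rk k"
   thus "r - l \<in> {..<r} - Rk k" using br'_diff_r[of l] by (auto simp: Rk_def)
  qed blast
 qed
 have b2: "(br l)^2 = (br' l)^2 - 4" for l
 proof -
  have "q ^ l * iq ^ l = 1" by (simp add: power_inverse)
  thus ?thesis by (simp add: qbrace_def qbrace'_def power2_eq_square algebra_simps)
 qed
 have pu: "poly u (br' k) = 1" "poly (pderiv u) (br' k) = 0"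
 proof -
  have "poly (1 - u) (br' k) = 0" unfolding u(2) by simp
  thus "poly u (br' k) = 1" by simp
  have "poly (pderiv (1 - u)) (br' k) = 0" unfolding u(2) by (rule poly_pderiv_double)
  thus "poly (pderiv u) (br' k) = 0" by (simp add: pderiv_diff)
 qed
 have 1: "?f l = br' k * poly p (br' k) + (br k)^2 * poly (pderiv p) (br' k)" if "l \<in> Rk k" for l
  using that pu unfolding b2 by (simp add: Rk_def pderiv_mult)
 have "(\<Sum>l<r. ?f l) = (\<Sum>l\<in>Rk k. ?f l)"
  by (rule sum.mono_neutral_right) (use 0 in \<open>auto simp: Rk_def\<close>)
 also have "... = of_nat (card (Rk k)) * (br' k * poly p (br' k) + (br k)^2 * poly (pderiv p) (br' k))"
 proof -
  have "(\<Sum>l\<in>Rk k. ?f l) = (\<Sum>l\<in>Rk k. br' k * poly p (br' k) + (br k)^2 * poly (pderiv p) (br' k))"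
   by (rule sum.cong[OF refl 1])
  thus ?thesis by simp
 qed
 finally have s: "ze (p * u) = of_nat (card (Rk k)) * (br' k * poly p (br' k) + (br k)^2 * poly (pderiv p) (br' k)) / 2"
  by (simp add: ze_def)
 show ?thesis
 proof (cases "k = 0")
  case True
  hence "card (Rk k) = 1" "br' k = 2" "br k = 0" using Rk[OF k] by (simp_all add: qbrace_def qbrace'_def)
  thus ?thesis using True unfolding s by simp
 next
  case False
  have "r - k ~= k" using r_odd k r_Suc by (metis add_diff_inverse_nat even_add le_imp_less_Suc not_less_iff_gr_or_eq)
  hence "card (Rk k) = 2" using Rk[OF k] False by simp
  thus ?thesis using False unfolding s by simp
 qed
qed

end

context qg
begin

definition pev :: "complex poly => 'u" where "pev p = fold_coeffs (%a v. scale a 1 + bb * v) p 0"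

lemma pev_pCons: "pev (pCons a p) = scale a 1 + bb * pev p"
 by (cases "p = 0"; cases "a = 0"; simp add: pev_def)

lemma pev_0: "pev 0 = 0" by (simp add: pev_def)

lemma pev_add: "pev (p + p') = pev p + pev p'"
 by (induction p p' rule: poly_induct2) (simp_all add: pev_0 pev_pCons scale_left_distrib distrib_left add_ac)

lemma pev_smult: "pev (Polynomial.smult c p) = scale c (pev p)"
 by (induction p) (simp_all add: pev_0 pev_pCons ss)

lemma pev_mult: "pev (p * p') = pev p * pev p'"
 by (induction p) (simp_all add: pev_0 pev_pCons pev_add pev_smult ss distrib_right massoc)

lemma pev_1: "pev 1 = 1" by (simp add: one_pCons pev_pCons pev_0)

lemma pev_diff: "pev (p - p') = pev p - pev p'"
 using pev_add[of "p - p'" p'] by simp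

lemma pev_monom: "pev (monom c j) = scale c (bb ^ j)"
 by (induction j) (simp_all add: monom_0 monom_Suc pev_pCons pev_0 ss)

lemma pev_lin: "pev [:- \<beta>, 1:] = bb - scale \<beta> 1"
 by (simp add: pev_pCons pev_0)

text \<open>The product of \<open>1 - z\<close> over the nontrivial \<open>r\<close>-th roots of
  unity is \<open>r\<close>; hence the square of \<open>{1}^N [N]!\<close> is \<open>r^2\<close>.
  This converts the normalization of the integral into a power of \<open>r\<close>.\<close>

lemma br_N_kap: "(br 1) ^ (2 * N) * kap = (of_nat r) ^ 3"
proof -
 have p: "(br 1) ^ N * qfact r N = (\<Prod>j\<in>{1..N}. br j)"
 proof -
  have "qfact r N = (\<Prod>j\<in>{1..N}. br j) / (\<Prod>j\<in>{1..N}. br 1)" by (simp add: qfact_def qint_def prod_dividef)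
  thus ?thesis using br1_nz' by simp
 qed
 have b: "(br j)^2 = - 1 * ((1 - y ^ j) * (1 - iy ^ j))" for j
 proof -
  have "y ^ j = q ^ j * q ^ j" "iy ^ j = iq ^ j * iq ^ j" "q ^ j * iq ^ j = 1"
   by (simp_all add: y_def power2_eq_square power_mult_distrib power_inverse)
  thus ?thesis by (simp add: qbrace_def power2_eq_square algebra_simps power_inverse)
 qed
 have nd: "~ r dvd j" if "0 < j" "j <= N" for j using that r_Suc by (auto dest: dvd_imp_le)
 have y1: "(\<Prod>j\<in>{1..N}. 1 - y ^ j) = of_nat r" "(\<Prod>j\<in>{1..N}. 1 - iy ^ j) = of_nat r"
  using root_prod[of y N] root_prod[of "iy" N] y_r(1,2) nd unfolding r_Suc[symmetric] by (simp_all add: y_pow_eq_1 power_inverse)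
 have "(\<Prod>j\<in>{1..N}. br j)^2 = (\<Prod>j\<in>{1..N}. (br j)^2)" by (simp add: prod_power_distrib)
 also have "... = (- 1) ^ N * ((\<Prod>j\<in>{1..N}. 1 - y ^ j) * (\<Prod>j\<in>{1..N}. 1 - iy ^ j))"
  unfolding b prod.distrib by simp
 finally have "(\<Prod>j\<in>{1..N}. br j)^2 = (of_nat r)^2" unfolding y1 using N_even by (simp add: power2_eq_square)
 hence "((br 1) ^ N * qfact r N)^2 = (of_nat r)^2" unfolding p .
 moreover have "(br 1) ^ (2 * N) * kap = of_nat r * ((br 1) ^ N * qfact r N)^2"
 proof -
  have "(br 1) ^ (2 * N) = ((br 1) ^ N)^2" by (simp only: power_mult[symmetric] mult.commute[of 2 N])
  thus ?thesis by (simp only: kap_def power_mult_distrib mult_ac)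
 qed
 ultimately show ?thesis by (simp add: power2_eq_square power3_eq_cube)
qed

subsection \<open>The minimal polynomial of the Casimir element\<close>

text \<open>\<open>r\<close> times the projection to the eigenvalue \<open>q ^ w\<close> of
  multiplication by \<open>K\<close>.\<close>

definition pw :: "nat => 'u" where "pw w = (\<Sum>c<r. scale (iq ^ (w * c)) (gk ^ c))"

lemma gk_pw: "gk * pw w = scale (q ^ w) (pw w)" "gk ^ N * pw w = scale (iq ^ w) (pw w)"
proof -
 let ?f = "%c. scale (iq ^ (w * c)) (gk ^ c)"
 have "?f r = ?f 0" using q_pow_r by (simp add: K_order mult.commute[of w r] power_mult power_inverse)
 hence sh: "(\<Sum>c<r. ?f (Suc c)) = (\<Sum>c<r. ?f c)"
  using sum.lessThan_Suc_shift[of ?f r] sum.lessThan_Suc[of ?f r] by simp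
 have "gk * ?f c = scale (q ^ w) (?f (Suc c))" for c
  by (simp add: ss power_add power_inverse)
 hence "gk * pw w = (\<Sum>c<r. scale (q ^ w) (?f (Suc c)))" by (simp only: pw_def sum_distrib_left)
 thus 1: "gk * pw w = scale (q ^ w) (pw w)" by (simp only: pw_def scale_sum_right[symmetric] sh)
 have "pw w = gk ^ N * (gk * pw w)" by (simp add: massoc[symmetric] KKinv)
 hence "pw w = scale (q ^ w) (gk ^ N * pw w)" by (simp only: 1 ss)
 hence "scale (iq ^ w) (pw w) = scale (iq ^ w) (scale (q ^ w) (gk ^ N * pw w))" by simp
 thus "gk ^ N * pw w = scale (iq ^ w) (pw w)" by (simp add: power_inverse)
qed

lemma pw_sum: "(\<Sum>w<r. pw w) = scale (of_nat r) 1"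
proof -
 have "(\<Sum>w<r. pw w) = (\<Sum>c<r. scale (\<Sum>w<r. (iq ^ w) ^ c) (gk ^ c))"
  unfolding pw_def scale_sum_left by (subst sum.swap) (simp add: power_mult)
 also have "... = (\<Sum>c<r. if c = 0 then scale (of_nat r) 1 else 0)"
  by (rule sum.cong) (auto simp: q_sum dest: dvd_imp_le)
 finally show ?thesis using r_Suc by simp
qed

text \<open>On an eigenspace of \<open>K\<close>, taking the factors of \<open>Pp\<close> in a
  suitable order turns \<open>1\<close> step by step into multiples of \<open>E^a F^a\<close>; after
  \<open>r\<close> factors \<open>E^r = 0\<close> appears.\<close>

lemma pev_Pp: "pev Pp = 0"
proof -
 have "pev Pp * pw w = 0" for w
 proof -
  \<comment> \<open>The index of the factor that cancels the \<open>K\<close>-terms at step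
    \<open>a\<close>: the exponent \<open>w - (2 a + 1)\<close>, with \<open>-1\<close> replaced by
    \<open>N\<close> since \<open>q ^ N = q^-1\<close>.\<close>
  define l where "l a = (w + N * (2 * a + 1)) mod r" for a
  have ql: "q ^ l a = q ^ w * iq ^ (2 * a + 1)" for a
   unfolding l_def q_pow_mod power_add[of q w] power_mult[of q N] q_N ..
  hence il: "iq ^ l a = iq ^ w * q ^ (2 * a + 1)" for a
   by (metis inverse_inverse_eq inverse_mult_distrib power_inverse)
  have yl: "iq * iy ^ a = iq ^ (2 * a + 1)" "q * y ^ a = q ^ (2 * a + 1)" for a
   by (simp_all add: y_def power_inverse flip: power_mult)
  have inj: "inj_on l {..<r}"
  proof (rule inj_onI)
   fix a a' assume a: "a \<in> {..<r}" "a' \<in> {..<r}" "l a = l a'"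
   hence "iq ^ (2 * a + 1) = iq ^ (2 * a' + 1)" using ql[of a] ql[of a'] by simp
   hence "q ^ (2 * a) = q ^ (2 * a')" by (simp add: power_inverse)
   hence "(q ^ a)^2 = (q ^ a')^2" by (simp add: power_mult[symmetric] mult.commute)
   hence yy: "y ^ a = y ^ a'" by (simp add: y_def power_mult[symmetric] mult.commute)
   have "i = j" if "i <= j" "j < r" "y ^ i = y ^ j" for i j
   proof -
    have "y ^ j = y ^ (i + (j - i))" using that(1) by simp
    hence "y ^ j = y ^ i * y ^ (j - i)" by (simp only: power_add)
    hence "r dvd j - i" using that y_pow_eq_1[of "j - i"] by simp
    thus ?thesis using that by (auto dest: dvd_imp_le)
   qed
   thus "a = a'" using a yy by (metis lessThan_iff nat_le_linear)
  qed
  have "l ` {..<r} = {..<r}" by (rule endo_inj_surj[OF _ _ inj]) (use r_Suc in \<open>auto simp: l_def\<close>)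
  hence P: "Pp = (\<Prod>a<r. lin (l a))" unfolding Pp_def using prod.reindex[OF inj, of lin] by simp
  have "pev (\<Prod>i<a. lin (l i)) * pw w = scale ((br 1) ^ (2 * a)) (ge ^ a * gf ^ a * pw w)" for a
  proof (induction a)
   case (Suc a)
   have "bb * (ge ^ a * gf ^ a * pw w) = bb * (ge ^ a * gf ^ a * gk ^ 0) * pw w" by (simp add: massoc)
   also have "... = scale ((br 1)^2) (ge ^ Suc a * gf ^ Suc a * pw w) + scale (iq * iy ^ a) (ge ^ a * gf ^ a * (gk * pw w))
     + scale (q * y ^ a) (ge ^ a * gf ^ a * (gk ^ N * pw w))"
    unfolding bb_EF by (simp add: distrib_right ss massoc)
   also have "... = scale ((br 1)^2) (ge ^ Suc a * gf ^ Suc a * pw w) + scale (br' (l a)) (ge ^ a * gf ^ a * pw w)"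
    unfolding gk_pw yl qbrace'_def ql il by (simp add: ss scale_left_distrib mult_ac add.assoc)
   finally have b: "bb * (ge ^ a * gf ^ a * pw w) - scale (br' (l a)) (ge ^ a * gf ^ a * pw w) = scale ((br 1)^2) (ge ^ Suc a * gf ^ Suc a * pw w)"
    by simp
   have "pev (\<Prod>i<Suc a. lin (l i)) * pw w = (bb - scale (br' (l a)) 1) * (pev (\<Prod>i<a. lin (l i)) * pw w)"
    by (simp only: prod.lessThan_Suc mult.commute[of "prod _ _"] pev_mult lin_def pev_lin massoc)
   also have "... = scale ((br 1) ^ (2 * a)) (bb * (ge ^ a * gf ^ a * pw w) - scale (br' (l a)) (ge ^ a * gf ^ a * pw w))"
    unfolding Suc by (simp add: left_diff_distrib ss mult.commute)
   finally show ?case unfolding b by (simp add: ss power_add[symmetric] mult_ac flip: power2_eq_square)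
  qed (simp add: pev_1)
  from this[of r] show ?thesis by (simp add: P E_nilpotent)
 qed
 hence "pev Pp * (\<Sum>w<r. pw w) = 0" by (simp add: sum_distrib_left)
 hence "scale (of_nat r) (pev Pp) = 0" by (simp add: pw_sum ss)
 thus ?thesis using r_ge by simp
qed

text \<open>Reduction modulo \<open>Pp\<close> leaves degree at most \<open>N\<close>, where
  \<open>li_bb\<close> sees only the top coefficient; \<open>ze\<close> extracts the same
  coefficient.\<close>

lemma li_pev: "left_integral (gk ^ c * pev p) = (if r dvd Suc c then of_nat r * ze p else 0)"
proof -
 define p0 where "p0 = p mod Pp"
 have lin0: "lin l ~= 0" for l by (simp add: lin_def)
 have dP: "degree Pp = r" "Pp ~= 0" unfolding Pp_def by (subst degree_prod_sum_eq) (auto simp: lin_def lin0)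
 have d0: "degree p0 <= N"
  using degree_mod_less[OF dP(2), of p] dP(1) r_Suc by (auto simp: p0_def)
 have pe: "p = Pp * (p div Pp) + p0" by (simp add: p0_def)
 have 1: "pev p = pev p0" by (subst pe) (simp only: pev_add pev_mult pev_Pp mult_zero_left add_0)
 have 2: "ze p = (of_nat r)^2 * coeff p0 N" by (subst pe) (simp only: ze_lin ze_Pp add_0 ze_coeff[OF d0 N_lt])
 have "pev (\<Sum>i\<le>n. monom (coeff p0 i) i) = (\<Sum>i\<le>n. scale (coeff p0 i) (bb ^ i))" for n
  by (induction n) (simp_all add: pev_add pev_monom)
 hence 3: "pev p0 = (\<Sum>i\<le>N. scale (coeff p0 i) (bb ^ i))" using poly_as_sum_of_monoms'[OF d0] by metis
 have "left_integral (gk ^ c * (\<Sum>i\<le>n. scale (coeff p0 i) (bb ^ i))) = (\<Sum>i\<le>n. coeff p0 i * (if i = N & r dvd Suc c then (of_nat r) ^ 3 else 0))" if "n <= N" for n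
  using that
 proof (induction n)
  case 0
  have "N ~= 0" using N_ge by simp
  thus ?case using li_bb[of 0 0 c] by (simp add: ss li_simps)
 next
  case (Suc n)
  have 1: "left_integral (bb ^ Suc n * gk ^ c) = (if Suc n = N & r dvd Suc c then (br 1) ^ (2 * Suc n) * kap else 0)"
   using li_bb[of "Suc n" 0 c] Suc.prems by (simp del: power_Suc mult_Suc_right One_nat_def)
  have "left_integral (gk ^ c * bb ^ Suc n) = (if Suc n = N & r dvd Suc c then (of_nat r) ^ 3 else 0)"
  proof (cases "Suc n = N")
   case True
   hence "(br 1) ^ (2 * Suc n) * kap = (of_nat r) ^ 3" using br_N_kap by (simp only:)
   thus ?thesis using 1 by (simp only: bb_pow_comm(3)[symmetric])
  next
   case False
   thus ?thesis using 1 by (simp only: bb_pow_comm(3)[symmetric] simp_thms if_False)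
  qed
  thus ?case using Suc by (simp only: sum.atMost_Suc distrib_left li_simps ss)
 qed
 from this[OF order_refl] have "left_integral (gk ^ c * pev p) = (if r dvd Suc c then coeff p0 N * (of_nat r) ^ 3 else 0)"
  unfolding 1 3 by (simp add: if_distrib[of "(*) _"] cong: if_cong)
 thus ?thesis unfolding 2 by (simp add: power2_eq_square power3_eq_cube)
qed

lemma eigen_iff: "((%x. casimir * x - scale (\<beta> / (br 1)^2) x) ^^ n) x = scale ((1 / (br 1)^2) ^ n) (pev ([:- \<beta>, 1:] ^ n) * x)"
proof (induction n)
 case (Suc n)
 have "casimir = scale (1 / (br 1)^2) bb" using br1_nz' by (simp add: bb_def)
 hence "casimir * x - scale (\<beta> / (br 1)^2) x = scale (1 / (br 1)^2) (pev [:- \<beta>, 1:] * x)" for x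
  by (simp add: pev_lin left_diff_distrib ss)
 thus ?case using Suc by (simp only: funpow.simps o_apply power_Suc pev_mult ss massoc)
qed (simp add: pev_1)

text \<open>With \<open>u\<close> from \<open>crt\<close>, \<open>pev u\<close> lies in the
  generalized eigenspace and is fixed by \<open>e\<close>, while \<open>1 - pev u\<close> is
  annihilated by the product over the other eigenvalues and hence killed by \<open>e\<close>. So
  \<open>e = pev u\<close>.\<close>

lemma idempotent_poly:
 assumes e: "casimir_idempotent (N + k) e"
 shows "\<exists>u X Y n. e = pev u & u = Qk k * X & 1 - u = [:- br' k, 1:] ^ Suc (Suc n) * Y"
proof -
 define n where "n = card (Rk k)"
 obtain u X Y where u: "u = Qk k * X" "1 - u = [:- br' k, 1:] ^ Suc (Suc n) * Y" using crt .
 have be: "beta (N + k) = br' k / (br 1)^2"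
 proof -
  have "N + k + 1 = r + k" using r_Suc by linarith
  thus ?thesis by (simp only: beta_def br'_add_r)
 qed
 have e1: "e * e = e" "e * x = x * e" for x using e unfolding casimir_idempotent_def by blast+
 have e2: "e * x = x" if "pev ([:- br' k, 1:] ^ j) * x = 0" for x j
 proof -
  have "x \<in> casimir_eigenspace (beta (N + k))"
   unfolding casimir_eigenspace_def be by (rule CollectI, rule exI[of _ j], subst eigen_iff) (simp only: that scale_zero_right)
  thus ?thesis using e unfolding casimir_idempotent_def by blast+
 qed
 have e3: "e * x = 0" if "pev [:- \<beta>, 1:] * x = 0" "\<beta> ~= br' k" for x \<beta>
 proof -
  have "x \<in> casimir_eigenspace (\<beta> / (br 1)^2)"
   unfolding casimir_eigenspace_def by (rule CollectI, rule exI[of _ 1]) (simp only: eigen_iff power_one_right that(1) scale_zero_right)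
  moreover have "\<beta> / (br 1)^2 ~= beta (N + k)" using that(2) br1_nz' by (simp add: be)
  ultimately show ?thesis using e unfolding casimir_idempotent_def by blast+
 qed
 have "e * pev u = pev u"
 proof (rule e2[of n])
  have "[:- br' k, 1:] ^ n * u = Pp * X" by (simp only: u(1) n_def Pp_Qk[of k] massoc)
  thus "pev ([:- br' k, 1:] ^ n) * pev u = 0" by (simp only: pev_mult[symmetric]) (simp add: pev_mult pev_Pp)
 qed
 moreover have e4: "e * x = 0" if "finite S" "!!l. l \<in> S ==> br' l ~= br' k" "pev (\<Prod>l\<in>S. lin l) * x = 0" for S x
  using that
 proof (induction S arbitrary: x rule: finite_induct)
  case (insert l S)
  have p: "pev (prod lin (insert l S)) = pev (prod lin S) * pev (lin l)"
   by (simp only: prod.insert[OF insert(1,2)] mult.commute[of "lin l"] pev_mult)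
  have "pev (prod lin S) * (pev (lin l) * x) = 0" using insert.prems(2) unfolding p by (simp only: massoc)
  hence "e * (pev (lin l) * x) = 0" using insert.IH[of "pev (lin l) * x"] insert.prems(1) by blast
  moreover have "pev (lin l) * (e * x) = e * (pev (lin l) * x)"
   by (simp only: massoc[symmetric] e1(2)[of "pev (lin l)"])
  ultimately have "pev (lin l) * (e * x) = 0" by simp
  hence "e * (e * x) = 0" using e3[of "br' l" "e * x"] insert.prems(1)[of l] by (simp add: lin_def)
  thus ?case using e1(1) by (simp add: massoc[symmetric])
 qed (simp add: pev_1)
 have "e * (1 - pev u) = 0"
 proof (rule e4[of "{..<r} - Rk k"])
  have "Qk k * (1 - u) = Pp * ([:- br' k, 1:] ^ 2 * Y)"
   by (simp only: u(2) Pp_Qk[of k] n_def power_Suc power2_eq_square mult_ac)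
  moreover have "pev (Qk k) * (1 - pev u) = pev (Qk k * (1 - u))" by (simp only: pev_mult pev_diff pev_1)
  ultimately show "pev (\<Prod>l\<in>{..<r} - Rk k. lin l) * (1 - pev u) = 0"
   by (simp only: Qk_def[symmetric] pev_mult pev_Pp mult_zero_left)
 qed (auto simp: Rk_def)
 ultimately have "e = pev u" by (simp add: right_diff_distrib)
 thus ?thesis using u by blast
qed

theorem li_block:
 assumes "casimir_idempotent (N + k) e" "k <= N"
 shows "left_integral (gk ^ c * bb ^ j * e) = (if r dvd Suc c then of_nat r *
   (if k = 0 then 2 ^ j else br' k ^ Suc j + (br k)^2 * (of_nat j * br' k ^ (j - 1))) else 0)"
proof -
 obtain u X Y n where u: "e = pev u" "u = Qk k * X" "1 - u = [:- br' k, 1:] ^ Suc (Suc n) * Y"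
  using idempotent_poly[OF assms(1)] by blast
 have "gk ^ c * bb ^ j * e = gk ^ c * pev (monom 1 j * u)" by (simp add: pev_mult pev_monom u(1) massoc)
 thus ?thesis
  using ze_block[OF assms(2) u(2,3), of "monom 1 j"] by (simp add: li_pev poly_monom pderiv_monom)
qed

section \<open>From \<open>K\<close> and the Casimir element to the whole algebra\<close>

lemma linL_zero: "linL (%x. 0)" and linL_diff: "linL T ==> linL T' ==> linL (%x. T x - T' x)"
 by (simp_all add: linL_def smult_distrib)

lemma li_weight: "left_integral (gk * x * gk ^ N) = left_integral x"
proof -
 have "left_integral (gk * x * gk ^ N) *. (1 :: lop) = left_integral x *. 1"
 proof (rule lin_ext[of "%x. left_integral (gk * x * gk ^ N) *. 1" "%x. left_integral x *. 1"])
  fix a b c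
  have "gk * (ge ^ a * gf ^ b * gk ^ c) * gk ^ N = (gk ^ 1 * ge ^ a) * gf ^ b * gk ^ (c + N)" by (simp add: massoc power_add)
  also have "... = scale (y ^ a) (ge ^ a * (gk ^ 1 * gf ^ b) * gk ^ (c + N))" unfolding ke_pow by (simp add: ss massoc)
  also have "... = scale (y ^ a * iy ^ b) (ge ^ a * gf ^ b * gk ^ (1 + (c + N)))" unfolding kf_pow by (simp add: ss massoc)
  finally have e: "gk * (ge ^ a * gf ^ b * gk ^ c) * gk ^ N = scale (y ^ a * iy ^ b) (ge ^ a * gf ^ b * gk ^ (1 + (c + N)))" .
  have d: "r dvd Suc (1 + (c + N)) \<longleftrightarrow> r dvd Suc c"
  proof -
   have "Suc (1 + (c + N)) = Suc c + r" using r_Suc by linarith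
   thus ?thesis by (simp only: dvd_add_triv_right_iff)
  qed
  show "left_integral (gk * (ge ^ a * gf ^ b * gk ^ c) * gk ^ N) *. (1 :: lop) = left_integral (ge ^ a * gf ^ b * gk ^ c) *. 1"
   unfolding e li_simps li_mono d by (auto simp: power_inverse)
 qed (simp_all add: linL_def distrib_left distrib_right li_simps ss smult_distrib)
 hence "ap (left_integral (gk * x * gk ^ N) *. (1 :: lop)) (%_. 1) (%_. A0) = ap (left_integral x *. 1) (%_. 1) (%_. A0)" by simp
 thus ?thesis by simp
qed

lemma li_off:
 assumes "gk * x * gk ^ N = scale c x" "c ~= 1"
 shows "left_integral x = 0"
proof -
 have "left_integral x = c * left_integral x" using li_weight[of x] assms(1) by (simp add: li_simps)
 thus ?thesis using assms(2) by (simp add: mult_cancel_right2)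
qed

text \<open>\<open>bb_EF\<close> is solved for its leading term, so monomials of degree zero reduce
  to \<open>bb ^ j * gk ^ c\<close>.\<close>

lemma bb_EF0:
 assumes T: "linL T" and 0: "!!j c. T (bb ^ j * gk ^ c) = 0"
 shows "T (bb ^ j * (ge ^ a * gf ^ a * gk ^ c)) = 0"
proof (induction a arbitrary: j c)
 case (Suc a)
 have "bb ^ j * (bb * (ge ^ a * gf ^ a * gk ^ c)) = scale ((br 1)^2) (bb ^ j * (ge ^ Suc a * gf ^ Suc a * gk ^ c))
  + scale (iq * iy ^ a) (bb ^ j * (ge ^ a * gf ^ a * gk ^ (c + 1))) + scale (q * y ^ a) (bb ^ j * (ge ^ a * gf ^ a * gk ^ (c + N)))"
  unfolding bb_EF by (simp only: distrib_left ss)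
 moreover have "bb ^ j * (bb * (ge ^ a * gf ^ a * gk ^ c)) = bb ^ Suc j * (ge ^ a * gf ^ a * gk ^ c)"
  by (simp add: power_commutes massoc[symmetric])
 ultimately have "T (bb ^ Suc j * (ge ^ a * gf ^ a * gk ^ c)) = (br 1)^2 *. T (bb ^ j * (ge ^ Suc a * gf ^ Suc a * gk ^ c))
  + (iq * iy ^ a) *. T (bb ^ j * (ge ^ a * gf ^ a * gk ^ (c + 1))) + (q * y ^ a) *. T (bb ^ j * (ge ^ a * gf ^ a * gk ^ (c + N)))"
  by (simp only: linLD[OF T])
 hence "(br 1)^2 *. T (bb ^ j * (ge ^ Suc a * gf ^ Suc a * gk ^ c)) = (br 1)^2 *. 0" by (simp only: Suc) simp
 thus ?case by (rule lop_cancel) (use br1_nz' in simp)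
qed (simp add: 0)

abbreviation mE :: "nat => nat => nat => 'u" where "mE d c j \<equiv> ge ^ d * (gk ^ c * bb ^ j)"
abbreviation mF :: "nat => nat => nat => 'u" where "mF d c j \<equiv> gf ^ d * (gk ^ c * bb ^ j)"

lemma fe_bb: "scale ((br 1)^2) (gf * ge) = bb - scale q gk - scale (iq) (gk ^ N)"
 "scale ((br 1)^2) (ge * gf) = bb - scale (iq) gk - scale q (gk ^ N)"
 using bb1 bb2 by (simp_all add: algebra_simps)

lemma m_left: "bb * mE d c j = mE d c (Suc j)" "gk * mE d c j = scale (y ^ d) (mE d (c + 1) j)" "gk ^ N * mE d c j = scale (iy ^ d) (mE d (c + N) j)"
 "bb * mF d c j = mF d c (Suc j)" "gk * mF d c j = scale (iy ^ d) (mF d (c + 1) j)" "gk ^ N * mF d c j = scale (y ^ d) (mF d (c + N) j)"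
proof -
 have n: "gk ^ N * gk ^ c = gk ^ (c + N)" by (simp only: power_add[symmetric] add.commute)
 have b: "bb * (x * (gk ^ c * bb ^ j)) = x * (gk ^ c * bb ^ Suc j)" if "bb * x = x * bb" for x
 proof -
  have "bb * (x * (gk ^ c * bb ^ j)) = (bb * x) * (gk ^ c * bb ^ j)" by (simp only: massoc)
  also have "... = x * ((bb * gk ^ c) * bb ^ j)" by (simp only: that massoc)
  also have "bb * gk ^ c = gk ^ c * bb" using bb_pow_comm(3)[of 1 c] by simp
  finally show ?thesis by (simp only: power_Suc massoc)
 qed
 show "bb * mE d c j = mE d c (Suc j)" "bb * mF d c j = mF d c (Suc j)"
  using bb_pow_comm(1,2)[of 1 d] by (intro b; simp)+
 have "gk * mE d c j = (gk ^ 1 * ge ^ d) * (gk ^ c * bb ^ j)" "gk * mF d c j = (gk ^ 1 * gf ^ d) * (gk ^ c * bb ^ j)" by (simp_all add: massoc)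
 thus "gk * mE d c j = scale (y ^ d) (mE d (c + 1) j)" "gk * mF d c j = scale (iy ^ d) (mF d (c + 1) j)"
  unfolding ke_pow kf_pow by (simp_all add: ss massoc)
 have "gk ^ N * mE d c j = (gk ^ N * ge ^ d) * (gk ^ c * bb ^ j)" "gk ^ N * mF d c j = (gk ^ N * gf ^ d) * (gk ^ c * bb ^ j)" by (simp_all add: massoc)
 thus "gk ^ N * mE d c j = scale (iy ^ d) (mE d (c + N) j)" "gk ^ N * mF d c j = scale (y ^ d) (mF d (c + N) j)"
  unfolding Nke by (simp_all add: ss massoc[symmetric] n[symmetric])
qed

text \<open>The adjoint action of \<open>F\<close> lowers the degree in \<open>E\<close> by one and
  produces only monomials of the same shape; \<open>E_ad\<close> is the counterpart for
  \<open>F\<close>-monomials.\<close>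

lemma F_ad: "scale ((br 1)^2) (gf * mE (Suc d) c j - gk ^ N * mE (Suc d) c j * gk * gf)
 = scale (1 - iy ^ (Suc d + c)) (mE d c (Suc j)) - scale (q * y ^ d - iy ^ (Suc d + c) * iq) (mE d (c + 1) j)
  - scale (iq * iy ^ d - iy ^ (Suc d + c) * q) (mE d (c + N) j)"
proof -
 define s where "s = iy ^ (Suc d + c)"
 have 1: "scale ((br 1)^2) (gf * mE (Suc d) c j) = mE d c (Suc j) - scale (q * y ^ d) (mE d (c + 1) j) - scale (iq * iy ^ d) (mE d (c + N) j)"
 proof -
  have "scale ((br 1)^2) (gf * mE (Suc d) c j) = scale ((br 1)^2) (gf * ge) * mE d c j" by (simp add: ss massoc)
  thus ?thesis unfolding fe_bb by (simp only: left_diff_distrib scale_mult_left m_left scale_scale)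
 qed
 have "gk ^ N * mE (Suc d) c j * gk * gf = scale (iy ^ Suc d) (ge ^ Suc d * (gk ^ (c + N) * bb ^ j * gk * gf))"
  unfolding m_left by (simp add: ss massoc)
 also have "gk ^ (c + N) * bb ^ j * gk * gf = bb ^ j * (gk ^ c * (gk ^ N * gk) * gf)"
  using bb_pow_comm(3)[of j "c + N"] by (simp add: power_add massoc[symmetric])
 also have "... = bb ^ j * (gk ^ c * gf ^ 1)" by (simp add: KKinv)
 also have "... = scale (iy ^ c) (gf * (gk ^ c * bb ^ j))"
  unfolding kf_pow using bb_pow_comm(2)[of j 1] bb_pow_comm(3)[of j c] by (simp add: ss massoc[symmetric]) (simp add: massoc)
 finally have "gk ^ N * mE (Suc d) c j * gk * gf = scale s (ge ^ d * ((ge * gf) * (gk ^ c * bb ^ j)))"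
  by (simp add: s_def ss power_add massoc power_commutes) (metis (no_types, lifting) massoc power_commutes)
 hence "scale ((br 1)^2) (gk ^ N * mE (Suc d) c j * gk * gf) = scale s (ge ^ d * (scale ((br 1)^2) (ge * gf) * (gk ^ c * bb ^ j)))"
  by (simp add: ss mult.commute)
 also have "scale ((br 1)^2) (ge * gf) * (gk ^ c * bb ^ j) = mE 0 c (Suc j) - scale (iq) (mE 0 (c + 1) j) - scale q (mE 0 (c + N) j)"
  using m_left(1-3)[of 0 c j] unfolding fe_bb by (simp add: left_diff_distrib scale_mult_left)
 finally have 2: "scale ((br 1)^2) (gk ^ N * mE (Suc d) c j * gk * gf) = scale s (mE d c (Suc j)) - scale (s * iq) (mE d (c + 1) j) - scale (s * q) (mE d (c + N) j)"
  by (simp add: right_diff_distrib ss)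
 show ?thesis unfolding scale_right_diff_distrib 1 2 s_def[symmetric] by (simp add: scale_left_diff_distrib algebra_simps)
qed

lemma E_ad: "scale ((br 1)^2) ((ge * mF (Suc d) c j - mF (Suc d) c j * ge) * gk ^ N)
 = scale (1 - y ^ c) (mF d (c + N) (Suc j)) - scale (iq * iy ^ d - y ^ c * q) (mF d (c + 1 + N) j)
  - scale (q * y ^ d - y ^ c * iq) (mF d (c + N + N) j)"
proof -
 have 1: "scale ((br 1)^2) (ge * mF (Suc d) c j) = mF d c (Suc j) - scale (iq * iy ^ d) (mF d (c + 1) j) - scale (q * y ^ d) (mF d (c + N) j)"
 proof -
  have "scale ((br 1)^2) (ge * mF (Suc d) c j) = scale ((br 1)^2) (ge * gf) * mF d c j" by (simp add: ss massoc)
  thus ?thesis unfolding fe_bb by (simp only: left_diff_distrib scale_mult_left m_left scale_scale)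
 qed
 have "gk ^ c * bb ^ j * ge = scale (y ^ c) (ge * (gk ^ c * bb ^ j))"
  using ke_pow[of c 1] bb_pow_comm(1)[of j 1] by (simp add: massoc) (simp add: massoc[symmetric] ss)
 hence "mF (Suc d) c j * ge = scale (y ^ c) (gf ^ Suc d * (ge * (gk ^ c * bb ^ j)))" by (simp add: massoc ss)
 also have "... = scale (y ^ c) (gf ^ d * ((gf * ge) * (gk ^ c * bb ^ j)))" by (simp only: power_Suc2 massoc)
 finally have "scale ((br 1)^2) (mF (Suc d) c j * ge) = scale (y ^ c) (gf ^ d * (scale ((br 1)^2) (gf * ge) * (gk ^ c * bb ^ j)))"
  by (simp add: ss mult.commute)
 also have "scale ((br 1)^2) (gf * ge) * (gk ^ c * bb ^ j) = mF 0 c (Suc j) - scale q (mF 0 (c + 1) j) - scale (iq) (mF 0 (c + N) j)"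
  using m_left(1-3)[of 0 c j] unfolding fe_bb by (simp add: left_diff_distrib scale_mult_left)
 finally have 2: "scale ((br 1)^2) (mF (Suc d) c j * ge) = scale (y ^ c) (mF d c (Suc j)) - scale (y ^ c * q) (mF d (c + 1) j) - scale (y ^ c * iq) (mF d (c + N) j)"
  by (simp add: right_diff_distrib ss)
 have 3: "mF d c j * gk ^ N = mF d (c + N) j" for c j
  using bb_pow_comm(3)[of j N] by (simp add: massoc power_add)
 have "scale ((br 1)^2) ((ge * mF (Suc d) c j - mF (Suc d) c j * ge) * gk ^ N)
  = (scale ((br 1)^2) (ge * mF (Suc d) c j) - scale ((br 1)^2) (mF (Suc d) c j * ge)) * gk ^ N"
  by (simp only: scale_mult_left scale_right_diff_distrib left_diff_distrib)
 thus ?thesis unfolding 1 2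
  by (simp only: left_diff_distrib scale_mult_left 3) (simp add: scale_left_diff_distrib algebra_simps)
qed

text \<open>Induction on the degree shows that \<open>Z\<close> vanishes on monomials of nonzero
  degree: the adjoint generator maps them to degree one lower, where \<open>Z\<close> contributes
  \<open>0\<close>, and the injectivity hypotheses finish the step. The integral vanishes there too
  because it is invariant under conjugation by \<open>K\<close>. Degree zero is the hypothesis on
  \<open>K\<close> and \<open>bb\<close>.\<close>

lemma principle:
 assumes Z: "linL Z" and e: "casimir_idempotent (N + k) e" "k <= N"
  and z0: "!!c j. Z (gk ^ c * bb ^ j) = left_integral (gk ^ c * bb ^ j * e) *. a"
  and zE: "!!w. Ev * Z w = Z ((ge * w - w * ge) * gk ^ N)" and zF: "!!w. Fv * Z w = Z (gf * w - gk ^ N * w * gk * gf)"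
  and iE: "!!d c j. Ev * Z (mF (Suc d) c j) = 0 ==> Z (mF (Suc d) c j) = 0"
  and iF: "!!d c j. Fv * Z (mE (Suc d) c j) = 0 ==> Z (mE (Suc d) c j) = 0"
 shows "Z x = left_integral (x * e) *. a"
proof -
 define X where "X j = of_nat r * (if k = 0 then 2 ^ j else br' k ^ Suc j + (br k)^2 * (of_nat j * br' k ^ (j - 1)))" for j
 have z0': "Z (gk ^ c * bb ^ j) = (if r dvd Suc c then X j else 0) *. a" for c j
  unfolding z0 li_block[OF e] X_def ..
 have ym: "iy ^ i = 1" "y ^ i = 1" if "r dvd i" for i using that y_pow_eq_1[of i] by (simp_all add: power_inverse)
 have dr: "r dvd Suc (c + N) \<longleftrightarrow> r dvd c" for c
 proof -
  have "Suc (c + N) = c + r" using r_Suc by linarith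
  thus ?thesis by (simp only: dvd_add_triv_right_iff)
 qed
 have iq: "y * iq = q" "iy * q = iq" by (simp_all add: y_def power2_eq_square)
 have sq: "(br 1)^2 ~= 0" using br1_nz' by simp
 have E0: "Z (mE (Suc d) c j) = 0" for d c j
 proof (induction d arbitrary: c j)
  case 0
  define s where "s = iy ^ Suc c"
  have "(br 1)^2 *. (Fv * Z (mE (Suc 0) c j)) = Z (scale ((br 1)^2) (gf * mE (Suc 0) c j - gk ^ N * mE (Suc 0) c j * gk * gf))"
   by (simp only: zF linLD(2)[OF Z])
  also have "... = (1 - s) *. Z (gk ^ c * bb ^ Suc j) - (q - s * iq) *. Z (gk ^ (c + 1) * bb ^ j) - (iq - s * q) *. Z (gk ^ (c + N) * bb ^ j)"
   unfolding F_ad linL_simps(2)[OF Z] linLD(2)[OF Z] s_def by (simp del: power_Suc)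
  also have "... = ((1 - s) * (if r dvd Suc c then X (Suc j) else 0)) *. a - ((q - s * iq) * (if r dvd Suc (c + 1) then X j else 0)) *. a
    - ((iq - s * q) * (if r dvd Suc (c + N) then X j else 0)) *. a"
   unfolding z0' smult_simps ..
  \<comment> \<open>In degree one the lower monomials need not vanish. But whenever divisibility by
    \<open>r\<close> makes one of them nonzero, it forces the power of \<open>y\<close> that makes
    its coefficient \<open>0\<close>.\<close>
  also have "(1 - s) * (if r dvd Suc c then X (Suc j) else 0) = 0" using ym(1)[of "Suc c"] by (simp add: s_def del: power_Suc)
  also have "(q - s * iq) * (if r dvd Suc (c + 1) then X j else 0) = 0"
  proof (cases "r dvd Suc (c + 1)")
   case True
   hence "iy * s = 1" using ym(1)[OF True] by (simp add: s_def)
   hence "s = y" by (simp add: field_simps)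
   thus ?thesis using iq by simp
  qed simp
  also have "(iq - s * q) * (if r dvd Suc (c + N) then X j else 0) = 0"
   unfolding dr using ym(1)[of c] iq by (simp add: s_def)
  finally have "(br 1)^2 *. (Fv * Z (mE (Suc 0) c j)) = (br 1)^2 *. 0" by simp
  thus ?case using lop_cancel[OF _ sq] iF by blast
 next
  case (Suc d)
  have "(br 1)^2 *. (Fv * Z (mE (Suc (Suc d)) c j)) = Z (scale ((br 1)^2) (gf * mE (Suc (Suc d)) c j - gk ^ N * mE (Suc (Suc d)) c j * gk * gf))"
   by (simp only: zF linLD(2)[OF Z])
  also have "... = (br 1)^2 *. 0"
   unfolding F_ad linL_simps(2)[OF Z] linLD(2)[OF Z] Suc by simp
  finally show ?case using lop_cancel[OF _ sq] iF by blast
 qed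
 have F0: "Z (mF (Suc d) c j) = 0" for d c j
 proof (induction d arbitrary: c j)
  case 0
  have "(br 1)^2 *. (Ev * Z (mF (Suc 0) c j)) = Z (scale ((br 1)^2) ((ge * mF (Suc 0) c j - mF (Suc 0) c j * ge) * gk ^ N))"
   by (simp only: zE linLD(2)[OF Z])
  also have "... = (1 - y ^ c) *. Z (gk ^ (c + N) * bb ^ Suc j) - (iq - y ^ c * q) *. Z (gk ^ (c + 1 + N) * bb ^ j) - (q - y ^ c * iq) *. Z (gk ^ (c + N + N) * bb ^ j)"
   unfolding E_ad linL_simps(2)[OF Z] linLD(2)[OF Z] by (simp del: power_Suc)
  also have "... = ((1 - y ^ c) * (if r dvd Suc (c + N) then X (Suc j) else 0)) *. a - ((iq - y ^ c * q) * (if r dvd Suc (c + 1 + N) then X j else 0)) *. a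
    - ((q - y ^ c * iq) * (if r dvd Suc (c + N + N) then X j else 0)) *. a"
   unfolding z0' smult_simps ..
  also have "(1 - y ^ c) * (if r dvd Suc (c + N) then X (Suc j) else 0) = 0" unfolding dr using ym(2)[of c] by simp
  also have "(iq - y ^ c * q) * (if r dvd Suc (c + 1 + N) then X j else 0) = 0"
  proof (cases "r dvd c + 1")
   case True
   hence "y * y ^ c = 1" using ym(2)[OF True] by simp
   hence "y ^ c = iy" by (simp add: field_simps)
   thus ?thesis using iq by simp
  qed (use dr[of "Suc c"] in simp)
  also have "(q - y ^ c * iq) * (if r dvd Suc (c + N + N) then X j else 0) = 0"
  proof (cases "r dvd c + N")
   case True
   hence "y ^ c * iy = 1" using ym(2)[OF True] y_r(3)[of 1] by (simp add: power_add)
   hence "y ^ c = y" by (simp add: field_simps)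
   thus ?thesis using iq by simp
  qed (simp add: dr[of "c + N"])
  finally have "(br 1)^2 *. (Ev * Z (mF (Suc 0) c j)) = (br 1)^2 *. 0" by simp
  thus ?case using lop_cancel[OF _ sq] iE by blast
 next
  case (Suc d)
  have "(br 1)^2 *. (Ev * Z (mF (Suc (Suc d)) c j)) = Z (scale ((br 1)^2) ((ge * mF (Suc (Suc d)) c j - mF (Suc (Suc d)) c j * ge) * gk ^ N))"
   by (simp only: zE linLD(2)[OF Z])
  also have "... = (br 1)^2 *. 0"
   unfolding E_ad linL_simps(2)[OF Z] linLD(2)[OF Z] Suc by simp
  finally show ?case using lop_cancel[OF _ sq] iE by blast
 qed
 define D where "D x = Z x - left_integral (x * e) *. a" for x
 have lD: "linL D" unfolding D_def
  by (rule linL_diff[OF Z]) (rule linL_comp(2)[OF li_lin])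
 have ec: "e * x = x * e" for x using e(1) unfolding casimir_idempotent_def by blast
 have bk: "bb ^ j * gk ^ c = gk ^ c * bb ^ j" for c j by (rule bb_pow_comm)
 have kk: "gk * x * gk ^ N = x" if "x = gk ^ c * bb ^ j * e" for x c j
 proof -
  have a: "gk * gk ^ c = gk ^ c * gk" "gk * bb ^ j = bb ^ j * gk" "gk * e = e * gk"
   using bk[of j 1] ec[of gk] by (simp_all add: power_commutes)
  have "gk * x = (gk * gk ^ c) * (bb ^ j * e)" unfolding that by (simp only: massoc)
  also have "... = gk ^ c * ((gk * bb ^ j) * e)" by (subst a(1)) (simp only: massoc)
  also have "... = gk ^ c * (bb ^ j * (gk * e))" by (subst a(2)) (simp only: massoc)
  also have "... = x * gk" unfolding a(3) that by (simp only: massoc)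
  finally have "gk * x * gk ^ N = x * (gk * gk ^ N)" by (simp only: massoc)
  thus ?thesis by (simp add: KKinv)
 qed
 have yd: "y ^ d ~= 1" "iy ^ d ~= 1" if "0 < d" "d < r" for d
  using that y_pow_eq_1[of d] by (auto simp: power_inverse dest: dvd_imp_le)
 have DE: "D (ge ^ d * (bb ^ j * gk ^ c)) = 0" if "d < r" for d j c
 proof (cases d)
  case 0 thus ?thesis by (simp add: D_def z0 bk)
 next
  case (Suc d')
  have "gk * (ge ^ d * (gk ^ c * bb ^ j * e)) * gk ^ N = scale (y ^ d) (ge ^ d * (gk * (gk ^ c * bb ^ j * e) * gk ^ N))"
   using ke_pow[of 1 d] by (simp add: massoc[symmetric] ss)
  hence "left_integral (ge ^ d * (gk ^ c * bb ^ j * e)) = 0"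
   using kk[OF refl] yd[of d] that Suc by (intro li_off[of _ "y ^ d"]) auto
  thus ?thesis using E0[of d' c j] Suc by (simp add: D_def bk massoc)
 qed
 have DF: "D (bb ^ j * gk ^ c * gf ^ d) = 0" if "d < r" for d j c
 proof -
  have "D (gf ^ d * (bb ^ j * gk ^ c)) = 0"
  proof (cases d)
   case 0 thus ?thesis by (simp add: D_def z0 bk)
  next
   case (Suc d')
   have "gk * (gf ^ d * (gk ^ c * bb ^ j * e)) * gk ^ N = scale (iy ^ d) (gf ^ d * (gk * (gk ^ c * bb ^ j * e) * gk ^ N))"
    using kf_pow[of 1 d] by (simp add: massoc[symmetric] ss)
   hence "left_integral (gf ^ d * (gk ^ c * bb ^ j * e)) = 0"
    using kk[OF refl] yd[of d] that Suc by (intro li_off[of _ "iy ^ d"]) auto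
   thus ?thesis using F0[of d' c j] Suc by (simp add: D_def bk massoc)
  qed
  moreover have "bb ^ j * gk ^ c * gf ^ d = scale (iy ^ (c * d)) (gf ^ d * (bb ^ j * gk ^ c))"
   using kf_pow[of c d] bb_pow_comm(2)[of j d] by (simp add: massoc ss) (simp add: massoc[symmetric])
  ultimately show ?thesis by (simp add: linLD(2)[OF lD])
 qed
 have "D x = (%x. 0) x"
 proof (rule lin_ext[OF lD linL_zero])
  fix a b c assume abc: "a < r" "b < r" "c < r"
  show "D (ge ^ a * gf ^ b * gk ^ c) = 0"
  proof (cases "b <= a")
   case True
   have "(%x. D (ge ^ (a - b) * x)) (bb ^ 0 * (ge ^ b * gf ^ b * gk ^ c)) = 0"
    by (rule bb_EF0[OF linL_comp(1)[OF lD]]) (rule DE, use abc in simp)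
   moreover have "ge ^ (a - b) * (ge ^ b * gf ^ b * gk ^ c) = ge ^ a * gf ^ b * gk ^ c"
    using True by (simp add: massoc[symmetric] power_add[symmetric])
   ultimately show ?thesis by simp
  next
   case False
   have "(%x. D (x * gf ^ (b - a))) (bb ^ 0 * (ge ^ a * gf ^ a * gk ^ c)) = 0"
    by (rule bb_EF0[OF linL_comp(2)[OF lD]]) (rule DF, use abc in simp)
   moreover have "ge ^ a * gf ^ a * gk ^ c * gf ^ (b - a) = scale (iy ^ (c * (b - a))) (ge ^ a * (gf ^ a * gf ^ (b - a)) * gk ^ c)"
    using kf_pow[of c "b - a"] by (simp add: massoc ss)
   moreover have "gf ^ a * gf ^ (b - a) = gf ^ b" using False by (simp add: power_add[symmetric])
   ultimately have "iy ^ (c * (b - a)) *. D (ge ^ a * gf ^ b * gk ^ c) = iy ^ (c * (b - a)) *. 0" by (simp add: linLD(2)[OF lD])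
   thus ?thesis by (rule lop_cancel) simp
  qed
 qed
 thus ?thesis by (simp add: D_def)
qed

end

context odd_root
begin

section \<open>Weights of bent operators; injectivity of \<open>E\<close> and \<open>F\<close> on
  the target\<close>

lemma loc_munit_comm: "loc m z ==> m <= i ==> munit a b i * z = z * munit a b i"
 by (simp add: loc_def munit_def)

text \<open>\<open>z\<close> is homogeneous of degree \<open>d\<close>. All \<open>l \<ge> m\<close>
  are included because after bending the weight is measured on \<open>2 m\<close> letters.\<close>

definition sP :: "nat => int => lop => bool" where
 "sP m d z \<longleftrightarrow> (\<forall>l\<ge>m. \<forall>j. Pm l j * z = z * Pm l (j + d))"

lemma sPI:
 assumes "loc m z" "!!j. Pm m j * z = z * Pm m (j + d)"
 shows "sP m d z"
proof -
 have "\<forall>j. Pm l j * z = z * Pm l (j + d)" if "m <= l" for l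
  using that
 proof (induction l rule: dec_induct)
  case (step l)
  note c = loc_munit_comm[OF assms(1) step(1)]
  have "Pm (Suc l) j * z = z * Pm (Suc l) (j + d)" for j
  proof -
   have "Pm (Suc l) j * z = Pm l j * z * munit A0 A0 l + Pm l (j - 1) * z * munit A1 A1 l"
    by (simp add: distrib_right massoc c)
   also have "... = z * (Pm l (j + d) * munit A0 A0 l + Pm l (j - 1 + d) * munit A1 A1 l)"
    using step(3) by (simp add: distrib_left massoc)
   also have "j - 1 + d = j + d - 1" by simp
   finally show ?thesis by simp
  qed
  thus ?case ..
 qed (use assms(2) in simp)
 thus ?thesis by (simp add: sP_def)
qed

lemma sP_mult: "sP m d z ==> sP m d' z' ==> sP m (d + d') (z * z')"
proof -
 assume a: "sP m d z" "sP m d' z'"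
 have "Pm l j * (z * z') = z * z' * Pm l (j + (d + d'))" if "m <= l" for l j
 proof -
  have "Pm l j * (z * z') = z * (Pm l (j + d) * z')" using a(1) that by (simp add: sP_def massoc[symmetric])
  thus ?thesis using a(2) that by (simp add: sP_def massoc add.assoc)
 qed
 thus ?thesis by (simp add: sP_def)
qed

lemma sP_add: "sP m d z ==> sP m d z' ==> sP m d (z + z')" "sP m d z ==> sP m d (c *. z)"
 by (simp_all add: sP_def distrib_left distrib_right)

lemma sP_pow: "sP m d z ==> sP m (int n * d) (z ^ n)"
proof (induction n)
 case (Suc n)
 thus ?case using sP_mult[OF Suc.prems Suc.IH] by (simp add: algebra_simps)
qed (simp add: sP_def)

lemma sP_X: "sP m 1 (Eo 0 m)" "sP m (- 1) (Fo 0 m)" "sP m 0 (Ko 0 m)" "sP m 0 (Lo 0 m)" "sP m 0 (Bo m)"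
proof -
 show E: "sP m 1 (Eo 0 m)" by (rule sPI) (use loc_X Pm_E in auto)
 show F: "sP m (- 1) (Fo 0 m)"
 proof (rule sPI)
  show "Pm m j * Fo 0 m = Fo 0 m * Pm m (j + - 1)" for j using Pm_F[of m "j - 1"] by simp
 qed (use loc_X in auto)
 show K: "sP m 0 (Ko 0 m)" by (rule sPI) (use loc_X Pm_K in auto)
 show L: "sP m 0 (Lo 0 m)" by (rule sPI) (use loc_X Pm_L in auto)
 show "sP m 0 (Bo m)" unfolding Bo_def
  by (intro sP_add K L) (use sP_mult[OF F E] in simp)
qed

lemma sP_good: "good m z ==> sP m 0 z"
 by (rule sPI) (use good_Pm in \<open>auto simp: good_def cmt_def\<close>)

lemma Pm_CU:
 assumes "sP m d w"
 shows "Pm (2 * m) (int m - d) * (w * CU m) = w * CU m"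
proof -
 have "Pm (2 * m) (int m - d) * (w * CU m) = w * (Pm (2 * m) (int m) * CU m)"
  using assms by (simp add: sP_def massoc[symmetric])
 also have "Pm (2 * m) (int m) * CU m = CU m"
  using capfam_CA[OF capfam_Pm[of 0], of m] by simp
 finally show ?thesis .
qed

text \<open>A bent operator of nonzero degree has nonzero weight, so the closed trace vanishes and
  only the \<open>t'\<close> term is left, which preserves the weight.\<close>

lemma Om_weight:
 assumes k: "0 < k" "k <= N" and w: "sP (N + k) d w" and d: "d ~= 0"
 shows "Pm (2 * N) (int N - d) * Om k w = Om k w"
proof -
 define P where "P n = Pm n ((int n - 2 * d) div 2)" for n
 have P: "capfam P" using capfam_Pm[of "2 * d"] unfolding P_def[abs_def] .
 have P2: "P (2 * n) = Pm (2 * n) (int n - d)" for n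
 proof -
  have "int (2 * n) - 2 * d = 2 * (int n - d)" by simp
  thus ?thesis unfolding P_def by (simp only:) simp
 qed
 have 1: "P (2 * (N + k)) * (w * CU (N + k)) = w * CU (N + k)" unfolding P2 using Pm_CU[OF w] by simp
 have "CA (N + k) * (P (2 * (N + k)) * (w * CU (N + k))) = P 0 * (CA (N + k) * (w * CU (N + k)))"
  using capfam_CA[OF P, of "N + k"] by (simp add: massoc[symmetric])
 moreover have "P 0 = 0" using d by (simp add: P_def)
 ultimately have 2: "CA (N + k) * (w * CU (N + k)) = 0" unfolding 1 by simp
 have "P (2 * N) * jg N = jg N * P (2 * N)"
  using sP_good[OF good_jg[of N]] unfolding P2 sP_def by simp
 hence "P (2 * N) * (jg N * (Cm k * (w * CU (N + k)))) = jg N * (P (2 * N) * Cm k * (w * CU (N + k)))"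
  by (simp add: massoc[symmetric])
 also have "P (2 * N) * Cm k = Cm k * P (2 * (N + k))" using capfam_Cm[OF P] by simp
 finally have "P (2 * N) * (jg N * (Cm k * (w * CU (N + k)))) = jg N * (Cm k * (w * CU (N + k)))"
  by (simp only: massoc 1)
 thus ?thesis by (simp add: Om_def 2 P2)
qed

lemma F_Om: "0 < k ==> F * Om k w = Om k w"
proof -
 have "F * jg N = jg N" using jg_F[of N] N_ge by simp
 from mult3[OF this] show ?thesis by (simp add: Om_def right_diff_distrib)
qed

lemma Om_lin: "Om k (w + w') = Om k w + Om k w'" "Om k (c *. w) = c *. Om k w"
 by (rule lop_eqI, simp add: Om_def distrib_left distrib_right algebra_simps ap_add ap_mult)+

lemma Om_EF:
 assumes "0 < k" "k <= N" "loc (N + k) w"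
 shows "Eo 0 (2 * N) * Om k w = Om k ((Eo 0 (N + k) * w - w * Eo 0 (N + k)) * Lo 0 (N + k))"
  "Fo 0 (2 * N) * Om k w = Om k (Fo 0 (N + k) * w - Lo 0 (N + k) * w * Ko 0 (N + k) * Fo 0 (N + k))"
proof -
 have *: "X (2 * N) * Om k w = Om k w'"
  if X: "capfam X" "X 0 = 0" and b: "X (2 * (N + k)) * (w * CU (N + k)) = w' * CU (N + k)" for X w'
 proof -
  have g: "X (2 * N) * jg N = jg N * X (2 * N)"
   using good_jg[of N] X(1) by (simp add: good_def cmt_def mult_2)
  have c: "X (2 * N) * Cm k = Cm k * X (2 * (N + k))" using capfam_Cm[OF X(1)] by simp
  have f: "X (2 * N) * Ak N = 0"
  proof -
   have "good (2 * N) F" using good_jf[of N] X(1) sP_def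
    by (metis (no_types, lifting) capfam_TLa good_def jf_TLa TLa_mono loc_mono TLa_loc le_add1 mult_2)
   hence "X (2 * N) * F = F * X (2 * N)" using X(1) by (simp add: good_def cmt_def)
   from mult3[OF this, of "CU N"] show ?thesis using capfam_CA[OF X(1), of N] X(2) by (simp add: A_N massoc)
  qed
  have a: "CA (N + k) * (w' * CU (N + k)) = 0"
   unfolding b[symmetric] using capfam_CA[OF X(1), of "N + k"] X(2) by (simp add: massoc[symmetric])
  have "X (2 * N) * (jg N * (Cm k * (w * CU (N + k)))) = jg N * (Cm k * (w' * CU (N + k)))"
   unfolding b[symmetric] using g c by (metis massoc)
  thus ?thesis using mult3[OF f] by (simp add: Om_def a right_diff_distrib)
 qed
 show "Eo 0 (2 * N) * Om k w = Om k ((Eo 0 (N + k) * w - w * Eo 0 (N + k)) * Lo 0 (N + k))"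
  by (rule *[OF capfam_X(3)]) (use E_bend[OF assms(3)] in \<open>simp_all add: massoc\<close>)
 show "Fo 0 (2 * N) * Om k w = Om k (Fo 0 (N + k) * w - Lo 0 (N + k) * w * Ko 0 (N + k) * Fo 0 (N + k))"
  by (rule *[OF capfam_X(4)]) (use F_bend[OF assms(3)] in simp_all)
qed

lemma Pm_sub: "N <= l ==> j < i ==> Pm N i * Pm l j = 0" "N <= l ==> int l - int N < j - i ==> Pm N i * Pm l j = 0"
proof -
 show "N <= l ==> j < i ==> Pm N i * Pm l j = 0"
 proof (induction l arbitrary: j rule: dec_induct)
  case (step l)
  hence "Pm N i * Pm l j = 0" "Pm N i * Pm l (j - 1) = 0" by auto
  thus ?case by (simp add: distrib_left massoc[symmetric])
 qed (simp add: Pm_mult)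
 show "N <= l ==> int l - int N < j - i ==> Pm N i * Pm l j = 0"
 proof (induction l arbitrary: j rule: dec_induct)
  case (step l)
  hence "Pm N i * Pm l j = 0" "Pm N i * Pm l (j - 1) = 0" by auto
  thus ?case by (simp add: distrib_left massoc[symmetric])
 qed (simp add: Pm_mult)
qed

text \<open>On the image of the top Jones--Wenzl idempotent the Casimir operator is the scalar \<open>2\<close>, so that
 \<open>F\<close> kills only the lowest weight vectors and \<open>E\<close> only the highest ones.\<close>

lemma weight_inj:
 assumes v: "F * v = v" "Pm N (int i) * v = v" and i: "i <= N"
 shows "Fo 0 N * v = 0 ==> i < N ==> v = 0" "Eo 0 N * v = 0 ==> 0 < i ==> v = 0"
proof -
 have B: "Bo N * v = 2 *. v"
  using mult3[OF Bo_F[simplified], of v] v(1) by (simp add: qbrace'_def)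
 have K: "Ko 0 N * v = wt 0 i *. v" "Lo 0 N * v = inverse (wt 0 i) *. v"
  using mult3[OF Pm_K(1)[of N "int i"], of v] mult3[OF Pm_L(1)[of N "int i"], of v] v(2) wt_powi(1)[of 0 i] wt_powi(2)[of i 0] by simp_all
 have z: "v = 0" if "z + inverse z = 2 ==> False" "(2 - z - inverse z) *. v = 0" for z
 proof (rule lop_cancel[of "2 - z - inverse z"])
  show "2 - z - inverse z ~= 0" using that(1) by (auto simp: algebra_simps)
 qed (use that(2) in simp)
 have z2: "z = 1" if "z + inverse z = 2" "z ~= 0" for z :: complex
 proof -
  have "(z - 1)^2 = z * (z + inverse z - 2)" using that(2) by (simp add: power2_eq_square algebra_simps)
  thus ?thesis using that(1) by simp
 qed
 have Bv: "(br 1)^2 *. (Fo 0 N * (Eo 0 N * v)) = (2 - q * wt 0 i - inverse (q * wt 0 i)) *. v"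
 proof -
  have "Bo N * v = (br 1)^2 *. (Fo 0 N * (Eo 0 N * v)) + (q * wt 0 i + iq * inverse (wt 0 i)) *. v"
   by (simp add: Bo_def distrib_right massoc K smult_distrib add.assoc)
  hence "(br 1)^2 *. (Fo 0 N * (Eo 0 N * v)) = 2 *. v - (q * wt 0 i + iq * inverse (wt 0 i)) *. v"
   unfolding B by (simp add: algebra_simps)
  thus ?thesis by (simp add: lop_diff_left lop_add_left diff_diff_eq inverse_mult_distrib mult.commute)
 qed
 show "v = 0" if "Eo 0 N * v = 0" "0 < i"
 proof (rule z[of "q * wt 0 i"])
  show "(2 - q * wt 0 i - inverse (q * wt 0 i)) *. v = 0" using Bv that(1) by simp
  assume "q * wt 0 i + inverse (q * wt 0 i) = 2"
  hence "q * wt 0 i = 1" by (intro z2) simp_all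
  moreover have "q * wt 0 i = inverse (y ^ i)" by (simp add: wt_def power_inverse massoc[symmetric])
  ultimately have "y ^ i = 1" by simp
  hence "r dvd i" by (simp add: y_pow_eq_1)
  thus False using that(2) i N_lt by (meson dvd_imp_le le_trans not_le)
 qed
 have EFv: "(br 1)^2 *. (Eo 0 N * (Fo 0 N * v)) = (2 - iq * wt 0 i - inverse (iq * wt 0 i)) *. v"
 proof -
  have b: "br 1 = q - iq" by (simp add: qbrace_def)
  have "Eo 0 N * (Fo 0 N * v) = Fo 0 N * (Eo 0 N * v) + (1 / br 1) *. (wt 0 i *. v - inverse (wt 0 i) *. v)"
   using arg_cong[OF EF[of 0 N], of "%x. x * v"] by (simp add: left_diff_distrib massoc K algebra_simps)
  hence "(br 1)^2 *. (Eo 0 N * (Fo 0 N * v)) = (br 1)^2 *. (Fo 0 N * (Eo 0 N * v)) + br 1 *. (wt 0 i *. v - inverse (wt 0 i) *. v)"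
   using br1_nz by (simp add: lop_add_right power2_eq_square)
  hence "(br 1)^2 *. (Eo 0 N * (Fo 0 N * v)) = ((2 - q * wt 0 i - inverse (q * wt 0 i)) + br 1 * (wt 0 i - inverse (wt 0 i))) *. v"
   unfolding Bv by (simp only: lop_diff_left[symmetric] lop_add_left[symmetric] smult_simps)
  also have "(2 - q * wt 0 i - inverse (q * wt 0 i)) + br 1 * (wt 0 i - inverse (wt 0 i)) = 2 - iq * wt 0 i - inverse (iq * wt 0 i)"
   unfolding b by (simp add: algebra_simps)
  finally show ?thesis .
 qed
 show "v = 0" if "Fo 0 N * v = 0" "i < N"
 proof (rule z[of "iq * wt 0 i"])
  show "(2 - iq * wt 0 i - inverse (iq * wt 0 i)) *. v = 0" using EFv that(1) by simp
  assume "iq * wt 0 i + inverse (iq * wt 0 i) = 2"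
  hence "iq * wt 0 i = 1" by (intro z2) simp_all
  moreover have "iq * wt 0 i = inverse (y ^ Suc i)" by (simp add: wt_def y_def power2_eq_square power_mult_distrib power_inverse inverse_mult_distrib)
  ultimately have "inverse (y ^ Suc i) = 1" by (simp only:)
  hence "y ^ Suc i = 1" by (simp only: inverse_eq_1_iff)
  hence "r dvd Suc i" unfolding y_pow_eq_1 .
  thus False using that(2) r_Suc by (auto dest: dvd_imp_le)
 qed
qed

lemma tail_Pm: "Fo N N * Pm N j = Pm N j * Fo N N" "Eo N N * Pm N j = Pm N j * Eo N N" "Ko N N * Pm N j = Pm N j * Ko N N"
 "Ko N N * Eo 0 N = Eo 0 N * Ko N N"
 using loc_tail[OF loc_Pm[of N N]] loc_tail[OF loc_X(3)[of N N]] by (auto simp: cmt_def)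

text \<open>Split \<open>v\<close> by the number of \<open>A1\<close> among its first
  \<open>N\<close> letters and go down from \<open>N\<close>. The total number is less than
  \<open>N\<close>, so the first component is \<open>0\<close>; if component \<open>i + 1\<close>
  vanishes, \<open>F v = 0\<close> says that \<open>F\<close> on the first half kills component
  \<open>i\<close>, which \<open>weight_inj\<close> excludes.\<close>

lemma inj_F:
 assumes v: "F * v = v" "Pm (2 * N) (int N - int (Suc d)) * v = v" "Fo 0 (2 * N) * v = 0"
 shows "v = 0"
proof -
 have FP: "F * (Pm N j * v) = Pm N j * v" for j
  using mult3[OF F_loc_P[of N j], of v] v(1) by (simp add: massoc)
 have st: "Pm N (int i) * v = 0" if "n <= N" "i = N - n" for n i
  using that
 proof (induction n arbitrary: i)
  case 0
  have "Pm N (int N) * (Pm (2 * N) (int N - int (Suc d)) * v) = 0"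
   using mult3[OF Pm_sub(1)[of "2 * N" "int N - int (Suc d)" "int N"], of v] by simp
  thus ?case using 0 v(2) by simp
 next
  case (Suc n)
  hence i: "i < N" "Suc i = N - n" by auto
  hence IH: "Pm N (int i + 1) * v = 0" using Suc.IH[of "Suc i"] Suc.prems by (simp add: add.commute)
  have "Pm N (int i + 1) * (Fo 0 (2 * N) * v) = Lo 0 N * (Fo N N * (Pm N (int i + 1) * v)) + Fo 0 N * (Pm N (int i) * v)"
  proof -
   have c: "Pm N j * Lo 0 N = Lo 0 N * Pm N j" for j by (simp add: Pm_L)
   show ?thesis using X_add(4)[of 0 N N]
    by (simp add: mult_2 distrib_left distrib_right massoc mult3[OF tail_Pm(1)] mult3[OF Pm_F] mult3[OF c[symmetric]])
  qed
  hence "Fo 0 N * (Pm N (int i) * v) = 0" using IH v(3) by simp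
  moreover have "Pm N (int i) * (Pm N (int i) * v) = Pm N (int i) * v" using mult3[OF Pm_mult[of N "int i" "int i"], of v] by simp
  ultimately show ?case using weight_inj(1)[OF FP, of i "int i"] i by simp
 qed
 have "v = (\<Sum>j = 0..N. Pm N (int j)) * v" by (simp add: Pm_sum)
 also have "... = 0" unfolding sum_distrib_right
 proof (rule sum.neutral, rule ballI)
  fix j assume "j \<in> {0..N}"
  thus "Pm N (int j) * v = 0" using st[of "N - j" j] by simp
 qed
 finally show ?thesis .
qed

text \<open>The mirror image, going up from \<open>0\<close>: the total number of \<open>A1\<close>
  exceeds \<open>N\<close>, so they cannot all lie among the last \<open>N\<close> letters.\<close>

lemma inj_E:
 assumes v: "F * v = v" "Pm (2 * N) (int N + int (Suc d)) * v = v" "Eo 0 (2 * N) * v = 0"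
 shows "v = 0"
proof -
 have FP: "F * (Pm N j * v) = Pm N j * v" for j
  using mult3[OF F_loc_P[of N j], of v] v(1) by (simp add: massoc)
 have st: "Pm N (int i) * v = 0" if "i <= N" for i
  using that
 proof (induction i)
  case 0
  have "Pm N 0 * (Pm (2 * N) (int N + int (Suc d)) * v) = 0"
   using mult3[OF Pm_sub(2)[of "2 * N" "int N + int (Suc d)" 0], of v] by simp
  thus ?case using v(2) by simp
 next
  case (Suc i)
  hence IH: "Pm N (int i) * v = 0" by simp
  have "Pm N (int i) * (Eo 0 (2 * N) * v) = Ko N N * (Eo 0 N * (Pm N (int i + 1) * v)) + Eo N N * (Pm N (int i) * v)"
   using X_add(3)[of 0 N N]
   by (simp add: mult_2 distrib_left distrib_right massoc mult3[OF tail_Pm(2)] mult3[OF tail_Pm(3)] mult3[OF tail_Pm(4)] mult3[OF Pm_E])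
  hence "Ko N N * (Eo 0 N * (Pm N (int (Suc i)) * v)) = 0" using IH v(3) by (simp add: add.commute)
  hence "Lo N N * (Ko N N * (Eo 0 N * (Pm N (int (Suc i)) * v))) = 0" by simp
  hence "Eo 0 N * (Pm N (int (Suc i)) * v) = 0" using mult3[OF KL(2)[of N N]] by simp
  moreover have "Pm N (int (Suc i)) * (Pm N (int (Suc i)) * v) = Pm N (int (Suc i)) * v" using mult3[OF Pm_mult[of N "int (Suc i)" "int (Suc i)"], of v] by simp
  ultimately show ?case using weight_inj(2)[OF FP, of "Suc i" "int (Suc i)"] Suc.prems by simp
 qed
 have "v = (\<Sum>j = 0..N. Pm N (int j)) * v" by (simp add: Pm_sum)
 also have "... = 0" unfolding sum_distrib_right by (rule sum.neutral) (auto intro: st)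
 finally show ?thesis .
qed

subsection \<open>Tensor powers as representations\<close>

lemma comm_power: "a * b = b * a ==> (a * b) ^ n = a ^ n * (b ^ n :: lop)"
proof (induction n)
 case (Suc n)
 have "b * a ^ n = a ^ n * b" using power_commuting_commutes[of a b n] Suc.prems by simp
 moreover have "(a * b) ^ Suc n = a * ((b * a ^ n) * b ^ n)"
  by (simp only: power_Suc Suc.IH[OF Suc.prems] massoc)
 ultimately show ?case by (simp only: power_Suc massoc)
qed simp

text \<open>The \<open>q\<close>-binomial formula when \<open>B\<close> squares to zero. At exponent
  \<open>r\<close> its only mixed coefficient is a full geometric sum and vanishes, which gives
  \<open>E^r = F^r = 0\<close> on one more letter.\<close>

lemma q_binomial:
 assumes B: "B * B = 0" and AB: "A * B = z *. (B * A)"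
 shows "(A + B) ^ Suc n = A ^ Suc n + (\<Sum>i<Suc n. z ^ i) *. (B * A ^ n :: lop)"
proof (induction n)
 case (Suc n)
 have "(A + B) ^ Suc (Suc n) = (A + B) * (A + B) ^ Suc n" by simp
 also have "... = A * A ^ Suc n + (\<Sum>i<Suc n. z ^ i) *. (A * B * A ^ n) + B * A ^ Suc n + (\<Sum>i<Suc n. z ^ i) *. (B * B * A ^ n)"
  unfolding Suc by (simp add: distrib_left distrib_right massoc lop_add_right del: power_Suc sum.lessThan_Suc)
 also have "... = A ^ Suc (Suc n) + ((\<Sum>i<Suc n. z ^ i) * z + 1) *. (B * A ^ Suc n)"
  unfolding AB B by (simp add: lop_add_left massoc)
 also have "(\<Sum>i<Suc n. z ^ i) * z + 1 = (\<Sum>i<Suc (Suc n). z ^ i)"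
  unfolding sum.lessThan_Suc_shift[of "%i. z ^ i" "Suc n"] sum_distrib_right by (simp only: power_Suc power_0 mult.commute add.commute)
 finally show ?case .
qed simp

lemma nilpotent_sum:
 assumes "B * B = 0" "A * B = z *. (B * A)" "A ^ r = 0" "z ^ r = 1" "z ~= 1"
 shows "(A + B) ^ r = (0 :: lop)"
 using q_binomial[OF assms(1,2), of N] assms(3) geo_root[OF assms(4,5)] unfolding r_Suc[symmetric] by simp

lemma y_ne_1: "y ~= 1" "iy ~= 1"
 using y_pow_eq_1[of 1] r_ge by (auto simp: inverse_eq_1_iff)

lemma Xo_pow: "Eo 0 m ^ r = 0" "Fo 0 m ^ r = 0" "Ko 0 m ^ r = 1"
proof (induction m)
 case 0
 have "r ~= 0" using r_ge by simp
 { case 1 show ?case using \<open>r ~= 0\<close> by (simp add: power_0_left) }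
 { case 2 show ?case using \<open>r ~= 0\<close> by (simp add: power_0_left) }
 { case 3 show ?case by simp }
next
 case (Suc m)
 have c: "sK m * Eo 0 m = Eo 0 m * sK m" "sE m * Eo 0 m = Eo 0 m * sE m" "sF m * Fo 0 m = Fo 0 m * sF m" "sF m * Lo 0 m = Lo 0 m * sF m" "sK m * Ko 0 m = Ko 0 m * sK m"
  using loc_X[of m m] by (simp_all add: loc_def sK_def munit_def)
 note c3 = c[THEN mult3] site_rels[THEN mult3]
 have yr: "y ^ r = 1" "iy ^ r = 1" using y_pow_eq_1[of r] by (simp_all add: power_inverse)
 have yq: "q = y * iq" by (simp add: y_def power2_eq_square)
 { case 1
  have "(Eo 0 m * sK m + sE m) ^ r = 0"
  proof (rule nilpotent_sum[OF _ _ _ yr(1) y_ne_1(1)])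
   have "sE m * (Eo 0 m * sK m) = iq *. (Eo 0 m * sE m)" by (simp add: c3 site_rels massoc)
   moreover have "Eo 0 m * sK m * sE m = q *. (Eo 0 m * sE m)" by (simp add: massoc site_rels)
   ultimately show "Eo 0 m * sK m * sE m = y *. (sE m * (Eo 0 m * sK m))" by (simp add: y_def power2_eq_square massoc)
   show "(Eo 0 m * sK m) ^ r = 0" using comm_power[of "Eo 0 m" "sK m" r] c(1) Suc(1) by simp
  qed (simp add: site_rels)
  thus ?case by simp }
 { case 2
  have "(Fo 0 m + Lo 0 m * sF m) ^ r = 0"
  proof (rule nilpotent_sum[OF _ _ _ yr(2) y_ne_1(2)])
   have "Lo 0 m * sF m * Fo 0 m = y *. (Fo 0 m * (Lo 0 m * sF m))"
    using mult3[OF LF[of 0 m], of "sF m"] by (simp add: massoc c y_def)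
   thus "Fo 0 m * (Lo 0 m * sF m) = iy *. (Lo 0 m * sF m * Fo 0 m)" by simp
   show "Lo 0 m * sF m * (Lo 0 m * sF m) = 0" by (simp add: massoc c3 site_rels)
  qed (rule Suc(2))
  thus ?case by (simp add: add.commute) }
 { case 3
  have "sK m ^ n = q ^ n *. munit A0 A0 m + iq ^ n *. munit A1 A1 m" for n
  proof (induction n)
   case (Suc n)
   thus ?case by (simp add: sK_munit distrib_left distrib_right munit_munit mult.commute)
  qed (simp add: munit_one)
  hence "sK m ^ r = 1" by (simp add: power_inverse munit_one)
  thus ?case using comm_power[of "Ko 0 m" "sK m" r] c(5) Suc(3) by simp }
qed

lemma Lo_pow: "Lo 0 m = Ko 0 m ^ N"
proof -
 have "Ko 0 m ^ N * (Ko 0 m * Lo 0 m) = Ko 0 m ^ r * Lo 0 m" unfolding r_Suc by (simp only: power_Suc2 massoc)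
 thus ?thesis by (simp add: KL Xo_pow)
qed

end

context qg
begin

lemma isrep_X: "isrep (Eo 0 m) (Fo 0 m) (Ko 0 m)"
proof -
 have "Ko 0 m * Fo 0 m = iy *. (Fo 0 m * Ko 0 m)" by (simp add: KF y_def)
 thus ?thesis
  using Xo_pow KE[of 0 m] EF[of 0 m] unfolding isrep_def Lo_pow[symmetric] y_def by simp
qed

definition AU :: "nat => 'u => lop" where "AU m = rhoU (Eo 0 m) (Fo 0 m) (Ko 0 m)"

lemma AU_lin: "linL (AU m)" and AU_mult: "AU m (x * z) = AU m x * AU m z"
 and AU_vals: "AU m ge = Eo 0 m" "AU m gf = Fo 0 m" "AU m gk = Ko 0 m" "AU m 1 = 1" "AU m Kinv = Lo 0 m" "AU m (gk ^ N) = Lo 0 m" "AU m bb = Bo m"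
proof -
 show 1: "linL (AU m)" unfolding AU_def by (rule rhoU_lin)
 show 2: "AU m (x * z) = AU m x * AU m z" for x z unfolding AU_def by (rule rhoU_mult[OF isrep_X])
 show v: "AU m ge = Eo 0 m" "AU m gf = Fo 0 m" "AU m gk = Ko 0 m" "AU m 1 = 1" "AU m Kinv = Lo 0 m"
  unfolding AU_def using rhoU_vals[OF isrep_X] by (simp_all add: Lo_pow)
 thus k: "AU m (gk ^ N) = Lo 0 m" by (simp add: Kinv_N)
 show "AU m bb = Bo m" by (simp add: bb1 linLD[OF 1] 2 v k Bo_def)
qed

lemma AU_pow: "AU m (x ^ n) = AU m x ^ n"
 by (induction n) (simp_all add: AU_mult AU_vals)

lemma AU_capfam: "good m z ==> AU m x * z = z * AU m x" and AU_loc: "loc m (AU m x)"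
proof -
 have *: "AU m x = (\<Sum>(a, b, c)\<in>pbw_indices. lkp (coords x) (a, b, c) *. (Eo 0 m ^ a * (Fo 0 m ^ b * Ko 0 m ^ c)))"
  by (simp add: AU_def rhoU_def)
 have p: "u ^ n * z = z * u ^ n" if "u * z = z * u" for u z :: lop and n using that by (metis power_commuting_commutes)
 have t: "(e * (f * k)) * z = z * (e * (f * k))" if "e * z = z * e" "f * z = z * f" "k * z = z * k" for e f k z :: lop
  using that by (metis massoc)
 show "AU m x * z = z * AU m x" if "good m z"
 proof -
  have "Eo 0 m * z = z * Eo 0 m" "Fo 0 m * z = z * Fo 0 m" "Ko 0 m * z = z * Ko 0 m"
   using that capfam_X unfolding good_def cmt_def by blast+
  thus ?thesis unfolding * sum_distrib_left sum_distrib_right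
  proof (intro sum.cong refl)
   fix i :: pbw_index
   obtain a b c where i: "i = (a, b, c)" by (cases i)
   show "(case i of (a, b, c) => lkp (coords x) (a, b, c) *. (Eo 0 m ^ a * (Fo 0 m ^ b * Ko 0 m ^ c))) * z
    = z * (case i of (a, b, c) => lkp (coords x) (a, b, c) *. (Eo 0 m ^ a * (Fo 0 m ^ b * Ko 0 m ^ c)))"
    unfolding i prod.case smult_simps using t[OF p p p] \<open>Eo 0 m * z = _\<close> \<open>Fo 0 m * z = _\<close> \<open>Ko 0 m * z = _\<close> by simp
  qed
 qed
 have lp: "loc m (u ^ n)" if "loc m u" for u n using that by (induction n) (simp_all add: loc_one loc_mult)
 have ls: "loc m (sum f S)" if "!!i. i \<in> S ==> loc m (f i)" for f :: "pbw_index => lop" and S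
  using that by (induction S rule: infinite_finite_induct) (simp_all add: loc_add loc_scale[OF loc_one, of m 0, simplified])
 show "loc m (AU m x)" unfolding *
  by (rule ls) (auto intro!: loc_scale loc_mult lp loc_X)
qed

text \<open>A power of a scalar plus a square-zero operator: the coefficient of \<open>h\<close> is
  a derivative, to be matched with the one in \<open>li_block\<close>.\<close>

lemma Bo_pow_jg: "k <= N ==> 0 < k ==> Bo (N + k) ^ j * jg k = br' k ^ j *. jg k + (of_nat j * br' k ^ (j - 1) * - ((br 1)^2 * qi k)) *. jh k"
proof (induction j)
 case (Suc j)
 note b = Bo_jg'[OF Suc.prems(1)] Bo_jh[OF Suc.prems(2,1)]
 have "Bo (N + k) ^ Suc j * jg k = Bo (N + k) * (Bo (N + k) ^ j * jg k)" by (simp add: massoc)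
 also have "... = br' k ^ j *. (br' k *. jg k + (- ((br 1)^2 * qi k)) *. jh k) + (of_nat j * br' k ^ (j - 1) * - ((br 1)^2 * qi k)) *. (br' k *. jh k)"
  unfolding Suc.IH[OF Suc.prems] by (simp only: distrib_left smult_simps(1) b)
 also have "... = br' k ^ Suc j *. jg k + (of_nat (Suc j) * br' k ^ j * - ((br 1)^2 * qi k)) *. jh k"
  by (rule lop_eqI, cases j) (simp_all add: algebra_simps)
 finally show ?case by simp
qed simp

section \<open>The color as a functional on the quantum group\<close>

definition Zb :: "nat => 'u => lop" where "Zb k x = Om k (AU (N + k) x * jg k)"

lemma Zb_lin: "linL (Zb k)"
 by (simp add: linL_def Zb_def linLD[OF AU_lin] distrib_right Om_lin)

lemma Zb_EF:
 assumes k: "0 < k" "k <= N"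
 shows "Eo 0 (2 * N) * Zb k w = Zb k ((ge * w - w * ge) * gk ^ N)" "Fo 0 (2 * N) * Zb k w = Zb k (gf * w - gk ^ N * w * gk * gf)"
proof -
 have l: "loc (N + k) (AU (N + k) w * jg k)" using AU_loc jg_loc k by (simp add: loc_mult)
 have c: "jg k * AU (N + k) x = AU (N + k) x * jg k" for x using AU_capfam[OF good_jg[OF k(2)]] by simp
 have c': "jg k * Eo 0 (N + k) = Eo 0 (N + k) * jg k" "jg k * Fo 0 (N + k) = Fo 0 (N + k) * jg k" "jg k * Ko 0 (N + k) = Ko 0 (N + k) * jg k" "jg k * Lo 0 (N + k) = Lo 0 (N + k) * jg k"
  using c[of ge] c[of gf] c[of gk] c[of "gk ^ N"] by (simp_all add: AU_vals)
 note m = AU_mult AU_vals linL_simps(2)[OF AU_lin]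
 show "Eo 0 (2 * N) * Zb k w = Zb k ((ge * w - w * ge) * gk ^ N)"
  unfolding Zb_def Om_EF(1)[OF k l] m by (simp add: left_diff_distrib massoc c' mult3[OF c'(1)])
 show "Fo 0 (2 * N) * Zb k w = Zb k (gf * w - gk ^ N * w * gk * gf)"
  unfolding Zb_def Om_EF(2)[OF k l] m by (simp add: left_diff_distrib massoc c' mult3[OF c'(3)])
qed

lemma Zb_weight:
 assumes k: "0 < k" "k <= N"
 shows "Pm (2 * N) (int N - int (Suc d)) * Zb k (mE (Suc d) c j) = Zb k (mE (Suc d) c j)"
  "Pm (2 * N) (int N + int (Suc d)) * Zb k (mF (Suc d) c j) = Zb k (mF (Suc d) c j)"
proof -
 have "sP (N + k) (int c * 0 + int j * 0) (AU (N + k) (gk ^ c * bb ^ j))"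
  unfolding AU_mult AU_pow AU_vals by (intro sP_mult sP_pow sP_X)
 hence 0: "sP (N + k) 0 (AU (N + k) (gk ^ c * bb ^ j))" by simp
 have "sP (N + k) (int (Suc d) * 1 + 0 + 0) (AU (N + k) (mE (Suc d) c j) * jg k)"
  unfolding AU_mult[of _ "ge ^ Suc d"] AU_pow[of _ ge] AU_vals by (intro sP_mult sP_pow sP_X 0 sP_good good_jg k)
 thus "Pm (2 * N) (int N - int (Suc d)) * Zb k (mE (Suc d) c j) = Zb k (mE (Suc d) c j)"
  unfolding Zb_def by (intro Om_weight[OF k]) simp_all
 have "sP (N + k) (int (Suc d) * (- 1) + 0 + 0) (AU (N + k) (mF (Suc d) c j) * jg k)"
  unfolding AU_mult[of _ "gf ^ Suc d"] AU_pow[of _ gf] AU_vals by (intro sP_mult sP_pow sP_X 0 sP_good good_jg k)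
 hence "Pm (2 * N) (int N - - int (Suc d)) * Zb k (mF (Suc d) c j) = Zb k (mF (Suc d) c j)"
  unfolding Zb_def by (intro Om_weight[OF k]) simp_all
 thus "Pm (2 * N) (int N + int (Suc d)) * Zb k (mF (Suc d) c j) = Zb k (mF (Suc d) c j)" by (simp only: diff_minus_eq_add)
qed

text \<open>On \<open>K^c\<close> times powers of \<open>bb\<close>, \<open>Om_pair_g\<close>
  provides the value term and \<open>Om_pair_h\<close> the derivative term of
  \<open>li_block\<close>; \<open>principle\<close> does the rest with the generators acting on
  \<open>2 N\<close> letters.\<close>

theorem block_pair:
 assumes k: "0 < k" "k <= N" and e: "casimir_idempotent (N + k) e"
 shows "Zb k x + Zb (r - k) x = left_integral (x * e) *. Ak N"
proof -
 have k': "0 < r - k" "r - k <= N" using r_diff[OF k] by auto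
 have F: "F * (Zb k x + Zb (r - k) x) = Zb k x + Zb (r - k) x" for x
  using F_Om k k' by (simp add: Zb_def distrib_left)
 have q': "br' (r - k) = br' k" using r_diff[OF k] br'_diff_r by auto
 show ?thesis
 proof (rule principle[OF _ e k(2), of "%x. Zb k x + Zb (r - k) x" _ "Eo 0 (2 * N)" "Fo 0 (2 * N)"])
  show "linL (%x. Zb k x + Zb (r - k) x)" using Zb_lin by (simp add: linL_def smult_distrib)
  fix c j
  have z: "Zb l (gk ^ c * bb ^ j) = br' l ^ j *. Om l (Ko 0 (N + l) ^ c * jg l)
    + (of_nat j * br' l ^ (j - 1)) *. ((- ((br 1)^2 * qi l)) *. Om l (Ko 0 (N + l) ^ c * jh l))" if "0 < l" "l <= N" for l
   unfolding Zb_def AU_mult AU_pow AU_vals massoc Bo_pow_jg[OF that(2,1)] by (simp only: distrib_left smult_simps(1) Om_lin smult_simps(3) massoc)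
  have "Zb k (gk ^ c * bb ^ j) + Zb (r - k) (gk ^ c * bb ^ j) =
    br' k ^ j *. (Om k (Ko 0 (N + k) ^ c * jg k) + Om (r - k) (Ko 0 (N + (r - k)) ^ c * jg (r - k)))
    + (of_nat j * br' k ^ (j - 1)) *. ((- ((br 1)^2 * qi k)) *. Om k (Ko 0 (N + k) ^ c * jh k) + (- ((br 1)^2 * qi (r - k))) *. Om (r - k) (Ko 0 (N + (r - k)) ^ c * jh (r - k)))"
   unfolding z[OF k] z[OF k'] q' by (simp only: lop_add_right add_ac)
  also have "... = left_integral (gk ^ c * bb ^ j * e) *. Ak N"
   unfolding Om_pair_g[OF k] Om_pair_h[OF k] li_block[OF e k(2)]
   using k(1) by (auto simp: lop_add_left[symmetric] algebra_simps)
  finally show "Zb k (gk ^ c * bb ^ j) + Zb (r - k) (gk ^ c * bb ^ j) = left_integral (gk ^ c * bb ^ j * e) *. Ak N" .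
 next
  show "Eo 0 (2 * N) * (Zb k w + Zb (r - k) w) = Zb k ((ge * w - w * ge) * gk ^ N) + Zb (r - k) ((ge * w - w * ge) * gk ^ N)" for w
   by (simp add: distrib_left Zb_EF[OF k] Zb_EF[OF k'])
  show "Fo 0 (2 * N) * (Zb k w + Zb (r - k) w) = Zb k (gf * w - gk ^ N * w * gk * gf) + Zb (r - k) (gf * w - gk ^ N * w * gk * gf)" for w
   by (simp add: distrib_left Zb_EF[OF k] Zb_EF[OF k'])
 next
  fix d c j
  show "Zb k (mF (Suc d) c j) + Zb (r - k) (mF (Suc d) c j) = 0" if "Eo 0 (2 * N) * (Zb k (mF (Suc d) c j) + Zb (r - k) (mF (Suc d) c j)) = 0"
   by (rule inj_E[OF F _ that, of d]) (simp only: distrib_left Zb_weight[OF k] Zb_weight[OF k'])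
  show "Zb k (mE (Suc d) c j) + Zb (r - k) (mE (Suc d) c j) = 0" if "Fo 0 (2 * N) * (Zb k (mE (Suc d) c j) + Zb (r - k) (mE (Suc d) c j)) = 0"
   by (rule inj_F[OF F _ that, of d]) (simp only: distrib_left Zb_weight[OF k] Zb_weight[OF k'])
 qed
qed

text \<open>Everything passes through \<open>ev\<close>, hence through the trivial module. So
  \<open>principle\<close> is applied with both target operators \<open>0\<close>, and elements of
  nonzero degree vanish already by weight.\<close>

theorem block_single:
 assumes e: "casimir_idempotent N e"
 shows "Ak N * (CA N * (AU N x * (F * CU N))) = left_integral (x * e) *. Ak N"
proof -
 define Z where "Z x = Ak N * (CA N * (AU N x * (F * CU N)))" for x
 have l: "loc N (AU N w * F)" for w using AU_loc F_loc jf_loc[of N N] by (simp add: loc_mult)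
 have c: "F * AU N x = AU N x * F" for x using AU_capfam[OF good_jf[of N]] by simp
 have c': "F * Eo 0 N = Eo 0 N * F" "F * Fo 0 N = Fo 0 N * F" "F * Ko 0 N = Ko 0 N * F" "F * Lo 0 N = Lo 0 N * F"
  using c[of ge] c[of gf] c[of gk] c[of "gk ^ N"] by (simp_all add: AU_vals)
 note m = AU_mult AU_vals linL_simps(2)[OF AU_lin]
 have X0: "CA N * (X (2 * N) * v) = 0" if "capfam X" "X 0 = 0" for X v
  using capfam_CA[OF that(1), of N] that(2) by (simp add: massoc[symmetric])
 have EZ: "Z ((ge * w - w * ge) * gk ^ N) = 0" "Z (gf * w - gk ^ N * w * gk * gf) = 0" for w
 proof -
  have "Z ((ge * w - w * ge) * gk ^ N) = Ak N * (CA N * (Eo 0 (2 * N) * (AU N w * F * CU N)))"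
   unfolding E_bend[OF l] Z_def m by (simp add: left_diff_distrib massoc c' mult3[OF c'(1)] mult3[OF c'(4)])
  thus "Z ((ge * w - w * ge) * gk ^ N) = 0" using X0[OF capfam_X(3)] by simp
  have "Z (gf * w - gk ^ N * w * gk * gf) = Ak N * (CA N * (Fo 0 (2 * N) * (AU N w * F * CU N)))"
   unfolding F_bend[OF l] Z_def m by (simp add: left_diff_distrib massoc c' mult3[OF c'(2)] mult3[OF c'(3)])
  thus "Z (gf * w - gk ^ N * w * gk * gf) = 0" using X0[OF capfam_X(4)] by simp
 qed
 have w0: "Z x = 0" if "sP N d (AU N x)" "d ~= 0" for x d
 proof -
  define P where "P n = Pm n ((int n - 2 * d) div 2)" for n
  have P: "capfam P" using capfam_Pm[of "2 * d"] unfolding P_def[abs_def] .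
  have "int (2 * N) - 2 * d = 2 * (int N - d)" by simp
  hence P2: "P (2 * N) = Pm (2 * N) (int N - d)" unfolding P_def by (simp only:) simp
  have "sP N (d + 0) (AU N x * F)" by (intro sP_mult that sP_good good_jf)
  hence "P (2 * N) * (AU N x * F * CU N) = AU N x * F * CU N" unfolding P2 using Pm_CU[of N d] by simp
  moreover have "P 0 = 0" using that(2) by (simp add: P_def)
  ultimately show ?thesis using X0[OF P, of "AU N x * F * CU N"] by (simp add: Z_def massoc)
 qed
 have g0: "sP N 0 (AU N (gk ^ c * bb ^ j))" for c j
 proof -
  have "sP N (int c * 0 + int j * 0) (AU N (gk ^ c * bb ^ j))"
   unfolding AU_mult AU_pow AU_vals by (intro sP_mult sP_pow sP_X)
  thus ?thesis by simp
 qed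
 have "Z x = left_integral (x * e) *. Ak N"
 proof (rule principle[of Z 0 e "Ak N" 0 0])
  show "linL Z" by (simp add: linL_def Z_def linLD[OF AU_lin] distrib_right distrib_left)
  show "casimir_idempotent (N + 0) e" using e by simp
  fix c j
  have "Bo N ^ j * F = 2 ^ j *. F"
  proof (induction j)
   case (Suc j)
   have "Bo N * F = 2 *. F" using Bo_F by (simp add: qbrace'_def)
   thus ?case using Suc by (simp add: massoc mult.commute)
  qed simp
  from mult3[OF this, of "CU N"]
  have "Z (gk ^ c * bb ^ j) = 2 ^ j *. (Ak N * (CA N * (Ko 0 N ^ c * (F * CU N))))"
   unfolding Z_def AU_mult AU_pow AU_vals by (simp add: massoc)
  thus "Z (gk ^ c * bb ^ j) = left_integral (gk ^ c * bb ^ j * e) *. Ak N"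
   unfolding Om_zero using li_block[of 0 e c j] e by (simp add: mult.commute)
 next
  fix d c j
  have "sP N (int (Suc d) * 1 + 0) (AU N (mE (Suc d) c j))"
   unfolding AU_mult[of _ "ge ^ Suc d"] AU_pow[of _ ge] AU_vals by (intro sP_mult sP_pow sP_X g0)
  thus "Z (mE (Suc d) c j) = 0" by (rule w0) simp
  have "sP N (int (Suc d) * (- 1) + 0) (AU N (mF (Suc d) c j))"
   unfolding AU_mult[of _ "gf ^ Suc d"] AU_pow[of _ gf] AU_vals by (intro sP_mult sP_pow sP_X g0)
  thus "Z (mF (Suc d) c j) = 0" by (rule w0) simp
 qed (simp_all add: EZ)
 thus ?thesis by (simp add: Z_def)
qed

end

section \<open>The action through the iterated coproduct\<close>

definition lopext :: "('a => lop) => ('a \<Rightarrow>\<^sub>0 complex) => lop" where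
 "lopext g v = (\<Sum>x\<in>pkeys v. lkp v x *. g x)"

lemma lopext_superset: "finite S ==> pkeys v <= S ==> lopext g v = (\<Sum>x\<in>S. lkp v x *. g x)"
 unfolding lopext_def by (rule sum.mono_neutral_left) (auto simp: in_keys_iff)

lemma lopext_bvec: "lopext g (bvec x) = g x"
 using lopext_superset[of "{x}" "bvec x" g] by (simp add: bvec_def)

lemma lopext_add: "lopext g (v + w) = lopext g v + lopext g w"
proof -
 let ?S = "pkeys v Un pkeys w"
 have "lopext g (v + w) = (\<Sum>x\<in>?S. lkp (v + w) x *. g x)"
  by (rule lopext_superset) (simp_all add: Poly_Mapping.keys_add)
 moreover have "lopext g v = (\<Sum>x\<in>?S. lkp v x *. g x)" "lopext g w = (\<Sum>x\<in>?S. lkp w x *. g x)"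
  by (rule lopext_superset; simp)+
 ultimately show ?thesis by (simp add: lookup_add lop_add_left sum.distrib)
qed

lemma lopext_fscale: "lopext g (fscale c v) = c *. lopext g v"
proof -
 have "pkeys (fscale c v) <= pkeys v" by (auto simp: in_keys_iff)
 hence "lopext g (fscale c v) = (\<Sum>x\<in>pkeys v. lkp (fscale c v) x *. g x)"
  by (intro lopext_superset) simp_all
 thus ?thesis by (simp add: lopext_def[of g v] lop_smult_sum)
qed

lemma lopext_sum: "lopext g (sum f S) = (\<Sum>x\<in>S. lopext g (f x))"
 by (induction S rule: infinite_finite_induct) (simp_all add: lopext_add, simp_all add: lopext_def)

lemma lopext_lext: "lopext g (lext f v) = lopext (%x. lopext g (f x)) v"
 by (simp add: lext_def lopext_sum lopext_fscale lopext_def[of "%x. lopext g (f x)"])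

lemma lopext_mult: "lopext (%x. X * g x) v = X * lopext g v" "lopext (%x. g x * X) v = lopext g v * X"
 by (simp_all add: lopext_def sum_distrib_left sum_distrib_right)

lemma mop_lext: "mop m n (%v. lext (%i. g i v) w) = lopext (%i. mop m n (g i)) w"
proof (rule lop_eqI)
 fix f s
 show "ap (mop m n (%v. lext (%i. g i v) w)) f s = ap (lopext (%i. mop m n (g i)) w) f s"
  unfolding ap_mop lext_def lopext_def lookup_sum_pm lookup_fscale ap_sum_lop ap_simps sum_distrib_right sum_distrib_left
  by (rule trans[OF sum.swap]) (simp only: massoc)
qed

lemma lext_mem: "(!!i. f i \<in> Xpow n) ==> lext f v \<in> Xpow n"
 unfolding lext_def Xpow_words by (intro fspan_sum fspan_fscale)

lemma funpow_flinear:
 assumes "flinear (Xpow m) (Xpow m) \<phi>"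
 shows "flinear (Xpow m) (Xpow m) (\<phi> ^^ a)" "mop m m (\<phi> ^^ a) = mop m m \<phi> ^ a"
proof -
 show l: "flinear (Xpow m) (Xpow m) (\<phi> ^^ a)" for a
  using assms by (induction a) (simp_all add: flinear_def)
 show "mop m m (\<phi> ^^ a) = mop m m \<phi> ^ a"
 proof (induction a)
  case 0
  thus ?case by (simp add: mop_id)
 next
  case (Suc a)
  have "mop m m (%z. \<phi> ((\<phi> ^^ a) z)) = mop m m \<phi> * mop m m (\<phi> ^^ a)"
   by (rule mop_comp[OF assms]) (use l[of a] bvec_Xpow in \<open>auto simp: flinear_def\<close>)
  thus ?case by (simp add: Suc comp_def)
 qed
qed

lemma shift_site: "shift m (site M i) = site M (m + i)"
proof -
 have "app (pre m s) ((dr m s)(i := x)) = s(m + i := x)" for s x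
  by (rule ext) (auto simp: app_def dr_def pre_def)
 thus ?thesis by (intro lop_eqI) (simp add: ap_shift ap_site dr_nth)
qed

lemma words_1: "words (Suc 0) = {[A0], [A1]}"
 by (auto simp: words_def length_Suc_conv)

locale kirby = op_functor r N \<Phi> + qg r N scale ge gf gk
 for r N \<Phi> and scale :: "complex => 'u::ring_1 => 'u" and ge gf gk :: 'u
begin

lemma keys_coords: "pkeys (coords x) <= pbw_indices"
 by (auto simp: in_keys_iff lookup_coords split: if_splits)

lemma linL_coords: "linL L ==> lopext (%i. L (pbw i)) (coords x) = L x"
proof -
 assume L: "linL L"
 have "L (\<Sum>i\<in>pbw_indices. scale (lkp (coords x) i) (pbw i)) = lopext (%i. L (pbw i)) (coords x)"
  unfolding linL_simps(3)[OF L] linLD(2)[OF L] by (rule lopext_superset[symmetric, OF fin_I keys_coords])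
 thus ?thesis by (simp only: u_expand[symmetric])
qed

lemma AU_lopext: "AU m x = lopext (%(a, b, c). Eo 0 m ^ a * (Fo 0 m ^ b * Ko 0 m ^ c)) (coords x)"
 unfolding AU_def rhoU_def lopext_superset[OF fin_I keys_coords] by (intro sum.cong refl) auto

lemma X_flinear: "flinear (Xpow (Suc 0)) (Xpow (Suc 0)) X_E" "flinear (Xpow (Suc 0)) (Xpow (Suc 0)) X_F" "flinear (Xpow (Suc 0)) (Xpow (Suc 0)) X_K"
 unfolding X_E_def X_F_def X_K_def
 by (rule flinear_lext; auto simp: Xpow_words words_1 fspan_fscale)+

lemma mop_X: "mop (Suc 0) (Suc 0) X_E = sE 0" "mop (Suc 0) (Suc 0) X_F = sF 0" "mop (Suc 0) (Suc 0) X_K = sK 0"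
proof -
 have a: "app [x] (dr (Suc 0) s) = s(0 := x)" for x s
  by (rule ext) (auto simp: app_def dr_def)
 have p: "pre (Suc 0) s = [s 0]" for s by (simp add: pre_def)
 show "mop (Suc 0) (Suc 0) X_E = sE 0"
 proof (rule lop_eqI)
  fix f s show "ap (mop (Suc 0) (Suc 0) X_E) f s = ap (sE 0) f s"
   by (cases "s 0") (simp_all add: ap_mop words_1 X_E_def a p lookup_bvec ap_munit)
 qed
 show "mop (Suc 0) (Suc 0) X_F = sF 0"
 proof (rule lop_eqI)
  fix f s show "ap (mop (Suc 0) (Suc 0) X_F) f s = ap (sF 0) f s"
   by (cases "s 0") (simp_all add: ap_mop words_1 X_F_def a p lookup_bvec ap_munit)
 qed
 show "mop (Suc 0) (Suc 0) X_K = sK 0"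
 proof (rule lop_eqI)
  fix f s show "ap (mop (Suc 0) (Suc 0) X_K) f s = ap (sK 0) f s"
   by (cases "s 0") (simp_all add: ap_mop words_1 X_K_def a p lookup_bvec ap_site sK_def)
 qed
qed

lemma X_act_Xpow: "v \<in> Xpow (Suc 0) ==> X_act x v \<in> Xpow (Suc 0)"
 and mop_X_act: "mop (Suc 0) (Suc 0) (X_act x) = AU (Suc 0) x"
proof -
 note l = X_flinear[THEN funpow_flinear(1)] and p = X_flinear[THEN funpow_flinear(2)]
 have m: "(X_K ^^ c) v \<in> Xpow (Suc 0)" "(X_F ^^ b) v \<in> Xpow (Suc 0)" "(X_E ^^ b) v \<in> Xpow (Suc 0)" if "v \<in> Xpow (Suc 0)" for v b c
  using l that by (simp_all add: flinear_def)
 show "v \<in> Xpow (Suc 0) ==> X_act x v \<in> Xpow (Suc 0)"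
  unfolding X_act_def by (rule lext_mem) (auto intro!: m)
 have t: "mop (Suc 0) (Suc 0) (%v. (X_E ^^ a) ((X_F ^^ b) ((X_K ^^ c) v))) = sE 0 ^ a * (sF 0 ^ b * sK 0 ^ c)" for a b c
 proof -
  have "mop (Suc 0) (Suc 0) (%v. (X_F ^^ b) ((X_K ^^ c) v)) = sF 0 ^ b * sK 0 ^ c"
   using mop_comp[OF l(2), of "Suc 0" "X_K ^^ c" "Suc 0" b] m bvec_Xpow by (simp add: p mop_X)
  thus ?thesis
   using mop_comp[OF l(1), of "Suc 0" "%v. (X_F ^^ b) ((X_K ^^ c) v)" "Suc 0" a] m bvec_Xpow by (simp add: p mop_X)
 qed
 have "mop (Suc 0) (Suc 0) (X_act x) = lopext (%i. mop (Suc 0) (Suc 0) (%v. case i of (a, b, c) => (X_E ^^ a) ((X_F ^^ b) ((X_K ^^ c) v)))) (coords x)"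
  unfolding mop_lext[symmetric] by (rule mop_cong) (simp add: X_act_def)
 also have "... = lopext (%(a, b, c). sE 0 ^ a * (sF 0 ^ b * sK 0 ^ c)) (coords x)"
  by (rule arg_cong[of _ _ "%g. lopext g (coords x)"], rule ext) (auto simp: t)
 finally show "mop (Suc 0) (Suc 0) (X_act x) = AU (Suc 0) x" by (simp add: AU_lopext)
qed

text \<open>How an element of the tensor square acts on \<open>m\<close> letters and one further
  letter; it is multiplicative, so it need only be computed on coproducts of generators.\<close>

definition Tm :: "nat => (pbw_index \<times> pbw_index \<Rightarrow>\<^sub>0 complex) => lop" where
 "Tm m = lopext (%(i, j). AU m (pbw i) * shift m (AU (Suc 0) (pbw j)))"

lemma Tm_utensor: "Tm m (utensor x z) = AU m x * shift m (AU (Suc 0) z)"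
proof -
 have l: "linL (%x. shift m (AU (Suc 0) x))" by (simp add: linL_def linLD[OF AU_lin] shift_simps)
 show ?thesis
  unfolding Tm_def utensor_def lext2_def lopext_lext lopext_bvec prod.case lopext_mult linL_coords[OF l] linL_coords[OF AU_lin] ..
qed

lemma Tm_mult:
 assumes "!!x. mop m m (Xpow_act m x) = AU m x"
 shows "Tm m (utensor_mult s t) = Tm m s * Tm m t"
proof -
 define g where "g = (%(i, j). AU m (pbw i) * shift m (AU (Suc 0) (pbw j)))"
 have c: "shift m Y * AU m x = AU m x * shift m Y" for Y x
  using mop_shift[of m m "Xpow_act m x" Y] assms by simp
 have u: "Tm m ((%(i, j) (k, l). utensor (pbw i * pbw k) (pbw j * pbw l)) p p') = g p * g p'" for p p'
 proof -
  obtain i j k l where p: "p = (i, j)" "p' = (k, l)" by (cases p; cases p')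
  show ?thesis unfolding p g_def prod.case Tm_utensor AU_mult shift_simps
   by (simp add: massoc mult3[OF c])
 qed
 have T: "Tm m = lopext g" by (simp add: Tm_def g_def)
 show ?thesis
  unfolding utensor_mult_def lext2_def T lopext_lext using u by (simp add: T lopext_mult)
qed

lemma Tm_coproduct:
 assumes "!!x. mop m m (Xpow_act m x) = AU m x"
 shows "Tm m (coproduct x) = AU (Suc m) x"
proof -
 have g: "shift m (sK 0) = sK m" "shift m (sE 0) = sE m" "shift m (sF 0) = sF m" "shift m 1 = 1"
  by (simp_all add: shift_site shift_simps sK_def munit_def)
 have p: "Tm m ((utensor_mult A ^^ n) s) = Tm m A ^ n * Tm m s" for A n s
  by (induction n) (simp_all add: Tm_mult[OF assms] massoc)
 have a: "Tm m (s + t) = Tm m s + Tm m t" for s t by (simp add: Tm_def lopext_add)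
 have "Tm m (coproduct_pbw i) = (case i of (a, b, c) => Eo 0 (Suc m) ^ a * (Fo 0 (Suc m) ^ b * Ko 0 (Suc m) ^ c))" for i
  by (cases i) (simp add: coproduct_pbw_def p a Tm_utensor g AU_vals)
 thus ?thesis
  by (simp add: coproduct_def Tm_def lopext_lext AU_lopext)
qed

lemma AU_0: "AU 0 x = counit x *. 1"
proof (rule lin_ext[of "AU 0" "%x. counit x *. 1"])
 show "linL (%x. counit x *. 1)"
  by (simp add: linL_def counit_def coords_lin lookup_add sum.distrib lop_add_left sum_distrib_left)
 fix a b c assume "a < r" "b < r" "c < r"
 hence "coords (ge ^ a * gf ^ b * gk ^ c) = bvec (a, b, c)" using coords_pbw[of "(a, b, c)"] by (simp add: pbw_def pbw_indices_def)
 thus "AU 0 (ge ^ a * gf ^ b * gk ^ c) = counit (ge ^ a * gf ^ b * gk ^ c) *. 1"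
  using \<open>c < r\<close> by (cases "a = 0"; cases "b = 0") (simp_all add: counit_def AU_mult AU_pow AU_vals lookup_bvec power_0_left)
qed (rule AU_lin)

text \<open>Identifies the action through the iterated coproduct with the explicit operators.
  Membership in \<open>Xpow m\<close> is carried along because \<open>mop_tensor\<close> requires
  it.\<close>

lemma Xpow_act_op: "(\<forall>x. \<forall>t\<in>words m. Xpow_act m x (bvec t) \<in> Xpow m) & (\<forall>x. mop m m (Xpow_act m x) = AU m x)"
proof (induction m)
 case 0
 have "mop 0 0 (fscale c) = c *. 1" for c
  by (rule lop_eqI) (simp add: ap_mop words_0 lookup_bvec)
 thus ?case by (simp add: AU_0 Xpow_words words_0 fspan_fscale)
next
 case (Suc m)
 have m1: "Suc m = m + Suc 0" by simp
 have X: "Xpow_act m x (bvec t) \<in> Xpow m" if "t \<in> words m" for t x using Suc that by blast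
 have A: "mop m m (Xpow_act m x) = AU m x" for x using Suc by blast
 define G where "G = (%p v. case p of (i, j) => xmap_tensor m (Xpow_act m (pbw i)) (X_act (pbw j)) v)"
 have G: "Xpow_act (Suc m) x = (%v. lext (%p. G p v) (coproduct x))" for x by (rule ext) (simp add: G_def)
 have "mop (m + Suc 0) (m + Suc 0) (G p) = (case p of (i, j) => AU m (pbw i) * shift m (AU (Suc 0) (pbw j)))" for p
 proof -
  obtain i j where p: "p = (i, j)" by (cases p)
  have "mop (m + Suc 0) (m + Suc 0) (xmap_tensor m (Xpow_act m (pbw i)) (X_act (pbw j))) = mop m m (Xpow_act m (pbw i)) * shift m (mop (Suc 0) (Suc 0) (X_act (pbw j)))"
   by (rule mop_tensor) (simp_all add: xmap_tensor_bvec X X_act_Xpow bvec_Xpow, simp add: words_def)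
  thus ?thesis by (simp add: p G_def A mop_X_act)
 qed
 hence M: "mop (Suc m) (Suc m) (Xpow_act (Suc m) x) = Tm m (coproduct x)" for x
  unfolding m1 G[unfolded m1] mop_lext by (simp add: Tm_def)
 have X': "Xpow_act (Suc m) x (bvec t) \<in> Xpow (Suc m)" if "t \<in> words (Suc m)" for x t
  unfolding G
 proof (rule lext_mem)
  fix p :: "pbw_index \<times> pbw_index"
  obtain i j where p: "p = (i, j)" by (cases p)
  have t: "take m t \<in> words m" "drop m t \<in> words (Suc 0)" using that take_words[of t m "Suc 0"] by simp_all
  show "G p (bvec t) \<in> Xpow (Suc m)"
   using xtensor_Xpow[OF X[OF t(1), of "pbw i"] X_act_Xpow[OF bvec_Xpow[OF t(2)], of "pbw j"]] by (simp add: p G_def xmap_tensor_bvec)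
 qed
 show ?case
 proof (intro conjI allI ballI)
  show "Xpow_act (Suc m) x (bvec t) \<in> Xpow (Suc m)" if "t \<in> words (Suc m)" for x t by (rule X'[OF that])
  show "mop (Suc m) (Suc m) (Xpow_act (Suc m) x) = AU (Suc m) x" for x unfolding M by (rule Tm_coproduct[OF A])
 qed
qed

lemma vop_const: "u \<in> TL 0 n ==> vop n (\<Phi> u (bvec [])) = op 0 n u & \<Phi> u (bvec []) \<in> Xpow n"
 unfolding vop_def using mop_cong[of 0 "%_. \<Phi> u (bvec [])" "\<Phi> u" n] \<Phi>_Xpow[of u 0 n "bvec []"] bvec_Xpow[of "[]" 0] by (simp add: words_0)

lemma vop_pair:
 assumes u: "u \<in> TL (2 * m) n"
 shows "vop n (pair_coev \<Phi> u m x) = op (2 * m) n u * (AU m x * CU m) & pair_coev \<Phi> u m x \<in> Xpow n"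
proof -
 define w where "w = \<Phi> (tl_coev m) (bvec [])"
 have w: "vop (2 * m) w = CU m" "w \<in> Xpow (2 * m)" using vop_const[OF TL_id(3)[of m]] by (simp_all add: w_def op_coev)
 define f where "f = xmap_tensor m (Xpow_act m x) (%z. z)"
 have "flinear (Xpow (m + m)) (Xpow (m + m)) f" "mop (m + m) (m + m) f = mop m m (Xpow_act m x)"
  unfolding f_def by (rule xmap_tensor_left, use Xpow_act_op in blast)+
 hence f: "flinear (Xpow (2 * m)) (Xpow (2 * m)) f" "mop (2 * m) (2 * m) f = AU m x" using Xpow_act_op[of m] by (simp_all add: mult_2)
 have fw: "f w \<in> Xpow (2 * m)" using f(1) w(2) by (simp add: flinear_def)
 have "vop n (\<Phi> u (f w)) = op (2 * m) n u * (AU m x * CU m)"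
  unfolding vop_map[OF map_linear[OF u] fw] vop_map[OF f(1) w(2)] f(2) w(1) ..
 thus ?thesis using \<Phi>_Xpow[OF u fw] by (simp add: pair_coev_def f_def w_def)
qed

lemma AU_shift: "shift m Y * AU m x = AU m x * shift m Y"
 using mop_shift[of m m "Xpow_act m x" Y] Xpow_act_op[of m] by simp

section \<open>The morphisms of the Kirby color\<close>

lemma r2: "2 * r - 2 = 2 * N" "r - Suc 0 = N" and r_ne: "0 < k ==> N + k ~= N" "N + k + 1 = r + k" "0 < k ==> N + k - r + 1 = k"
 using r_Suc by linarith+

lemma op_jgN: "jw_g r (2 * N) \<in> TL (2 * N) (2 * N)" "op (2 * N) (2 * N) (jw_g r (2 * N)) = jg N"
 using op_jg[of N] N_ge by (simp_all add: mult_2)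

context
 fixes k :: nat assumes k: "0 < k" "k <= N"
begin

definition Rg :: lop where "Rg = op (N + k) (N + k) (tl_rot (jw_g r (N + k)))"

lemma Rg_CU: "shift (N + k) Rg * CU (N + k) = jg k * CU (N + k)"
 using rot_bend[of "jw_g r (N + k)" "N + k"] op_jg[OF k] by (simp add: Rg_def)

lemma Rg_comm: "shift (N + k) Y * jg k = jg k * shift (N + k) Y"
 using mop_shift[of "N + k" "N + k" "\<Phi> (jw_g r (N + k))" Y] op_jg[OF k] by simp

text \<open>Bent around, the rotated idempotent becomes \<open>g\<close> itself, and unbending is
  injective; no product rule for rotated tangles has to be proved.\<close>

lemma Rg_idem: "Rg * Rg = Rg"
proof (rule shift_CU_inj[of "N + k"])
 have "shift (N + k) (Rg * Rg) * CU (N + k) = jg k * jg k * CU (N + k)"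
  by (simp only: shift_simps massoc Rg_CU mult3[OF Rg_comm])
 thus "shift (N + k) (Rg * Rg) * CU (N + k) = shift (N + k) Rg * CU (N + k)" by (simp only: jg_idem[OF k] Rg_CU)
qed

definition Sg :: lop where "Sg = jg k * shift (N + k) Rg"

lemma Sg_idem: "Sg * Sg = Sg"
 by (simp add: Sg_def massoc mult3[OF Rg_comm] mult3[OF jg_idem[OF k]] flip: shift_simps(2)) (simp add: Rg_idem)

text \<open>The rotated factor slides around \<open>CU\<close> and becomes a second copy of
  \<open>g\<close>, absorbed by the first; the source idempotent thus amounts to a single
  \<open>jg k\<close>.\<close>

lemma Sg_bend: "Sg * (AU (N + k) x * CU (N + k)) = AU (N + k) x * jg k * CU (N + k)"
proof -
 have c: "jg k * AU (N + k) x = AU (N + k) x * jg k" using AU_capfam[OF good_jg[OF k(2)]] by simp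
 show ?thesis by (simp only: Sg_def massoc mult3[OF AU_shift] Rg_CU mult3[OF c] mult3[OF jg_idem[OF k]])
qed

lemma kc_src_op: "kc_src r (N + k) \<in> TL (2 * (N + k)) (2 * (N + k))" "op (2 * (N + k)) (2 * (N + k)) (kc_src r (N + k)) = Sg"
proof -
 note g = op_jg[OF k, THEN conjunct1] op_jg[OF k, THEN conjunct2]
 have e: "kc_src r (N + k) = jw_g r (N + k) \<otimes>\<^sub>T tl_rot (jw_g r (N + k))" using k r_1 by (simp add: kc_src_def)
 show "kc_src r (N + k) \<in> TL (2 * (N + k)) (2 * (N + k))" "op (2 * (N + k)) (2 * (N + k)) (kc_src r (N + k)) = Sg"
  unfolding e mult_2 using TL_tensor[OF g(1) TL_rot[OF g(1)]] op_tensor[OF g(1) TL_rot[OF g(1)]]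
  by (simp_all add: Sg_def Rg_def g(2))
qed

lemma kc_t_op: "kc_t r (N + k) \<in> TL (2 * (N + k)) (2 * N)" "op (2 * (N + k)) (2 * N) (kc_t r (N + k)) = Ak N * (CA (N + k) * Sg)"
proof -
 note v = TL_comp[OF TL_id(2) kc_src_op(1), of r]
 show "kc_t r (N + k) \<in> TL (2 * (N + k)) (2 * N)" "op (2 * (N + k)) (2 * N) (kc_t r (N + k)) = Ak N * (CA (N + k) * Sg)"
  unfolding kc_t_def using TL_comp[OF kc_a_TL v]
  by (simp_all only: op_comp[OF v kc_a_TL] op_comp[OF kc_src_op(1) TL_id(2)] op_kc_a op_ev kc_src_op(2))
qed

lemma kc_t'_op: "kc_t' r (N + k) \<in> TL (2 * (N + k)) (2 * N)" "op (2 * (N + k)) (2 * N) (kc_t' r (N + k)) = jg N * (Cm k * Sg)"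
proof -
 define c where "c = tl_id N \<otimes>\<^sub>T tl_ev k \<otimes>\<^sub>T tl_id N"
 note t = TL_tensor[OF TL_id(2)[of k] TL_id(1)[of N]]
 have s: "N + (2 * k + N) = 2 * (N + k)" "N + (0 + N) = 2 * N" by simp_all
 have c: "c \<in> TL (2 * (N + k)) (2 * N)" "op (2 * (N + k)) (2 * N) c = Cm k"
  using TL_tensor[OF TL_id(1)[of N] t] op_tensor[OF TL_id(1)[of N] t] op_tensor[OF TL_id(2)[of k] TL_id(1)[of N]]
  unfolding c_def[symmetric] s by (simp_all add: op_id shift_simps op_ev shift_CA_N)
 have e: "kc_t' r (N + k) = tl_comp r (jw_g r (2 * N)) (tl_comp r c (kc_src r (N + k)))"
  unfolding kc_t'_def r2(1) r_1 r_ne(3)[OF k(1)] c_def ..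
 note cs = TL_comp[OF c(1) kc_src_op(1), of r]
 show "kc_t' r (N + k) \<in> TL (2 * (N + k)) (2 * N)" "op (2 * (N + k)) (2 * N) (kc_t' r (N + k)) = jg N * (Cm k * Sg)"
  unfolding e using TL_comp[OF op_jgN(1) cs] by (simp_all only: op_comp[OF cs op_jgN(1)] op_comp[OF kc_src_op(1) c(1)] op_jgN c kc_src_op(2))
qed

lemma kirby_op: "kirby_color r (N + k) \<in> TL (2 * (N + k)) (2 * N)"
 "op (2 * (N + k)) (2 * N) (kirby_color r (N + k)) = ((- 1) ^ k * (br' k / 2)) *. (Ak N * (CA (N + k) * Sg)) - ((- 1) ^ k * qi k) *. (jg N * (Cm k * Sg))"
proof -
 have e: "kirby_color r (N + k) = fscale ((- 1) ^ k * (br' k / 2)) (kc_t r (N + k)) - fscale ((- 1) ^ k * qi k) (kc_t' r (N + k))"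
  using k r_1 unfolding kirby_color_def r_ne(2) qi_add_r br'_add_r sgn_N by simp
 show "kirby_color r (N + k) \<in> TL (2 * (N + k)) (2 * N)"
  "op (2 * (N + k)) (2 * N) (kirby_color r (N + k)) = ((- 1) ^ k * (br' k / 2)) *. (Ak N * (CA (N + k) * Sg)) - ((- 1) ^ k * qi k) *. (jg N * (Cm k * Sg))"
  unfolding e using kc_t_op kc_t'_op by (simp_all only: TL_lin op_diff op_scale)
qed

lemma kirby_pair: "vop (2 * N) (pair_coev \<Phi> (kirby_color r (N + k)) (N + k) x) = Zb k x"
 unfolding vop_pair[OF kirby_op(1), THEN conjunct1] kirby_op(2) left_diff_distrib smult_simps massoc Sg_bend
 by (simp add: Zb_def Om_def lop_diff_right massoc)

lemma kirby_idem: "kirby_color r (N + k) \<in> TL_idem r (2 * (N + k)) (kc_src r (N + k)) (2 * N) (jw_g r (2 * N))"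
proof -
 note K = kirby_op(1) and S = kc_src_op(1) and J = op_jgN(1)
 have j: "jg N * Ak N = Ak N" "jg N * jg N = jg N" using Ak_jg[of N] jg_idem[of N] N_ge by simp_all
 have "tl_comp r (kirby_color r (N + k)) (kc_src r (N + k)) = kirby_color r (N + k)"
  by (rule op_inj[OF TL_comp[OF K S] K]) (simp only: op_comp[OF S K] kirby_op(2) kc_src_op(2) left_diff_distrib smult_simps massoc Sg_idem)
 moreover have "tl_comp r (jw_g r (2 * N)) (kirby_color r (N + k)) = kirby_color r (N + k)"
  by (rule op_inj[OF TL_comp[OF J K] K]) (simp only: op_comp[OF K J] kirby_op(2) op_jgN(2) right_diff_distrib smult_simps mult3[OF j(1)] mult3[OF j(2)])
 ultimately show ?thesis using K by (simp add: TL_idem_def)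
qed

end

lemma shift_tU: "shift m (tU i) = tU (m + i)"
 by (simp add: tU_def shift_simps shift_cap shift_cup)

text \<open>A generator on the right legs of nested cups equals the reflected generator on the left
  legs.\<close>

lemma tU_CU: "i + 2 <= m ==> tU (m + i) * CU m = tU (m - 2 - i) * CU m"
proof (induction i arbitrary: m)
 case 0
 hence "m = Suc (Suc (m - 2))" by linarith
 then obtain p where m: "m = Suc (Suc p)" by blast
 have c: "cu (Suc (Suc p)) * cu p = cu p * cu p" using cup_cup_far[of p "Suc (Suc p)" q] by simp
 show ?case
  by (simp add: m tU_def massoc mult3[OF cc_down] mult3[OF cc_up] mult3[OF c])
next
 case (Suc i)
 then obtain p where m: "m = Suc p" "i + 2 <= p" by (cases m) auto
 have j: "m + Suc i = Suc (Suc (p + i))" "m - 2 - Suc i = p - 2 - i" using m by simp_all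
 have c: "cp (Suc (Suc (p + i))) * cu p = cu p * cp (p + i)" "cu (Suc (Suc (p + i))) * cu p = cu p * cu (p + i)"
  using cap_far_cup[of p "Suc (Suc (p + i))" q] cup_cup_far[of p "Suc (Suc (p + i))" q] by simp_all
 have "tU (m + Suc i) * CU m = cu p * (tU (p + i) * CU p)"
  unfolding j unfolding m(1) by (simp add: tU_def massoc mult3[OF c(1)] mult3[OF c(2)])
 also have "... = cu p * tU (p - 2 - i) * CU p" using Suc.IH[OF m(2)] by (simp add: massoc)
 also have "cu p * tU (p - 2 - i) = tU (p - 2 - i) * cu p"
  by (rule loc_cup[OF loc_U[of "p - 2 - i" p]]) (use m in auto)
 finally show ?case by (simp add: j(2) m(1) massoc)
qed

lemma F_shift: "shift N Y * F = F * shift N Y"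
 using mop_shift[of N N "\<Phi> (jw_f r N)" Y] op_jf[of N] by simp

text \<open>For the index \<open>r - 1\<close> the second source factor is \<open>f\<close> itself,
  not its rotation, so \<open>tl_bend\<close> does not apply directly. Instead, any Temperley--Lieb
  element acts by the same scalar on \<open>F\<close> and on the right legs of the bent
  \<open>F\<close>, because every generator acts by \<open>0\<close> on both; apply this to
  \<open>F\<close>.\<close>

lemma F_CU: "shift N F * (F * CU N) = F * CU N"
proof -
 have "\<exists>c. z * F = c *. F & shift N z * (F * CU N) = c *. (F * CU N)" if "TLa N z" for z
  using that
 proof induction
  case one
  thus ?case by (intro exI[of _ 1]) (simp add: shift_simps)
 next
  case (gen i)
  have "F * tU (N - 2 - i) = 0" using jf_cup[of "N - 2 - i" N] gen by (simp add: tU_def flip: massoc)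
  hence "F * (tU (N - 2 - i) * CU N) = 0" by (simp flip: massoc)
  hence "shift N (tU i) * (F * CU N) = 0"
   using tU_CU[OF gen] by (simp add: mult3[OF F_shift] massoc) (simp add: shift_tU)
  moreover have "tU i * F = 0" using jf_cap[OF gen] by (simp add: tU_def massoc)
  ultimately show ?case by (intro exI[of _ 0]) simp
 next
  case (add x y)
  then obtain c d where "x * F = c *. F" "shift N x * (F * CU N) = c *. (F * CU N)" "y * F = d *. F" "shift N y * (F * CU N) = d *. (F * CU N)"
   by blast
  thus ?case by (intro exI[of _ "c + d"]) (simp add: shift_simps distrib_right lop_add_left)
 next
  case (mult x y)
  then obtain c d where "x * F = c *. F" "shift N x * (F * CU N) = c *. (F * CU N)" "y * F = d *. F" "shift N y * (F * CU N) = d *. (F * CU N)"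
   by blast
  thus ?case by (intro exI[of _ "d * c"]) (simp add: shift_simps massoc)
 next
  case (scale x c)
  then obtain d where "x * F = d *. F" "shift N x * (F * CU N) = d *. (F * CU N)" by blast
  thus ?case by (intro exI[of _ "c * d"]) (simp add: shift_simps)
 qed
 from this[OF jf_TLa] obtain c where c: "F * F = c *. F" "shift N F * (F * CU N) = c *. (F * CU N)" by blast
 have "c *. (F * CU N) = (c *. F) * CU N" by simp
 also have "... = F * CU N" unfolding c(1)[symmetric] by simp
 finally show ?thesis using c(2) by simp
qed

lemma single_op: "kirby_color r N \<in> TL (2 * N) (2 * N)" "kc_src r N \<in> TL (2 * N) (2 * N)"
 "op (2 * N) (2 * N) (kirby_color r N) = Ak N * (CA N * (F * shift N F))" "op (2 * N) (2 * N) (kc_src r N) = F * shift N F"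
proof -
 note f = op_jf[of N, THEN conjunct1] op_jf[of N, THEN conjunct2]
 have e: "kc_src r N = jw_f r N \<otimes>\<^sub>T jw_f r N" by (simp only: kc_src_def r_1 if_True simp_thms)
 have s: "kc_src r N \<in> TL (2 * N) (2 * N)" "op (2 * N) (2 * N) (kc_src r N) = F * shift N F"
  unfolding e mult_2 using TL_tensor[OF f(1) f(1)] op_tensor[OF f(1) f(1)] by (simp_all only: f(2))
 thus "kc_src r N \<in> TL (2 * N) (2 * N)" "op (2 * N) (2 * N) (kc_src r N) = F * shift N F" by simp_all
 have k: "kirby_color r N = tl_comp r (kc_a r) (tl_comp r (tl_ev N) (kc_src r N))"
  by (simp only: kirby_color_def kc_t_def r_1 if_True simp_thms)
 note v = TL_comp[OF TL_id(2) s(1), of r]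
 show "kirby_color r N \<in> TL (2 * N) (2 * N)" "op (2 * N) (2 * N) (kirby_color r N) = Ak N * (CA N * (F * shift N F))"
  unfolding k using TL_comp[OF kc_a_TL v] by (simp_all only: op_comp[OF v kc_a_TL] op_comp[OF s(1) TL_id(2)] op_kc_a op_ev s(2))
qed

lemma single_pair: "vop (2 * N) (pair_coev \<Phi> (kirby_color r N) N x) = Ak N * (CA N * (AU N x * (F * CU N)))"
proof -
 have c: "F * AU N x = AU N x * F" using AU_capfam[OF good_jf[of N]] by simp
 have "F * (shift N F * CU N) = F * CU N" using F_CU by (simp add: mult3[OF F_shift] massoc)
 thus ?thesis
  unfolding vop_pair[OF single_op(1), THEN conjunct1] single_op(3) by (simp add: massoc mult3[OF AU_shift] mult3[OF c])
qed

lemma single_idem: "kirby_color r N \<in> TL_idem r (2 * N) (kc_src r N) (2 * N) (jw_g r (2 * N))"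
proof -
 note K = single_op(1) and S = single_op(2) and J = op_jgN(1)
 have j: "jg N * Ak N = Ak N" using Ak_jg[of N] N_ge by simp
 have s: "F * shift N F * (F * shift N F) = F * shift N F"
  by (simp add: massoc mult3[OF F_shift] flip: shift_simps(2))
 have "tl_comp r (kirby_color r N) (kc_src r N) = kirby_color r N"
  by (rule op_inj[OF TL_comp[OF K S] K]) (simp only: op_comp[OF S K] single_op(3,4) massoc s[unfolded massoc])
 moreover have "tl_comp r (jw_g r (2 * N)) (kirby_color r N) = kirby_color r N"
  by (rule op_inj[OF TL_comp[OF J K] K]) (simp add: op_comp[OF K J] single_op(3) op_jgN(2) mult3[OF j])
 ultimately show ?thesis using K by (simp add: TL_idem_def)
qed

lemma diagrammatic:
 assumes e: "\<forall>m\<in>{r - 1..2 * r - 2}. casimir_idempotent m (e m)"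
 shows "diagrammatic_integral \<Phi> e (kirby_color r)"
proof -
 have a: "vop (2 * N) (\<Phi> (kc_a r) (bvec [])) = Ak N" "\<Phi> (kc_a r) (bvec []) \<in> Xpow (2 * N)"
  using vop_const[OF kc_a_TL] op_kc_a by simp_all
 have ax: "fscale c (\<Phi> (kc_a r) (bvec [])) \<in> Xpow (2 * N)" for c using a(2) by (simp add: Xpow_words fspan_fscale)
 have "pair_coev \<Phi> (kirby_color r N) N x = fscale (left_integral (x * e N)) (\<Phi> (kc_a r) (bvec []))" for x
 proof (rule vop_inj[of "2 * N"])
  have "casimir_idempotent N (e N)" using e r_1 r2(1) by simp
  thus "vop (2 * N) (pair_coev \<Phi> (kirby_color r N) N x) = vop (2 * N) (fscale (left_integral (x * e N)) (\<Phi> (kc_a r) (bvec [])))"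
   unfolding single_pair vop_lin a(1) by (rule block_single)
 qed (use vop_pair[OF single_op(1)] ax in auto)
 moreover have "pair_coev \<Phi> (kirby_color r m) m x + pair_coev \<Phi> (kirby_color r (3 * r - m - 2)) (3 * r - m - 2) x
   = fscale (left_integral (x * e m)) (\<Phi> (kc_a r) (bvec []))" if m: "m \<in> {r..2 * r - 2}" for x m
 proof -
  define k where "k = m - N"
  have k: "m = N + k" "0 < k" "k <= N" "3 * r - m - 2 = N + (r - k)" using m r_Suc by (auto simp: k_def)
  have k': "0 < r - k" "r - k <= N" using r_diff[OF k(2,3)] by auto
  have c: "casimir_idempotent (N + k) (e (N + k))" using e k(3) r_1 r2(1) by simp
  show ?thesis unfolding k(4) unfolding k(1)
  proof (rule vop_inj[of "2 * N"])
   show "vop (2 * N) (pair_coev \<Phi> (kirby_color r (N + k)) (N + k) x + pair_coev \<Phi> (kirby_color r (N + (r - k))) (N + (r - k)) x)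
    = vop (2 * N) (fscale (left_integral (x * e (N + k))) (\<Phi> (kc_a r) (bvec [])))"
    unfolding vop_lin kirby_pair[OF k(2,3)] kirby_pair[OF k'] a(1) by (rule block_pair[OF k(2,3) c])
   show "pair_coev \<Phi> (kirby_color r (N + k)) (N + k) x + pair_coev \<Phi> (kirby_color r (N + (r - k))) (N + (r - k)) x \<in> Xpow (2 * N)"
    using vop_pair[OF kirby_op(1)[OF k(2,3)]] vop_pair[OF kirby_op(1)[OF k']] unfolding Xpow_words by (blast intro: fspan_add)
  qed (rule ax)
 qed
 moreover have "kirby_color r m \<in> TL_idem r (2 * m) (kc_src r m) (2 * N) (jw_g r (2 * N))" if m: "m \<in> {N..2 * N}" for m
 proof (cases "m = N")
  case True
  thus ?thesis using single_idem by simp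
 next
  case False
  hence "m = N + (m - N)" "0 < m - N" "m - N <= N" using m by auto
  thus ?thesis using kirby_idem[of "m - N"] by metis
 qed
 ultimately show ?thesis unfolding diagrammatic_integral_def r2(1) r_1 by blast
qed

end

theorem proposition5p6:
  fixes r :: nat
    and scale :: "complex \<Rightarrow> 'u::ring_1 \<Rightarrow> 'u"
    and E F K :: 'u
    and e :: "nat \<Rightarrow> 'u"
    and \<Phi> :: "tl \<Rightarrow> xvec \<Rightarrow> xvec"
  assumes "3 \<le> r" and "odd r"
    and "small_quantum_group scale r E F K"
    and "\<forall>m\<in>{r - 1..2 * r - 2}. small_quantum_group.casimir_idempotent scale r E F K m (e m)"
    and "tl_functor r \<Phi>"
  shows "small_quantum_group.diagrammatic_integral scale r E F K \<Phi> e (kirby_color r)"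
proof -
  have r: "r = Suc (r - 1)" using assms(1) by linarith
  have "odd_root r (r - 1)" using assms(1,2) r by (rule odd_root.intro)
  then have "kirby r (r - 1) \<Phi> scale E F K"
    using assms(3,5) by (intro kirby.intro op_functor.intro qg.intro)
  then show ?thesis by (rule kirby.diagrammatic[OF _ assms(4)])
qed

end
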